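(* Let $N\ge1$, fix a starting point $x\in C_N^B$ and $k_2>0$, and for $k_1>0$ let $(X_{t,(k_1,k_2)})_{t\ge0}$ be the Bessel process of type $B_N$ with multiplicities $(k_1,k_2)$ started in $x$. Let $\mathbf 1:=(1,\dots,1)\in\mathbb R^N$. Then for every $t>0$, $$X_{t,(k_1,k_2)}-\sqrt{2tk_1}\,\mathbf 1$$ converges in distribution as $k_1\to\infty$ to $X^A_{t/2,k_2}$, where $(X^A_{s,k_2})_{s\ge0}$ is the Bessel process of type $A_{N-1}$ with multiplicity $k_2$ started in the origin.
   Context: $C_N^B:=\{x\in\mathbb R^N: x_1\ge\dots\ge x_N\ge0\}$, $C_N^A:=\{x\in\mathbb R^N:x_1\ge\dots\ge x_N\}$. The Bessel process of type $B_N$ with multiplicities $(k_1,k_2)$ is the diffusion on $C_N^B$ with reflecting boundary and generator $Lf=\frac12\Delta f+k_2\sum_{i}\sum_{j\ne i}\big(\frac{1}{x_i-x_j}+\frac{1}{x_i+x_j}\big)\partial_i f+k_1\sum_i\frac{1}{x_i}\partial_i f$ (domain: restrictions of $C^2$ functions invariant under permutations and sign changes of coordinates). The Bessel process of type $A_{N-1}$ with multiplicity $k$ is the diffusion on $C_N^A$ with reflecting boundary and generator $Lf=\frac12\Delta f+k\sum_i\sum_{j\ne i}\frac{1}{x_i-x_j}\partial_i f$ (domain: restrictions of permutation-invariant $C^2$ functions); started in $0$, $X^A_{s,k}$ has density on $C_N^A$ proportional to $e^{-\|y\|^2/(2s)}\prod_{i<j}(y_i-y_j)^{2k}$. *)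

theory Defs
  imports "HOL-Probability.Probability"
begin

text \<open>Coordinates are indexed by a finite linearly ordered type 'n (N = CARD('n));
  the order on 'n plays the role of the order 1 < 2 < ... < N.\<close>

definition chamber_B :: "((real,'n::{finite,linorder}) vec) set" where
  "chamber_B = {y. (\<forall>i j. i \<le> j \<longrightarrow> y$j \<le> y$i) \<and> (\<forall>i. 0 \<le> y$i)}"

definition chamber_A :: "((real,'n::{finite,linorder}) vec) set" where
  "chamber_A = {y. \<forall>i j. i \<le> j \<longrightarrow> y$j \<le> y$i}"

definition pdiff :: "'n::{finite,linorder} \<Rightarrow> ((real,'n) vec \<Rightarrow> real) \<Rightarrow> (real,'n) vec \<Rightarrow> real" where
  "pdiff i f y = deriv (\<lambda>h. f (y + h *\<^sub>R axis i 1)) 0"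

definition has_pdiff :: "'n::{finite,linorder} \<Rightarrow> ((real,'n) vec \<Rightarrow> real) \<Rightarrow> (real,'n) vec \<Rightarrow> bool" where
  "has_pdiff i f y \<longleftrightarrow> (\<lambda>h. f (y + h *\<^sub>R axis i 1)) differentiable (at 0)"

definition C2_fun :: "((real,'n::{finite,linorder}) vec \<Rightarrow> real) \<Rightarrow> bool" where
  "C2_fun f \<longleftrightarrow>
     (\<forall>i y. has_pdiff i f y) \<and> (\<forall>i. continuous_on UNIV (pdiff i f)) \<and>
     (\<forall>i j y. has_pdiff j (pdiff i f) y) \<and> (\<forall>i j. continuous_on UNIV (pdiff j (pdiff i f)))"

definition laplacian :: "((real,'n::{finite,linorder}) vec \<Rightarrow> real) \<Rightarrow> (real,'n) vec \<Rightarrow> real" where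
  "laplacian f y = (\<Sum>i\<in>UNIV. pdiff i (pdiff i f) y)"

definition perm_invariant :: "((real,'n::{finite,linorder}) vec \<Rightarrow> real) \<Rightarrow> bool" where
  "perm_invariant f \<longleftrightarrow> (\<forall>\<sigma> y. \<sigma> permutes (UNIV :: 'n set) \<longrightarrow> f (\<chi> i. y $ \<sigma> i) = f y)"

definition sign_invariant :: "((real,'n::{finite,linorder}) vec \<Rightarrow> real) \<Rightarrow> bool" where
  "sign_invariant f \<longleftrightarrow> (\<forall>\<epsilon> y. (\<forall>i. \<epsilon> i = 1 \<or> \<epsilon> i = (-1::real)) \<longrightarrow> f (\<chi> i. \<epsilon> i * y $ i) = f y)"

definition compact_support :: "((real,'n::{finite,linorder}) vec \<Rightarrow> real) \<Rightarrow> bool" where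
  "compact_support f \<longleftrightarrow> (\<exists>R. \<forall>y. R < norm y \<longrightarrow> f y = 0)"

definition domain_B :: "((real,'n::{finite,linorder}) vec \<Rightarrow> real) set" where
  "domain_B = {f. C2_fun f \<and> perm_invariant f \<and> sign_invariant f \<and> compact_support f}"

definition gen_B :: "real \<Rightarrow> real \<Rightarrow> ((real,'n::{finite,linorder}) vec \<Rightarrow> real) \<Rightarrow> (real,'n) vec \<Rightarrow> real" where
  "gen_B k1 k2 f y =
     laplacian f y / 2
     + k2 * (\<Sum>i\<in>UNIV. \<Sum>j\<in>UNIV - {i}.
               (1 / (y$i - y$j) + 1 / (y$i + y$j)) * pdiff i f y)
     + k1 * (\<Sum>i\<in>UNIV. (1 / y$i) * pdiff i f y)"

definition mart_term ::
  "(real \<Rightarrow> 'a \<Rightarrow> (real,'n::{finite,linorder}) vec) \<Rightarrow> (((real,'n) vec \<Rightarrow> real) \<Rightarrow> (real,'n) vec \<Rightarrow> real)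
     \<Rightarrow> ((real,'n) vec \<Rightarrow> real) \<Rightarrow> real \<Rightarrow> 'a \<Rightarrow> real" where
  "mart_term X L f t \<omega> = f (X t \<omega>) - f (X 0 \<omega>) - integral {0..t} (\<lambda>s. L f (X s \<omega>))"

definition nat_filtr_gen :: "'a measure \<Rightarrow> (real \<Rightarrow> 'a \<Rightarrow> (real,'n::{finite,linorder}) vec) \<Rightarrow> real \<Rightarrow> 'a set set" where
  "nat_filtr_gen M X s = {X u -` B \<inter> space M | u B. u \<in> {0..s} \<and> B \<in> sets borel}"

definition bessel_B_process ::
  "'a measure \<Rightarrow> (real \<Rightarrow> 'a \<Rightarrow> (real,'n::{finite,linorder}) vec) \<Rightarrow> real \<Rightarrow> real \<Rightarrow> (real,'n) vec \<Rightarrow> bool" where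
  "bessel_B_process M X k1 k2 x \<longleftrightarrow>
     prob_space M \<and>
     (\<forall>t\<ge>0. X t \<in> borel_measurable M) \<and>
     (\<forall>\<omega>\<in>space M. continuous_on {0..} (\<lambda>t. X t \<omega>) \<and> (\<forall>t\<ge>0. X t \<omega> \<in> chamber_B) \<and> X 0 \<omega> = x) \<and>
     (\<forall>f\<in>domain_B. \<forall>s t. 0 \<le> s \<and> s \<le> t \<longrightarrow>
        integrable M (mart_term X (gen_B k1 k2) f t) \<and>
        integrable M (mart_term X (gen_B k1 k2) f s) \<and>
        (\<forall>A\<in>sigma_sets (space M) (nat_filtr_gen M X s).
           set_lebesgue_integral M A (mart_term X (gen_B k1 k2) f t)
             = set_lebesgue_integral M A (mart_term X (gen_B k1 k2) f s)))"

section \<open>Law of the Bessel process of type A_{N-1} started in 0 at time s\<close>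

definition weight_A :: "real \<Rightarrow> real \<Rightarrow> (real,'n::{finite,linorder}) vec \<Rightarrow> real" where
  "weight_A k s y = exp (- (norm y * norm y) / (2 * s)) *
     (\<Prod>p\<in>{(i,j). i < j}. (y $ fst p - y $ snd p) powr (2*k))"

definition bessel_A_law :: "real \<Rightarrow> real \<Rightarrow> ((real,'n::{finite,linorder}) vec) measure" where
  "bessel_A_law k s =
     density lborel (\<lambda>y. ennreal (indicator chamber_A y * weight_A k s y
        / (\<integral>z. indicator (chamber_A :: (real,'n) vec set) z * weight_A k s z \<partial>lborel)))"

definition conv_distr_at_top ::
  "(real \<Rightarrow> 'a measure) \<Rightarrow> (real \<Rightarrow> 'a \<Rightarrow> 'b::euclidean_space) \<Rightarrow> 'b measure \<Rightarrow> bool" where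
  "conv_distr_at_top M Y \<mu> \<longleftrightarrow>
     (\<forall>g :: 'b \<Rightarrow> real. continuous_on UNIV g \<and> bounded (range g) \<longrightarrow>
        ((\<lambda>k. \<integral>\<omega>. g (Y k \<omega>) \<partial>M k) \<longlongrightarrow> (\<integral>y. g y \<partial>\<mu>)) at_top)"

end

theory Submission
  imports Defs
begin

text \<open>Only the one-dimensional marginals of the process enter, through the forward equation
  \<open>E f(X_t) = f(x) + \<integral> E (L f)(X_s) ds\<close>. In the centred squares
  \<open>u_i = (X_i^2 - 2 k1 s) / b\<close> with \<open>b = 2 sqrt (2 k1)\<close>, time derivative plus generator become
  \<open>s A + B / b\<close>, where A is the generator of type A, and A and B lower the degree of symmetric polynomials by 2 and 1.
  Hence the moments of u converge, as \<open>k1 \<rightarrow> \<infinity>\<close>, to the solution of the recursion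
  \<open>m_p' = s m_(A p)\<close>. Integration by parts shows that the moments of the law of type A solve the same recursion, and
  this law has exponential moments, so that convergence of the symmetric moments implies weak convergence.
  Finally \<open>X - a\<close> and \<open>(X^2 - a^2) / (2 a)\<close> with \<open>a = sqrt (2 t k1)\<close> are asymptotically equal.\<close>

section \<open>Partial derivatives and the generator on invariant functions\<close>

text \<open>The scale \<open>b\<close> is forced by the noise: \<open>X_i^2\<close> has drift about
  \<open>2 k1\<close> and quadratic variation \<open>4 X_i^2 ds\<close>, about
  \<open>8 k1 s ds\<close>, so division by \<open>b = sqrt (8 k1)\<close> leaves the clock
  \<open>s ds\<close>. Up to time \<open>t\<close> this clock has run to \<open>t^2 / 2\<close>, and
  the remaining division by \<open>sqrt t\<close> in \<open>V\<close> turns it into the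
  \<open>t / 2\<close> of the limit law. Two obstacles shape the argument. The process is known only
  through a martingale problem for compactly supported invariant functions, so polynomials have to
  be reached by truncation and the moment bounds have to come from the generator itself. And the
  generator is singular on the walls, where division by zero moreover assigns it an artificial
  value: invariance of the test functions keeps it bounded, while the identities for the centred
  squares hold only off the walls and call for a proof that almost no time is spent there.\<close>

definition has_partial :: "'n::{finite,linorder} \<Rightarrow> ((real,'n) vec \<Rightarrow> real) \<Rightarrow> ((real,'n) vec \<Rightarrow> real) \<Rightarrow> bool" where
  "has_partial i f f' \<longleftrightarrow> (\<forall>y. ((\<lambda>r. f (y + r *\<^sub>R axis i 1)) has_real_derivative f' y) (at 0))"

text \<open>The derivatives are carried as explicit functions, so that sums, products and
  compositions are differentiated by rules; \<open>C2_dataD\<close> translates back to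
  \<open>pdiff\<close> and \<open>C2_fun\<close>.\<close>

definition C2_data :: "((real,'n::{finite,linorder}) vec \<Rightarrow> real) \<Rightarrow> ('n \<Rightarrow> (real,'n) vec \<Rightarrow> real) \<Rightarrow> ('n \<Rightarrow> 'n \<Rightarrow> (real,'n) vec \<Rightarrow> real) \<Rightarrow> bool" where
  "C2_data f g h \<longleftrightarrow> continuous_on UNIV f \<and> (\<forall>i. continuous_on UNIV (g i)) \<and> (\<forall>i j. continuous_on UNIV (h i j))
     \<and> (\<forall>i. has_partial i f (g i)) \<and> (\<forall>i j. has_partial j (g i) (h i j))"

lemma has_partialD:
  assumes "has_partial i f f'"
  shows "((\<lambda>r. f (y + r *\<^sub>R axis i 1)) has_real_derivative f' (y + r0 *\<^sub>R axis i 1)) (at r0)"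
proof -
  have "((\<lambda>r. f ((y + r0 *\<^sub>R axis i 1) + r *\<^sub>R axis i 1)) has_real_derivative f' (y + r0 *\<^sub>R axis i 1)) (at 0)"
    using assms unfolding has_partial_def by blast
  then have "((\<lambda>r. f (y + (r0 + r) *\<^sub>R axis i 1)) has_real_derivative f' (y + r0 *\<^sub>R axis i 1)) (at 0)"
    by (simp add: scaleR_add_left add.assoc)
  then show ?thesis
    using DERIV_at_within_shift[of "\<lambda>r. f (y + r *\<^sub>R axis i 1)" "f' (y + r0 *\<^sub>R axis i 1)" r0 0 UNIV] by simp
qed

lemma has_partial_const: "has_partial i (\<lambda>_. c) (\<lambda>_. 0)"
  by (simp add: has_partial_def)

lemma has_partial_component: "has_partial i (\<lambda>y. y $ j) (\<lambda>_. if j = i then 1 else 0)"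
  by (auto simp: has_partial_def axis_def intro!: derivative_eq_intros)

lemma has_partial_add:
  "has_partial i f f' \<Longrightarrow> has_partial i g g' \<Longrightarrow> has_partial i (\<lambda>y. f y + g y) (\<lambda>y. f' y + g' y)"
  unfolding has_partial_def by (auto intro: DERIV_add)

lemma has_partial_mult:
  "has_partial i f f' \<Longrightarrow> has_partial i g g' \<Longrightarrow> has_partial i (\<lambda>y. f y * g y) (\<lambda>y. f' y * g y + f y * g' y)"
  unfolding has_partial_def by (auto intro!: derivative_eq_intros)

lemma has_partial_sum:
  "(\<And>a. a \<in> S \<Longrightarrow> has_partial i (f a) (f' a)) \<Longrightarrow> has_partial i (\<lambda>y. \<Sum>a\<in>S. f a y) (\<lambda>y. \<Sum>a\<in>S. f' a y)"
  unfolding has_partial_def by (auto intro!: DERIV_sum)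

lemma has_partial_compose:
  assumes "has_partial i f f'" "\<And>x. (F has_real_derivative F' x) (at x)"
  shows "has_partial i (\<lambda>y. F (f y)) (\<lambda>y. F' (f y) * f' y)"
  unfolding has_partial_def
proof
  fix y
  show "((\<lambda>r. F (f (y + r *\<^sub>R axis i 1))) has_real_derivative F' (f y) * f' y) (at 0)"
    using DERIV_chain2[of F "F' (f y)" "\<lambda>r. f (y + r *\<^sub>R axis i 1)" 0 "f' y" UNIV] assms
    by (simp add: has_partial_def)
qed

lemma has_partial_eqI:
  "has_partial i f f' \<Longrightarrow> f = g \<Longrightarrow> f' = g' \<Longrightarrow> has_partial i g g'" by simp

lemma pdiff_eqI:
  assumes "has_partial i f f'"
  shows "pdiff i f = f'" "has_pdiff i f y"
  using assms unfolding has_partial_def pdiff_def has_pdiff_def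
  by (auto simp: fun_eq_iff intro!: DERIV_imp_deriv real_differentiable_def[THEN iffD2] exI)

lemma C2_dataD:
  assumes "C2_data f g h"
  shows "C2_fun f" "pdiff i f = g i" "pdiff j (g i) = h i j"
proof -
  have p: "pdiff i f = g i" "has_pdiff i f y" "pdiff j (g i) = h i j" "has_pdiff j (g i) y" for i j y
    using assms pdiff_eqI unfolding C2_data_def by blast+
  then show "pdiff i f = g i" "pdiff j (g i) = h i j" by auto
  from p(2,4) have "All (has_pdiff i f)" "All (has_pdiff j (g i))" for i j by blast+
  with assms show "C2_fun f" unfolding C2_fun_def p C2_data_def by blast
qed

lemma C2_dataE:
  assumes "C2_data f g h"
  shows "continuous_on UNIV f" "continuous_on UNIV (g i)" "continuous_on UNIV (h i j)"
    "has_partial i f (g i)" "has_partial j (g i) (h i j)"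
  using assms unfolding C2_data_def by auto

lemma gen_B_C2_data:
  assumes "C2_data f g h"
  shows "gen_B k1 k2 f y = (\<Sum>i\<in>UNIV. h i i y) / 2
     + k2 * (\<Sum>i\<in>UNIV. \<Sum>j\<in>UNIV - {i}. (1 / (y$i - y$j) + 1 / (y$i + y$j)) * g i y)
     + k1 * (\<Sum>i\<in>UNIV. (1 / y$i) * g i y)"
  by (simp add: gen_B_def laplacian_def C2_dataD[OF assms])

lemma sum_offdiag_swap:
  fixes F :: "'n::finite \<Rightarrow> 'n \<Rightarrow> 'a::comm_monoid_add"
  shows "(\<Sum>i\<in>UNIV. \<Sum>j\<in>UNIV - {i}. F i j) = (\<Sum>i\<in>UNIV. \<Sum>j\<in>UNIV - {i}. F j i)"
proof -
  have "(\<Sum>i\<in>UNIV. \<Sum>j\<in>UNIV - {i}. F i j) = (\<Sum>i\<in>UNIV. \<Sum>j | j \<in> UNIV \<and> i \<noteq> j. F i j)"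
    by (intro sum.cong) auto
  also have "\<dots> = (\<Sum>j\<in>UNIV. \<Sum>i | i \<in> UNIV \<and> i \<noteq> j. F i j)"
    by (rule sum.swap_restrict) auto
  also have "\<dots> = (\<Sum>i\<in>UNIV. \<Sum>j\<in>UNIV - {i}. F j i)"
    by (intro sum.cong) auto
  finally show ?thesis .
qed

lemma sum_offdiag_symmetrize:
  fixes F :: "'n::finite \<Rightarrow> 'n \<Rightarrow> real"
  shows "(\<Sum>i\<in>UNIV. \<Sum>j\<in>UNIV - {i}. F i j) = (\<Sum>i\<in>UNIV. \<Sum>j\<in>UNIV - {i}. F i j + F j i) / 2"
  using sum_offdiag_swap[of F] by (simp add: sum.distrib)

section \<open>Bounds that tame the singular drift\<close>

lemma partial_increment_bound:
  assumes "has_partial j g h" "\<And>\<theta>. \<bar>\<theta>\<bar> \<le> \<bar>r\<bar> \<Longrightarrow> \<bar>h (y + \<theta> *\<^sub>R axis j 1)\<bar> \<le> K"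
  shows "\<bar>g (y + r *\<^sub>R axis j 1) - g y\<bar> \<le> K * \<bar>r\<bar>"
proof -
  have "norm ((\<lambda>r. g (y + r *\<^sub>R axis j 1)) r - (\<lambda>r. g (y + r *\<^sub>R axis j 1)) 0) \<le> K * norm (r - 0)"
  proof (rule field_differentiable_bound)
    show "convex {-\<bar>r\<bar>..\<bar>r\<bar>}" by simp
    fix \<theta> :: real assume "\<theta> \<in> {-\<bar>r\<bar>..\<bar>r\<bar>}"
    then have "\<bar>\<theta>\<bar> \<le> \<bar>r\<bar>" by (auto simp: abs_le_iff)
    then show "norm (h (y + \<theta> *\<^sub>R axis j 1)) \<le> K" using assms(2) by simp
    show "((\<lambda>r. g (y + r *\<^sub>R axis j 1)) has_field_derivative h (y + \<theta> *\<^sub>R axis j 1)) (at \<theta> within {-\<bar>r\<bar>..\<bar>r\<bar>})"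
      by (rule has_field_derivative_at_within[OF has_partialD[OF assms(1)]])
  qed auto
  then show ?thesis by simp
qed

lemma component_abs_le_norm: "\<bar>(y::(real,'n::finite) vec) $ i\<bar> \<le> norm y"
  using component_le_norm_cart[of y i] by simp

text \<open>The reflection swapping two coordinates is a path of two coordinate moves of length
  \<open>\<bar>y$i - y$j\<bar>\<close> each, and it exchanges the two partial derivatives of a symmetric function.\<close>

lemma partial_diff_bound:
  assumes f: "C2_data f g h" and inv: "perm_invariant f"
    and K: "\<And>z i j. norm z \<le> 5 * norm y \<Longrightarrow> \<bar>h i j z\<bar> \<le> K"
  shows "\<bar>g i y - g j y\<bar> \<le> 2 * K * \<bar>y$i - y$j\<bar>"
proof (cases "i = j")
  case True
  then show ?thesis by simp
next
  case ij: False
  define \<sigma> where "\<sigma> = Transposition.transpose i j"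
  have \<sigma>: "\<sigma> permutes UNIV" unfolding \<sigma>_def by (rule permutes_swap_id) auto
  define d where "d = y$j - y$i"
  define y1 where "y1 = y + d *\<^sub>R axis i 1"
  define y2 where "y2 = y1 + (-d) *\<^sub>R axis j 1"
  have y2: "y2 = (\<chi> l. y $ \<sigma> l)"
    using ij by (auto simp: y2_def y1_def d_def vec_eq_iff axis_def \<sigma>_def Transposition.transpose_def)
  have "f (y2 + r *\<^sub>R axis i 1) = f (y + r *\<^sub>R axis j 1)" for r
  proof -
    have "y2 + r *\<^sub>R axis i 1 = (\<chi> l. (y + r *\<^sub>R axis j 1) $ \<sigma> l)"
      using ij by (auto simp: y2 vec_eq_iff axis_def \<sigma>_def Transposition.transpose_def)
    then show ?thesis using inv[unfolded perm_invariant_def, rule_format, OF \<sigma>] by metis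
  qed
  then have "(\<lambda>r. f (y2 + r *\<^sub>R axis i 1)) = (\<lambda>r. f (y + r *\<^sub>R axis j 1))" by (rule ext)
  then have 0: "((\<lambda>r. f (y + r *\<^sub>R axis j 1)) has_real_derivative g i y2) (at 0)"
    using C2_dataE(4)[OF f, of i, unfolded has_partial_def, rule_format, of y2] by simp
  have gj: "g j y = g i y2"
    by (rule DERIV_unique[OF C2_dataE(4)[OF f, of j, unfolded has_partial_def, rule_format, of y] 0])
  have d: "\<bar>d\<bar> \<le> 2 * norm y" unfolding d_def
    using component_abs_le_norm[of y i] component_abs_le_norm[of y j] by linarith
  \<comment> \<open>The 5: each of the two moves has length at most \<open>2 * norm y\<close>, so
    the whole path from \<open>y\<close> stays in the ball of radius
    \<open>norm y + 2 * (2 * norm y)\<close>.\<close>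
  have b: "norm (y + a *\<^sub>R axis i 1 + c *\<^sub>R axis j 1) \<le> 5 * norm y" if "\<bar>a\<bar> \<le> \<bar>d\<bar>" "\<bar>c\<bar> \<le> \<bar>d\<bar>" for a c
    using norm_triangle_ineq[of "y + a *\<^sub>R axis i 1" "c *\<^sub>R axis j 1"] norm_triangle_ineq[of y "a *\<^sub>R axis i 1"] that d
    by (simp add: norm_axis_1)
  have 1: "\<bar>g i y1 - g i y\<bar> \<le> K * \<bar>d\<bar>" unfolding y1_def
    by (rule partial_increment_bound[OF C2_dataE(5)[OF f]]) (use b[of _ 0] K in auto)
  have "\<bar>g i y2 - g i y1\<bar> \<le> K * \<bar>- d\<bar>" unfolding y2_def
    by (rule partial_increment_bound[OF C2_dataE(5)[OF f]]) (use b[of d] K in \<open>auto simp: y1_def\<close>)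
  with 1 gj have "\<bar>g i y - g j y\<bar> \<le> 2 * (K * \<bar>d\<bar>)" by simp
  then show ?thesis by (simp add: d_def abs_minus_commute)
qed

text \<open>Comes from differentiating \<open>f (S z) = f z\<close> for the sign change
  \<open>S\<close> of coordinate \<open>j\<close>. For \<open>i = j\<close> it makes
  \<open>g i\<close> odd in that coordinate, hence zero on the hyperplane
  \<open>y $ i = 0\<close>.\<close>

lemma sign_flip:
  assumes f: "C2_data f g h" and inv: "sign_invariant f"
  shows "g i (\<chi> l. if l = j then - y $ l else y $ l) = (if i = j then - g i y else g i y)"
proof -
  define S where "S = (\<lambda>y::(real,'a) vec. \<chi> l. if l = j then - y $ l else y $ l)"
  define e :: real where "e = (if i = j then -1 else 1)"
  have S: "f (S z) = f z" for z
  proof -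
    have "S z = (\<chi> l. (if l = j then -1 else 1) * z $ l)" by (auto simp: S_def vec_eq_iff)
    then show ?thesis using inv[unfolded sign_invariant_def, rule_format, of "\<lambda>l. if l = j then -1 else 1" z] by simp
  qed
  have "S (y + r *\<^sub>R axis i 1) = S y + (e * r) *\<^sub>R axis i 1" for r
    by (auto simp: S_def vec_eq_iff e_def axis_def)
  then have 1: "f (S y + (e * r) *\<^sub>R axis i 1) = f (y + r *\<^sub>R axis i 1)" for r using S[of "y + r *\<^sub>R axis i 1"] S by simp
  have "((\<lambda>r. f (S y + (e * r) *\<^sub>R axis i 1)) has_real_derivative g i (S y) * e) (at 0)"
    using DERIV_chain2[of "\<lambda>r. f (S y + r *\<^sub>R axis i 1)" "g i (S y)" "\<lambda>r. e * r" 0 e UNIV]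
      C2_dataE(4)[OF f, of i] by (simp add: has_partial_def DERIV_cmult_Id)
  then have "((\<lambda>r. f (y + r *\<^sub>R axis i 1)) has_real_derivative g i (S y) * e) (at 0)" by (simp add: 1)
  then have "g i (S y) * e = g i y"
    by (rule DERIV_unique[OF _ C2_dataE(4)[OF f, of i, unfolded has_partial_def, rule_format, of y]])
  then show ?thesis by (auto simp: S_def e_def split: if_splits)
qed

text \<open>Flipping the sign of coordinate \<open>j\<close> turns \<open>y $ i - y $ j\<close> into
  \<open>y $ i + y $ j\<close> and, of the two derivatives, reverses the sign of \<open>g j\<close>
  only; so this is the difference bound at the flipped point.\<close>

lemma partial_sum_bound:
  assumes f: "C2_data f g h" and inv: "perm_invariant f" "sign_invariant f" and ij: "i \<noteq> j"
    and K: "\<And>z i j. norm z \<le> 5 * norm y \<Longrightarrow> \<bar>h i j z\<bar> \<le> K"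
  shows "\<bar>g i y + g j y\<bar> \<le> 2 * K * \<bar>y$i + y$j\<bar>"
proof -
  define y' :: "(real,'a) vec" where "y' = (\<chi> l. if l = j then - y $ l else y $ l)"
  have n: "norm y' = norm y" unfolding norm_vec_def L2_set_def
    by (intro arg_cong[where f=sqrt] sum.cong) (auto simp: y'_def)
  have "\<bar>g i y' - g j y'\<bar> \<le> 2 * K * \<bar>y'$i - y'$j\<bar>"
    by (rule partial_diff_bound[OF f inv(1)]) (use K n in auto)
  then show ?thesis using sign_flip[OF f inv(2), of i j y] sign_flip[OF f inv(2), of j j y] ij
    by (simp add: y'_def)
qed

text \<open>By oddness \<open>g i\<close> vanishes on the hyperplane \<open>y $ i = 0\<close>; the
  bound controls its increment along the coordinate line that leads there.\<close>

lemma partial_bound: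
  assumes f: "C2_data f g h" and inv: "sign_invariant f"
    and K: "\<And>z i j. norm z \<le> 5 * norm y \<Longrightarrow> \<bar>h i j z\<bar> \<le> K"
  shows "\<bar>g i y\<bar> \<le> K * \<bar>y$i\<bar>"
proof -
  define y0 where "y0 = y + (- y$i) *\<^sub>R axis i 1"
  have "(\<chi> l. if l = i then - y0 $ l else y0 $ l) = y0" by (auto simp: y0_def vec_eq_iff axis_def)
  then have 0: "g i y0 = 0" using sign_flip[OF f inv, of i i y0] by simp
  have "\<bar>g i y0 - g i y\<bar> \<le> K * \<bar>- y$i\<bar>" unfolding y0_def
  proof (rule partial_increment_bound[OF C2_dataE(5)[OF f]])
    fix a :: real assume "\<bar>a\<bar> \<le> \<bar>- y$i\<bar>"
    then have "norm (y + a *\<^sub>R axis i 1) \<le> 5 * norm y"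
      using norm_triangle_ineq[of y "a *\<^sub>R axis i 1"] component_abs_le_norm[of y i] by (simp add: norm_axis_1)
    then show "\<bar>h i i (y + a *\<^sub>R axis i 1)\<bar> \<le> K" by (rule K)
  qed
  then show ?thesis using 0 by simp
qed

definition gen_const :: "real \<Rightarrow> real \<Rightarrow> 'n::finite itself \<Rightarrow> real" where
  "gen_const k1 k2 _ = real CARD('n) / 2 + 2 * k2 * real CARD('n)^2 + k1 * real CARD('n)"

lemma gen_const_nonneg: "k1 \<ge> 0 \<Longrightarrow> k2 \<ge> 0 \<Longrightarrow> gen_const k1 k2 TYPE('n::finite) \<ge> 0"
  by (simp add: gen_const_def)

text \<open>Each pole of the drift is compensated by partial derivatives that vanish on the same
  wall: symmetrising the double sum over \<open>i\<close> and \<open>j\<close> replaces single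
  derivatives by \<open>g i y - g j y\<close> over \<open>y $ i - y $ j\<close> and
  \<open>g i y + g j y\<close> over \<open>y $ i + y $ j\<close>, each quotient being at most
  \<open>2 * K\<close>. Half of \<open>4 * K\<close> over at most \<open>N^2\<close> pairs gives the
  coefficient of \<open>k2\<close> in \<open>gen_const\<close>.\<close>

lemma gen_B_bound:
  fixes f :: "(real,'n::{finite,linorder}) vec \<Rightarrow> real"
  assumes f: "C2_data f g h" and inv: "perm_invariant f" "sign_invariant f" and k: "k1 \<ge> 0" "k2 \<ge> 0"
    and K: "\<And>z i j. norm z \<le> 5 * norm y \<Longrightarrow> \<bar>h i j z\<bar> \<le> K"
  shows "\<bar>gen_B k1 k2 f y\<bar> \<le> gen_const k1 k2 TYPE('n) * K"
proof -
  have K0: "K \<ge> 0" using K[of y undefined undefined] by (simp add: order_trans[OF abs_ge_zero])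
  \<comment> \<open>The case \<open>b = 0\<close> is included: the quotient is then 0, so the bounds
    hold on the walls as well.\<close>
  have q: "\<bar>a / b\<bar> \<le> c" if "\<bar>a\<bar> \<le> c * \<bar>b\<bar>" "c \<ge> 0" for a b c :: real
    using that by (cases "b = 0") (auto simp: divide_simps)
  have 1: "\<bar>\<Sum>i\<in>UNIV. h i i y\<bar> \<le> real CARD('n) * K"
    by (rule order_trans[OF sum_abs]) (use sum_bounded_above[of UNIV "\<lambda>i. \<bar>h i i y\<bar>" K] K[of y] in auto)
  have 2: "\<bar>\<Sum>i\<in>UNIV. (1 / y$i) * g i y\<bar> \<le> real CARD('n) * K"
    by (rule order_trans[OF sum_abs]) (use sum_bounded_above[of UNIV "\<lambda>i. \<bar>(1 / y$i) * g i y\<bar>" K] K0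
        q[OF partial_bound[OF f inv(2) K]] in auto)
  let ?F = "\<lambda>i j. (1 / (y$i - y$j) + 1 / (y$i + y$j)) * g i y"
  have F: "?F i j + ?F j i = (g i y - g j y) / (y$i - y$j) + (g i y + g j y) / (y$i + y$j)" for i j
  proof -
    have "1 / (y$j - y$i) = - (1 / (y$i - y$j))" by (metis minus_diff_eq minus_divide_right)
    then show ?thesis by (simp add: algebra_simps add_divide_distrib diff_divide_distrib)
  qed
  have Fb: "\<bar>?F i j + ?F j i\<bar> \<le> 4 * K" if "i \<noteq> j" for i j
  proof -
    have "\<bar>(g i y - g j y) / (y$i - y$j)\<bar> \<le> 2 * K"
      by (intro q partial_diff_bound[OF f inv(1)] K) (use K0 in auto)
    moreover have "\<bar>(g i y + g j y) / (y$i + y$j)\<bar> \<le> 2 * K"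
      by (intro q partial_sum_bound[OF f inv that] K) (use K0 in auto)
    ultimately show ?thesis unfolding F by linarith
  qed
  have "\<bar>\<Sum>i\<in>UNIV. \<Sum>j\<in>UNIV - {i}. ?F i j + ?F j i\<bar> \<le> (\<Sum>i\<in>UNIV. \<Sum>j\<in>UNIV - {i::'n}. 4 * K)"
    by (rule order_trans[OF sum_abs] sum_mono)+ (use Fb in auto)
  also have "\<dots> \<le> (\<Sum>i\<in>(UNIV::'n set). \<Sum>j\<in>(UNIV::'n set). 4 * K)"
    by (intro sum_mono sum_mono2) (use K0 in auto)
  also have "\<dots> = 4 * K * real CARD('n)^2" by (simp add: power2_eq_square)
  finally have 3: "\<bar>\<Sum>i\<in>UNIV. \<Sum>j\<in>UNIV - {i}. ?F i j\<bar> \<le> 2 * K * real CARD('n)^2"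
    by (subst sum_offdiag_symmetrize) simp
  have "\<bar>gen_B k1 k2 f y\<bar> \<le> real CARD('n) * K / 2 + k2 * (2 * K * real CARD('n)^2) + k1 * (real CARD('n) * K)"
    unfolding gen_B_C2_data[OF f]
    using 1 mult_left_mono[OF 2 k(1)] mult_left_mono[OF 3 k(2)] k
    by (intro order_trans[OF abs_triangle_ineq] add_mono) (auto simp: abs_mult)
  then show ?thesis by (simp add: gen_const_def algebra_simps)
qed

lemma gen_B_measurable:
  assumes f: "C2_data f g h"
  shows "gen_B k1 k2 f \<in> borel_measurable borel"
proof -
  have [measurable]: "g i \<in> borel_measurable borel" "h i j \<in> borel_measurable borel" for i j
    using C2_dataE[OF f] by (auto intro: borel_measurable_continuous_onI)
  have "gen_B k1 k2 f = (\<lambda>y. (\<Sum>i\<in>UNIV. h i i y) / 2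
     + k2 * (\<Sum>i\<in>UNIV. \<Sum>j\<in>UNIV - {i}. (1 / (y$i - y$j) + 1 / (y$i + y$j)) * g i y)
     + k1 * (\<Sum>i\<in>UNIV. (1 / y$i) * g i y))" by (simp add: gen_B_C2_data[OF f] fun_eq_iff)
  then show ?thesis by simp
qed

section \<open>Calculus rules for explicit derivatives\<close>

lemma C2_data_add:
  assumes "C2_data f g h" "C2_data f' g' h'"
  shows "C2_data (\<lambda>y. f y + f' y) (\<lambda>i y. g i y + g' i y) (\<lambda>i j y. h i j y + h' i j y)"
  using assms unfolding C2_data_def by (auto intro!: has_partial_add continuous_intros)

lemma C2_data_sum:
  assumes "\<And>a. a \<in> S \<Longrightarrow> C2_data (f a) (g a) (h a)"
  shows "C2_data (\<lambda>y. \<Sum>a\<in>S. f a y) (\<lambda>i y. \<Sum>a\<in>S. g a i y) (\<lambda>i j y. \<Sum>a\<in>S. h a i j y)"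
  using assms unfolding C2_data_def by (auto intro!: has_partial_sum continuous_intros)

lemma C2_data_mult:
  assumes "C2_data f g h" "C2_data f' g' h'"
  shows "C2_data (\<lambda>y. f y * f' y) (\<lambda>i y. g i y * f' y + f y * g' i y)
    (\<lambda>i j y. (h i j y * f' y + g i y * g' j y) + (g j y * g' i y + f y * h' i j y))"
  using assms unfolding C2_data_def by (auto intro!: has_partial_mult has_partial_add continuous_intros)

lemma C2_data_const: "C2_data (\<lambda>_. c) (\<lambda>_ _. 0) (\<lambda>_ _ _. 0)"
  unfolding C2_data_def by (auto intro: has_partial_const)

lemma C2_data_cmult:
  assumes "C2_data f g h"
  shows "C2_data (\<lambda>y. c * f y) (\<lambda>i y. c * g i y) (\<lambda>i j y. c * h i j y)"
  using C2_data_mult[OF C2_data_const[of c] assms] by simp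

lemma C2_data_compose:
  assumes f: "C2_data f g h"
    and F: "\<And>x. (F has_real_derivative F' x) (at x)" "\<And>x. (F' has_real_derivative F'' x) (at x)"
    "continuous_on UNIV F''"
  shows "C2_data (\<lambda>y. F (f y)) (\<lambda>i y. F' (f y) * g i y)
     (\<lambda>i j y. F'' (f y) * g j y * g i y + F' (f y) * h i j y)"
proof -
  have c: "continuous_on UNIV (\<lambda>y. F (f y))" "continuous_on UNIV (\<lambda>y. F' (f y))" "continuous_on UNIV (\<lambda>y. F'' (f y))"
    using C2_dataE(1)[OF f] F DERIV_continuous_on[of UNIV F F'] DERIV_continuous_on[of UNIV F' F'']
    by (auto intro!: continuous_on_compose2[where f=f and t=UNIV])
  show ?thesis using f c unfolding C2_data_def
    by (auto intro!: has_partial_compose[where F=F] has_partial_mult has_partial_compose[where F=F'] F continuous_intros)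
qed

lemma C2_data_component: "C2_data (\<lambda>y. y $ l) (\<lambda>i _. if l = i then 1 else 0) (\<lambda>_ _ _. 0)"
  unfolding C2_data_def
  by (intro conjI allI has_partial_component has_partial_const continuous_intros)

section \<open>Polynomial growth and truncation\<close>

text \<open>Powers of \<open>1 + norm y ^ 2\<close> are themselves twice continuously differentiable
  and invariant, so the majorant can serve as a test function in
  \<open>moment_bound_nn\<close>.\<close>

definition poly_growth :: "('a::real_normed_vector \<Rightarrow> real) \<Rightarrow> bool" where
  "poly_growth f \<longleftrightarrow> (\<exists>K m. \<forall>y. \<bar>f y\<bar> \<le> K * (1 + norm y ^ 2) ^ m)"

lemma poly_growthE:
  assumes "poly_growth f"
  obtains K m where "K \<ge> 0" "\<And>n y. n \<ge> m \<Longrightarrow> \<bar>f y\<bar> \<le> K * (1 + norm y ^ 2) ^ n"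
proof -
  obtain K m where K: "\<And>y. \<bar>f y\<bar> \<le> K * (1 + norm y ^ 2) ^ m"
    using assms unfolding poly_growth_def by blast
  have "\<bar>f y\<bar> \<le> \<bar>K\<bar> * (1 + norm y ^ 2) ^ n" if "n \<ge> m" for n y
  proof -
    have "\<bar>f y\<bar> \<le> K * (1 + norm y ^ 2) ^ m" by (rule K)
    also have "\<dots> \<le> \<bar>K\<bar> * (1 + norm y ^ 2) ^ n"
      using that by (intro mult_mono power_increasing) auto
    finally show ?thesis .
  qed
  then show thesis using that[of "\<bar>K\<bar>" m] by auto
qed

lemma poly_growth_const: "poly_growth (\<lambda>_. c)"
  unfolding poly_growth_def by (intro exI[of _ "\<bar>c\<bar>"] exI[of _ 0]) auto

lemma poly_growth_add:
  assumes "poly_growth f" "poly_growth g" shows "poly_growth (\<lambda>y. f y + g y)"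
proof -
  obtain K m where K: "K \<ge> 0" "\<And>n y. n \<ge> m \<Longrightarrow> \<bar>f y\<bar> \<le> K * (1 + norm y ^ 2) ^ n"
    using poly_growthE[OF assms(1)] by blast
  obtain K' m' where K': "K' \<ge> 0" "\<And>n y. n \<ge> m' \<Longrightarrow> \<bar>g y\<bar> \<le> K' * (1 + norm y ^ 2) ^ n"
    using poly_growthE[OF assms(2)] by blast
  have "\<bar>f y + g y\<bar> \<le> (K + K') * (1 + norm y ^ 2) ^ (m + m')" for y
    using K(2)[of "m+m'" y] K'(2)[of "m+m'" y] by (simp add: distrib_right)
  then show ?thesis unfolding poly_growth_def by blast
qed

lemma poly_growth_mult:
  assumes "poly_growth f" "poly_growth g" shows "poly_growth (\<lambda>y. f y * g y)"
proof -
  obtain K m where K: "K \<ge> 0" "\<And>n y. n \<ge> m \<Longrightarrow> \<bar>f y\<bar> \<le> K * (1 + norm y ^ 2) ^ n"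
    using poly_growthE[OF assms(1)] by blast
  obtain K' m' where K': "K' \<ge> 0" "\<And>n y. n \<ge> m' \<Longrightarrow> \<bar>g y\<bar> \<le> K' * (1 + norm y ^ 2) ^ n"
    using poly_growthE[OF assms(2)] by blast
  have "\<bar>f y * g y\<bar> \<le> (K * K') * (1 + norm y ^ 2) ^ (m + m')" for y
  proof -
    have "\<bar>f y * g y\<bar> \<le> (K * (1 + norm y ^ 2) ^ m) * (K' * (1 + norm y ^ 2) ^ m')"
      unfolding abs_mult using K K' by (intro mult_mono) auto
    then show ?thesis by (simp add: power_add algebra_simps)
  qed
  then show ?thesis unfolding poly_growth_def by blast
qed

lemma poly_growth_sum:
  "(\<And>a. a \<in> S \<Longrightarrow> poly_growth (f a)) \<Longrightarrow> poly_growth (\<lambda>y. \<Sum>a\<in>S. f a y)"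
  by (induction S rule: infinite_finite_induct) (auto intro: poly_growth_const poly_growth_add)

lemma poly_growth_mono:
  "poly_growth g \<Longrightarrow> (\<And>y. \<bar>f y\<bar> \<le> \<bar>g y\<bar>) \<Longrightarrow> poly_growth f"
proof -
  assume "poly_growth g" and le: "\<And>y. \<bar>f y\<bar> \<le> \<bar>g y\<bar>"
  then obtain K m where "\<And>y. \<bar>g y\<bar> \<le> K * (1 + norm y ^ 2) ^ m" unfolding poly_growth_def by auto
  then have "\<bar>f y\<bar> \<le> K * (1 + norm y ^ 2) ^ m" for y using le[of y] order_trans by blast
  then show "poly_growth f" unfolding poly_growth_def by auto
qed

lemma poly_growth_abs: "poly_growth f \<Longrightarrow> poly_growth (\<lambda>y. \<bar>f y\<bar>)"
  by (erule poly_growth_mono) auto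

lemma poly_growth_norm_power: "poly_growth (\<lambda>y. (1 + norm y ^ 2) ^ m)"
  unfolding poly_growth_def by (intro exI[of _ 1] exI[of _ m]) auto

lemma poly_growth_component: "poly_growth (\<lambda>y::(real,'n::finite) vec. y $ i)"
  unfolding poly_growth_def
proof (intro exI allI)
  fix y :: "(real,'n) vec"
  have "\<bar>y $ i\<bar> \<le> norm y" by (rule component_abs_le_norm)
  also have "\<dots> \<le> 1 * (1 + norm y ^ 2) ^ 1"
    using zero_le_power2[of "norm y - 1"] norm_ge_zero[of y] unfolding power2_diff power_one_right by (simp, linarith)
  finally show "\<bar>y $ i\<bar> \<le> 1 * (1 + norm y ^ 2) ^ 1" .
qed

lemma norm_power2_vec: "norm (y::(real,'n::finite) vec) ^ 2 = (\<Sum>i\<in>UNIV. (y $ i)^2)"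
  by (simp add: norm_vec_def L2_set_def sum_nonneg)

lemma C2_data_norm2:
  "C2_data (\<lambda>y::(real,'n::{finite,linorder}) vec. norm y ^ 2) (\<lambda>i y. 2 * y $ i) (\<lambda>i j y. if i = j then 2 else 0)"
proof -
  have "C2_data (\<lambda>y::(real,'n) vec. \<Sum>l\<in>UNIV. y $ l * y $ l)
     (\<lambda>i y. \<Sum>l\<in>UNIV. (if l = i then 1 else 0) * y $ l + y $ l * (if l = i then 1 else 0))
     (\<lambda>i j y. \<Sum>l\<in>UNIV. (0 * y $ l + (if l = i then 1 else 0) * (if l = j then 1 else 0))
         + ((if l = j then 1 else 0) * (if l = i then 1 else 0) + y $ l * 0))"
    by (intro C2_data_sum C2_data_mult C2_data_component)
  moreover have "(\<lambda>y::(real,'n) vec. \<Sum>l\<in>UNIV. y $ l * y $ l) = (\<lambda>y. norm y ^ 2)"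
    unfolding norm_power2_vec by (simp only: power2_eq_square)
  moreover have "(\<lambda>i (y::(real,'n) vec). \<Sum>l\<in>UNIV. (if l = i then 1 else 0) * y $ l + y $ l * (if l = i then 1 else 0)) = (\<lambda>i y. 2 * y $ i)"
    by (simp add: fun_eq_iff sum.distrib if_distrib[of "\<lambda>c. c * _"] if_distrib[of "\<lambda>c. _ * c"] cong: if_cong)
  moreover have "(\<lambda>i j (y::(real,'n) vec). \<Sum>l\<in>UNIV. (0 * y $ l + (if l = i then 1 else 0) * (if l = j then 1 else 0))
         + ((if l = j then 1 else 0) * (if l = i then 1 else 0) + y $ l * 0)) = (\<lambda>i j y. if i = j then 2 else 0)"
    by (auto simp: fun_eq_iff sum.distrib if_distrib[of "\<lambda>c. c * _"] if_distrib[of "\<lambda>c. _ * c"] cong: if_cong)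
  ultimately show ?thesis by simp
qed

lemma norm_perm: "\<sigma> permutes UNIV \<Longrightarrow> norm (\<chi> i. (y::(real,'n::finite) vec) $ \<sigma> i) = norm y"
  unfolding norm_vec_def L2_set_def by (simp add: sum.permute[of \<sigma> UNIV "\<lambda>i. (y $ i)^2"] o_def)

lemma norm_sign: "(\<And>i. \<epsilon> i = 1 \<or> \<epsilon> i = (-1::real)) \<Longrightarrow> norm (\<chi> i. \<epsilon> i * (y::(real,'n::finite) vec) $ i) = norm y"
proof -
  assume e: "\<And>i. \<epsilon> i = 1 \<or> \<epsilon> i = (-1::real)"
  have "(norm ((\<chi> i. \<epsilon> i * y $ i) $ i))\<^sup>2 = (norm (y $ i))\<^sup>2" for i using e[of i] by auto
  then show ?thesis unfolding norm_vec_def L2_set_def by simp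
qed

lemma invariant_norm:
  fixes F :: "real \<Rightarrow> real"
  shows "perm_invariant (\<lambda>y::(real,'n::{finite,linorder}) vec. F (norm y))" "sign_invariant (\<lambda>y::(real,'n) vec. F (norm y))"
  unfolding perm_invariant_def sign_invariant_def by (auto simp: norm_perm norm_sign)

lemma invariant_mult:
  "perm_invariant f \<Longrightarrow> perm_invariant g \<Longrightarrow> perm_invariant (\<lambda>y. f y * g y)"
  "sign_invariant f \<Longrightarrow> sign_invariant g \<Longrightarrow> sign_invariant (\<lambda>y. f y * g y)"
  by (simp_all add: perm_invariant_def sign_invariant_def)

section \<open>A C^2 cutoff with derivative bounds that do not depend on its scale\<close>

lemma DERIV_max_power:
  "((\<lambda>v::real. (max 0 v) ^ Suc (Suc n)) has_real_derivative real (Suc (Suc n)) * (max 0 v) ^ Suc n) (at v)"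
proof (cases "v = 0")
  case False
  then consider "v > 0" | "v < 0" by linarith
  then show ?thesis
  proof cases
    case 1
    have "((\<lambda>v::real. v ^ Suc (Suc n)) has_real_derivative real (Suc (Suc n)) * v ^ Suc n) (at v)"
      using DERIV_pow[of "Suc (Suc n)" v] by simp
    then show ?thesis using 1
      by (subst DERIV_cong_ev[OF refl _ refl, where g="\<lambda>v. v ^ Suc (Suc n)"])
        (auto intro!: eventually_mono[OF eventually_nhds_in_open[of "{0<..}" v]])
  next
    case 2
    then show ?thesis
      by (subst DERIV_cong_ev[OF refl _ refl, where g="\<lambda>v. 0"])
        (auto intro!: eventually_mono[OF eventually_nhds_in_open[of "{..<0}" v]])
  qed
next
  case True
  have "((\<lambda>h::real. (max 0 h) ^ Suc n) \<longlongrightarrow> (max 0 0) ^ Suc n) (at 0)"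
    by (intro tendsto_intros)
  then have t: "((\<lambda>h::real. (max 0 h) ^ Suc n) \<longlongrightarrow> 0) (at 0)" by simp
  have "((\<lambda>h::real. (max 0 h) ^ Suc (Suc n) / h) \<longlongrightarrow> 0) (at 0)"
    by (rule Lim_null_comparison[OF _ t]) (auto simp: eventually_at_filter max_def)
  then show ?thesis using True by (simp add: DERIV_def)
qed

text \<open>The cube is the lowest integer power of a positive part that is C^2; depending on
  \<open>norm y\<close> alone, the function respects both invariances. For \<open>a > 0\<close> the
  support is the ball of radius \<open>1 / sqrt a\<close>.\<close>

definition cutoff :: "real \<Rightarrow> ('a::real_normed_vector) \<Rightarrow> real" where
  "cutoff a y = (max 0 (1 - a * norm y ^ 2)) ^ 3"

definition cutoff_g :: "real \<Rightarrow> 'n \<Rightarrow> (real,'n::{finite,linorder}) vec \<Rightarrow> real" where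
  "cutoff_g a i y = - a * (3 * (max 0 (1 - a * norm y ^ 2)) ^ 2) * (2 * y $ i)"

definition cutoff_h :: "real \<Rightarrow> 'n \<Rightarrow> 'n \<Rightarrow> (real,'n::{finite,linorder}) vec \<Rightarrow> real" where
  "cutoff_h a i j y = a\<^sup>2 * (6 * (max 0 (1 - a * norm y ^ 2))) * (2 * y $ j) * (2 * y $ i)
     + - a * (3 * (max 0 (1 - a * norm y ^ 2)) ^ 2) * (if i = j then 2 else 0)"

lemma C2_data_cutoff: "C2_data (cutoff a) (cutoff_g a) (cutoff_h a :: 'n \<Rightarrow> 'n \<Rightarrow> (real,'n::{finite,linorder}) vec \<Rightarrow> real)"
proof -
  let ?m = "\<lambda>w::real. max 0 (1 - a * w)"
  have lin: "((\<lambda>w. 1 - a * w) has_real_derivative - a) (at w)" for w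
    by (auto intro!: derivative_eq_intros)
  have 1: "((\<lambda>w. ?m w ^ 3) has_real_derivative - a * (3 * ?m w ^ 2)) (at w)" for w
    using DERIV_chain2[of "\<lambda>v. (max 0 v) ^ 3" "3 * (max 0 (1 - a * w))^2" "\<lambda>w. 1 - a * w" w "- a" UNIV, OF _ lin]
      DERIV_max_power[of 1 "1 - a * w"]
    by (simp add: eval_nat_numeral mult.commute)
  have 2: "((\<lambda>w. - a * (3 * ?m w ^ 2)) has_real_derivative a\<^sup>2 * (6 * ?m w)) (at w)" for w
  proof -
    have "((\<lambda>w. ?m w ^ 2) has_real_derivative (2 * ?m w) * - a) (at w)"
      using DERIV_chain2[of "\<lambda>v. (max 0 v) ^ 2" "2 * (max 0 (1 - a * w))" "\<lambda>w. 1 - a * w" w "- a" UNIV, OF _ lin]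
        DERIV_max_power[of 0 "1 - a * w"]
      by (simp add: eval_nat_numeral mult.commute)
    then have "((\<lambda>w. - a * (3 * ?m w ^ 2)) has_real_derivative - a * (3 * ((2 * ?m w) * - a))) (at w)"
      by (intro DERIV_cmult)
    then show ?thesis by (simp add: power2_eq_square algebra_simps)
  qed
  have "continuous_on UNIV (\<lambda>w. a\<^sup>2 * (6 * ?m w))" by (intro continuous_intros)
  from C2_data_compose[OF C2_data_norm2 1 2 this]
  show ?thesis unfolding cutoff_def[abs_def] cutoff_g_def[abs_def] cutoff_h_def[abs_def] by simp
qed

text \<open>On the support \<open>a * norm y ^ 2 \<le> 1\<close>, so every derivative gains a factor
  of order \<open>1 / (1 + norm y)\<close>, uniformly in \<open>a\<close>; for small
  \<open>norm y\<close> this is where \<open>a \<le> 1\<close> enters. The numbers are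
  \<open>6 * 2\<close> and \<open>(24 + 6) * 2\<close>.\<close>

lemma cutoff_bounds:
  fixes y :: "(real,'n::{finite,linorder}) vec"
  assumes a: "0 < a" "a \<le> 1"
  shows "0 \<le> cutoff a y" "cutoff a y \<le> 1"
    "(1 + norm y) * \<bar>cutoff_g a i y\<bar> \<le> 12" "(1 + norm y ^ 2) * \<bar>cutoff_h a i j y\<bar> \<le> 60"
proof -
  define u where "u = max 0 (1 - a * norm y ^ 2)"
  have u: "0 \<le> u" "u \<le> 1" using a by (auto simp: u_def)
  show "0 \<le> cutoff a y" "cutoff a y \<le> 1" using u by (auto simp: cutoff_def u_def[symmetric] power_le_one)
  have u2: "u^2 \<le> 1" using u by (simp add: power_le_one)
  show "(1 + norm y) * \<bar>cutoff_g a i y\<bar> \<le> 12"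
  proof (cases "u = 0")
    case False
    then have ay: "a * norm y ^ 2 \<le> 1" by (auto simp: u_def max_def split: if_splits)
    have "a * norm y \<le> 1"
    proof (cases "norm y \<le> 1")
      case True then show ?thesis using a by (simp add: mult_le_one)
    next
      case False
      then have "a * norm y * 1 \<le> a * norm y * norm y" using a by (intro mult_left_mono) auto
      then show ?thesis using ay by (simp add: power2_eq_square mult.assoc)
    qed
    then have s: "(1 + norm y) * (a * norm y) \<le> 2" using ay by (simp add: distrib_right power2_eq_square algebra_simps)
    have "\<bar>cutoff_g a i y\<bar> = 6 * a * u^2 * \<bar>y $ i\<bar>" using a by (simp add: cutoff_g_def u_def[symmetric] abs_mult)
    also have "\<dots> \<le> 6 * a * 1 * norm y" using a u2 component_abs_le_norm[of y i] by (intro mult_mono) auto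
    finally have "(1 + norm y) * \<bar>cutoff_g a i y\<bar> \<le> (1 + norm y) * (6 * a * norm y)" by (intro mult_left_mono) auto
    then show ?thesis using s by simp
  qed (simp add: cutoff_g_def u_def[symmetric])
  show "(1 + norm y ^ 2) * \<bar>cutoff_h a i j y\<bar> \<le> 60"
  proof (cases "u = 0")
    case False
    then have ay: "a * norm y ^ 2 \<le> 1" by (auto simp: u_def max_def split: if_splits)
    have "\<bar>y $ j\<bar> * \<bar>y $ i\<bar> \<le> norm y * norm y"
      using component_abs_le_norm[of y i] component_abs_le_norm[of y j] by (intro mult_mono) auto
    then have "a * (\<bar>y $ j\<bar> * \<bar>y $ i\<bar>) \<le> a * (norm y * norm y)" using a by (intro mult_left_mono) auto
    then have yy: "a * (\<bar>y $ j\<bar> * \<bar>y $ i\<bar>) \<le> 1" using ay by (simp add: power2_eq_square)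
    have "\<bar>cutoff_h a i j y\<bar> \<le> \<bar>a\<^sup>2 * (6 * u) * (2 * y $ j) * (2 * y $ i)\<bar> + \<bar>- a * (3 * u\<^sup>2) * (if i = j then 2 else 0)\<bar>"
      unfolding cutoff_h_def u_def[symmetric] by (rule abs_triangle_ineq)
    also have "\<bar>a\<^sup>2 * (6 * u) * (2 * y $ j) * (2 * y $ i)\<bar> = (24 * a) * u * (a * (\<bar>y $ j\<bar> * \<bar>y $ i\<bar>))"
      using a u by (simp add: abs_mult power2_eq_square)
    also have "\<dots> \<le> (24 * a) * 1 * 1" using a u yy by (intro mult_mono) auto
    also have "\<bar>- a * (3 * u\<^sup>2) * (if i = j then 2 else 0)\<bar> \<le> 6 * a"
      using a u2 by (auto simp: abs_mult)
    finally have "\<bar>cutoff_h a i j y\<bar> \<le> 30 * a" by simp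
    then have "(1 + norm y ^ 2) * \<bar>cutoff_h a i j y\<bar> \<le> (1 + norm y ^ 2) * (30 * a)" by (intro mult_left_mono) auto
    also have "\<dots> \<le> 60" using a ay by (simp add: distrib_right algebra_simps)
    finally show ?thesis .
  qed (simp add: cutoff_h_def u_def[symmetric])
qed

definition trunc_g where
  "trunc_g a f g i y = g i y * cutoff a y + f y * cutoff_g a i y"

definition trunc_h where
  "trunc_h a f g h i j y = (h i j y * cutoff a y + g i y * cutoff_g a j y) + (g j y * cutoff_g a i y + f y * cutoff_h a i j y)"

lemma C2_data_trunc:
  "C2_data f g h \<Longrightarrow> C2_data (\<lambda>y. f y * cutoff a y) (trunc_g a f g) (trunc_h a f g h)"
  using C2_data_mult[OF _ C2_data_cutoff, of f g h a] unfolding trunc_g_def[abs_def] trunc_h_def[abs_def] .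

text \<open>The growth of orders 2, 1, 0 allowed for \<open>f\<close>, \<open>g\<close>,
  \<open>h\<close> is offset by the decay of the second, first and zeroth derivatives of the cutoff;
  \<open>85 = 1 + 12 + 12 + 60\<close> collects the four terms of the product rule. \<open>A\<close>
  is a number at the fixed point \<open>y\<close>, so in applications it may depend polynomially on
  \<open>y\<close>.\<close>

lemma trunc_h_bound:
  fixes y :: "(real,'n::{finite,linorder}) vec"
  assumes a: "0 < a" "a \<le> 1"
    and A: "\<bar>f y\<bar> \<le> A * (1 + norm y ^ 2)" "\<And>i. \<bar>g i y\<bar> \<le> A * (1 + norm y)" "\<And>i j. \<bar>h i j y\<bar> \<le> A"
  shows "\<bar>trunc_h a f g h i j y\<bar> \<le> 85 * A"
proof -
  note b = cutoff_bounds[OF a, of y]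
  have A0: "A \<ge> 0" using A(3)[of undefined undefined] abs_ge_zero order_trans by blast
  have 1: "\<bar>h i j y * cutoff a y\<bar> \<le> A * 1" unfolding abs_mult using A b A0 by (intro mult_mono) auto
  have 2: "\<bar>g i y * cutoff_g a j y\<bar> \<le> 12 * A" for i j
  proof -
    have "\<bar>g i y * cutoff_g a j y\<bar> \<le> A * (1 + norm y) * \<bar>cutoff_g a j y\<bar>"
      unfolding abs_mult using A by (intro mult_right_mono) auto
    also have "\<dots> \<le> A * 12" unfolding mult.assoc using b A0 by (intro mult_left_mono) auto
    finally show ?thesis by simp
  qed
  have 3: "\<bar>f y * cutoff_h a i j y\<bar> \<le> A * 60"
  proof -
    have "\<bar>f y * cutoff_h a i j y\<bar> \<le> A * (1 + norm y^2) * \<bar>cutoff_h a i j y\<bar>"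
      unfolding abs_mult using A by (intro mult_right_mono) auto
    also have "\<dots> \<le> A * 60" unfolding mult.assoc using b A0 by (intro mult_left_mono) auto
    finally show ?thesis by simp
  qed
  show ?thesis unfolding trunc_h_def using 1 2[of i j] 2[of j i] 3 by linarith
qed

lemma cutoff_tendsto:
  assumes "a \<longlonglongrightarrow> 0"
  shows "(\<lambda>n. cutoff (a n) y) \<longlonglongrightarrow> 1" "(\<lambda>n. cutoff_g (a n) i y) \<longlonglongrightarrow> 0" "(\<lambda>n. cutoff_h (a n) i j y) \<longlonglongrightarrow> 0"
proof -
  have "(\<lambda>n. cutoff (a n) y) \<longlonglongrightarrow> (max 0 (1 - 0 * norm y ^ 2)) ^ 3"
    unfolding cutoff_def by (intro tendsto_intros assms)
  then show "(\<lambda>n. cutoff (a n) y) \<longlonglongrightarrow> 1" by simp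
  have "(\<lambda>n. cutoff_g (a n) i y) \<longlonglongrightarrow> - 0 * (3 * (max 0 (1 - 0 * norm y ^ 2)) ^ 2) * (2 * y $ i)"
    unfolding cutoff_g_def by (intro tendsto_intros assms)
  then show "(\<lambda>n. cutoff_g (a n) i y) \<longlonglongrightarrow> 0" by simp
  have "(\<lambda>n. cutoff_h (a n) i j y) \<longlonglongrightarrow> 0\<^sup>2 * (6 * (max 0 (1 - 0 * norm y ^ 2))) * (2 * y $ j) * (2 * y $ i)
     + - 0 * (3 * (max 0 (1 - 0 * norm y ^ 2)) ^ 2) * (if i = j then 2 else 0)"
    unfolding cutoff_h_def by (intro tendsto_intros assms)
  then show "(\<lambda>n. cutoff_h (a n) i j y) \<longlonglongrightarrow> 0" by simp
qed

lemma trunc_tendsto: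
  assumes "a \<longlonglongrightarrow> 0"
  shows "(\<lambda>n. f y * cutoff (a n) y) \<longlonglongrightarrow> f y" "(\<lambda>n. trunc_g (a n) f g i y) \<longlonglongrightarrow> g i y"
    "(\<lambda>n. trunc_h (a n) f g h i j y) \<longlonglongrightarrow> h i j y"
  unfolding trunc_g_def trunc_h_def
proof -
  note c = cutoff_tendsto[OF assms]
  show "(\<lambda>n. f y * cutoff (a n) y) \<longlonglongrightarrow> f y"
    using tendsto_mult[OF tendsto_const c(1), of "f y" y] by simp
  show "(\<lambda>n. g i y * cutoff (a n) y + f y * cutoff_g (a n) i y) \<longlonglongrightarrow> g i y"
    using tendsto_add[OF tendsto_mult[OF tendsto_const c(1), of "g i y" y] tendsto_mult[OF tendsto_const c(2), of "f y" i y]] by simp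
  have "(\<lambda>n. (h i j y * cutoff (a n) y + g i y * cutoff_g (a n) j y) + (g j y * cutoff_g (a n) i y + f y * cutoff_h (a n) i j y))
     \<longlonglongrightarrow> (h i j y * 1 + g i y * 0) + (g j y * 0 + f y * 0)"
    by (intro tendsto_intros c)
  then show "(\<lambda>n. (h i j y * cutoff (a n) y + g i y * cutoff_g (a n) j y) + (g j y * cutoff_g (a n) i y + f y * cutoff_h (a n) i j y))
     \<longlonglongrightarrow> h i j y" by simp
qed

text \<open>At a fixed \<open>y\<close> the coefficients of the generator are mere numbers, so
  pointwise convergence holds everywhere, walls included.\<close>

lemma gen_B_tendsto:
  assumes f: "\<And>n. C2_data (f n) (g n) (h n)" "C2_data f' g' h'"
    and "\<And>i. (\<lambda>n. g n i y) \<longlonglongrightarrow> g' i y" "\<And>i. (\<lambda>n. h n i i y) \<longlonglongrightarrow> h' i i y"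
  shows "(\<lambda>n. gen_B k1 k2 (f n) y) \<longlonglongrightarrow> gen_B k1 k2 f' y"
  unfolding gen_B_C2_data[OF f(1)] gen_B_C2_data[OF f(2)]
  by (intro tendsto_intros assms) auto

lemma has_partial_zero_outside:
  assumes "has_partial i f f'" "\<And>y. R < norm y \<Longrightarrow> f y = 0" "R < norm y"
  shows "f' y = 0"
proof -
  have "((\<lambda>r. norm (y + r *\<^sub>R axis i 1)) \<longlongrightarrow> norm (y + 0 *\<^sub>R axis i 1)) (nhds 0)"
    by (intro tendsto_intros filterlim_ident)
  then have "\<forall>\<^sub>F r in nhds 0. R < norm (y + r *\<^sub>R axis i 1)"
    using assms(3) by (intro order_tendstoD) auto
  then have ev: "\<forall>\<^sub>F r in nhds 0. f (y + r *\<^sub>R axis i 1) = 0"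
    by eventually_elim (use assms(2) in auto)
  have "((\<lambda>r. f (y + r *\<^sub>R axis i 1)) has_real_derivative 0) (at 0)"
    by (subst DERIV_cong_ev[OF refl ev refl]) simp
  with assms(1) show ?thesis unfolding has_partial_def using DERIV_unique by blast
qed

lemma continuous_zero_outside_bounded:
  fixes f :: "(real,'n::finite) vec \<Rightarrow> real"
  assumes "continuous_on UNIV f" "\<And>y. R < norm y \<Longrightarrow> f y = 0"
  shows "\<exists>K. \<forall>y. \<bar>f y\<bar> \<le> K"
proof -
  have "bounded (f ` cball 0 R)"
    by (intro compact_imp_bounded compact_continuous_image continuous_on_subset[OF assms(1)]) auto
  then obtain K where K: "\<And>y. norm y \<le> R \<Longrightarrow> \<bar>f y\<bar> \<le> K" unfolding bounded_iff by fastforce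
  have "\<bar>f y\<bar> \<le> max K 0" for y using K[of y] assms(2)[of y] by (cases "norm y \<le> R") (auto simp: max_def)
  then show ?thesis by blast
qed

lemma C2_data_compact_support_bounded:
  assumes f: "C2_data f g h" and c: "compact_support f"
  shows "\<exists>K. (\<forall>y. \<bar>f y\<bar> \<le> K) \<and> (\<forall>i j y. \<bar>h i j y\<bar> \<le> K)"
proof -
  obtain R where R: "\<And>y. R < norm y \<Longrightarrow> f y = 0" using c unfolding compact_support_def by blast
  have g: "R < norm y \<Longrightarrow> g i y = 0" for i y using has_partial_zero_outside[OF C2_dataE(4)[OF f] R] by blast
  have h: "R < norm y \<Longrightarrow> h i j y = 0" for i j y using has_partial_zero_outside[OF C2_dataE(5)[OF f] g] by blast
  let ?F = "\<lambda>y. \<bar>f y\<bar> + (\<Sum>i\<in>UNIV. \<Sum>j\<in>UNIV. \<bar>h i j y\<bar>)"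
  have "\<exists>K. \<forall>y. \<bar>?F y\<bar> \<le> K"
    by (rule continuous_zero_outside_bounded[of _ R]) (use R h C2_dataE[OF f] in \<open>auto intro!: continuous_intros\<close>)
  then obtain K where K: "\<And>y. \<bar>?F y\<bar> \<le> K" by blast
  have s: "\<bar>h i j y\<bar> \<le> (\<Sum>i\<in>UNIV. \<Sum>j\<in>UNIV. \<bar>h i j y\<bar>)" for i j y
  proof -
    have "\<bar>h i j y\<bar> \<le> (\<Sum>j\<in>UNIV. \<bar>h i j y\<bar>)" by (intro member_le_sum) auto
    also have "\<dots> \<le> (\<Sum>i\<in>UNIV. \<Sum>j\<in>UNIV. \<bar>h i j y\<bar>)"
      by (rule member_le_sum[of i UNIV "\<lambda>i. \<Sum>j\<in>UNIV. \<bar>h i j y\<bar>"]) (auto intro: sum_nonneg)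
    finally show ?thesis .
  qed
  have "\<bar>f y\<bar> \<le> K \<and> \<bar>h i j y\<bar> \<le> K" for i j y
    using K[of y] s[of i j y] abs_ge_zero[of "h i j y"] abs_ge_zero[of "f y"] by linarith
  then show ?thesis by blast
qed

section \<open>Moments and the forward equation of the process of type B\<close>

lemma invariant_cutoff: "perm_invariant (cutoff a)" "sign_invariant (cutoff a)"
  using invariant_norm[of "\<lambda>r. (max 0 (1 - a * r ^ 2)) ^ 3"] by (simp_all add: cutoff_def[abs_def])

lemma LINT_abs_le_const:
  assumes "\<And>s. s \<in> {0..t} \<Longrightarrow> \<bar>F s\<bar> \<le> C" "t \<ge> 0" "C \<ge> (0::real)"
  shows "\<bar>LINT s:{0..t}|lborel. F s\<bar> \<le> C * t"
proof (cases "set_integrable lborel {0..t} F")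
  case True
  have i: "integrable lborel (\<lambda>s. indicator {0..t} s * C)"
    using integrable_real_indicator[of "{0..t}" lborel] assms by simp
  have "\<bar>LINT s:{0..t}|lborel. F s\<bar> \<le> (\<integral>s. indicator {0..t} s * C \<partial>lborel)"
    unfolding set_lebesgue_integral_def
    by (rule integral_abs_bound_integral) (use True i assms in \<open>auto simp: set_integrable_def split: split_indicator\<close>)
  also have "\<dots> = C * t" using assms by simp
  finally show ?thesis .
next
  \<comment> \<open>A function that is not integrable has integral 0, so the bound persists.\<close>
  case False
  then show ?thesis using assms by (simp add: set_lebesgue_integral_def set_integrable_def not_integrable_integral_eq)
qed

locale bessel_B =
  fixes M :: "'a measure" and X :: "real \<Rightarrow> 'a \<Rightarrow> (real,'n::{finite,linorder}) vec" and k1 k2 :: real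
    and x :: "(real,'n) vec"
  assumes process: "bessel_B_process M X k1 k2 x" and k1_pos: "k1 > 0" and k2_pos: "k2 > 0"
begin

sublocale prob_space M
  using process by (simp add: bessel_B_process_def)

text \<open>Writing \<open>max 0 s\<close> for the time extends every path continuously to negative
  times by its starting value, so that functions of time can be treated as measurable on all of
  \<open>lborel\<close>.\<close>

lemma X_measurable [measurable]: "X (max 0 s) \<in> borel_measurable M"
  using process by (simp add: bessel_B_process_def)

lemma X_path:
  assumes "\<omega> \<in> space M"
  shows "continuous_on UNIV (\<lambda>s. X (max 0 s) \<omega>)" "X (max 0 s) \<omega> \<in> chamber_B" "X 0 \<omega> = x"
proof -
  have c: "continuous_on {0..} (\<lambda>t. X t \<omega>)" using assms process by (simp add: bessel_B_process_def)
  show "continuous_on UNIV (\<lambda>s. X (max 0 s) \<omega>)"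
    by (rule continuous_on_compose2[OF c]) (auto intro!: continuous_intros)
  show "X (max 0 s) \<omega> \<in> chamber_B" "X 0 \<omega> = x" using assms process by (auto simp: bessel_B_process_def)
qed

text \<open>The paths are continuous, so the process is the limit of its step versions on the grid
  of mesh \<open>1 / Suc n\<close>; each of these is measurable as a countable patchwork. Fubini's
  theorem in \<open>dynkin_compact_support\<close> rests on this.\<close>

lemma X_joint_measurable: "(\<lambda>p. X (max 0 (fst p)) (snd p)) \<in> borel_measurable (lborel \<Otimes>\<^sub>M M)"
proof (rule borel_measurable_LIMSEQ_metric)
  fix n :: nat
  have "(\<lambda>p. (\<lambda>i::int. \<lambda>p. X (max 0 (of_int i / real (Suc n))) (snd p)) \<lfloor>real (Suc n) * fst p\<rfloor> p)
      \<in> borel_measurable (lborel \<Otimes>\<^sub>M M)"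
    by (rule measurable_compose_countable[where f="\<lambda>i p. X (max 0 (of_int i / real (Suc n))) (snd p)"
          and g="\<lambda>p. \<lfloor>real (Suc n) * fst p\<rfloor>"]) measurable
  then show "(\<lambda>p. X (max 0 (of_int \<lfloor>real (Suc n) * fst p\<rfloor> / real (Suc n))) (snd p)) \<in> borel_measurable (lborel \<Otimes>\<^sub>M M)" by simp
next
  fix p :: "real \<times> 'a" assume p: "p \<in> space (lborel \<Otimes>\<^sub>M M)"
  then have w: "snd p \<in> space M" by (auto simp: space_pair_measure)
  have "(\<lambda>n. of_int \<lfloor>real (Suc n) * fst p\<rfloor> / real (Suc n)) \<longlonglongrightarrow> fst p"
  proof (rule tendsto_sandwich[OF _ _ _ tendsto_const])
    have "(\<lambda>n. fst p - inverse (real (Suc n))) \<longlonglongrightarrow> fst p - 0"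
      by (intro tendsto_diff tendsto_const LIMSEQ_inverse_real_of_nat)
    then show "(\<lambda>n. fst p - inverse (real (Suc n))) \<longlonglongrightarrow> fst p" by simp
    show "\<forall>\<^sub>F n in sequentially. fst p - inverse (real (Suc n)) \<le> of_int \<lfloor>real (Suc n) * fst p\<rfloor> / real (Suc n)"
    proof (intro always_eventually allI)
      fix n
      have "real (Suc n) * fst p - 1 \<le> of_int \<lfloor>real (Suc n) * fst p\<rfloor>" by linarith
      then have "(real (Suc n) * fst p - 1) / real (Suc n) \<le> of_int \<lfloor>real (Suc n) * fst p\<rfloor> / real (Suc n)"
        by (rule divide_right_mono) simp
      then show "fst p - inverse (real (Suc n)) \<le> of_int \<lfloor>real (Suc n) * fst p\<rfloor> / real (Suc n)"
        by (simp add: diff_divide_distrib inverse_eq_divide del: of_nat_Suc)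
    qed
    show "\<forall>\<^sub>F n in sequentially. of_int \<lfloor>real (Suc n) * fst p\<rfloor> / real (Suc n) \<le> fst p"
    proof (intro always_eventually allI)
      fix n
      have "of_int \<lfloor>real (Suc n) * fst p\<rfloor> \<le> real (Suc n) * fst p" by linarith
      then have "of_int \<lfloor>real (Suc n) * fst p\<rfloor> / real (Suc n) \<le> (real (Suc n) * fst p) / real (Suc n)"
        by (rule divide_right_mono) simp
      then show "of_int \<lfloor>real (Suc n) * fst p\<rfloor> / real (Suc n) \<le> fst p" by (simp del: of_nat_Suc)
    qed
  qed
  then show "(\<lambda>n. X (max 0 (of_int \<lfloor>real (Suc n) * fst p\<rfloor> / real (Suc n))) (snd p)) \<longlonglongrightarrow> X (max 0 (fst p)) (snd p)"
    using continuous_on_tendsto_compose[OF X_path(1)[OF w]] by auto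
qed

definition ex :: "((real,'n) vec \<Rightarrow> real) \<Rightarrow> real \<Rightarrow> real" where
  "ex q s = (\<integral>\<omega>. q (X (max 0 s) \<omega>) \<partial>M)"

lemma ex_measurable:
  assumes [measurable]: "q \<in> borel_measurable borel"
  shows "ex q \<in> borel_measurable lborel"
proof -
  have "(\<lambda>p. q (X (max 0 (fst p)) (snd p))) \<in> borel_measurable (lborel \<Otimes>\<^sub>M M)"
    using measurable_compose[OF X_joint_measurable assms] by simp
  then have "(\<lambda>s. \<integral>\<omega>. q (X (max 0 s) \<omega>) \<partial>M) \<in> borel_measurable lborel"
    by (intro borel_measurable_lebesgue_integral) (simp add: split_beta)
  then show ?thesis unfolding ex_def[abs_def] .
qed

text \<open>The martingale property, tested on the whole space between the times 0 and
  \<open>t\<close>, says that the martingale term has mean 0. Invariance and compact support bound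
  the generator by a constant, which licenses the exchange of expectation and time integral.\<close>

lemma dynkin_compact_support:
  assumes f: "C2_data f g h" and dom: "f \<in> domain_B" and t: "t \<ge> 0"
  shows "ex f t = f x + (LINT s:{0..t}|lborel. ex (gen_B k1 k2 f) s)"
proof -
  let ?L = "gen_B k1 k2 f"
  have inv: "perm_invariant f" "sign_invariant f" "compact_support f" using dom by (auto simp: domain_B_def)
  obtain K where K: "\<And>y. \<bar>f y\<bar> \<le> K" "\<And>i j y. \<bar>h i j y\<bar> \<le> K"
    using C2_data_compact_support_bounded[OF f inv(3)] by blast
  define C where "C = gen_const k1 k2 TYPE('n) * K"
  have L: "\<bar>?L y\<bar> \<le> C" for y unfolding C_def
    by (rule gen_B_bound[OF f inv(1,2)]) (use k1_pos k2_pos K in auto)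
  have C0: "C \<ge> 0" using L[of undefined] by linarith
  have [measurable]: "?L \<in> borel_measurable borel" by (rule gen_B_measurable[OF f])
  have [measurable]: "f \<in> borel_measurable borel" by (rule borel_measurable_continuous_onI[OF C2_dataE(1)[OF f]])
  let ?I = "\<lambda>\<omega>. LINT s:{0..t}|lborel. ?L (X (max 0 s) \<omega>)"
  \<comment> \<open>\<open>mart_term\<close> is stated with the gauge integral over
    \<open>{0..t}\<close>; for this bounded measurable integrand it equals the Lebesgue integral
    that Fubini's theorem handles.\<close>
  have mart: "mart_term X (gen_B k1 k2) f t \<omega> = f (X (max 0 t) \<omega>) - f x - ?I \<omega>" if w: "\<omega> \<in> space M" for \<omega>
  proof -
    have m: "(\<lambda>s. ?L (X (max 0 s) \<omega>)) \<in> borel_measurable lborel"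
      using borel_measurable_continuous_onI[OF X_path(1)[OF w]] by measurable
    have "integrable lborel (\<lambda>s. indicator {0..t} s * C)"
      using integrable_real_indicator[of "{0..t}" lborel] t by simp
    then have "set_integrable lborel {0..t} (\<lambda>s. ?L (X (max 0 s) \<omega>))"
      unfolding set_integrable_def
      by (rule Bochner_Integration.integrable_bound) (use m in \<open>auto split: split_indicator intro!: AE_I2 order_trans[OF L abs_ge_self]\<close>)
    then have "?I \<omega> = integral {0..t} (\<lambda>s. ?L (X (max 0 s) \<omega>))"
      by (rule set_borel_integral_eq_integral(2))
    also have "\<dots> = integral {0..t} (\<lambda>s. ?L (X s \<omega>))"
      by (intro integral_cong) (auto simp: max_def)
    finally show ?thesis using X_path(3)[OF w] t by (simp add: mart_term_def max_def)
  qed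
  have pr: "0 \<le> s \<Longrightarrow> s \<le> t \<Longrightarrow>
        integrable M (mart_term X (gen_B k1 k2) f t) \<and>
        (\<forall>A\<in>sigma_sets (space M) (nat_filtr_gen M X s).
           set_lebesgue_integral M A (mart_term X (gen_B k1 k2) f t)
             = set_lebesgue_integral M A (mart_term X (gen_B k1 k2) f s))" for s t
    using process dom unfolding bessel_B_process_def by blast
  have "set_lebesgue_integral M (space M) (mart_term X (gen_B k1 k2) f t)
      = set_lebesgue_integral M (space M) (mart_term X (gen_B k1 k2) f 0)"
    using pr[of 0 t] t sigma_sets_top by blast
  also have "mart_term X (gen_B k1 k2) f 0 = (\<lambda>_. 0)" by (simp add: mart_term_def fun_eq_iff)
  finally have m0: "(\<integral>\<omega>. mart_term X (gen_B k1 k2) f t \<omega> \<partial>M) = 0"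
    using pr[of t t] t by (simp add: set_integral_space)
  have "(\<integral>\<omega>. mart_term X (gen_B k1 k2) f t \<omega> \<partial>M) = (\<integral>\<omega>. f (X (max 0 t) \<omega>) - f x - ?I \<omega> \<partial>M)"
    by (intro Bochner_Integration.integral_cong refl mart)
  with m0 have m1: "(\<integral>\<omega>. f (X (max 0 t) \<omega>) - f x - ?I \<omega> \<partial>M) = 0" by simp
  have fint: "integrable M (\<lambda>\<omega>. f (X (max 0 t) \<omega>))"
    by (rule integrable_const_bound[of _ K]) (use K in auto)
  interpret P: pair_sigma_finite lborel M ..
  let ?F = "\<lambda>s \<omega>. indicator {0..t} s * ?L (X (max 0 s) \<omega>)"
  have Fm: "(\<lambda>p. ?F (fst p) (snd p)) \<in> borel_measurable (lborel \<Otimes>\<^sub>M M)"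
    using X_joint_measurable by measurable
  have Fi: "integrable (lborel \<Otimes>\<^sub>M M) (\<lambda>(s, \<omega>). ?F s \<omega>)"
  proof (rule Bochner_Integration.integrable_bound)
    have "emeasure (lborel \<Otimes>\<^sub>M M) ({0..t} \<times> space M) = emeasure lborel {0..t} * emeasure M (space M)"
      by (intro emeasure_pair_measure_Times) auto
    also have "\<dots> < \<infinity>" using t by (simp add: emeasure_space_1)
    finally show "integrable (lborel \<Otimes>\<^sub>M M) (\<lambda>p. C * indicator ({0..t} \<times> space M) p)"
      by (intro integrable_mult_right) (auto simp: integrable_indicator_iff)
    show "(\<lambda>(s, \<omega>). ?F s \<omega>) \<in> borel_measurable (lborel \<Otimes>\<^sub>M M)" using Fm by (simp add: split_beta)
    show "AE p in lborel \<Otimes>\<^sub>M M. norm (case p of (s, \<omega>) \<Rightarrow> ?F s \<omega>) \<le> norm (C * indicator ({0..t} \<times> space M) p)"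
      using L C0 by (intro AE_I2) (auto simp: indicator_def space_pair_measure split: if_splits)
  qed
  have sw: "(\<integral>\<omega>. (\<integral>s. ?F s \<omega> \<partial>lborel) \<partial>M) = (\<integral>s. (\<integral>\<omega>. ?F s \<omega> \<partial>M) \<partial>lborel)"
    by (rule P.Fubini_integral[OF Fi])
  have Iint: "integrable M ?I"
    using P.integrable_snd[OF Fi] by (simp add: set_lebesgue_integral_def)
  have "(\<integral>\<omega>. f (X (max 0 t) \<omega>) - f x - ?I \<omega> \<partial>M) = ex f t - f x - (\<integral>\<omega>. ?I \<omega> \<partial>M)"
    using fint Iint by (simp add: ex_def prob_space)
  moreover have "(\<integral>\<omega>. ?I \<omega> \<partial>M) = (LINT s:{0..t}|lborel. ex ?L s)"
    using sw by (simp add: set_lebesgue_integral_def ex_def)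
  ultimately show ?thesis using m1 by simp
qed

lemma dynkin_trunc:
  assumes f: "C2_data f g h" and inv: "perm_invariant f" "sign_invariant f" and a: "0 < a" and t: "t \<ge> 0"
  shows "ex (\<lambda>y. f y * cutoff a y) t
     = f x * cutoff a x + (LINT s:{0..t}|lborel. ex (gen_B k1 k2 (\<lambda>y. f y * cutoff a y)) s)"
proof (rule dynkin_compact_support[OF C2_data_trunc[OF f] _ t])
  have "compact_support (\<lambda>y. f y * cutoff a y)" unfolding compact_support_def
  proof (intro exI allI impI)
    \<comment> \<open>Beyond radius 1 the norm is below its square, so \<open>1 / a\<close> can
      stand in for the exact radius \<open>1 / sqrt a\<close>.\<close>
    fix y :: "(real,'n) vec" assume y: "max 1 (1 / a) < norm y"
    then have "1 < norm y" by simp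
    then have "1 * norm y < norm y * norm y" by (intro mult_strict_right_mono) auto
    then have "norm y < norm y ^ 2" by (simp only: power2_eq_square mult_1_left)
    then have "1 / a < norm y ^ 2" using y by simp
    then have "1 < a * norm y ^ 2" using a by (simp add: field_simps)
    then show "f y * cutoff a y = 0" by (simp add: cutoff_def)
  qed
  then show "(\<lambda>y. f y * cutoff a y) \<in> domain_B"
    using C2_dataD(1)[OF C2_data_trunc[OF f]] inv by (simp add: domain_B_def invariant_mult invariant_cutoff)
qed

lemma abs_ex_le:
  assumes "integrable M (\<lambda>\<omega>. B (X (max 0 s) \<omega>))" "\<And>y. \<bar>q y\<bar> \<le> B y"
  shows "\<bar>ex q s\<bar> \<le> ex B s"
proof (cases "integrable M (\<lambda>\<omega>. q (X (max 0 s) \<omega>))")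
  case True
  have "\<bar>ex q s\<bar> \<le> (\<integral>\<omega>. \<bar>q (X (max 0 s) \<omega>)\<bar> \<partial>M)" unfolding ex_def by (rule integral_abs_bound)
  also have "\<dots> \<le> ex B s" unfolding ex_def by (intro integral_mono integrable_abs True assms)
  finally show ?thesis .
next
  case False
  have "0 \<le> B y" for y using assms(2)[of y] by linarith
  then show ?thesis using False by (simp add: ex_def not_integrable_integral_eq)
qed

text \<open>The factor 25 is the square of the radius ratio 5 in \<open>gen_B_bound\<close>.\<close>

lemma gen_B_growth_bound:
  fixes f :: "(real,'n) vec \<Rightarrow> real"
  assumes f: "C2_data f g h" "perm_invariant f" "sign_invariant f"
    and K: "K \<ge> 0" "\<And>i j y. \<bar>h i j y\<bar> \<le> K * (1 + norm y ^ 2) ^ m"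
  shows "\<bar>gen_B k1 k2 f y\<bar> \<le> gen_const k1 k2 TYPE('n) * (K * 25 ^ m) * (1 + norm y ^ 2) ^ m"
proof -
  have "\<bar>gen_B k1 k2 f y\<bar> \<le> gen_const k1 k2 TYPE('n) * (K * (25 * (1 + norm y ^ 2)) ^ m)"
  proof (rule gen_B_bound[OF f])
    fix z :: "(real,'n) vec" and i j assume "norm z \<le> 5 * norm y"
    then have "norm z ^ 2 \<le> (5 * norm y) ^ 2" by (intro power_mono) auto
    then have "1 + norm z ^ 2 \<le> 25 * (1 + norm y ^ 2)" by (simp add: power_mult_distrib)
    then have "K * (1 + norm z ^ 2) ^ m \<le> K * (25 * (1 + norm y ^ 2)) ^ m"
      using K by (intro mult_left_mono power_mono) auto
    then show "\<bar>h i j z\<bar> \<le> K * (25 * (1 + norm y ^ 2)) ^ m" using K(2)[of i j z] by linarith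
  qed (use k1_pos k2_pos in auto)
  then show ?thesis by (simp only: power_mult_distrib mult.assoc)
qed

text \<open>Induction on the power works because the generator lowers it: the second derivatives of
  \<open>(1 + norm y ^ 2) ^ Suc d\<close> grow only like the \<open>d\<close>-th power, whose mean
  is already bounded on \<open>{0..T}\<close>. The truncated functions obey Dynkin's formula with a
  constant independent of the truncation, and Fatou's lemma removes the cutoff. Nonnegative
  integrals are used since finiteness is part of the claim.\<close>

lemma moment_bound_nn:
  "\<exists>C. C \<ge> 0 \<and> (\<forall>s\<in>{0..T}. (\<integral>\<^sup>+\<omega>. ennreal ((1 + norm (X (max 0 s) \<omega>) ^ 2) ^ d) \<partial>M) \<le> ennreal C)"
proof (induction d)
  case 0
  show ?case by (intro exI[of _ 1]) (simp add: emeasure_space_1)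
next
  case (Suc d)
  then obtain C where C: "C \<ge> 0" "\<And>s. s \<in> {0..T} \<Longrightarrow> (\<integral>\<^sup>+\<omega>. ennreal ((1 + norm (X (max 0 s) \<omega>) ^ 2) ^ d) \<partial>M) \<le> ennreal C"
    by blast
  let ?p = "\<lambda>y::(real,'n) vec. (1 + norm y ^ 2) ^ d"
  have pi: "integrable M (\<lambda>\<omega>. ?p (X (max 0 s) \<omega>))" if "s \<in> {0..T}" for s
    using C(2)[OF that] by (intro integrableI_bounded) (auto simp: top_unique intro: le_less_trans)
  have pC: "ex ?p s \<le> C" if "s \<in> {0..T}" for s
  proof -
    have "ennreal (ex ?p s) \<le> ennreal C" unfolding ex_def
      using C(2)[OF that] by (subst nn_integral_eq_integral[symmetric, OF pi[OF that]]) auto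
    then show ?thesis using C(1) by simp
  qed
  let ?f = "\<lambda>y::(real,'n) vec. (1 + norm y ^ 2) ^ Suc d"
  let ?F' = "\<lambda>w::real. real (Suc d) * (1 + w) ^ d"
  let ?F'' = "\<lambda>w::real. real (Suc d) * (real d * (1 + w) ^ (d - 1))"
  have F: "((\<lambda>w::real. (1 + w) ^ Suc d) has_real_derivative ?F' w) (at w)" for w
    by (rule derivative_eq_intros refl | simp)+
  have F': "(?F' has_real_derivative ?F'' w) (at w)" for w
    by (rule derivative_eq_intros refl | simp)+
  have cont: "continuous_on UNIV ?F''" by (intro continuous_intros)
  define g where "g = (\<lambda>i (y::(real,'n) vec). ?F' (norm y ^ 2) * (2 * y $ i))"
  define h where "h = (\<lambda>i j (y::(real,'n) vec). ?F'' (norm y ^ 2) * (2 * y $ j) * (2 * y $ i) + ?F' (norm y ^ 2) * (if i = j then 2 else 0))"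
  have f: "C2_data ?f g h" unfolding g_def h_def by (rule C2_data_compose[OF C2_data_norm2 F F' cont])
  have inv: "perm_invariant ?f" "sign_invariant ?f"
    using invariant_norm[of "\<lambda>r. (1 + r ^ 2) ^ Suc d"] by auto
  \<comment> \<open>The two summands bound the two terms of \<open>h\<close>; in the first,
    \<open>4 * (y $ j * y $ i)\<close> comes from the gradient \<open>2 * y\<close> of
    \<open>norm y ^ 2\<close> and restores the power of \<open>1 + norm y ^ 2\<close> lost in
    \<open>?F''\<close>.\<close>
  define K where "K = 4 * real (Suc d) * real (Suc d) + 2 * real (Suc d)"
  have K1: "1 \<le> K" "2 * real (Suc d) \<le> K" and K0: "K \<ge> 0" by (auto simp: K_def)
  have b: "\<bar>?f y\<bar> \<le> K * ?p y * (1 + norm y ^ 2)" "\<bar>g i y\<bar> \<le> K * ?p y * (1 + norm y)" "\<bar>h i j y\<bar> \<le> K * ?p y" for i j y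
  proof -
    have "1 * (?p y * (1 + norm y ^ 2)) \<le> K * (?p y * (1 + norm y ^ 2))" using K1 by (intro mult_right_mono) auto
    then show "\<bar>?f y\<bar> \<le> K * ?p y * (1 + norm y ^ 2)" by (simp add: mult_ac)
    have "\<bar>g i y\<bar> = (2 * real (Suc d)) * ?p y * \<bar>y $ i\<bar>" by (simp add: g_def abs_mult)
    also have "\<dots> \<le> K * ?p y * (1 + norm y)"
      using K1 K0 component_abs_le_norm[of y i] by (intro mult_mono) auto
    finally show "\<bar>g i y\<bar> \<le> K * ?p y * (1 + norm y)" .
    have 1: "\<bar>?F'' (norm y ^ 2) * (2 * y $ j) * (2 * y $ i)\<bar> \<le> 4 * real (Suc d) * real (Suc d) * ?p y"
    proof (cases d)
      case (Suc d')
      have "\<bar>y $ j\<bar> * \<bar>y $ i\<bar> \<le> norm y * norm y"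
        using component_abs_le_norm[of y i] component_abs_le_norm[of y j] by (intro mult_mono) auto
      then have yy: "\<bar>y $ j\<bar> * \<bar>y $ i\<bar> \<le> 1 + norm y ^ 2" by (simp add: power2_eq_square)
      have "\<bar>?F'' (norm y ^ 2) * (2 * y $ j) * (2 * y $ i)\<bar> = 4 * real (Suc d) * real d * (1 + norm y ^ 2) ^ d' * (\<bar>y $ j\<bar> * \<bar>y $ i\<bar>)"
        using Suc by (simp add: abs_mult)
      also have "\<dots> \<le> 4 * real (Suc d) * real (Suc d) * (1 + norm y ^ 2) ^ d' * (1 + norm y ^ 2)"
        using yy by (intro mult_mono) auto
      finally show ?thesis using Suc by (simp add: mult_ac)
    qed auto
    have "\<bar>?F' (norm y ^ 2) * (if i = j then 2 else 0)\<bar> \<le> 2 * real (Suc d) * ?p y"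
      by (auto simp: abs_mult algebra_simps)
    with 1 show "\<bar>h i j y\<bar> \<le> K * ?p y" unfolding h_def K_def distrib_right
      by (intro order_trans[OF abs_triangle_ineq] add_mono)
  qed
  define C1 where "C1 = gen_const k1 k2 TYPE('n) * (85 * K * 25 ^ d)"
  have C10: "C1 \<ge> 0" using gen_const_nonneg[of k1 k2, where 'n='n] k1_pos k2_pos K0 by (auto simp: C1_def)
  define a where "a = (\<lambda>n. inverse (real (Suc n)))"
  have a: "0 < a n" "a n \<le> 1" for n by (auto simp: a_def field_simps)
  have a0: "a \<longlonglongrightarrow> 0" unfolding a_def by (rule LIMSEQ_inverse_real_of_nat)
  let ?fn = "\<lambda>n y. ?f y * cutoff (a n) y"
  \<comment> \<open>\<open>C1\<close> does not depend on \<open>n\<close>, thanks to the uniform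
    cutoff bounds behind \<open>trunc_h_bound\<close>.\<close>
  have gen: "\<bar>gen_B k1 k2 (?fn n) y\<bar> \<le> C1 * ?p y" for n y
    unfolding C1_def
  proof (rule gen_B_growth_bound[OF C2_data_trunc[OF f]])
    show "perm_invariant (?fn n)" "sign_invariant (?fn n)" by (intro invariant_mult inv invariant_cutoff)+
    show "0 \<le> 85 * K" using K0 by simp
    show "\<bar>trunc_h (a n) ?f g h i j y\<bar> \<le> 85 * K * ?p y" for i j y
      using trunc_h_bound[OF a, of ?f y "K * ?p y" g h] b by (simp add: mult.assoc)
  qed
  \<comment> \<open>\<open>\<bar>T\<bar>\<close> keeps the bound nonnegative when
    \<open>T < 0\<close> and \<open>{0..T}\<close> is empty.\<close>
  define C2 where "C2 = ?f x + C1 * C * \<bar>T\<bar>"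
  have "C2 \<ge> 0" using C10 C by (auto simp: C2_def)
  moreover have "(\<integral>\<^sup>+\<omega>. ennreal (?f (X (max 0 s) \<omega>)) \<partial>M) \<le> ennreal C2" if s: "s \<in> {0..T}" for s
  proof -
    have fb: "ex (?fn n) s \<le> C2" for n
    proof -
      have "\<bar>LINT u:{0..s}|lborel. ex (gen_B k1 k2 (?fn n)) u\<bar> \<le> (C1 * C) * s"
      proof (rule LINT_abs_le_const)
        fix u assume "u \<in> {0..s}"
        then have u: "u \<in> {0..T}" using s by auto
        have "\<bar>ex (gen_B k1 k2 (?fn n)) u\<bar> \<le> ex (\<lambda>y. C1 * ?p y) u"
          by (rule abs_ex_le) (use pi[OF u] gen in auto)
        also have "\<dots> = C1 * ex ?p u" by (simp add: ex_def)
        also have "\<dots> \<le> C1 * C" using pC[OF u] C10 by (rule mult_left_mono)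
        finally show "\<bar>ex (gen_B k1 k2 (?fn n)) u\<bar> \<le> C1 * C" .
      qed (use s C10 C in auto)
      also have "\<dots> \<le> C1 * C * \<bar>T\<bar>" using s C10 C by (intro mult_left_mono) auto
      finally have "\<bar>LINT u:{0..s}|lborel. ex (gen_B k1 k2 (?fn n)) u\<bar> \<le> C1 * C * \<bar>T\<bar>" .
      moreover have "?f x * cutoff (a n) x \<le> ?f x * 1"
        using cutoff_bounds(1,2)[OF a, of n x] by (intro mult_left_mono) auto
      moreover have "ex (?fn n) s = ?f x * cutoff (a n) x + (LINT u:{0..s}|lborel. ex (gen_B k1 k2 (?fn n)) u)"
        by (rule dynkin_trunc[OF f inv]) (use a s in auto)
      ultimately show ?thesis unfolding C2_def by linarith
    qed
    have [measurable]: "cutoff b \<in> borel_measurable (borel :: (real,'n) vec measure)" for b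
      by (rule borel_measurable_continuous_onI[OF C2_dataE(1)[OF C2_data_cutoff]])
    have nn: "(\<integral>\<^sup>+\<omega>. ennreal (?fn n (X (max 0 s) \<omega>)) \<partial>M) \<le> ennreal C2" for n
    proof -
      obtain B where B: "\<And>y::(real,'n) vec. \<bar>?fn n y\<bar> \<le> B"
      proof -
        have "\<bar>?fn n y\<bar> \<le> (1 + real (Suc n)) ^ Suc d" for y :: "(real,'n) vec"
        proof (cases "a n * norm y ^ 2 \<le> 1")
          case True
          then have "norm y ^ 2 \<le> real (Suc n)" by (simp add: a_def field_simps)
          then have "?f y \<le> (1 + real (Suc n)) ^ Suc d" by (intro power_mono) auto
          moreover have "?f y * cutoff (a n) y \<le> ?f y * 1"
            using cutoff_bounds(1,2)[OF a, of n y] by (intro mult_left_mono) auto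
          ultimately show ?thesis using cutoff_bounds(1)[OF a, of n y] by (simp add: abs_mult)
        qed (simp add: cutoff_def)
        then show thesis using that by blast
      qed
      have i: "integrable M (\<lambda>\<omega>. ?fn n (X (max 0 s) \<omega>))"
        by (rule integrable_const_bound[of _ B]) (use B in auto)
      have "(\<integral>\<^sup>+\<omega>. ennreal (?fn n (X (max 0 s) \<omega>)) \<partial>M) = ennreal (ex (?fn n) s)"
        unfolding ex_def by (rule nn_integral_eq_integral[OF i]) (use cutoff_bounds(1)[OF a] in \<open>auto intro!: AE_I2 mult_nonneg_nonneg\<close>)
      then show ?thesis using fb[of n] by (simp add: ennreal_leI)
    qed
    have "(\<integral>\<^sup>+\<omega>. ennreal (?f (X (max 0 s) \<omega>)) \<partial>M) = (\<integral>\<^sup>+\<omega>. liminf (\<lambda>n. ennreal (?fn n (X (max 0 s) \<omega>))) \<partial>M)"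
    proof (intro nn_integral_cong)
      fix \<omega>
      have "(\<lambda>n. ennreal (?fn n (X (max 0 s) \<omega>))) \<longlonglongrightarrow> ennreal (?f (X (max 0 s) \<omega>))"
        by (intro tendsto_ennrealI trunc_tendsto(1)[OF a0])
      then show "ennreal (?f (X (max 0 s) \<omega>)) = liminf (\<lambda>n. ennreal (?fn n (X (max 0 s) \<omega>)))"
        by (rule lim_imp_Liminf[OF sequentially_bot, THEN sym])
    qed
    also have "\<dots> \<le> liminf (\<lambda>n. \<integral>\<^sup>+\<omega>. ennreal (?fn n (X (max 0 s) \<omega>)) \<partial>M)"
      by (rule nn_integral_liminf) measurable
    also have "\<dots> \<le> limsup (\<lambda>n. ennreal C2)"
      by (intro order_trans[OF Liminf_le_Limsup] Limsup_mono always_eventually allI nn) auto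
    also have "\<dots> = ennreal C2" by (simp add: Limsup_const)
    finally show ?thesis .
  qed
  ultimately show ?case by blast
qed

lemma integrable_poly_growth:
  assumes q: "poly_growth q" and [measurable]: "q \<in> borel_measurable borel"
  shows "integrable M (\<lambda>\<omega>. q (X (max 0 s) \<omega>))"
proof -
  obtain K m where K: "\<And>y. \<bar>q y\<bar> \<le> K * (1 + norm y ^ 2) ^ m" using q unfolding poly_growth_def by blast
  obtain C where "(\<integral>\<^sup>+\<omega>. ennreal ((1 + norm (X (max 0 s) \<omega>) ^ 2) ^ m) \<partial>M) \<le> ennreal C"
    using moment_bound_nn[of "max 0 s" m] by force
  then have "integrable M (\<lambda>\<omega>. (1 + norm (X (max 0 s) \<omega>) ^ 2) ^ m)"
    by (intro integrableI_bounded) (auto simp: top_unique intro: le_less_trans)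
  then have "integrable M (\<lambda>\<omega>. K * (1 + norm (X (max 0 s) \<omega>) ^ 2) ^ m)" by simp
  then show ?thesis
    by (rule Bochner_Integration.integrable_bound) (auto intro!: AE_I2 order_trans[OF K] order_trans[OF _ abs_ge_self])
qed

lemma ex_poly_growth_bounded:
  assumes q: "poly_growth q" and [measurable]: "q \<in> borel_measurable borel"
  obtains C where "C \<ge> 0" "\<And>s. s \<in> {0..T} \<Longrightarrow> \<bar>ex q s\<bar> \<le> C"
proof -
  obtain K m where K': "K \<ge> 0" "\<And>n y. n \<ge> m \<Longrightarrow> \<bar>q y\<bar> \<le> K * (1 + norm y ^ 2) ^ n" using poly_growthE[OF q] by blast
  have K: "K \<ge> 0" "\<And>y. \<bar>q y\<bar> \<le> K * (1 + norm y ^ 2) ^ m" using K' by auto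
  obtain C where C: "C \<ge> 0" "\<And>s. s \<in> {0..T} \<Longrightarrow> (\<integral>\<^sup>+\<omega>. ennreal ((1 + norm (X (max 0 s) \<omega>) ^ 2) ^ m) \<partial>M) \<le> ennreal C"
    using moment_bound_nn[of T m] by blast
  let ?p = "\<lambda>y::(real,'n) vec. (1 + norm y ^ 2) ^ m"
  have i: "integrable M (\<lambda>\<omega>. ?p (X (max 0 s) \<omega>))" for s
    by (rule integrable_poly_growth[OF poly_growth_norm_power]) measurable
  have "\<bar>ex q s\<bar> \<le> K * C" if "s \<in> {0..T}" for s
  proof -
    have "ennreal (ex ?p s) \<le> ennreal C" unfolding ex_def
      using C(2)[OF that] by (subst nn_integral_eq_integral[symmetric, OF i]) auto
    then have "ex ?p s \<le> C" using C(1) by simp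
    have "\<bar>ex q s\<bar> \<le> ex (\<lambda>y. K * ?p y) s" by (rule abs_ex_le) (use i K in auto)
    also have "\<dots> = K * ex ?p s" by (simp add: ex_def)
    also have "\<dots> \<le> K * C" using \<open>ex ?p s \<le> C\<close> K(1) by (rule mult_left_mono)
    finally show ?thesis .
  qed
  then show thesis using that[of "K * C"] K C by auto
qed

lemma ex_tendsto:
  assumes [measurable]: "\<And>n. q n \<in> borel_measurable borel" "q' \<in> borel_measurable borel" "B \<in> borel_measurable borel"
    and B: "poly_growth B" "\<And>n y. \<bar>q n y\<bar> \<le> B y" and lim: "\<And>y. (\<lambda>n. q n y) \<longlonglongrightarrow> q' y"
  shows "(\<lambda>n. ex (q n) s) \<longlonglongrightarrow> ex q' s"
  unfolding ex_def
  by (rule integral_dominated_convergence[where w="\<lambda>\<omega>. B (X (max 0 s) \<omega>)"])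
    (use lim B(2) integrable_poly_growth[OF B(1)] in auto)

text \<open>Dominated convergence is applied twice, over the probability space at each time and then
  over \<open>{0..t}\<close>, where \<open>ex B\<close> is bounded.\<close>

lemma LINT_ex_tendsto:
  assumes q [measurable]: "\<And>n. q n \<in> borel_measurable borel" "q' \<in> borel_measurable borel" "B \<in> borel_measurable borel"
    and B: "poly_growth B" "\<And>n y. \<bar>q n y\<bar> \<le> B y" and lim: "\<And>y. (\<lambda>n. q n y) \<longlonglongrightarrow> q' y" and t: "t \<ge> 0"
  shows "(\<lambda>n. LINT s:{0..t}|lborel. ex (q n) s) \<longlonglongrightarrow> (LINT s:{0..t}|lborel. ex q' s)"
proof -
  obtain C where C: "C \<ge> 0" "\<And>s. s \<in> {0..t} \<Longrightarrow> \<bar>ex B s\<bar> \<le> C" using ex_poly_growth_bounded[OF B(1)] by auto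
  have [measurable]: "ex (q n) \<in> borel_measurable lborel" "ex q' \<in> borel_measurable lborel" for n
    by (rule ex_measurable[OF q(1)], rule ex_measurable[OF q(2)])
  have le: "\<bar>ex (q n) s\<bar> \<le> C" if "s \<in> {0..t}" for n s
    using abs_ex_le[of B s "q n", OF integrable_poly_growth[OF B(1) q(3)] B(2)] C(2)[OF that] by auto
  show ?thesis unfolding set_lebesgue_integral_def
  proof (rule integral_dominated_convergence[where w="\<lambda>s. indicator {0..t} s * C"])
    show "integrable lborel (\<lambda>s. indicator {0..t} s * C)"
      using integrable_real_indicator[of "{0..t}" lborel] t by simp
    show "AE s in lborel. (\<lambda>n. indicator {0..t} s *\<^sub>R ex (q n) s) \<longlonglongrightarrow> indicator {0..t} s *\<^sub>R ex q' s"
      by (intro AE_I2 tendsto_intros ex_tendsto[of q q' B]) (use assms in auto)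
  qed (use le in \<open>auto split: split_indicator\<close>)
qed

text \<open>The enlarged domain of test functions: polynomial growth of \<open>f\<close> and of its
  first two derivatives replaces compact support.\<close>

definition smooth_invariant :: "((real,'n) vec \<Rightarrow> real) \<Rightarrow> bool" where
  "smooth_invariant f \<longleftrightarrow> perm_invariant f \<and> sign_invariant f \<and> (\<exists>g h. C2_data f g h \<and> poly_growth f \<and>
     (\<forall>i. poly_growth (g i)) \<and> (\<forall>i j. poly_growth (h i j)))"

text \<open>A common polynomial bounds \<open>f\<close> and its derivatives, hence by
  \<open>trunc_h_bound\<close> the generators of all truncations at once; since all moments are
  finite, dominated convergence removes the cutoff from Dynkin's formula.\<close>

lemma dynkin:
  assumes "smooth_invariant f"
  shows "t \<ge> 0 \<Longrightarrow> ex f t = f x + (LINT s:{0..t}|lborel. ex (gen_B k1 k2 f) s)"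
    and "poly_growth (gen_B k1 k2 f)" "gen_B k1 k2 f \<in> borel_measurable borel" "poly_growth f" "f \<in> borel_measurable borel"
proof -
  obtain g h where f: "C2_data f g h" and inv: "perm_invariant f" "sign_invariant f"
    and gr: "poly_growth f" "\<And>i. poly_growth (g i)" "\<And>i j. poly_growth (h i j)"
    using assms unfolding smooth_invariant_def by blast
  let ?B = "\<lambda>y. \<bar>f y\<bar> + ((\<Sum>i\<in>UNIV. \<bar>g i y\<bar>) + (\<Sum>i\<in>UNIV. \<Sum>j\<in>UNIV. \<bar>h i j y\<bar>))"
  have "poly_growth ?B" by (intro poly_growth_add poly_growth_sum poly_growth_abs gr)
  then obtain K m where K: "K \<ge> 0" "\<And>n y. n \<ge> m \<Longrightarrow> \<bar>?B y\<bar> \<le> K * (1 + norm y ^ 2) ^ n" by (rule poly_growthE) blast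
  let ?A = "\<lambda>y. K * (1 + norm y ^ 2) ^ m"
  have Bs: "\<bar>f y\<bar> \<le> ?B y" "\<bar>g i y\<bar> \<le> ?B y" "\<bar>h i j y\<bar> \<le> ?B y" for i j y
  proof -
    have 1: "\<bar>g i y\<bar> \<le> (\<Sum>i\<in>UNIV. \<bar>g i y\<bar>)" by (intro member_le_sum) auto
    have "\<bar>h i j y\<bar> \<le> (\<Sum>j\<in>UNIV. \<bar>h i j y\<bar>)" by (intro member_le_sum) auto
    also have "\<dots> \<le> (\<Sum>i\<in>UNIV. \<Sum>j\<in>UNIV. \<bar>h i j y\<bar>)"
      by (rule member_le_sum[of i UNIV "\<lambda>i. \<Sum>j\<in>UNIV. \<bar>h i j y\<bar>"]) (auto intro: sum_nonneg)
    finally have 2: "\<bar>h i j y\<bar> \<le> (\<Sum>i\<in>UNIV. \<Sum>j\<in>UNIV. \<bar>h i j y\<bar>)" .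
    have "0 \<le> (\<Sum>i\<in>UNIV. \<bar>g i y\<bar>)" "0 \<le> (\<Sum>i\<in>UNIV. \<Sum>j\<in>UNIV. \<bar>h i j y\<bar>)" by (auto intro!: sum_nonneg)
    with 1 2 show "\<bar>f y\<bar> \<le> ?B y" "\<bar>g i y\<bar> \<le> ?B y" "\<bar>h i j y\<bar> \<le> ?B y" by linarith+
  qed
  have A: "\<bar>f y\<bar> \<le> ?A y" "\<bar>g i y\<bar> \<le> ?A y" "\<bar>h i j y\<bar> \<le> ?A y" for i j y
    using Bs(1)[of y] Bs(2)[of i y] Bs(3)[of i j y] K(2)[of m y] by linarith+
  have A0: "?A y \<ge> 0" for y :: "(real,'n) vec" using K(1) by simp
  define a where "a = (\<lambda>n. inverse (real (Suc n)))"
  have a: "0 < a n" "a n \<le> 1" for n by (auto simp: a_def field_simps)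
  have a0: "a \<longlonglongrightarrow> 0" unfolding a_def by (rule LIMSEQ_inverse_real_of_nat)
  let ?fn = "\<lambda>n y. f y * cutoff (a n) y"
  note fn = C2_data_trunc[OF f]
  define C1 where "C1 = gen_const k1 k2 TYPE('n) * (85 * K * 25 ^ m)"
  have gen: "\<bar>gen_B k1 k2 (?fn n) y\<bar> \<le> C1 * (1 + norm y ^ 2) ^ m" for n y
    unfolding C1_def
  proof (rule gen_B_growth_bound[OF fn])
    show "perm_invariant (?fn n)" "sign_invariant (?fn n)" by (intro invariant_mult inv invariant_cutoff)+
    show "0 \<le> 85 * K" using K by simp
    show "\<bar>trunc_h (a n) f g h i j y\<bar> \<le> 85 * K * (1 + norm y ^ 2) ^ m" for i j y
    proof -
      have "?A y * 1 \<le> ?A y * (1 + norm y ^ 2)" "?A y * 1 \<le> ?A y * (1 + norm y)"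
        by (intro mult_left_mono A0; simp)+
      then have "\<bar>f y\<bar> \<le> ?A y * (1 + norm y ^ 2)" "\<And>i. \<bar>g i y\<bar> \<le> ?A y * (1 + norm y)"
        using A(1)[of y] A(2)[of _ y] by (fastforce intro: order_trans)+
      then have "\<bar>trunc_h (a n) f g h i j y\<bar> \<le> 85 * ?A y" by (intro trunc_h_bound a A)
      then show ?thesis by simp
    qed
  qed
  show gm: "gen_B k1 k2 f \<in> borel_measurable borel" by (rule gen_B_measurable[OF f])
  show fm: "f \<in> borel_measurable borel" by (rule borel_measurable_continuous_onI[OF C2_dataE(1)[OF f]])
  show "poly_growth f" by (rule gr)
  have lim: "(\<lambda>n. gen_B k1 k2 (?fn n) y) \<longlonglongrightarrow> gen_B k1 k2 f y" for y
    by (rule gen_B_tendsto[OF fn f trunc_tendsto(2)[OF a0] trunc_tendsto(3)[OF a0]])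
  have "\<bar>gen_B k1 k2 f y\<bar> \<le> C1 * (1 + norm y ^ 2) ^ m" for y
    by (rule LIMSEQ_le_const2[OF tendsto_rabs[OF lim]]) (use gen in auto)
  then show "poly_growth (gen_B k1 k2 f)" unfolding poly_growth_def by blast
  show "ex f t = f x + (LINT s:{0..t}|lborel. ex (gen_B k1 k2 f) s)" if t: "t \<ge> 0"
  proof (rule LIMSEQ_unique)
    have [measurable]: "?fn n \<in> borel_measurable borel" for n
      by (rule borel_measurable_continuous_onI[OF C2_dataE(1)[OF fn]])
    show "(\<lambda>n. ex (?fn n) t) \<longlonglongrightarrow> ex f t"
    proof (rule ex_tendsto[where B="\<lambda>y. \<bar>f y\<bar>"])
      show "\<bar>f y * cutoff (a n) y\<bar> \<le> \<bar>f y\<bar>" for n y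
        using mult_left_mono[of "\<bar>cutoff (a n) y\<bar>" 1 "\<bar>f y\<bar>"] cutoff_bounds(1,2)[OF a, of n y] by (simp add: abs_mult)
    qed (use fm gr trunc_tendsto(1)[OF a0] in \<open>auto intro: poly_growth_abs\<close>)
    have "(\<lambda>n. ?fn n x + (LINT s:{0..t}|lborel. ex (gen_B k1 k2 (?fn n)) s))
      \<longlonglongrightarrow> f x + (LINT s:{0..t}|lborel. ex (gen_B k1 k2 f) s)"
    proof (intro tendsto_add trunc_tendsto(1)[OF a0] LINT_ex_tendsto[where B="\<lambda>y. C1 * (1 + norm y ^ 2) ^ m"])
      show "poly_growth (\<lambda>y::(real,'n) vec. C1 * (1 + norm y ^ 2) ^ m)"
        by (intro poly_growth_mult poly_growth_const poly_growth_norm_power)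
    qed (use gm gen lim t gen_B_measurable[OF fn] in auto)
    then show "(\<lambda>n. ex (?fn n) t) \<longlonglongrightarrow> f x + (LINT s:{0..t}|lborel. ex (gen_B k1 k2 f) s)"
      using dynkin_trunc[OF f inv a(1) t] by simp
  qed
qed

end

section \<open>The process spends no time on the walls\<close>

text \<open>Near 0 this looks like the square of \<open>r\<close>, with second derivative 2 at 0 for
  every \<open>c\<close>, yet for \<open>c > 0\<close> it is at most \<open>1 / c\<close>
  everywhere. For large \<open>c\<close> it therefore detects \<open>r = 0\<close> through its
  second derivative while being uniformly small itself.\<close>

definition bump :: "real \<Rightarrow> real \<Rightarrow> real" where "bump c r = (1 - exp (- c * r\<^sup>2)) / c"
definition bump' :: "real \<Rightarrow> real \<Rightarrow> real" where "bump' c r = 2 * r * exp (- c * r\<^sup>2)"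
definition bump'' :: "real \<Rightarrow> real \<Rightarrow> real" where "bump'' c r = (2 - 4 * (c * r\<^sup>2)) * exp (- c * r\<^sup>2)"

lemma bump_deriv:
  "c > 0 \<Longrightarrow> (bump c has_real_derivative bump' c r) (at r)" "(bump' c has_real_derivative bump'' c r) (at r)"
  unfolding bump_def[abs_def] bump'_def[abs_def] bump''_def
  by (auto intro!: derivative_eq_intros simp: field_simps power2_eq_square)

lemma bump_bounds:
  assumes "c > 0"
  shows "0 \<le> bump c r" "bump c r \<le> 1 / c" "\<bar>bump'' c r\<bar> \<le> 6" "bump c (- r) = bump c r"
proof -
  have e: "exp (- c * r\<^sup>2) \<le> 1" "0 < exp (- c * r\<^sup>2)" using assms by auto
  show "0 \<le> bump c r" "bump c r \<le> 1 / c" using e assms by (auto simp: bump_def divide_right_mono)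
  have "c * r\<^sup>2 * exp (- c * r\<^sup>2) \<le> 1"
  proof -
    have "c * r\<^sup>2 \<le> exp (c * r\<^sup>2)" using exp_ge_add_one_self[of "c * r\<^sup>2"] by linarith
    then show ?thesis by (simp add: exp_minus field_simps)
  qed
  moreover have "0 \<le> c * r\<^sup>2 * exp (- c * r\<^sup>2)" using assms by simp
  moreover have "bump'' c r = 2 * exp (- c * r\<^sup>2) - 4 * (c * r\<^sup>2 * exp (- c * r\<^sup>2))"
    by (simp add: bump''_def algebra_simps)
  ultimately show "\<bar>bump'' c r\<bar> \<le> 6" using e by linarith
  show "bump c (- r) = bump c r" by (simp add: bump_def)
qed

lemma bump_tendsto:
  shows "(\<lambda>n. bump' (real (Suc n)) r) \<longlonglongrightarrow> 0"
    and "(\<lambda>n. bump'' (real (Suc n)) r) \<longlonglongrightarrow> (if r = 0 then 2 else 0)"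
proof -
  have v: "filterlim (\<lambda>n. real (Suc n) * r\<^sup>2) at_top sequentially" if "r \<noteq> 0"
    by (rule filterlim_at_top_mult_tendsto_pos[OF tendsto_const _ filterlim_compose[OF filterlim_real_sequentially filterlim_Suc]])
      (use that in simp)
  have p: "(\<lambda>n. (real (Suc n) * r\<^sup>2) ^ k * exp (- real (Suc n) * r\<^sup>2)) \<longlonglongrightarrow> 0" if "r \<noteq> 0" for k
    using filterlim_compose[OF tendsto_power_div_exp_0[of k] v[OF that]] by (simp add: exp_minus divide_inverse del: of_nat_Suc)
  show "(\<lambda>n. bump' (real (Suc n)) r) \<longlonglongrightarrow> 0"
  proof (cases "r = 0")
    case False
    then show ?thesis using tendsto_mult[OF tendsto_const[of "2 * r"] p[OF False, of 0]] by (simp add: bump'_def)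
  qed (simp add: bump'_def)
  show "(\<lambda>n. bump'' (real (Suc n)) r) \<longlonglongrightarrow> (if r = 0 then 2 else 0)"
  proof (cases "r = 0")
    case False
    have "(\<lambda>n. 2 * ((real (Suc n) * r\<^sup>2) ^ 0 * exp (- real (Suc n) * r\<^sup>2))
        - 4 * ((real (Suc n) * r\<^sup>2) ^ 1 * exp (- real (Suc n) * r\<^sup>2))) \<longlonglongrightarrow> 2 * 0 - 4 * 0"
      by (intro tendsto_intros p[OF False])
    moreover have "bump'' c r = 2 * ((c * r\<^sup>2) ^ 0 * exp (- c * r\<^sup>2)) - 4 * ((c * r\<^sup>2) ^ 1 * exp (- c * r\<^sup>2))" for c
      by (simp add: bump''_def algebra_simps)
    ultimately show ?thesis using False by (simp del: of_nat_Suc)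
  qed (simp add: bump''_def)
qed

text \<open>\<open>(l, j, e)\<close> stands for the linear form \<open>y $ l + e * y $ j\<close>; for \<open>e = 0\<close> the index \<open>j\<close> is immaterial.\<close>

definition roots :: "('n \<times> 'n \<times> real) set" where
  "roots = {(l, j, e). (l \<noteq> j \<and> e \<in> {-1, 1}) \<or> e = 0}"

definition root_val :: "'n \<times> 'n \<times> real \<Rightarrow> (real,'n::finite) vec \<Rightarrow> real" where
  "root_val a y = (case a of (l, j, e) \<Rightarrow> y $ l + e * y $ j)"

definition root_coeff :: "'n \<times> 'n \<times> real \<Rightarrow> 'n \<Rightarrow> real" where
  "root_coeff a i = (case a of (l, j, e) \<Rightarrow> (if l = i then 1 else 0) + e * (if j = i then 1 else 0))"

definition wall_fun :: "real \<Rightarrow> (real,'n::finite) vec \<Rightarrow> real" where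
  "wall_fun c y = (\<Sum>a\<in>roots. bump c (root_val a y))"

text \<open>Comparing squares excludes the walls \<open>y $ i = y $ j\<close> and
  \<open>y $ i = - y $ j\<close> at once.\<close>

definition regular :: "(real,'n::finite) vec \<Rightarrow> bool" where
  "regular y \<longleftrightarrow> (\<forall>i. y $ i \<noteq> 0) \<and> (\<forall>i j. i \<noteq> j \<longrightarrow> (y $ i)\<^sup>2 \<noteq> (y $ j)\<^sup>2)"

lemma finite_roots: "finite (roots :: ('n::finite \<times> 'n \<times> real) set)"
  by (rule finite_subset[of _ "UNIV \<times> UNIV \<times> {-1, 0, 1}"]) (auto simp: roots_def)

lemma root_coeff_le: "a \<in> roots \<Longrightarrow> \<bar>root_coeff a i\<bar> \<le> 1"
  by (auto simp: roots_def root_coeff_def)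

lemma C2_data_wall_fun:
  assumes "c > 0"
  shows "C2_data (wall_fun c :: (real,'n::{finite,linorder}) vec \<Rightarrow> real)
     (\<lambda>i y. \<Sum>a\<in>roots. bump' c (root_val a y) * root_coeff a i)
     (\<lambda>i j y. \<Sum>a\<in>roots. bump'' c (root_val a y) * root_coeff a j * root_coeff a i)"
proof -
  have 1: "C2_data (root_val a) (\<lambda>i _. root_coeff a i) (\<lambda>_ _ _. 0)" for a :: "'n \<times> 'n \<times> real"
  proof -
    obtain l j e where a: "a = (l, j, e)" by (cases a)
    show ?thesis
      using C2_data_add[OF C2_data_component[of l] C2_data_cmult[OF C2_data_component[of j], of e]]
      by (simp add: a root_val_def[abs_def] root_coeff_def)
  qed
  have "continuous_on UNIV (bump'' c)" unfolding bump''_def[abs_def] by (intro continuous_intros)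
  from C2_data_compose[OF 1 bump_deriv(1)[OF assms] bump_deriv(2) this]
  have "C2_data (\<lambda>y. bump c (root_val a y)) (\<lambda>i y. bump' c (root_val a y) * root_coeff a i)
     (\<lambda>i j y. bump'' c (root_val a y) * root_coeff a j * root_coeff a i)" for a :: "'n \<times> 'n \<times> real" by simp
  then show ?thesis unfolding wall_fun_def[abs_def] by (intro C2_data_sum)
qed

text \<open>Permutations and sign changes permute the linear forms in \<open>roots\<close> up to an
  overall sign, which the even function \<open>bump c\<close> ignores.\<close>

lemma invariant_wall_fun:
  assumes "c > 0"
  shows "perm_invariant (wall_fun c :: (real,'n::{finite,linorder}) vec \<Rightarrow> real)" "sign_invariant (wall_fun c :: (real,'n) vec \<Rightarrow> real)"
proof -
  show "perm_invariant (wall_fun c :: (real,'n) vec \<Rightarrow> real)" unfolding perm_invariant_def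
  proof (intro allI impI)
    fix \<sigma> :: "'n \<Rightarrow> 'n" and y :: "(real,'n) vec" assume s: "\<sigma> permutes UNIV"
    then have b: "bij \<sigma>" by (rule permutes_bij)
    show "wall_fun c (\<chi> i. y $ \<sigma> i) = wall_fun c y" unfolding wall_fun_def
      by (rule sum.reindex_bij_witness[of _ "\<lambda>(l,j,e). (inv \<sigma> l, inv \<sigma> j, e)" "\<lambda>(l,j,e). (\<sigma> l, \<sigma> j, e)"])
        (auto simp: roots_def root_val_def bij_is_inj[OF b] bij_is_surj[OF b] surj_f_inv_f inj_eq
           intro: injD[OF bij_is_inj[OF bij_imp_bij_inv[OF b]]] injD[OF bij_is_inj[OF b]])
  qed
  show "sign_invariant (wall_fun c :: (real,'n) vec \<Rightarrow> real)" unfolding sign_invariant_def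
  proof (intro allI impI)
    fix \<epsilon> :: "'n \<Rightarrow> real" and y :: "(real,'n) vec" assume s: "\<forall>i. \<epsilon> i = 1 \<or> \<epsilon> i = -1"
    have e2: "\<epsilon> i * \<epsilon> i = 1" for i using s[rule_format, of i] by auto
    have m: "(l, j, e * \<epsilon> l * \<epsilon> j) \<in> roots" if "(l, j, e) \<in> roots" for l j e
      using that s[rule_format, of l] s[rule_format, of j] by (auto simp: roots_def)
    have "e * \<epsilon> l * \<epsilon> j * \<epsilon> l * \<epsilon> j = e" for e l j
      using e2[of l] e2[of j] by (simp add: mult_ac)
    \<comment> \<open>Pulling out the sign \<open>\<epsilon> l\<close> of the first coordinate
      changes the relative sign \<open>e\<close> into
      \<open>e * \<epsilon> l * \<epsilon> j\<close>.\<close>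
    moreover have "bump c (root_val (l, j, e * \<epsilon> l * \<epsilon> j) y) = bump c (root_val (l, j, e) (\<chi> i. \<epsilon> i * y $ i))" for l j e
    proof -
      have "root_val (l, j, e) (\<chi> i. \<epsilon> i * y $ i) = \<epsilon> l * root_val (l, j, e * \<epsilon> l * \<epsilon> j) y"
        using e2[of l] by (simp add: root_val_def algebra_simps)
      then show ?thesis using s[rule_format, of l] bump_bounds(4)[OF assms] by auto
    qed
    ultimately show "wall_fun c (\<chi> i. \<epsilon> i * y $ i) = wall_fun c y" unfolding wall_fun_def
      by (intro sum.reindex_bij_witness[of _ "\<lambda>(l,j,e). (l, j, e * \<epsilon> l * \<epsilon> j)" "\<lambda>(l,j,e). (l, j, e * \<epsilon> l * \<epsilon> j)"])
        (auto simp: m)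
  qed
qed

lemma bump'_growth: "\<bar>bump' c r\<bar> \<le> 2 * \<bar>r\<bar>" if "c > 0"
proof -
  have "\<bar>bump' c r\<bar> = 2 * \<bar>r\<bar> * exp (- c * r\<^sup>2)" by (simp add: bump'_def abs_mult)
  also have "\<dots> \<le> 2 * \<bar>r\<bar> * 1" using that by (intro mult_left_mono) auto
  finally show ?thesis by simp
qed

context bessel_B begin

lemma smooth_invariant_wall_fun: "c > 0 \<Longrightarrow> smooth_invariant (wall_fun c)"
proof -
  assume c: "c > 0"
  have rv: "poly_growth (root_val a :: (real,'n) vec \<Rightarrow> real)" for a
    unfolding root_val_def[abs_def]
    by (cases a) (auto intro!: poly_growth_add poly_growth_mult poly_growth_const poly_growth_component)
  have "poly_growth (wall_fun c)" unfolding wall_fun_def[abs_def]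
    by (intro poly_growth_sum poly_growth_mono[OF poly_growth_const[of "1 / c"]])
      (use bump_bounds(1,2)[OF c] c in auto)
  moreover have "poly_growth (\<lambda>y::(real,'n) vec. \<Sum>a\<in>roots. bump' c (root_val a y) * root_coeff a i)" for i
  proof (intro poly_growth_sum poly_growth_mult poly_growth_const)
    fix a :: "'n \<times> 'n \<times> real"
    show "poly_growth (\<lambda>y. bump' c (root_val a y))"
      by (rule poly_growth_mono[OF poly_growth_mult[OF poly_growth_const[of 2] rv]])
        (use bump'_growth[OF c] in \<open>simp add: abs_mult\<close>)
  qed
  moreover have "poly_growth (\<lambda>y::(real,'n) vec. \<Sum>a\<in>roots. bump'' c (root_val a y) * root_coeff a j * root_coeff a i)" for i j
    by (intro poly_growth_sum poly_growth_mult poly_growth_const poly_growth_mono[OF poly_growth_const[of 6]])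
      (use bump_bounds(3)[OF c] in auto)
  ultimately show ?thesis unfolding smooth_invariant_def
    using invariant_wall_fun[OF c] C2_data_wall_fun[OF c] by blast
qed

text \<open>Although the generator is meaningless on the walls of the chamber (divisions by zero evaluate to 0),
  the martingale problem forces the process to spend no time there: the functions \<open>wall_fun c\<close> tend to 0
  uniformly as c grows, while their Laplacians tend to a function that is positive exactly on the walls.\<close>

lemma AE_regular:
  assumes t: "t \<ge> 0"
  shows "AE s in lborel. s \<in> {0..t} \<longrightarrow> (AE \<omega> in M. regular (X (max 0 s) \<omega>))"
proof -
  \<comment> \<open>\<open>l\<close> is the limit of the generators: a form that vanishes at
    \<open>y\<close> contributes through the limit 2 of \<open>bump''\<close>, whereas the drift
    terms disappear because \<open>bump'\<close> tends to 0 at every point.\<close>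
  define l where "l = (\<lambda>y::(real,'n) vec. (\<Sum>i\<in>UNIV. \<Sum>a\<in>roots. (if root_val a y = 0 then 2 else 0) * root_coeff a i * root_coeff a i) / 2)"
  let ?f = "\<lambda>n. wall_fun (real (Suc n)) :: (real,'n) vec \<Rightarrow> real"
  have pos: "real (Suc n) > 0" for n by simp
  note C2 = C2_data_wall_fun[OF pos, where 'n='n]
  have rvm [measurable]: "root_val a \<in> borel_measurable (borel :: (real,'n) vec measure)" for a
    unfolding root_val_def[abs_def] by (cases a) simp
  have lm [measurable]: "l \<in> borel_measurable borel" unfolding l_def by measurable
  have l0: "l y \<ge> 0" for y unfolding l_def by (auto intro!: sum_nonneg)
  define S where "S = real (card (roots :: ('n \<times> 'n \<times> real) set)) * 6"
  have gen: "\<bar>gen_B k1 k2 (?f n) y\<bar> \<le> gen_const k1 k2 TYPE('n) * S" for n y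
  proof (rule gen_B_bound[OF C2 invariant_wall_fun[OF pos]])
    show "\<bar>\<Sum>a\<in>roots. bump'' (real (Suc n)) (root_val a z) * root_coeff a j * root_coeff a i\<bar> \<le> S" for z :: "(real,'n) vec" and i j
    proof -
      have "\<bar>\<Sum>a\<in>roots. bump'' (real (Suc n)) (root_val a z) * root_coeff a j * root_coeff a i\<bar> \<le> (\<Sum>a\<in>(roots :: ('n \<times> 'n \<times> real) set). 6)"
      proof (rule order_trans[OF sum_abs], rule sum_mono)
        fix a :: "'n \<times> 'n \<times> real" assume a: "a \<in> roots"
        have "\<bar>bump'' (real (Suc n)) (root_val a z) * root_coeff a j * root_coeff a i\<bar> \<le> 6 * 1 * 1"
          unfolding abs_mult using bump_bounds(3)[OF pos] root_coeff_le[OF a] by (intro mult_mono) auto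
        then show "\<bar>bump'' (real (Suc n)) (root_val a z) * root_coeff a j * root_coeff a i\<bar> \<le> 6" by simp
      qed
      then show ?thesis by (simp add: S_def)
    qed
  qed (use k1_pos k2_pos in auto)
  have lim: "(\<lambda>n. gen_B k1 k2 (?f n) y) \<longlonglongrightarrow> l y" for y
  proof -
    have g: "(\<lambda>n. \<Sum>a\<in>roots. bump' (real (Suc n)) (root_val a y) * root_coeff a i) \<longlonglongrightarrow> (\<Sum>a\<in>roots. 0 * root_coeff a i)" for i
      by (intro tendsto_intros bump_tendsto)
    have h: "(\<lambda>n. \<Sum>i\<in>UNIV. \<Sum>a\<in>roots. bump'' (real (Suc n)) (root_val a y) * root_coeff a i * root_coeff a i)
        \<longlonglongrightarrow> (\<Sum>i\<in>UNIV. \<Sum>a\<in>roots. (if root_val a y = 0 then 2 else 0) * root_coeff a i * root_coeff a i)"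
      by (intro tendsto_intros bump_tendsto)
    have "(\<lambda>n. gen_B k1 k2 (?f n) y) \<longlonglongrightarrow> (\<Sum>i\<in>UNIV. \<Sum>a\<in>roots. (if root_val a y = 0 then 2 else 0) * root_coeff a i * root_coeff a i) / 2
       + k2 * (\<Sum>i\<in>UNIV. \<Sum>j\<in>UNIV - {i}. (1 / (y$i - y$j) + 1 / (y$i + y$j)) * (\<Sum>a\<in>roots. 0 * root_coeff a i))
       + k1 * (\<Sum>i\<in>UNIV. (1 / y$i) * (\<Sum>a\<in>roots. 0 * root_coeff a i))"
      unfolding gen_B_C2_data[OF C2] by (intro tendsto_add tendsto_mult tendsto_const tendsto_sum tendsto_divide g h) auto
    then show ?thesis by (simp add: l_def)
  qed
  have f0: "(\<lambda>n. ?f n y) \<longlonglongrightarrow> 0" and fb: "\<bar>?f n y\<bar> \<le> S" for n y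
  proof -
    have le: "\<bar>?f n y\<bar> \<le> S * inverse (real (Suc n))" for n
    proof -
      have "\<bar>?f n y\<bar> \<le> (\<Sum>a\<in>(roots :: ('n \<times> 'n \<times> real) set). 6 * inverse (real (Suc n)))"
        unfolding wall_fun_def
      proof (rule order_trans[OF sum_abs], rule sum_mono)
        fix a :: "'n \<times> 'n \<times> real"
        have "\<bar>bump (real (Suc n)) (root_val a y)\<bar> \<le> inverse (real (Suc n))"
          using bump_bounds(1,2)[OF pos, of n "root_val a y"] by (simp add: inverse_eq_divide)
        also have "\<dots> \<le> 6 * inverse (real (Suc n))" by simp
        finally show "\<bar>bump (real (Suc n)) (root_val a y)\<bar> \<le> 6 * inverse (real (Suc n))" .
      qed
      then show ?thesis by (simp add: S_def)
    qed
    have "(\<lambda>n. S * inverse (real (Suc n))) \<longlonglongrightarrow> 0"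
      using tendsto_mult[OF tendsto_const[of S] LIMSEQ_inverse_real_of_nat] by simp
    then show "(\<lambda>n. ?f n y) \<longlonglongrightarrow> 0"
      by (rule Lim_null_comparison[rotated]) (use le in auto)
    have "S * inverse (real (Suc n)) \<le> S * 1" by (intro mult_left_mono) (auto simp: S_def field_simps)
    then show "\<bar>?f n y\<bar> \<le> S" using le[of n] by simp
  qed
  have sm: "smooth_invariant (?f n)" for n by (rule smooth_invariant_wall_fun[OF pos])
  have L1: "(\<lambda>n. ex (?f n) t) \<longlonglongrightarrow> ex (\<lambda>_. 0) t"
    by (rule ex_tendsto[where B="\<lambda>_. S"]) (use dynkin(5)[OF sm] f0 fb poly_growth_const in auto)
  have L2: "(\<lambda>n. ?f n x + (LINT s:{0..t}|lborel. ex (gen_B k1 k2 (?f n)) s)) \<longlonglongrightarrow> 0 + (LINT s:{0..t}|lborel. ex l s)"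
    by (intro tendsto_add f0 LINT_ex_tendsto[where B="\<lambda>_. gen_const k1 k2 TYPE('n) * S"])
      (use dynkin(3)[OF sm] lim gen t poly_growth_const in auto)
  \<comment> \<open>The function values tend to 0 uniformly, so in the limit of Dynkin's formula the
    time integral of the mean of \<open>l\<close> must be 0; as \<open>l\<close> is nonnegative, it
    vanishes almost everywhere.\<close>
  have z: "(LINT s:{0..t}|lborel. ex l s) = 0"
    using LIMSEQ_unique[OF L1 L2[folded dynkin(1)[OF sm t]]] by (simp add: ex_def)
  obtain B where B: "\<And>y. \<bar>l y\<bar> \<le> B"
    using LIMSEQ_le_const2[OF tendsto_rabs[OF lim]] gen by blast
  have lint: "integrable M (\<lambda>\<omega>. l (X (max 0 s) \<omega>))" for s
    by (rule integrable_const_bound[of _ B]) (use B in auto)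
  have ex0: "ex l s \<ge> 0" for s unfolding ex_def by (intro Bochner_Integration.integral_nonneg l0)
  have exB: "ex l s \<le> B" for s
  proof -
    have "ex l s \<le> (\<integral>\<omega>. B \<partial>M)" unfolding ex_def by (intro integral_mono lint) (use B abs_le_D1 in auto)
    then show ?thesis by (simp add: prob_space)
  qed
  have [measurable]: "ex l \<in> borel_measurable lborel" by (rule ex_measurable[OF lm])
  have ei: "integrable lborel (\<lambda>s. indicator {0..t} s *\<^sub>R ex l s)"
  proof (rule Bochner_Integration.integrable_bound)
    show "integrable lborel (\<lambda>s. indicator {0..t} s * B)"
      using integrable_real_indicator[of "{0..t}" lborel] t by simp
    show "AE s in lborel. norm (indicator {0..t} s *\<^sub>R ex l s) \<le> norm (indicator {0..t} s * B)"
      using ex0 exB by (intro AE_I2) (auto split: split_indicator intro: order_trans[OF _ abs_ge_self])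
  qed measurable
  have "AE s in lborel. indicator {0..t} s *\<^sub>R ex l s = 0"
    using z integral_nonneg_eq_0_iff_AE[OF ei] ex0 by (auto simp: set_lebesgue_integral_def)
  then show ?thesis
  proof eventually_elim
    fix s assume s: "indicator {0..t} s *\<^sub>R ex l s = (0::real)"
    show "s \<in> {0..t} \<longrightarrow> (AE \<omega> in M. regular (X (max 0 s) \<omega>))"
    proof
      assume "s \<in> {0..t}"
      then have "(\<integral>\<omega>. l (X (max 0 s) \<omega>) \<partial>M) = 0" using s by (simp add: ex_def)
      then have "AE \<omega> in M. l (X (max 0 s) \<omega>) = 0"
        using integral_nonneg_eq_0_iff_AE[OF lint] l0 by auto
      then show "AE \<omega> in M. regular (X (max 0 s) \<omega>)"
      proof eventually_elim
        fix \<omega> assume "l (X (max 0 s) \<omega>) = 0"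
        moreover define y where "y = X (max 0 s) \<omega>"
        ultimately have "(\<Sum>i\<in>UNIV. \<Sum>a\<in>roots. (if root_val a y = 0 then 2 else 0) * root_coeff a i * root_coeff a i) = 0"
          by (simp add: l_def)
        then have "(\<Sum>a\<in>roots. (if root_val a y = 0 then 2 else 0) * root_coeff a i * root_coeff a i) = 0" for i
          by (subst (asm) sum_nonneg_eq_0_iff) (auto intro!: sum_nonneg)
        then have k: "(if root_val a y = 0 then 2 else 0) * root_coeff a i * root_coeff a i = 0" if "a \<in> roots" for a i
          using that by (subst (asm) sum_nonneg_eq_0_iff) (auto simp: finite_roots)
        \<comment> \<open>The coefficient of the form at its first index \<open>l\<close> is always
          1, also when \<open>e = 0\<close> and \<open>j = l\<close>, so it is the indicator of
          \<open>root_val a y = 0\<close> that makes the term vanish.\<close>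
        have nz: "root_val (l, j, e) y \<noteq> 0" if "(l, j, e) \<in> roots" for l j e
          using k[OF that, of l] that by (auto simp: root_coeff_def roots_def split: if_splits)
        have "y $ i \<noteq> 0" for i using nz[of i i 0] by (simp add: roots_def root_val_def)
        moreover have "(y $ i)\<^sup>2 \<noteq> (y $ j)\<^sup>2" if "i \<noteq> j" for i j
          using nz[of i j 1] nz[of i j "-1"] that by (auto simp: roots_def root_val_def power2_eq_iff)
        ultimately show "regular (X (max 0 s) \<omega>)" by (simp add: regular_def y_def)
      qed
    qed
  qed
qed

text \<open>For almost every time the walls carry no mass by \<open>AE_regular\<close>, so
  identities that fail on the walls, where quotients by 0 are read as 0, may still be used under the
  time integral.\<close>

lemma LINT_ex_cong:
  assumes t: "t \<ge> 0" and eq: "\<And>s y. s \<in> {0..t} \<Longrightarrow> regular y \<Longrightarrow> q s y = q' s y"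
    and m: "\<And>s. q s \<in> borel_measurable borel" "\<And>s. q' s \<in> borel_measurable borel"
    and [measurable]: "(\<lambda>s. ex (q s) s) \<in> borel_measurable lborel" "(\<lambda>s. ex (q' s) s) \<in> borel_measurable lborel"
  shows "(LINT s:{0..t}|lborel. ex (q s) s) = (LINT s:{0..t}|lborel. ex (q' s) s)"
  unfolding set_lebesgue_integral_def
proof (rule integral_cong_AE)
  show "AE s in lborel. indicator {0..t} s *\<^sub>R ex (q s) s = indicator {0..t} s *\<^sub>R ex (q' s) s"
    using AE_regular[OF t]
  proof eventually_elim
    fix s assume s: "s \<in> {0..t} \<longrightarrow> (AE \<omega> in M. regular (X (max 0 s) \<omega>))"
    show "indicator {0..t} s *\<^sub>R ex (q s) s = indicator {0..t} s *\<^sub>R ex (q' s) s"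
    proof (cases "s \<in> {0..t}")
      case True
      then have ae: "AE \<omega> in M. regular (X (max 0 s) \<omega>)" using s by blast
      have [measurable]: "q s \<in> borel_measurable borel" "q' s \<in> borel_measurable borel" by (rule m)+
      have "ex (q s) s = ex (q' s) s" unfolding ex_def
      proof (rule integral_cong_AE)
        show "AE \<omega> in M. q s (X (max 0 s) \<omega>) = q' s (X (max 0 s) \<omega>)"
          using ae by eventually_elim (use eq True in auto)
      qed measurable
      then show ?thesis by simp
    qed simp
  qed
qed measurable

end

section \<open>Dynkin's formula for functions that are polynomial in time\<close>

definition locally_bounded_measurable :: "(real \<Rightarrow> real) \<Rightarrow> bool" where
  "locally_bounded_measurable F \<longleftrightarrow> F \<in> borel_measurable lborel \<and> (\<forall>T. \<exists>C\<ge>0. \<forall>s\<in>{0..T}. \<bar>F s\<bar> \<le> C)"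

lemma lbm_set_integrable:
  assumes F: "locally_bounded_measurable F"
  shows "set_integrable lborel {0..t} F"
proof (cases "t \<ge> 0")
  case t: True
  have [measurable]: "F \<in> borel_measurable lborel" using F by (simp add: locally_bounded_measurable_def)
  obtain C where C: "C \<ge> 0" "\<And>s. s \<in> {0..t} \<Longrightarrow> \<bar>F s\<bar> \<le> C" using F unfolding locally_bounded_measurable_def by blast
  show ?thesis unfolding set_integrable_def
  proof (rule Bochner_Integration.integrable_bound)
    show "integrable lborel (\<lambda>s. indicator {0..t} s * C)"
      using integrable_real_indicator[of "{0..t}" lborel] t by simp
    show "AE s in lborel. norm (indicator {0..t} s *\<^sub>R F s) \<le> norm (indicator {0..t} s * C)"
      using C by (intro AE_I2) (auto split: split_indicator)
  qed measurable
qed (simp add: set_integrable_def)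

lemma lbm_add:
  assumes "locally_bounded_measurable F" "locally_bounded_measurable G"
  shows "locally_bounded_measurable (\<lambda>s. F s + G s)"
  unfolding locally_bounded_measurable_def
proof (intro conjI allI)
  show "(\<lambda>s. F s + G s) \<in> borel_measurable lborel"
    using assms by (auto simp: locally_bounded_measurable_def)
  fix T
  obtain C D where "C \<ge> 0" "\<And>s. s \<in> {0..T} \<Longrightarrow> \<bar>F s\<bar> \<le> C" "D \<ge> 0" "\<And>s. s \<in> {0..T} \<Longrightarrow> \<bar>G s\<bar> \<le> D"
    using assms unfolding locally_bounded_measurable_def by meson
  then show "\<exists>C\<ge>0. \<forall>s\<in>{0..T}. \<bar>F s + G s\<bar> \<le> C"
    by (intro exI[of _ "C + D"]) (auto intro!: order_trans[OF abs_triangle_ineq] add_mono)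
qed

lemma lbm_times:
  assumes "locally_bounded_measurable F"
  shows "locally_bounded_measurable (\<lambda>s. s * F s)"
  unfolding locally_bounded_measurable_def
proof (intro conjI allI)
  show "(\<lambda>s. s * F s) \<in> borel_measurable lborel"
    using assms by (auto simp: locally_bounded_measurable_def)
  fix T
  obtain C where C: "C \<ge> 0" "\<And>s. s \<in> {0..T} \<Longrightarrow> \<bar>F s\<bar> \<le> C"
    using assms unfolding locally_bounded_measurable_def by meson
  have "\<bar>s * F s\<bar> \<le> \<bar>T\<bar> * C" if "s \<in> {0..T}" for s
    unfolding abs_mult using C(2)[OF that] that C(1) by (intro mult_mono) auto
  then show "\<exists>C\<ge>0. \<forall>s\<in>{0..T}. \<bar>s * F s\<bar> \<le> C"
    using C(1) by (intro exI[of _ "\<bar>T\<bar> * C"]) auto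
qed

text \<open>Fubini's theorem on the triangle \<open>r \<le> s\<close> inside the square.\<close>

lemma LINT_iterated:
  assumes G: "locally_bounded_measurable G" and t: "t \<ge> 0"
  shows "(LINT s:{0..t}|lborel. (LINT r:{0..s}|lborel. G r)) = (LINT r:{0..t}|lborel. (t - r) * G r)"
proof -
  have Gm [measurable]: "G \<in> borel_measurable borel" using G by (simp add: locally_bounded_measurable_def)
  obtain C where C: "C \<ge> 0" "\<And>s. s \<in> {0..t} \<Longrightarrow> \<bar>G s\<bar> \<le> C" using G unfolding locally_bounded_measurable_def by blast
  let ?F = "\<lambda>s r. indicator {0..t} s * (if r \<le> s then 1 else 0) * (indicator {0..t} r * G r)"
  have Fi: "integrable (lborel \<Otimes>\<^sub>M lborel) (\<lambda>(s, r). ?F s r)"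
  proof (rule Bochner_Integration.integrable_bound)
    have "emeasure (lborel \<Otimes>\<^sub>M lborel) ({0..t} \<times> {0..t}) = emeasure lborel {0..t} * emeasure lborel {0..t}"
      by (intro lborel.emeasure_pair_measure_Times) auto
    also have "\<dots> < \<infinity>" using t by (simp add: ennreal_mult_less_top)
    finally show "integrable (lborel \<Otimes>\<^sub>M lborel) (\<lambda>p. C * indicator ({0..t} \<times> {0..t}) p)"
      by (intro integrable_mult_right) (auto simp: integrable_indicator_iff)
    show "(\<lambda>(s, r). ?F s r) \<in> borel_measurable (lborel \<Otimes>\<^sub>M lborel)"
      unfolding split_beta by measurable
    show "AE p in lborel \<Otimes>\<^sub>M lborel. norm (case p of (s, r) \<Rightarrow> ?F s r) \<le> norm (C * indicator ({0..t} \<times> {0..t}) p)"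
      using C by (intro AE_I2) (auto simp: indicator_def)
  qed
  have sw: "(\<integral>s. (\<integral>r. ?F s r \<partial>lborel) \<partial>lborel) = (\<integral>r. (\<integral>s. ?F s r \<partial>lborel) \<partial>lborel)"
    by (rule lborel_pair.Fubini_integral[OF Fi, symmetric])
  have i1: "(\<integral>r. ?F s r \<partial>lborel) = indicator {0..t} s *\<^sub>R (LINT r:{0..s}|lborel. G r)" for s
    unfolding set_lebesgue_integral_def
    by (cases "s \<in> {0..t}") (auto intro!: Bochner_Integration.integral_cong simp: indicator_def)
  have i2: "(\<integral>s. ?F s r \<partial>lborel) = indicator {0..t} r *\<^sub>R ((t - r) * G r)" for r
  proof (cases "r \<in> {0..t}")
    case True
    have "(\<integral>s. ?F s r \<partial>lborel) = (\<integral>s. indicator {r..t} s * G r \<partial>lborel)"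
      using True by (intro Bochner_Integration.integral_cong) (auto simp: indicator_def)
    also have "\<dots> = (t - r) * G r" using True by simp
    finally show ?thesis using True by simp
  qed simp
  show ?thesis using sw unfolding i1 i2 by (simp only: set_lebesgue_integral_def)
qed

text \<open>Integration by parts for \<open>s * F s\<close>. The integrand \<open>G\<close> is only
  measurable, so \<open>F\<close> may fail to be differentiable at some points, and the rule is
  derived from \<open>LINT_iterated\<close> instead of the chain of pointwise derivatives.\<close>

lemma time_times_antiderivative:
  assumes G: "locally_bounded_measurable G" and F: "locally_bounded_measurable F"
    and FG: "\<And>t. t \<ge> 0 \<Longrightarrow> F t = c + (LINT s:{0..t}|lborel. G s)" and t: "t \<ge> 0"
  shows "t * F t = (LINT s:{0..t}|lborel. F s + s * G s)"
proof -
  have c1: "(LINT s:{0..t}|lborel. c) = t * c" using t by (simp add: set_lebesgue_integral_def)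
  have Gs: "set_integrable lborel {0..t} G" "set_integrable lborel {0..t} (\<lambda>s. s * G s)"
    by (intro lbm_set_integrable G lbm_times)+
  have Fs: "set_integrable lborel {0..t} F" by (rule lbm_set_integrable[OF F])
  have "set_integrable lborel {0..t} (\<lambda>_. c)"
    unfolding set_integrable_def using integrable_real_indicator[of "{0..t}" lborel] t by simp
  then have I: "set_integrable lborel {0..t} (\<lambda>s. F s - c)" by (intro set_integral_diff Fs)
  have "(LINT s:{0..t}|lborel. F s - c) = (LINT s:{0..t}|lborel. (LINT r:{0..s}|lborel. G r))"
    using FG by (intro set_lebesgue_integral_cong) auto
  also have "\<dots> = (LINT r:{0..t}|lborel. t * G r - r * G r)"
    unfolding LINT_iterated[OF G t] by (simp add: left_diff_distrib)
  also have "\<dots> = t * (LINT r:{0..t}|lborel. G r) - (LINT r:{0..t}|lborel. r * G r)"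
    using Gs by (simp add: set_integral_diff)
  also have "\<dots> = t * (F t - c) - (LINT r:{0..t}|lborel. r * G r)" using FG[OF t] by simp
  finally have "(LINT s:{0..t}|lborel. F s - c) + (LINT r:{0..t}|lborel. r * G r) = t * F t - t * c"
    by (simp add: right_diff_distrib)
  moreover have "(LINT s:{0..t}|lborel. F s - c) = (LINT s:{0..t}|lborel. F s) - t * c"
    using Fs \<open>set_integrable lborel {0..t} (\<lambda>_. c)\<close> c1 by (simp add: set_integral_diff)
  ultimately show ?thesis using Fs Gs by (simp add: set_integral_add)
qed

context bessel_B begin

lemma gen_B_linear:
  assumes "smooth_invariant f" "smooth_invariant f'"
  shows "gen_B k1 k2 (\<lambda>y. f y + c * f' y) y = gen_B k1 k2 f y + c * gen_B k1 k2 f' y"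
    and "smooth_invariant (\<lambda>y. f y + c * f' y)"
proof -
  obtain g h where f: "C2_data f g h" and inv: "perm_invariant f" "sign_invariant f"
    and gr: "poly_growth f" "\<And>i. poly_growth (g i)" "\<And>i j. poly_growth (h i j)"
    using assms unfolding smooth_invariant_def by blast
  obtain g' h' where f': "C2_data f' g' h'" and inv': "perm_invariant f'" "sign_invariant f'"
    and gr': "poly_growth f'" "\<And>i. poly_growth (g' i)" "\<And>i j. poly_growth (h' i j)"
    using assms unfolding smooth_invariant_def by blast
  note s = C2_data_add[OF f C2_data_cmult[OF f', of c]]
  show "gen_B k1 k2 (\<lambda>y. f y + c * f' y) y = gen_B k1 k2 f y + c * gen_B k1 k2 f' y"
    unfolding gen_B_C2_data[OF s] gen_B_C2_data[OF f] gen_B_C2_data[OF f']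
    by (simp add: distrib_left distrib_right sum.distrib sum_distrib_left add_divide_distrib mult_ac sum_divide_distrib)
  have "perm_invariant (\<lambda>y. f y + c * f' y)" "sign_invariant (\<lambda>y. f y + c * f' y)"
    using inv inv' by (simp_all add: perm_invariant_def sign_invariant_def)
  moreover have "poly_growth (\<lambda>y. f y + c * f' y)" "poly_growth (\<lambda>y. g i y + c * g' i y)"
    "poly_growth (\<lambda>y. h i j y + c * h' i j y)" for i j
    by (intro poly_growth_add poly_growth_mult poly_growth_const gr gr')+
  ultimately show "smooth_invariant (\<lambda>y. f y + c * f' y)" unfolding smooth_invariant_def
    using s by blast
qed

text \<open>The martingale problem tests with functions of space only. Polynomials in time are built
  in Horner form, so that each constructor adds one multiplication by \<open>s\<close>, which
  \<open>time_times_antiderivative\<close> can handle.\<close>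

inductive time_poly :: "(real \<Rightarrow> (real,'n) vec \<Rightarrow> real) \<Rightarrow> bool" where
  base: "smooth_invariant q \<Longrightarrow> time_poly (\<lambda>s. q)"
| step: "smooth_invariant q \<Longrightarrow> time_poly \<phi> \<Longrightarrow> time_poly (\<lambda>s y. q y + s * \<phi> s y)"

lemma lbm_ex:
  assumes "poly_growth q" "q \<in> borel_measurable borel"
  shows "locally_bounded_measurable (ex q)"
  unfolding locally_bounded_measurable_def
  using ex_measurable[OF assms(2)] ex_poly_growth_bounded[OF assms] by metis

lemma ex_add:
  assumes "poly_growth q" "q \<in> borel_measurable borel" "poly_growth q'" "q' \<in> borel_measurable borel"
  shows "ex (\<lambda>y. q y + c * q' y) s = ex q s + c * ex q' s"
  unfolding ex_def using integrable_poly_growth[OF assms(1,2)] integrable_poly_growth[OF assms(3,4)] by simp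

text \<open>The induction follows the Horner form. \<open>D\<close> is the time derivative; it is
  quantified existentially so that it can grow along with the induction, and
  \<open>time_poly_dynkin\<close> identifies it with any given derivative by uniqueness.\<close>

lemma time_poly_dynkin_aux:
  assumes "time_poly \<phi>"
  shows "(\<forall>s. smooth_invariant (\<phi> s)) \<and> locally_bounded_measurable (\<lambda>s. ex (\<phi> s) s) \<and>
    (\<exists>D. (\<forall>s y. ((\<lambda>s. \<phi> s y) has_real_derivative D s y) (at s)) \<and>
      (\<forall>s. poly_growth (D s) \<and> D s \<in> borel_measurable borel) \<and>
      locally_bounded_measurable (\<lambda>s. ex (\<lambda>y. D s y + gen_B k1 k2 (\<phi> s) y) s) \<and>
      (\<forall>t\<ge>0. ex (\<phi> t) t = \<phi> 0 x + (LINT s:{0..t}|lborel. ex (\<lambda>y. D s y + gen_B k1 k2 (\<phi> s) y) s)))"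
  using assms
proof induction
  case (base q)
  then show ?case
    by (intro conjI allI exI[of _ "\<lambda>_ _. 0"]) (auto simp: dynkin lbm_ex poly_growth_const)
next
  case (step q \<phi>)
  from step.IH obtain D where sm: "\<And>s. smooth_invariant (\<phi> s)" and F: "locally_bounded_measurable (\<lambda>s. ex (\<phi> s) s)"
    and D: "\<And>s y. ((\<lambda>s. \<phi> s y) has_real_derivative D s y) (at s)"
      "\<And>s. poly_growth (D s)" "\<And>s. D s \<in> borel_measurable borel"
      "locally_bounded_measurable (\<lambda>s. ex (\<lambda>y. D s y + gen_B k1 k2 (\<phi> s) y) s)"
      "\<And>t. t \<ge> 0 \<Longrightarrow> ex (\<phi> t) t = \<phi> 0 x + (LINT s:{0..t}|lborel. ex (\<lambda>y. D s y + gen_B k1 k2 (\<phi> s) y) s)"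
    by blast
  note q = dynkin[OF step.hyps(1)] and p = dynkin[OF sm]
  let ?\<phi> = "\<lambda>s y. q y + s * \<phi> s y" and ?D = "\<lambda>s y. \<phi> s y + s * D s y"
  let ?G = "\<lambda>s. ex (\<lambda>y. D s y + gen_B k1 k2 (\<phi> s) y) s" and ?F = "\<lambda>s. ex (\<phi> s) s"
  have sm': "smooth_invariant (?\<phi> s)" for s by (rule gen_B_linear(2)[OF step.hyps(1) sm])
  have DG: "poly_growth (\<lambda>y. D s y + gen_B k1 k2 (\<phi> s) y)" "(\<lambda>y. D s y + gen_B k1 k2 (\<phi> s) y) \<in> borel_measurable borel" for s
    using D(2,3) p by (auto intro!: poly_growth_add)
  have e1: "ex (?\<phi> s) s = ex q s + s * ?F s" for s by (rule ex_add) (use q p in auto)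
  have e2: "ex (\<lambda>y. ?D s y + gen_B k1 k2 (?\<phi> s) y) s = ex (gen_B k1 k2 q) s + (?F s + s * ?G s)" for s
  proof -
    have "ex (\<lambda>y. ?D s y + gen_B k1 k2 (?\<phi> s) y) s = ex (\<lambda>y. (gen_B k1 k2 q y + 1 * \<phi> s y) + s * (D s y + gen_B k1 k2 (\<phi> s) y)) s"
      by (simp add: gen_B_linear(1)[OF step.hyps(1) sm] algebra_simps)
    also have "\<dots> = ex (\<lambda>y. gen_B k1 k2 q y + 1 * \<phi> s y) s + s * ?G s"
      by (rule ex_add) (use q p DG in \<open>auto intro!: poly_growth_add\<close>)
    also have "ex (\<lambda>y. gen_B k1 k2 q y + 1 * \<phi> s y) s = ex (gen_B k1 k2 q) s + 1 * ?F s"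
      by (rule ex_add) (use q p in auto)
    finally show ?thesis by simp
  qed
  have FsG: "locally_bounded_measurable (\<lambda>s. ?F s + s * ?G s)" by (intro lbm_add lbm_times F D)
  have lq: "locally_bounded_measurable (ex (gen_B k1 k2 q))" by (rule lbm_ex) (use q in auto)
  show ?case
  proof (intro conjI exI[of _ ?D] allI impI)
    show "smooth_invariant (?\<phi> s)" for s by (rule sm')
    show "locally_bounded_measurable (\<lambda>s. ex (?\<phi> s) s)"
      unfolding e1 by (intro lbm_add lbm_times F lbm_ex) (use q in auto)
    show "((\<lambda>s. ?\<phi> s y) has_real_derivative ?D s y) (at s)" for s y
      by (rule derivative_eq_intros D refl | simp)+
    show "poly_growth (?D s)" for s
      by (intro poly_growth_add poly_growth_mult poly_growth_const D) (use p in auto)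
    show "?D s \<in> borel_measurable borel" for s using D(3)[of s] p(5)[of s] by measurable
    show "locally_bounded_measurable (\<lambda>s. ex (\<lambda>y. ?D s y + gen_B k1 k2 (?\<phi> s) y) s)"
      unfolding e2 by (intro lbm_add[OF lq FsG])
    fix t :: real assume t: "t \<ge> 0"
    have "ex (?\<phi> t) t = (q x + (LINT s:{0..t}|lborel. ex (gen_B k1 k2 q) s)) + (LINT s:{0..t}|lborel. ?F s + s * ?G s)"
      unfolding e1 using q(1)[OF t] time_times_antiderivative[OF D(4) F D(5) t] by simp
    also have "\<dots> = q x + (LINT s:{0..t}|lborel. ex (gen_B k1 k2 q) s + (?F s + s * ?G s))"
      using lbm_set_integrable[OF lq] lbm_set_integrable[OF FsG] by (simp add: set_integral_add)
    finally show "ex (?\<phi> t) t = ?\<phi> 0 x + (LINT s:{0..t}|lborel. ex (\<lambda>y. ?D s y + gen_B k1 k2 (?\<phi> s) y) s)"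
      unfolding e2 by simp
  qed
qed

lemma time_poly_dynkin:
  assumes \<phi>: "time_poly \<phi>" and D: "\<And>s y. ((\<lambda>s. \<phi> s y) has_real_derivative D s y) (at s)"
  shows "smooth_invariant (\<phi> s)" "locally_bounded_measurable (\<lambda>s. ex (\<phi> s) s)"
    "poly_growth (D s)" "D s \<in> borel_measurable borel"
    "locally_bounded_measurable (\<lambda>s. ex (\<lambda>y. D s y + gen_B k1 k2 (\<phi> s) y) s)"
    "t \<ge> 0 \<Longrightarrow> ex (\<phi> t) t = \<phi> 0 x + (LINT s:{0..t}|lborel. ex (\<lambda>y. D s y + gen_B k1 k2 (\<phi> s) y) s)"
proof -
  note aux = time_poly_dynkin_aux[OF \<phi>]
  obtain D' where D': "\<And>s y. ((\<lambda>s. \<phi> s y) has_real_derivative D' s y) (at s)"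
      "\<And>s. poly_growth (D' s)" "\<And>s. D' s \<in> borel_measurable borel"
      "locally_bounded_measurable (\<lambda>s. ex (\<lambda>y. D' s y + gen_B k1 k2 (\<phi> s) y) s)"
      "\<And>t. t \<ge> 0 \<Longrightarrow> ex (\<phi> t) t = \<phi> 0 x + (LINT s:{0..t}|lborel. ex (\<lambda>y. D' s y + gen_B k1 k2 (\<phi> s) y) s)"
    using aux by blast
  have "D' = D" by (intro ext DERIV_unique[OF D'(1) D])
  with aux D' show "smooth_invariant (\<phi> s)" "locally_bounded_measurable (\<lambda>s. ex (\<phi> s) s)"
    "poly_growth (D s)" "D s \<in> borel_measurable borel"
    "locally_bounded_measurable (\<lambda>s. ex (\<lambda>y. D s y + gen_B k1 k2 (\<phi> s) y) s)"
    "t \<ge> 0 \<Longrightarrow> ex (\<phi> t) t = \<phi> 0 x + (LINT s:{0..t}|lborel. ex (\<lambda>y. D s y + gen_B k1 k2 (\<phi> s) y) s)"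
    by auto
qed

end

section \<open>Power sums\<close>

definition psum :: "nat \<Rightarrow> (real,'n::finite) vec \<Rightarrow> real" where
  "psum m u = (\<Sum>i\<in>UNIV. (u $ i) ^ m)"

text \<open>Products of power sums span the symmetric polynomials; the list records the exponents,
  whose sum is the degree. An entry 0 is allowed and contributes the constant N.\<close>

fun psums :: "nat list \<Rightarrow> (real,'n::finite) vec \<Rightarrow> real" where
  "psums [] u = 1"
| "psums (m # ms) u = psum m u * psums ms u"

text \<open>Here and in \<open>ddpsums\<close> the subtractions \<open>m - 1\<close> and
  \<open>m - 2\<close> truncate, but wherever they do so the factor \<open>real m\<close> or
  \<open>real (m - 1)\<close> vanishes.\<close>

fun dpsums :: "'n \<Rightarrow> nat list \<Rightarrow> (real,'n::finite) vec \<Rightarrow> real" where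
  "dpsums i [] u = 0"
| "dpsums i (m # ms) u = real m * (u $ i) ^ (m - 1) * psums ms u + psum m u * dpsums i ms u"

fun ddpsums :: "'n \<Rightarrow> 'n \<Rightarrow> nat list \<Rightarrow> (real,'n::finite) vec \<Rightarrow> real" where
  "ddpsums i j [] u = 0"
| "ddpsums i j (m # ms) u = ((if i = j then real m * real (m - 1) * (u $ i) ^ (m - 2) else 0) * psums ms u
      + real m * (u $ i) ^ (m - 1) * dpsums j ms u)
    + (real m * (u $ j) ^ (m - 1) * dpsums i ms u + psum m u * ddpsums i j ms u)"

lemma psums_append: "psums (ms @ ns) u = psums ms u * psums ns u"
  by (induction ms) auto

lemma C2_data_psum:
  "C2_data (psum m) (\<lambda>i u. real m * (u $ i) ^ (m - 1))
    (\<lambda>i j (u::(real,'n::{finite,linorder}) vec). if i = j then real m * real (m - 1) * (u $ i) ^ (m - 2) else 0)"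
proof -
  have 1: "((\<lambda>v::real. v ^ m) has_real_derivative real m * v ^ (m - 1)) (at v)" for m v
    using DERIV_pow[of m v] by simp
  have 2: "((\<lambda>v::real. real m * v ^ (m - 1)) has_real_derivative real m * (real (m - 1) * v ^ (m - 2))) (at v)" for v
    using DERIV_cmult[OF 1[of "m - 1" v], of "real m"] by (simp add: numeral_2_eq_2)
  have "continuous_on UNIV (\<lambda>v::real. real m * (real (m - 1) * v ^ (m - 2)))" by (intro continuous_intros)
  from C2_data_compose[OF C2_data_component 1 2 this]
  have "C2_data (\<lambda>u::(real,'n) vec. \<Sum>l\<in>UNIV. (u $ l) ^ m)
     (\<lambda>i u. \<Sum>l\<in>UNIV. real m * (u $ l) ^ (m - 1) * (if l = i then 1 else 0))
     (\<lambda>i j u. \<Sum>l\<in>UNIV. real m * (real (m - 1) * (u $ l) ^ (m - 2)) * (if l = j then 1 else 0) * (if l = i then 1 else 0)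
        + real m * (u $ l) ^ (m - 1) * 0)"
    by (intro C2_data_sum)
  moreover have "(\<lambda>i (u::(real,'n) vec). \<Sum>l\<in>UNIV. real m * (u $ l) ^ (m - 1) * (if l = i then 1 else 0)) = (\<lambda>i u. real m * (u $ i) ^ (m - 1))"
    by (simp add: fun_eq_iff if_distrib[of "\<lambda>c. _ * c"] cong: if_cong)
  moreover have "(\<lambda>i j (u::(real,'n) vec). \<Sum>l\<in>UNIV. real m * (real (m - 1) * (u $ l) ^ (m - 2)) * (if l = j then 1 else 0) * (if l = i then 1 else 0)
        + real m * (u $ l) ^ (m - 1) * 0) = (\<lambda>i j u. if i = j then real m * real (m - 1) * (u $ i) ^ (m - 2) else 0)"
    by (auto simp: fun_eq_iff if_distrib[of "\<lambda>c. _ * c"] cong: if_cong)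
  ultimately show ?thesis unfolding psum_def[abs_def] by simp
qed

lemma C2_data_psums: "C2_data (psums ms) (\<lambda>i. dpsums i ms) (\<lambda>i j (u::(real,'n::{finite,linorder}) vec). ddpsums i j ms u)"
proof (induction ms)
  case Nil
  show ?case using C2_data_const[of 1] by simp
next
  case (Cons m ms)
  from C2_data_mult[OF C2_data_psum this] show ?case by simp
qed

lemma perm_invariant_psums: "perm_invariant (psums ms)"
proof -
  have "psum m (\<chi> i. y $ \<sigma> i) = psum m y" if "\<sigma> permutes UNIV" for m \<sigma> and y :: "(real,'a) vec"
    using sum.permute[OF that, of "\<lambda>i. (y $ i) ^ m"] by (simp add: psum_def o_def)
  then show ?thesis unfolding perm_invariant_def by (induction ms) auto
qed

section \<open>Degrees of symmetric polynomials under the two operators\<close>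

definition distinct_coords :: "(real,'n::finite) vec \<Rightarrow> bool" where
  "distinct_coords u \<longleftrightarrow> (\<forall>i j. i \<noteq> j \<longrightarrow> u $ i \<noteq> u $ j)"

text \<open>A symmetric polynomial given by coefficients and exponent lists: the moment recursions
  have to read off the terms and their degrees, which the function alone does not display.\<close>

definition lincomb :: "(real \<times> nat list) list \<Rightarrow> (real,'n::finite) vec \<Rightarrow> real" where
  "lincomb cs u = (\<Sum>(c, ns)\<leftarrow>cs. c * psums ns u)"

lemma lincomb_simps [simp]:
  "lincomb [] u = 0" "lincomb ((c, ns) # cs) u = c * psums ns u + lincomb cs u" "lincomb (cs @ ds) u = lincomb cs u + lincomb ds u"
  by (simp_all add: lincomb_def)

text \<open>Off the walls, \<open>\<phi>\<close> is homogeneous of degree \<open>d - e\<close>; in particular it vanishes there if \<open>d < e\<close>.\<close>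

definition lower :: "nat \<Rightarrow> nat \<Rightarrow> ((real,'n::finite) vec \<Rightarrow> real) \<Rightarrow> bool" where
  "lower e d \<phi> \<longleftrightarrow> (\<exists>cs. (\<forall>(c, ns)\<in>set cs. sum_list ns + e = d) \<and> (\<forall>u. distinct_coords u \<longrightarrow> \<phi> u = lincomb cs u))"

lemma lower_cong: "lower e d \<psi> \<Longrightarrow> (\<And>u. distinct_coords u \<Longrightarrow> \<phi> u = \<psi> u) \<Longrightarrow> lower e d \<phi>"
  unfolding lower_def by auto

lemma lower_zero: "lower e d (\<lambda>_. 0)"
  unfolding lower_def by (intro exI[of _ "[]"]) auto

lemma lower_psums: "sum_list ns + e = d \<Longrightarrow> lower e d (\<lambda>u. c * psums ns u)"
  unfolding lower_def by (intro exI[of _ "[(c, ns)]"]) auto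

lemma lower_add: "lower e d \<phi> \<Longrightarrow> lower e d \<psi> \<Longrightarrow> lower e d (\<lambda>u. \<phi> u + \<psi> u)"
  unfolding lower_def
  by (elim exE conjE, rule_tac x="cs @ csa" in exI) auto

lemma lower_mult_psums: "lower e d \<phi> \<Longrightarrow> lower e (d + sum_list ns) (\<lambda>u. c * psums ns u * \<phi> u)"
proof -
  assume "lower e d \<phi>"
  then obtain cs where cs: "\<forall>(c, ns)\<in>set cs. sum_list ns + e = d" "\<And>u. distinct_coords u \<Longrightarrow> \<phi> u = lincomb cs u"
    unfolding lower_def by blast
  have "c * psums ns u * lincomb cs u = lincomb (map (\<lambda>(b, ms). (c * b, ns @ ms)) cs) u" for u
    by (induction cs) (auto simp: psums_append algebra_simps)
  with cs show ?thesis unfolding lower_def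
    by (intro exI[of _ "map (\<lambda>(b, ms). (c * b, ns @ ms)) cs"]) auto
qed

lemma lower_cmult: "lower e d \<phi> \<Longrightarrow> lower e d (\<lambda>u. c * \<phi> u)"
  using lower_mult_psums[of e d \<phi> "[]" c] by simp

lemma lower_sum: "(\<And>a. a \<in> S \<Longrightarrow> lower e d (f a)) \<Longrightarrow> lower e d (\<lambda>u. \<Sum>a\<in>S. f a u)"
  by (induction S rule: infinite_finite_induct) (auto intro: lower_zero lower_add)

text \<open>Summing over \<open>i\<close> merges \<open>u_i^r\<close> with the derivative
  \<open>m u_i^(m-1)\<close> of a power sum into the power sum of exponent \<open>r + m - 1\<close>.
  Such sums are the mixed terms in the product rule of a second-order operator.\<close>

lemma lower_gradient: "lower 1 (r + sum_list ms) (\<lambda>u::(real,'n::finite) vec. \<Sum>i\<in>UNIV. (u $ i) ^ r * dpsums i ms u)"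
proof (induction ms)
  case Nil
  show ?case using lower_zero by simp
next
  case (Cons m ms)
  have 1: "lower 1 (r + sum_list (m # ms)) (\<lambda>u::(real,'n) vec. real m * psums ((r + (m - 1)) # ms) u)"
  proof (cases m)
    case 0
    then show ?thesis using lower_zero by simp
  next
    case (Suc m')
    then show ?thesis by (intro lower_psums) simp
  qed
  have 2: "lower 1 (r + sum_list (m # ms)) (\<lambda>u::(real,'n) vec. 1 * psums [m] u * (\<Sum>i\<in>UNIV. (u $ i) ^ r * dpsums i ms u))"
    using lower_mult_psums[OF Cons, of "[m]" 1] by (simp add: add_ac)
  show ?case
    by (rule lower_cong[OF lower_add[OF 1 2]])
      (simp add: psum_def sum_distrib_left sum_distrib_right sum.distrib power_add algebra_simps)
qed

text \<open>Symmetrisation in \<open>i\<close> and \<open>j\<close> produces, up to the factor 1/2,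
  the divided difference of the \<open>r\<close>-th power, a sum of \<open>r\<close> monomials of
  degree \<open>r - 1\<close>. The double sum leaves out \<open>i = j\<close>; adding the diagonal
  yields products of two power sums, and subtracting it again costs \<open>r\<close> times the power
  sum of exponent \<open>r - 1\<close>.\<close>

lemma lower_interaction: "lower 1 r (\<lambda>u. \<Sum>i\<in>UNIV. \<Sum>j\<in>UNIV - {i}. (u $ i) ^ r / (u $ i - u $ j))"
proof (cases r)
  case 0
  have "(\<Sum>i\<in>UNIV. \<Sum>j\<in>UNIV - {i}. (u $ i) ^ r / (u $ i - u $ j)) = 0" for u :: "(real,'a) vec"
  proof (subst sum_offdiag_symmetrize)
    have "1 / (u $ i - u $ j) + 1 / (u $ j - u $ i) = 0" for i j
      by (metis add.right_inverse minus_diff_eq minus_divide_right)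
    then show "(\<Sum>i\<in>UNIV. \<Sum>j\<in>UNIV - {i}. (u $ i) ^ r / (u $ i - u $ j) + (u $ j) ^ r / (u $ j - u $ i)) / 2 = 0"
      using 0 by simp
  qed
  then show ?thesis using lower_zero by simp
next
  case (Suc r')
  let ?Q = "\<lambda>u::(real,'a) vec. (1/2) * (\<Sum>a<r. (1 * psums [r - Suc a, a] u + (-1) * psums [r'] u))"
  have "lower 1 r ?Q"
    by (intro lower_cmult lower_sum lower_add lower_psums) (use Suc in auto)
  then show ?thesis
  proof (rule lower_cong)
    fix u :: "(real,'a) vec" assume u: "distinct_coords u"
    have p: "(u $ i) ^ r / (u $ i - u $ j) + (u $ j) ^ r / (u $ j - u $ i) = (\<Sum>a<r. (u $ j) ^ (r - Suc a) * (u $ i) ^ a)" if "j \<in> UNIV - {i}" for i j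
    proof -
      have d: "u $ i - u $ j \<noteq> 0" using u that by (auto simp: distinct_coords_def)
      have "(u $ j) ^ r / (u $ j - u $ i) = - ((u $ j) ^ r / (u $ i - u $ j))" by (metis minus_diff_eq minus_divide_right)
      then have "(u $ i) ^ r / (u $ i - u $ j) + (u $ j) ^ r / (u $ j - u $ i) = ((u $ i) ^ r - (u $ j) ^ r) / (u $ i - u $ j)"
        by (simp add: diff_divide_distrib)
      also have "\<dots> = (\<Sum>a<r. (u $ j) ^ (r - Suc a) * (u $ i) ^ a)"
        using d by (simp add: power_diff_sumr2)
      finally show ?thesis .
    qed
    have diag: "(u $ i) ^ (r - Suc a) * (u $ i) ^ a = (u $ i) ^ r'" if "a < r" for i a
      using that Suc by (simp flip: power_add)
    have "(\<Sum>i\<in>UNIV. \<Sum>j\<in>UNIV - {i}. (u $ i) ^ r / (u $ i - u $ j))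
       = (\<Sum>i\<in>UNIV. \<Sum>j\<in>UNIV - {i}. \<Sum>a<r. (u $ j) ^ (r - Suc a) * (u $ i) ^ a) / 2"
      by (subst sum_offdiag_symmetrize) (intro arg_cong[where f="\<lambda>x. x / 2"] sum.cong refl p)
    also have "(\<Sum>i\<in>UNIV. \<Sum>j\<in>UNIV - {i}. \<Sum>a<r. (u $ j) ^ (r - Suc a) * (u $ i) ^ a)
       = (\<Sum>i\<in>UNIV. (\<Sum>j\<in>UNIV. \<Sum>a<r. (u $ j) ^ (r - Suc a) * (u $ i) ^ a) - (\<Sum>a<r. (u $ i) ^ r'))"
      by (intro sum.cong refl) (simp add: sum_diff diag)
    also have "\<dots> = (\<Sum>i\<in>UNIV. \<Sum>j\<in>UNIV. \<Sum>a<r. (u $ j) ^ (r - Suc a) * (u $ i) ^ a) - (\<Sum>i\<in>UNIV. \<Sum>a<r. (u $ i) ^ r')"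
      by (simp add: sum_subtractf)
    also have "(\<Sum>i\<in>UNIV. \<Sum>j\<in>UNIV. \<Sum>a<r. (u $ j) ^ (r - Suc a) * (u $ i) ^ a) = (\<Sum>a<r. psums [r - Suc a, a] u)"
    proof -
      have "(\<Sum>i\<in>UNIV. \<Sum>j\<in>UNIV. \<Sum>a<r. (u $ j) ^ (r - Suc a) * (u $ i) ^ a) = (\<Sum>i\<in>UNIV. \<Sum>a<r. \<Sum>j\<in>UNIV. (u $ j) ^ (r - Suc a) * (u $ i) ^ a)"
        by (intro sum.cong refl sum.swap)
      also have "\<dots> = (\<Sum>a<r. \<Sum>i\<in>UNIV. \<Sum>j\<in>UNIV. (u $ j) ^ (r - Suc a) * (u $ i) ^ a)" by (rule sum.swap)
      also have "\<dots> = (\<Sum>a<r. psums [r - Suc a, a] u)"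
        by (intro sum.cong refl) (simp add: psum_def sum_distrib_left sum_distrib_right)
      finally show ?thesis .
    qed
    also have "(\<Sum>i\<in>UNIV. \<Sum>a<r. (u $ i) ^ r') = (\<Sum>a<r. psums [r'] u)"
      by (subst sum.swap) (simp add: psum_def)
    finally show "(\<Sum>i\<in>UNIV. \<Sum>j\<in>UNIV - {i}. (u $ i) ^ r / (u $ i - u $ j)) = ?Q u"
      by (simp add: sum_subtractf)
  qed
qed

definition opA :: "real \<Rightarrow> nat list \<Rightarrow> (real,'n::finite) vec \<Rightarrow> real" where
  "opA k ms u = (\<Sum>i\<in>UNIV. ddpsums i i ms u) / 2 + k * (\<Sum>i\<in>UNIV. \<Sum>j\<in>UNIV - {i}. dpsums i ms u / (u $ i - u $ j))"

text \<open>The terms of order \<open>1 / b\<close>: in the centred squares \<open>u\<close> the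
  quadratic variation per unit time is \<open>s + 4 * u $ i / b\<close>, whose second summand gives
  the factors 2 and 4; the sum of first derivatives is the Ito correction of squaring, half the
  second derivative of \<open>y_i^2\<close>.\<close>

definition opB :: "real \<Rightarrow> nat list \<Rightarrow> (real,'n::finite) vec \<Rightarrow> real" where
  "opB k ms u = 2 * (\<Sum>i\<in>UNIV. u $ i * ddpsums i i ms u) + (\<Sum>i\<in>UNIV. dpsums i ms u)
     + 4 * k * (\<Sum>i\<in>UNIV. \<Sum>j\<in>UNIV - {i}. u $ i * dpsums i ms u / (u $ i - u $ j))"

text \<open>The product rule of a second-order operator: it acts on each factor in turn, and the
  last sum is the mixed term of the two gradients. The induction on the list of exponents rests on
  this.\<close>

lemma opA_Cons:
  "opA k (m # ms) u = (real m * real (m - 1) / 2 * psum (m - 2) u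
       + k * real m * (\<Sum>i\<in>UNIV. \<Sum>j\<in>UNIV - {i}. (u $ i) ^ (m - 1) / (u $ i - u $ j))) * psums ms u
     + psum m u * opA k ms u + real m * (\<Sum>i\<in>UNIV. (u $ i) ^ (m - 1) * dpsums i ms u)"
proof -
  have 1: "(\<Sum>i\<in>UNIV. ddpsums i i (m # ms) u) = real m * real (m - 1) * psum (m - 2) u * psums ms u
     + 2 * (real m * (\<Sum>i\<in>UNIV. (u $ i) ^ (m - 1) * dpsums i ms u)) + psum m u * (\<Sum>i\<in>UNIV. ddpsums i i ms u)"
    by (simp add: sum.distrib psum_def[of "m - 2"] sum_distrib_left sum_distrib_right mult_ac del: One_nat_def)
  have 2: "(\<Sum>i\<in>UNIV. \<Sum>j\<in>UNIV - {i}. dpsums i (m # ms) u / (u $ i - u $ j))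
    = real m * (\<Sum>i\<in>UNIV. \<Sum>j\<in>UNIV - {i}. (u $ i) ^ (m - 1) / (u $ i - u $ j)) * psums ms u
    + psum m u * (\<Sum>i\<in>UNIV. \<Sum>j\<in>UNIV - {i}. dpsums i ms u / (u $ i - u $ j))"
    by (simp add: sum.distrib sum_distrib_left sum_distrib_right add_divide_distrib mult_ac)
  show ?thesis unfolding opA_def 1 2 by (simp add: algebra_simps add_divide_distrib)
qed

lemma opB_Cons:
  "opB k (m # ms) u = (2 * real m * real (m - 1) * psum (m - 1) u + real m * psum (m - 1) u
       + 4 * k * real m * (\<Sum>i\<in>UNIV. \<Sum>j\<in>UNIV - {i}. (u $ i) ^ m / (u $ i - u $ j))) * psums ms u
     + psum m u * opB k ms u + 4 * real m * (\<Sum>i\<in>UNIV. (u $ i) ^ m * dpsums i ms u)"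
proof -
  have p: "real m * (u $ i * (u $ i) ^ (m - 1)) = real m * (u $ i) ^ m" for i by (cases m) auto
  have p2: "real m * real (m - 1) * (u $ i * (u $ i) ^ (m - 2)) = real m * real (m - 1) * (u $ i) ^ (m - 1)" for i
  proof (cases m)
    case (Suc m') then show ?thesis by (cases m') auto
  qed auto
  have 1: "(\<Sum>i\<in>UNIV. u $ i * ddpsums i i (m # ms) u) = real m * real (m - 1) * psum (m - 1) u * psums ms u
     + 2 * (real m * (\<Sum>i\<in>UNIV. (u $ i) ^ m * dpsums i ms u)) + psum m u * (\<Sum>i\<in>UNIV. u $ i * ddpsums i i ms u)"
  proof -
    have "u $ i * ddpsums i i (m # ms) u = (real m * real (m - 1) * (u $ i * (u $ i) ^ (m - 2))) * psums ms u
      + 2 * ((real m * (u $ i * (u $ i) ^ (m - 1))) * dpsums i ms u) + psum m u * (u $ i * ddpsums i i ms u)" for i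
      by (simp add: algebra_simps)
    then show ?thesis unfolding p p2
      by (simp add: sum.distrib psum_def[of "m - 1"] sum_distrib_left sum_distrib_right mult_ac del: One_nat_def)
  qed
  have 2: "(\<Sum>i\<in>UNIV. \<Sum>j\<in>UNIV - {i}. u $ i * dpsums i (m # ms) u / (u $ i - u $ j))
    = real m * (\<Sum>i\<in>UNIV. \<Sum>j\<in>UNIV - {i}. (u $ i) ^ m / (u $ i - u $ j)) * psums ms u
    + psum m u * (\<Sum>i\<in>UNIV. \<Sum>j\<in>UNIV - {i}. u $ i * dpsums i ms u / (u $ i - u $ j))"
  proof -
    have "u $ i * dpsums i (m # ms) u / (u $ i - u $ j) = (real m * (u $ i * (u $ i) ^ (m - 1))) / (u $ i - u $ j) * psums ms u
       + psum m u * (u $ i * dpsums i ms u / (u $ i - u $ j))" for i j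
      by (simp add: distrib_left add_divide_distrib mult_ac)
    then show ?thesis unfolding p
      by (simp add: sum.distrib sum_distrib_left sum_distrib_right mult_ac)
  qed
  have 3: "(\<Sum>i\<in>UNIV. dpsums i (m # ms) u) = real m * psum (m - 1) u * psums ms u + psum m u * (\<Sum>i\<in>UNIV. dpsums i ms u)"
    by (simp add: sum.distrib psum_def[of "m - 1"] sum_distrib_left sum_distrib_right mult_ac del: One_nat_def)
  show ?thesis unfolding opB_def 1 2 3 by (simp add: algebra_simps)
qed

lemma lower_opA: "lower 2 (sum_list ms) (opA k ms :: (real,'n::finite) vec \<Rightarrow> real)"
proof (induction ms)
  case Nil
  then show ?case using lower_zero by (simp add: opA_def[abs_def])
next
  case (Cons m ms)
  show ?case
  proof (cases "m = 0")
    case True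
    have "lower 2 (sum_list (m # ms)) (\<lambda>u::(real,'n) vec. 1 * psums [m] u * opA k ms u)"
      using lower_mult_psums[OF Cons, of "[m]" 1] by (simp add: add_ac)
    then show ?thesis by (rule lower_cong) (simp add: opA_Cons True)
  next
    case False
    \<comment> \<open>A polynomial one degree below \<open>d\<close> is two degrees below
      \<open>Suc d\<close>; the interaction and mixed terms carry the power \<open>m - 1\<close>
      instead of \<open>m\<close>, which accounts for the missing degree.\<close>
    have up: "lower 1 d \<phi> \<Longrightarrow> lower 2 (Suc d) \<phi>" for d and \<phi> :: "(real,'n) vec \<Rightarrow> real" unfolding lower_def by auto
    have 1: "lower 2 (sum_list (m # ms)) (\<lambda>u::(real,'n) vec. real m * real (m - 1) / 2 * psums ((m - 2) # ms) u)"
    proof (cases "m = 1")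
      case True
      then show ?thesis using lower_zero by simp
    qed (use False in \<open>intro lower_psums, simp\<close>)
    have 2: "lower 2 (sum_list (m # ms)) (\<lambda>u::(real,'n) vec. (k * real m) * psums ms u * (\<Sum>i\<in>UNIV. \<Sum>j\<in>UNIV - {i}. (u $ i) ^ (m - 1) / (u $ i - u $ j)))"
      using lower_mult_psums[OF up[OF lower_interaction[of "m - 1"]], of ms "k * real m"] False by simp
    have 3: "lower 2 (sum_list (m # ms)) (\<lambda>u::(real,'n) vec. 1 * psums [m] u * opA k ms u)"
      using lower_mult_psums[OF Cons, of "[m]" 1] by (simp add: add_ac)
    have 4: "lower 2 (sum_list (m # ms)) (\<lambda>u::(real,'n) vec. real m * (\<Sum>i\<in>UNIV. (u $ i) ^ (m - 1) * dpsums i ms u))"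
      using lower_cmult[OF up[OF lower_gradient[of "m - 1" ms]], of "real m"] False by simp
    show ?thesis by (rule lower_cong[OF lower_add[OF 1 lower_add[OF 2 lower_add[OF 3 4]]]])
        (simp add: opA_Cons algebra_simps)
  qed
qed

lemma lower_opB: "lower 1 (sum_list ms) (opB k ms :: (real,'n::finite) vec \<Rightarrow> real)"
proof (induction ms)
  case Nil
  then show ?case using lower_zero by (simp add: opB_def[abs_def])
next
  case (Cons m ms)
  have 1: "lower 1 (sum_list (m # ms)) (\<lambda>u::(real,'n) vec. (2 * real m * real (m - 1) + real m) * psums ((m - 1) # ms) u)"
  proof (cases "m = 0")
    case True
    then show ?thesis using lower_zero by simp
  qed (intro lower_psums, simp)
  have 2: "lower 1 (sum_list (m # ms)) (\<lambda>u::(real,'n) vec. (4 * k * real m) * psums ms u * (\<Sum>i\<in>UNIV. \<Sum>j\<in>UNIV - {i}. (u $ i) ^ m / (u $ i - u $ j)))"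
    using lower_mult_psums[OF lower_interaction[of m], of ms "4 * k * real m"] by simp
  have 3: "lower 1 (sum_list (m # ms)) (\<lambda>u::(real,'n) vec. 1 * psums [m] u * opB k ms u)"
    using lower_mult_psums[OF Cons, of "[m]" 1] by (simp add: add_ac)
  have 4: "lower 1 (sum_list (m # ms)) (\<lambda>u::(real,'n) vec. (4 * real m) * (\<Sum>i\<in>UNIV. (u $ i) ^ m * dpsums i ms u))"
    using lower_cmult[OF lower_gradient[of m ms], of "4 * real m"] by simp
  show ?case by (rule lower_cong[OF lower_add[OF 1 lower_add[OF 2 lower_add[OF 3 4]]]])
      (simp add: opB_Cons algebra_simps)
qed

text \<open>Euler's relation for homogeneous functions; it evaluates the term of Stein's equation
  that stems from the Gaussian factor.\<close>

lemma euler_psums: "(\<Sum>i\<in>UNIV. u $ i * dpsums i ms u) = real (sum_list ms) * psums ms u"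
proof (induction ms)
  case (Cons m ms)
  have p: "real m * (u $ i * (u $ i) ^ (m - 1)) = real m * (u $ i) ^ m" for i by (cases m) auto
  have "u $ i * dpsums i (m # ms) u = (real m * (u $ i * (u $ i) ^ (m - 1))) * psums ms u + psum m u * (u $ i * dpsums i ms u)" for i
    by (simp add: algebra_simps)
  then have "(\<Sum>i\<in>UNIV. u $ i * dpsums i (m # ms) u) = real m * psum m u * psums ms u + psum m u * (\<Sum>i\<in>UNIV. u $ i * dpsums i ms u)"
    unfolding p by (simp add: sum.distrib psum_def[of m] sum_distrib_left sum_distrib_right mult_ac del: One_nat_def)
  then show ?case unfolding Cons by (simp add: algebra_simps)
qed simp

section \<open>The moment equation of the centred squares\<close>

lemma poly_growth_power: "poly_growth f \<Longrightarrow> poly_growth (\<lambda>y. f y ^ m)"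
  by (induction m) (auto intro: poly_growth_const poly_growth_mult)

context bessel_B begin

lemma smooth_invariant_const: "smooth_invariant (\<lambda>_. c)"
proof -
  have "perm_invariant (\<lambda>_::(real,'n) vec. c)" "sign_invariant (\<lambda>_::(real,'n) vec. c)"
    by (simp_all add: perm_invariant_def sign_invariant_def)
  then show ?thesis unfolding smooth_invariant_def
    using C2_data_const[of c, where 'a='n] poly_growth_const by blast
qed

lemma smooth_invariant_mult:
  assumes "smooth_invariant f" "smooth_invariant f'"
  shows "smooth_invariant (\<lambda>y. f y * f' y)"
proof -
  obtain g h where f: "C2_data f g h" and inv: "perm_invariant f" "sign_invariant f"
    and gr: "poly_growth f" "\<And>i. poly_growth (g i)" "\<And>i j. poly_growth (h i j)"
    using assms unfolding smooth_invariant_def by blast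
  obtain g' h' where f': "C2_data f' g' h'" and inv': "perm_invariant f'" "sign_invariant f'"
    and gr': "poly_growth f'" "\<And>i. poly_growth (g' i)" "\<And>i j. poly_growth (h' i j)"
    using assms unfolding smooth_invariant_def by blast
  have "poly_growth (\<lambda>y. f y * f' y)" "poly_growth (\<lambda>y. g i y * f' y + f y * g' i y)"
    "poly_growth (\<lambda>y. (h i j y * f' y + g i y * g' j y) + (g j y * g' i y + f y * h' i j y))" for i j
    by (intro poly_growth_add poly_growth_mult gr gr')+
  then show ?thesis unfolding smooth_invariant_def
    using C2_data_mult[OF f f'] invariant_mult(1)[OF inv(1) inv'(1)] invariant_mult(2)[OF inv(2) inv'(2)] by blast
qed

lemma smooth_invariant_add: "smooth_invariant f \<Longrightarrow> smooth_invariant f' \<Longrightarrow> smooth_invariant (\<lambda>y. f y + f' y)"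
  using gen_B_linear(2)[of f f' 1] by simp

lemma smooth_invariant_psum: "smooth_invariant (psum (2 * j))"
proof -
  have "perm_invariant (psum (2 * j) :: (real,'n) vec \<Rightarrow> real)"
    using perm_invariant_psums[of "[2 * j]"] by (simp add: perm_invariant_def)
  moreover have "sign_invariant (psum (2 * j) :: (real,'n) vec \<Rightarrow> real)"
    unfolding sign_invariant_def psum_def
  proof (intro allI impI)
    fix \<epsilon> :: "'n \<Rightarrow> real" and y :: "(real,'n) vec" assume e: "\<forall>i. \<epsilon> i = 1 \<or> \<epsilon> i = -1"
    have "\<epsilon> i ^ (2 * j) = 1" for i using e[rule_format, of i] by auto
    then show "(\<Sum>i\<in>UNIV. (\<chi> i. \<epsilon> i * y $ i) $ i ^ (2 * j)) = (\<Sum>i\<in>UNIV. y $ i ^ (2 * j))"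
      by (simp add: power_mult_distrib)
  qed
  moreover have "poly_growth (psum m :: (real,'n) vec \<Rightarrow> real)" for m
    unfolding psum_def[abs_def] by (intro poly_growth_sum poly_growth_power poly_growth_component)
  moreover have "poly_growth (\<lambda>u::(real,'n) vec. real m * (u $ i) ^ (m - 1))"
    "poly_growth (\<lambda>u::(real,'n) vec. if i = j then real m * real (m - 1) * (u $ i) ^ (m - 2) else 0)" for m i j
    by (cases "i = j"; simp; intro poly_growth_mult poly_growth_const poly_growth_power poly_growth_component)+
  ultimately show ?thesis unfolding smooth_invariant_def using C2_data_psum[of "2 * j"] by blast
qed

lemma time_poly_add: "time_poly \<phi> \<Longrightarrow> time_poly \<psi> \<Longrightarrow> time_poly (\<lambda>s y. \<phi> s y + \<psi> s y)"
proof (induction arbitrary: \<psi> rule: time_poly.induct)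
  case (base q)
  from base(2) show ?case
  proof cases
    case (base q')
    then show ?thesis using time_poly.base[OF smooth_invariant_add[OF \<open>smooth_invariant q\<close> base(2)]] by simp
  next
    case (step q' \<phi>')
    then show ?thesis using time_poly.step[OF smooth_invariant_add[OF \<open>smooth_invariant q\<close> step(2)] step(3)]
      by (simp add: add_ac)
  qed
next
  case (step q \<phi>)
  from step(4) show ?case
  proof cases
    case (base q')
    then show ?thesis using time_poly.step[OF smooth_invariant_add[OF \<open>smooth_invariant q\<close> base(2)] step(2)]
      by (simp add: add_ac)
  next
    case s: (step q' \<phi>')
    show ?thesis using time_poly.step[OF smooth_invariant_add[OF \<open>smooth_invariant q\<close> s(2)] step(3)[OF s(3)]] s(1)
      by (simp add: algebra_simps)
  qed
qed

lemma time_poly_times: "time_poly \<phi> \<Longrightarrow> time_poly (\<lambda>s y. s * \<phi> s y)"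
  using time_poly.step[OF smooth_invariant_const[of 0]] by simp

lemma time_poly_mult_base: "time_poly \<phi> \<Longrightarrow> smooth_invariant q \<Longrightarrow> time_poly (\<lambda>s y. q y * \<phi> s y)"
proof (induction rule: time_poly.induct)
  case (base q')
  then show ?case by (intro time_poly.base smooth_invariant_mult)
next
  case (step q' \<phi>)
  have "time_poly (\<lambda>s y. q y * q' y + s * (q y * \<phi> s y))"
    by (intro time_poly.step smooth_invariant_mult step)
  then show ?case by (simp add: algebra_simps)
qed

lemma time_poly_mult: "time_poly \<phi> \<Longrightarrow> time_poly \<psi> \<Longrightarrow> time_poly (\<lambda>s y. \<phi> s y * \<psi> s y)"
proof (induction rule: time_poly.induct)
  case (base q)
  then show ?case by (intro time_poly_mult_base)
next
  case (step q \<phi>)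
  have "time_poly (\<lambda>s y. q y * \<psi> s y + s * (\<phi> s y * \<psi> s y))"
    by (intro time_poly_add time_poly_mult_base time_poly_times step)
  then show ?case by (simp add: algebra_simps)
qed

lemma time_poly_sum: "finite S \<Longrightarrow> (\<And>a. a \<in> S \<Longrightarrow> time_poly (\<phi> a)) \<Longrightarrow> time_poly (\<lambda>s y. \<Sum>a\<in>S. \<phi> a s y)"
  by (induction S rule: finite_induct) (auto intro: time_poly.base smooth_invariant_const time_poly_add)

lemma time_poly_power: "smooth_invariant q \<Longrightarrow> time_poly (\<lambda>s y. s ^ m * q y)"
proof (induction m)
  case 0
  then show ?case using time_poly.base by simp
next
  case (Suc m)
  then show ?case using time_poly_times[of "\<lambda>s y. s ^ m * q y"] by (simp add: mult_ac)
qed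

section \<open>The generator in centred squares\<close>

definition bscale :: real where "bscale = 2 * sqrt (2 * k1)"

text \<open>\<open>2 * k1 * s\<close> is the growth that the drift \<open>k1 / x\<close> produces in
  the square of a coordinate. Squaring also makes symmetric polynomials of the result even in every
  coordinate, so they are admissible test functions.\<close>

definition centred :: "real \<Rightarrow> (real,'n) vec \<Rightarrow> (real,'n) vec" where
  "centred s y = (\<chi> i. ((y $ i)\<^sup>2 - 2 * k1 * s) / bscale)"

lemma bscale: "bscale > 0" "bscale\<^sup>2 = 8 * k1"
proof -
  show "bscale > 0" unfolding bscale_def using k1_pos by simp
  show "bscale\<^sup>2 = 8 * k1" unfolding bscale_def power_mult_distrib using k1_pos by simp
qed

lemma centred_nth: "centred s y $ i = ((y $ i)\<^sup>2 - 2 * k1 * s) / bscale"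
  by (simp add: centred_def)

text \<open>The binomial theorem exhibits a polynomial in \<open>s\<close> whose coefficients are
  even power sums of \<open>y\<close>, which are smooth and invariant under sign changes.\<close>

lemma time_poly_psum: "time_poly (\<lambda>s y. psum m (centred s y))"
proof -
  let ?c = "\<lambda>k. real (m choose k) * (- (2 * k1)) ^ (m - k) / bscale ^ m"
  have "time_poly (\<lambda>s y. \<Sum>k\<le>m. s ^ (m - k) * (?c k * psum (2 * k) y))"
    by (intro time_poly_sum time_poly_power smooth_invariant_mult smooth_invariant_const smooth_invariant_psum) auto
  moreover have "psum m (centred s y) = (\<Sum>k\<le>m. s ^ (m - k) * (?c k * psum (2 * k) y))" for s y
  proof -
    have "(centred s y $ i) ^ m = (\<Sum>k\<le>m. s ^ (m - k) * (?c k * (y $ i) ^ (2 * k)))" for i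
    proof -
      have "(centred s y $ i) ^ m = ((y $ i)\<^sup>2 + (- (2 * k1)) * s) ^ m / bscale ^ m"
        by (simp add: centred_nth power_divide)
      also have "\<dots> = (\<Sum>k\<le>m. s ^ (m - k) * (?c k * (y $ i) ^ (2 * k)))"
        unfolding binomial_ring sum_divide_distrib power_mult[of "y $ i" 2]
        by (intro sum.cong refl) (simp only: power_mult_distrib times_divide_eq_left times_divide_eq_right mult_ac)
      finally show ?thesis .
    qed
    then have "psum m (centred s y) = (\<Sum>i\<in>UNIV. \<Sum>k\<le>m. s ^ (m - k) * (?c k * (y $ i) ^ (2 * k)))" by (simp add: psum_def)
    also have "\<dots> = (\<Sum>k\<le>m. \<Sum>i\<in>UNIV. s ^ (m - k) * (?c k * (y $ i) ^ (2 * k)))" by (rule sum.swap)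
    finally show ?thesis by (simp add: psum_def sum_distrib_left)
  qed
  ultimately show ?thesis by simp
qed

lemma time_poly_psums: "time_poly (\<lambda>s y. psums ms (centred s y))"
  by (induction ms) (auto intro: time_poly.base smooth_invariant_const time_poly_mult time_poly_psum)

lemma DERIV_psums_centred:
  "((\<lambda>s. psums ms (centred s y)) has_real_derivative - (2 * k1 / bscale) * (\<Sum>i\<in>UNIV. dpsums i ms (centred s y))) (at s)"
proof (induction ms)
  case (Cons m ms)
  have "((\<lambda>s. (centred s y $ i) ^ m) has_real_derivative real m * (centred s y $ i) ^ (m - 1) * - (2 * k1 / bscale)) (at s)" for i
  proof -
    have "((\<lambda>s. centred s y $ i) has_real_derivative - (2 * k1 / bscale)) (at s)"
      unfolding centred_nth using bscale(1) by (auto intro!: derivative_eq_intros)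
    from DERIV_power[OF this, of m] show ?thesis by (simp add: mult_ac)
  qed
  then have 1: "((\<lambda>s. psum m (centred s y)) has_real_derivative (\<Sum>i\<in>UNIV. real m * (centred s y $ i) ^ (m - 1) * - (2 * k1 / bscale))) (at s)"
    unfolding psum_def by (intro DERIV_sum) auto
  have "((\<lambda>s. psum m (centred s y) * psums ms (centred s y)) has_real_derivative
     (\<Sum>i\<in>UNIV. real m * (centred s y $ i) ^ (m - 1) * - (2 * k1 / bscale)) * psums ms (centred s y)
     + (- (2 * k1 / bscale) * (\<Sum>i\<in>UNIV. dpsums i ms (centred s y))) * psum m (centred s y)) (at s)"
    by (rule DERIV_mult[OF 1 Cons])
  moreover have "(\<Sum>i\<in>UNIV. real m * (centred s y $ i) ^ (m - 1) * - (2 * k1 / bscale)) * psums ms (centred s y)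
     + (- (2 * k1 / bscale) * (\<Sum>i\<in>UNIV. dpsums i ms (centred s y))) * psum m (centred s y)
     = - (2 * k1 / bscale) * (\<Sum>i\<in>UNIV. dpsums i (m # ms) (centred s y))"
    by (simp add: sum.distrib sum_distrib_left sum_distrib_right algebra_simps)
  ultimately show ?case by simp
qed simp

text \<open>Moving coordinate \<open>i\<close> of \<open>y\<close> by \<open>r\<close> moves only
  coordinate \<open>i\<close> of \<open>centred s y\<close>, by
  \<open>(2 * y $ i * r + r^2) / bscale\<close>, so this is the one-variable chain rule.\<close>

lemma has_partial_centred:
  assumes "has_partial i F F'"
  shows "has_partial i (\<lambda>y. F (centred s y)) (\<lambda>y. F' (centred s y) * (2 * y $ i / bscale))"
  unfolding has_partial_def
proof
  fix y :: "(real,'n) vec"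
  let ?\<rho> = "\<lambda>r::real. (2 * y $ i * r + r\<^sup>2) / bscale"
  have eq: "centred s (y + r *\<^sub>R axis i 1) = centred s y + ?\<rho> r *\<^sub>R axis i 1" for r
    using bscale(1) by (auto simp: vec_eq_iff centred_nth axis_def field_simps power2_eq_square)
  have "(?\<rho> has_real_derivative 2 * y $ i / bscale) (at 0)" using bscale(1) by (auto intro!: derivative_eq_intros)
  moreover have "((\<lambda>\<rho>. F (centred s y + \<rho> *\<^sub>R axis i 1)) has_real_derivative F' (centred s y)) (at (?\<rho> 0))"
    using assms by (simp add: has_partial_def)
  ultimately show "((\<lambda>r. F (centred s (y + r *\<^sub>R axis i 1))) has_real_derivative F' (centred s y) * (2 * y $ i / bscale)) (at 0)"
    unfolding eq by (intro DERIV_chain2[of "\<lambda>\<rho>. F (centred s y + \<rho> *\<^sub>R axis i 1)" _ ?\<rho>])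
qed

lemma C2_data_centred:
  assumes F: "C2_data F G H"
  shows "C2_data (\<lambda>y. F (centred s y)) (\<lambda>i y. G i (centred s y) * (2 * y $ i / bscale))
    (\<lambda>i j y. H i j (centred s y) * (2 * y $ j / bscale) * (2 * y $ i / bscale) + G i (centred s y) * (2 * (if i = j then 1 else 0) / bscale))"
proof -
  have c: "continuous_on UNIV (centred s)"
    unfolding centred_def[abs_def] by (intro continuous_intros) (use bscale(1) in auto)
  have cc: "continuous_on UNIV (\<lambda>y. f (centred s y))" if "continuous_on UNIV f" for f :: "(real,'n) vec \<Rightarrow> real"
    by (rule continuous_on_compose2[OF that c]) auto
  have y: "has_partial j (\<lambda>y::(real,'n) vec. 2 * y $ i / bscale) (\<lambda>_. 2 * (if i = j then 1 else 0) / bscale)" for i j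
  proof -
    have "((\<lambda>v. 2 * v / bscale) has_real_derivative 2 / bscale) (at v)" for v
      using bscale(1) by (auto intro!: derivative_eq_intros)
    from has_partial_compose[OF has_partial_component this, of j i] show ?thesis
      by (rule has_partial_eqI) auto
  qed
  have "has_partial j (\<lambda>y. G i (centred s y) * (2 * y $ i / bscale))
     (\<lambda>y. H i j (centred s y) * (2 * y $ j / bscale) * (2 * y $ i / bscale) + G i (centred s y) * (2 * (if i = j then 1 else 0) / bscale))" for i j
    by (rule has_partial_mult[OF has_partial_centred[OF C2_dataE(5)[OF F]] y])
  then show ?thesis unfolding C2_data_def
    using C2_dataE[OF F] has_partial_centred[OF C2_dataE(4)[OF F]] bscale(1)
    by (auto intro!: continuous_intros cc)
qed

lemma regular_centred: "regular y \<Longrightarrow> distinct_coords (centred s y)"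
  using bscale(1) by (auto simp: regular_def distinct_coords_def centred_nth)

text \<open>Three effects meet here. The drift \<open>k1 / y $ i\<close> contributes
  \<open>2 * k1 / bscale\<close> times the sum of first derivatives, which the time derivative of
  the centring cancels. The two poles add up to \<open>2 * y $ i\<close> over a difference of
  squares, that is, over \<open>bscale * (u $ i - u $ j)\<close>. The chain rule then leaves
  \<open>4 * y_i^2 / bscale^2\<close> in front of the second derivatives and of the interaction, and
  this factor equals \<open>s + 4 * u $ i / bscale\<close>.\<close>

lemma generator_centred:
  assumes y: "regular y"
  shows "- (2 * k1 / bscale) * (\<Sum>i\<in>UNIV. dpsums i ms (centred s y)) + gen_B k1 k2 (\<lambda>y. psums ms (centred s y)) y
     = s * opA k2 ms (centred s y) + 1 / bscale * opB k2 ms (centred s y)"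
proof -
  define u where "u = centred s y"
  define b where "b = bscale"
  have b: "b > 0" "b * b = 8 * k1" using bscale by (auto simp: b_def power2_eq_square)
  have y2: "(y $ i)\<^sup>2 = b * u $ i + 2 * k1 * s" for i using b by (simp add: u_def centred_nth b_def[symmetric])
  have y0: "y $ i \<noteq> 0" for i using y by (simp add: regular_def)
  have yd: "y $ i - y $ j \<noteq> 0" "y $ i + y $ j \<noteq> 0" "u $ i - u $ j \<noteq> 0" if "i \<noteq> j" for i j
  proof -
    have "(y $ i)\<^sup>2 \<noteq> (y $ j)\<^sup>2" using y that by (simp add: regular_def)
    then show "y $ i - y $ j \<noteq> 0" "y $ i + y $ j \<noteq> 0" by (auto simp: power2_eq_iff)
    show "u $ i - u $ j \<noteq> 0" using regular_centred[OF y] that by (auto simp: distinct_coords_def u_def)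
  qed
  \<comment> \<open>This is where the choice \<open>b * b = 8 * k1\<close> pays: the leading part of
    the coefficient becomes exactly \<open>s\<close>.\<close>
  have key: "4 * (b * u $ i + 2 * k1 * s) / (b * b) = 4 * u $ i / b + s" for i
  proof -
    have "4 * (b * u $ i + 2 * k1 * s) / (b * b) = 4 * (b * u $ i) / (b * b) + (b * b) * s / (b * b)"
      by (simp add: b(2) add_divide_distrib algebra_simps)
    then show ?thesis using b(1) by simp
  qed
  have t1: "(ddpsums i i ms u * (2 * y $ i / b) * (2 * y $ i / b) + dpsums i ms u * (2 * (if i = i then 1 else 0) / b)) / 2
     = s * (ddpsums i i ms u / 2) + 1 / b * (2 * (u $ i * ddpsums i i ms u) + dpsums i ms u)" for i
  proof -
    have "(2 * y $ i / b) * (2 * y $ i / b) = 4 * (y $ i)\<^sup>2 / (b * b)" by (simp add: power2_eq_square)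
    then have "(2 * y $ i / b) * (2 * y $ i / b) = 4 * u $ i / b + s" unfolding y2 key .
    then have "ddpsums i i ms u * (2 * y $ i / b) * (2 * y $ i / b) = ddpsums i i ms u * (4 * u $ i / b + s)"
      by (simp only: mult.assoc)
    then show ?thesis by (simp add: algebra_simps add_divide_distrib)
  qed
  have t2: "(1 / (y $ i - y $ j) + 1 / (y $ i + y $ j)) * (dpsums i ms u * (2 * y $ i / b))
     = s * (dpsums i ms u / (u $ i - u $ j)) + 1 / b * (4 * (u $ i * dpsums i ms u / (u $ i - u $ j)))" if "j \<in> UNIV - {i}" for i j
  proof -
    have ij: "i \<noteq> j" using that by auto
    have "(1 / (y $ i - y $ j) + 1 / (y $ i + y $ j)) * (2 * y $ i / b) = 4 * (y $ i)\<^sup>2 / (b * ((y $ i)\<^sup>2 - (y $ j)\<^sup>2))"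
    proof -
      have "(y $ i)\<^sup>2 - (y $ j)\<^sup>2 = (y $ i - y $ j) * (y $ i + y $ j)" by (simp add: power2_eq_square algebra_simps)
      then show ?thesis using yd[OF ij] b by (simp add: field_simps power2_eq_square)
    qed
    also have "(y $ i)\<^sup>2 - (y $ j)\<^sup>2 = b * (u $ i - u $ j)" by (simp add: y2 algebra_simps)
    also have "4 * (y $ i)\<^sup>2 / (b * (b * (u $ i - u $ j))) = 4 * (b * u $ i + 2 * k1 * s) / (b * b) / (u $ i - u $ j)"
      by (simp add: y2 mult.assoc)
    also note key
    finally have "(1 / (y $ i - y $ j) + 1 / (y $ i + y $ j)) * (2 * y $ i / b) = (4 * u $ i / b + s) / (u $ i - u $ j)" .
    then have "(1 / (y $ i - y $ j) + 1 / (y $ i + y $ j)) * (dpsums i ms u * (2 * y $ i / b)) = dpsums i ms u * ((4 * u $ i / b + s) / (u $ i - u $ j))"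
      by (simp only: mult.left_commute)
    then show ?thesis by (simp add: algebra_simps add_divide_distrib)
  qed
  have t3: "(1 / y $ i) * (dpsums i ms u * (2 * y $ i / b)) = 2 / b * dpsums i ms u" for i
    using y0[of i] by simp
  have "gen_B k1 k2 (\<lambda>y. psums ms (centred s y)) y
    = (\<Sum>i\<in>UNIV. (ddpsums i i ms u * (2 * y $ i / b) * (2 * y $ i / b) + dpsums i ms u * (2 * (if i = i then 1 else 0) / b)) / 2)
      + k2 * (\<Sum>i\<in>UNIV. \<Sum>j\<in>UNIV - {i}. (1 / (y$i - y$j) + 1 / (y$i + y$j)) * (dpsums i ms u * (2 * y $ i / b)))
      + k1 * (\<Sum>i\<in>UNIV. (1 / y$i) * (dpsums i ms u * (2 * y $ i / b)))"
    unfolding gen_B_C2_data[OF C2_data_centred[OF C2_data_psums]] u_def b_def by (simp add: sum_divide_distrib)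
  also have "\<dots> = (\<Sum>i\<in>UNIV. s * (ddpsums i i ms u / 2) + 1 / b * (2 * (u $ i * ddpsums i i ms u) + dpsums i ms u))
      + k2 * (\<Sum>i\<in>UNIV. \<Sum>j\<in>UNIV - {i}. s * (dpsums i ms u / (u $ i - u $ j)) + 1 / b * (4 * (u $ i * dpsums i ms u / (u $ i - u $ j))))
      + k1 * (\<Sum>i\<in>UNIV. 2 / b * dpsums i ms u)"
    unfolding t1 t3 by (intro arg_cong2[where f="(+)"] arg_cong2[where f="(*)"] sum.cong refl t2)
  also have "\<dots> = s * opA k2 ms u + 1 / b * opB k2 ms u + (2 * k1 / b) * (\<Sum>i\<in>UNIV. dpsums i ms u)"
    unfolding opA_def opB_def sum.distrib sum_distrib_left[symmetric] sum_divide_distrib[symmetric]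
    by (simp add: algebra_simps)
  finally show ?thesis by (simp add: u_def b_def)
qed

definition mom :: "nat list \<Rightarrow> real \<Rightarrow> real" where
  "mom ms s = ex (\<lambda>y. psums ms (centred s y)) s"

lemma lbm_mom: "locally_bounded_measurable (mom ms)"
  unfolding mom_def[abs_def] by (rule time_poly_dynkin(2)[OF time_poly_psums DERIV_psums_centred])

lemma smooth_invariant_psums_centred: "smooth_invariant (\<lambda>y. psums ms (centred s y))"
  by (rule time_poly_dynkin(1)[OF time_poly_psums DERIV_psums_centred])

lemma lincomb_centred:
  shows "poly_growth (\<lambda>y. lincomb cs (centred s y))" "(\<lambda>y. lincomb cs (centred s y)) \<in> borel_measurable borel"
    "ex (\<lambda>y. lincomb cs (centred s y)) s = (\<Sum>(c, ns)\<leftarrow>cs. c * mom ns s)"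
proof (induction cs)
  case Nil
  { case 1 show ?case by (simp add: poly_growth_const) next
    case 2 show ?case by simp next
    case 3 show ?case by (simp add: ex_def) }
next
  case (Cons a cs)
  obtain c ns where a: "a = (c, ns)" by (cases a)
  note p = dynkin(4,5)[OF smooth_invariant_psums_centred[of ns s]]
  note [measurable] = p(2) Cons(2)
  { case 1 show ?case unfolding a lincomb_simps by (intro poly_growth_add poly_growth_mult poly_growth_const p Cons) next
    case 2 show ?case unfolding a lincomb_simps by measurable next
    case 3
    have "ex (\<lambda>y. lincomb cs (centred s y) + c * psums ns (centred s y)) s = ex (\<lambda>y. lincomb cs (centred s y)) s + c * mom ns s"
      unfolding mom_def by (rule ex_add[OF Cons(1,2) p])
    then show ?case unfolding a lincomb_simps Cons(3) by (simp add: add_ac) }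
qed

text \<open>The forward equation for a polynomial in time and space, in which
  \<open>generator_centred\<close> replaces the singular expression under the integral. In the
  application \<open>cs\<close> and \<open>ds\<close> come from \<open>lower_opA\<close> and
  \<open>lower_opB\<close>, so only moments of lower degree remain on the right.\<close>

lemma moment_equation:
  assumes t: "t \<ge> 0"
    and A: "\<And>u::(real,'n) vec. distinct_coords u \<Longrightarrow> opA k2 ms u = lincomb cs u"
    and B: "\<And>u::(real,'n) vec. distinct_coords u \<Longrightarrow> opB k2 ms u = lincomb ds u"
  shows "mom ms t = psums ms (centred 0 x)
    + (LINT s:{0..t}|lborel. s * (\<Sum>(c, ns)\<leftarrow>cs. c * mom ns s) + 1 / bscale * (\<Sum>(c, ns)\<leftarrow>ds. c * mom ns s))"
proof -
  let ?D = "\<lambda>s y. - (2 * k1 / bscale) * (\<Sum>i\<in>UNIV. dpsums i ms (centred s y)) + gen_B k1 k2 (\<lambda>y. psums ms (centred s y)) y"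
  let ?R = "\<lambda>s y. s * lincomb cs (centred s y) + 1 / bscale * lincomb ds (centred s y)"
  note T = time_poly_dynkin[OF time_poly_psums DERIV_psums_centred]
  have R: "ex (?R s) s = s * (\<Sum>(c, ns)\<leftarrow>cs. c * mom ns s) + 1 / bscale * (\<Sum>(c, ns)\<leftarrow>ds. c * mom ns s)" for s
  proof -
    \<comment> \<open>The summand 0 brings the expression into the form \<open>q + c * q'\<close> of
      \<open>ex_add\<close>.\<close>
    have "ex (\<lambda>y. (0 + s * lincomb cs (centred s y)) + 1 / bscale * lincomb ds (centred s y)) s
       = ex (\<lambda>y. 0 + s * lincomb cs (centred s y)) s + 1 / bscale * ex (\<lambda>y. lincomb ds (centred s y)) s"
      by (rule ex_add) (use lincomb_centred in \<open>auto intro!: poly_growth_mult poly_growth_const\<close>)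
    also have "ex (\<lambda>y. 0 + s * lincomb cs (centred s y)) s = ex (\<lambda>_. 0) s + s * ex (\<lambda>y. lincomb cs (centred s y)) s"
      by (rule ex_add) (use lincomb_centred poly_growth_const in auto)
    finally show ?thesis unfolding lincomb_centred(3) by (simp add: ex_def)
  qed
  have ml: "(\<lambda>s. \<Sum>(c, ns)\<leftarrow>cs. c * mom ns s) \<in> borel_measurable borel" for cs :: "(real \<times> nat list) list"
  proof (induction cs)
    case (Cons a cs)
    moreover have "mom ns \<in> borel_measurable borel" for ns using lbm_mom by (simp add: locally_bounded_measurable_def)
    ultimately show ?case by (cases a) auto
  qed simp
  have "mom ms t = psums ms (centred 0 x) + (LINT s:{0..t}|lborel. ex (?D s) s)"
    unfolding mom_def by (rule T(6)[OF t])
  also have "(LINT s:{0..t}|lborel. ex (?D s) s) = (LINT s:{0..t}|lborel. ex (?R s) s)"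
  proof (rule LINT_ex_cong[OF t])
    fix s and y :: "(real,'n) vec" assume y: "regular y"
    show "?D s y = ?R s y" unfolding generator_centred[OF y] using A[OF regular_centred[OF y]] B[OF regular_centred[OF y]] by simp
  next
    fix s
    show "?D s \<in> borel_measurable borel"
      using T(4)[of ms s] dynkin(3)[OF smooth_invariant_psums_centred[of ms s]] by measurable
    show "?R s \<in> borel_measurable borel"
      using lincomb_centred(2)[of cs s] lincomb_centred(2)[of ds s] by measurable
  next
    show "(\<lambda>s. ex (?D s) s) \<in> borel_measurable lborel" using T(5) by (simp add: locally_bounded_measurable_def)
    show "(\<lambda>s. ex (?R s) s) \<in> borel_measurable lborel" unfolding R using ml[of cs] ml[of ds] by simp
  qed
  finally show ?thesis unfolding R .
qed

end

section \<open>The regularised weight of type A\<close>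

lemma power_le_fact_exp: "0 \<le> x \<Longrightarrow> x ^ n \<le> fact n * exp (x::real)"
proof -
  assume x: "0 \<le> x"
  have "(\<Sum>i\<in>{n}. inverse (fact i) * x ^ i) \<le> (\<Sum>i. inverse (fact i) * x ^ i)"
    using x summable_exp[of x] by (intro sum_le_suminf) auto
  also have "\<dots> = exp x" by (simp add: exp_def)
  finally show ?thesis by (simp add: field_simps)
qed

lemma poly_exp_bound:
  assumes "poly_growth q"
  obtains C where "C > 0" "\<And>y. \<bar>q y\<bar> \<le> C * exp (norm y)"
proof -
  obtain K m where K: "K \<ge> 0" "\<And>n y. n \<ge> m \<Longrightarrow> \<bar>q y\<bar> \<le> K * (1 + norm y ^ 2) ^ n" using poly_growthE[OF assms] by blast
  have "\<bar>q y\<bar> \<le> (K * (fact (2 * m) * exp 1) + 1) * exp (norm y)" for y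
  proof -
    have "1 + norm y ^ 2 \<le> (1 + norm y) ^ 2" by (simp add: power2_eq_square algebra_simps)
    then have "(1 + norm y ^ 2) ^ m \<le> ((1 + norm y) ^ 2) ^ m" by (intro power_mono) auto
    also have "\<dots> = (1 + norm y) ^ (2 * m)" by (simp add: power_mult)
    also have "\<dots> \<le> fact (2 * m) * exp (1 + norm y)" by (intro power_le_fact_exp) simp
    also have "\<dots> = (fact (2 * m) * exp 1) * exp (norm y)" by (simp add: exp_add)
    finally have "K * (1 + norm y ^ 2) ^ m \<le> K * ((fact (2 * m) * exp 1) * exp (norm y))" using K(1) by (rule mult_left_mono)
    then have "\<bar>q y\<bar> \<le> K * ((fact (2 * m) * exp 1) * exp (norm y))" using K(2)[of m y] by linarith
    then show ?thesis by (simp add: distrib_right add_increasing2)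
  qed
  moreover have "0 \<le> K * (fact (2 * m) * exp 1)" using K(1) by simp
  then have "0 < K * (fact (2 * m) * exp 1) + 1" by linarith
  ultimately show thesis using that by blast
qed

text \<open>Comparison on unit shells: for \<open>m \<le> norm y \<le> m + 1\<close> the function is
  at most \<open>exp (- m)\<close>, and the volumes of balls grow only polynomially.\<close>

lemma integrable_exp_neg_norm: "integrable lborel (\<lambda>y::'a::euclidean_space. exp (- norm y))"
proof (rule integrableI_bounded)
  let ?N = "DIM('a)"
  define V where "V = unit_ball_vol (real ?N)"
  have V0: "V \<ge> 0" by (simp add: V_def)
  have "(\<integral>\<^sup>+y. ennreal (norm (exp (- norm (y::'a)))) \<partial>lborel)
      \<le> (\<integral>\<^sup>+y. (\<Sum>m. ennreal (exp (- real m)) * indicator (cball 0 (real (Suc m))) (y::'a)) \<partial>lborel)"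
  proof (intro nn_integral_mono)
    fix y :: 'a
    define m where "m = nat \<lfloor>norm y\<rfloor>"
    have m: "real m \<le> norm y" "norm y \<le> real (Suc m)" unfolding m_def by (simp_all add: of_nat_nat, linarith)
    have F: "F m \<le> suminf F" for F :: "nat \<Rightarrow> ennreal" using sum_le_suminf[of F "{m}"] by simp
    have "ennreal (norm (exp (- norm y))) \<le> ennreal (exp (- real m)) * indicator (cball 0 (real (Suc m))) y"
      using m by (simp add: indicator_def ennreal_leI)
    also have "\<dots> \<le> (\<Sum>i. ennreal (exp (- real i)) * indicator (cball 0 (real (Suc i))) y)"
      by (rule F[of "\<lambda>i. ennreal (exp (- real i)) * indicator (cball 0 (real (Suc i))) y"])
    finally show "ennreal (norm (exp (- norm y))) \<le> (\<Sum>m. ennreal (exp (- real m)) * indicator (cball 0 (real (Suc m))) y)" .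
  qed
  also have "\<dots> = (\<Sum>m. ennreal (exp (- real m)) * emeasure lborel (cball (0::'a) (real (Suc m))))"
  proof -
    have "(\<integral>\<^sup>+y. ennreal (exp (- real m)) * indicator (cball 0 (real (Suc m))) (y::'a) \<partial>lborel)
       = ennreal (exp (- real m)) * emeasure lborel (cball (0::'a) (real (Suc m)))" for m
      by (rule nn_integral_cmult_indicator) simp
    moreover have "(\<lambda>y::'a. ennreal (exp (- real m)) * indicator (cball 0 (real (Suc m))) y) \<in> borel_measurable lborel" for m
      using borel_closed[OF closed_cball[of "0::'a" "real (Suc m)"]] by (intro borel_measurable_times_ennreal borel_measurable_const borel_measurable_indicator) (simp del: of_nat_Suc)
    ultimately show ?thesis by (subst nn_integral_suminf) (auto simp del: of_nat_Suc)
  qed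
  also have "\<dots> = (\<Sum>m. ennreal (exp (- real m) * (V * real (Suc m) ^ ?N)))"
    by (simp add: emeasure_cball V_def ennreal_mult' del: of_nat_Suc)
  also have "\<dots> < \<infinity>"
  proof -
    define C where "C = V * (2 ^ ?N * (fact ?N * exp (1/2)))"
    \<comment> \<open>Half of the decay pays for the volume: \<open>(Suc m / 2) ^ N\<close> is at
      most \<open>fact N * exp (Suc m / 2)\<close>.\<close>
    have le: "exp (- real m) * (V * real (Suc m) ^ ?N) \<le> C * exp (- 1 / 2) ^ m" for m
    proof -
      have "real (Suc m) ^ ?N = 2 ^ ?N * (real (Suc m) / 2) ^ ?N" by (simp add: power_divide)
      also have "\<dots> \<le> 2 ^ ?N * (fact ?N * exp (real (Suc m) / 2))" by (intro mult_left_mono power_le_fact_exp) auto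
      finally have "exp (- real m) * (V * real (Suc m) ^ ?N) \<le> exp (- real m) * (V * (2 ^ ?N * (fact ?N * exp (real (Suc m) / 2))))"
        using V0 by (intro mult_left_mono) auto
      also have "\<dots> = V * (2 ^ ?N * (fact ?N * (exp (real (Suc m) / 2) * exp (- real m))))" by (simp add: mult_ac)
      also have "exp (real (Suc m) / 2) * exp (- real m) = exp (1/2) * exp (- 1 / 2) ^ m"
        by (simp add: exp_of_nat_mult[symmetric] exp_add[symmetric] field_simps)
      finally show ?thesis by (simp add: C_def mult_ac)
    qed
    have "summable (\<lambda>m. C * exp (- 1 / 2 :: real) ^ m)" by (intro summable_mult summable_geometric) simp
    then have "summable (\<lambda>m. exp (- real m) * (V * real (Suc m) ^ ?N))"
      by (rule summable_comparison_test'[where N=0]) (use le V0 in \<open>simp add: abs_mult\<close>)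
    then show ?thesis using V0 by (subst suminf_ennreal2) auto
  qed
  finally show "(\<integral>\<^sup>+y. ennreal (norm (exp (- norm (y::'a)))) \<partial>lborel) < \<infinity>" .
qed measurable

lemma integrable_exp_dominated:
  assumes "q \<in> borel_measurable borel" "\<And>y::'a::euclidean_space. \<bar>q y\<bar> \<le> C * exp (- norm y)"
  shows "integrable lborel q"
proof (rule Bochner_Integration.integrable_bound)
  show "integrable lborel (\<lambda>y::'a. C * exp (- norm y))" by (intro integrable_mult_right integrable_exp_neg_norm)
  show "AE y in lborel. norm (q y) \<le> norm (C * exp (- norm y))"
    using assms(2) by (intro AE_I2) (auto intro: order_trans[OF _ abs_ge_self])
qed (use assms in simp)

text \<open>Integrals of difference quotients vanish by translation invariance, so no iterated integration is needed.\<close>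

lemma integral_partial_eq_0:
  fixes H :: "(real,'n::{finite,linorder}) vec \<Rightarrow> real"
  assumes H: "has_partial i H H'" and m [measurable]: "H \<in> borel_measurable borel" "H' \<in> borel_measurable borel"
    and b: "\<And>y. \<bar>H y\<bar> \<le> C * exp (- norm y)" "\<And>y. \<bar>H' y\<bar> \<le> C * exp (- norm y)"
  shows "(\<integral>y. H' y \<partial>lborel) = 0"
proof -
  define h where "h = (\<lambda>n. inverse (real (Suc n)))"
  have h: "h n > 0" "h n \<le> 1" "h \<longlonglongrightarrow> 0" for n
    unfolding h_def by (simp, simp add: field_simps, rule LIMSEQ_inverse_real_of_nat)
  have C0: "C \<ge> 0" using b(1)[of 0] by simp
  let ?q = "\<lambda>n y. (H (y + h n *\<^sub>R axis i 1) - H y) / h n"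
  have lim: "(\<lambda>n. \<integral>y. ?q n y \<partial>lborel) \<longlonglongrightarrow> (\<integral>y. H' y \<partial>lborel)"
  \<comment> \<open>The factor \<open>exp 1\<close> covers shifts of length at most 1, which change
    \<open>norm y\<close> by at most 1.\<close>
  proof (rule integral_dominated_convergence[where w="\<lambda>y. C * exp 1 * exp (- norm y)"])
    show "integrable lborel (\<lambda>y::(real,'n) vec. C * exp 1 * exp (- norm y))" by (intro integrable_mult_right integrable_exp_neg_norm)
    show "AE y in lborel. (\<lambda>n. ?q n y) \<longlonglongrightarrow> H' y"
    proof (intro AE_I2)
      fix y
      have "((\<lambda>r. (H (y + r *\<^sub>R axis i 1) - H y) / r) \<longlongrightarrow> H' y) (at 0)"
        using H[unfolded has_partial_def, rule_format, of y] by (simp add: DERIV_def)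
      moreover have "filterlim h (at 0) sequentially"
        unfolding filterlim_at using h(3) less_imp_neq[OF h(1)] by (auto intro!: always_eventually)
      ultimately show "(\<lambda>n. ?q n y) \<longlonglongrightarrow> H' y" by (rule filterlim_compose)
    qed
    show "AE y in lborel. norm (?q n y) \<le> C * exp 1 * exp (- norm y)" for n
    proof (intro AE_I2)
      fix y
      have "\<bar>H (y + h n *\<^sub>R axis i 1) - H y\<bar> \<le> (C * exp 1 * exp (- norm y)) * \<bar>h n\<bar>"
      proof (rule partial_increment_bound[OF H])
        fix r assume "\<bar>r\<bar> \<le> \<bar>h n\<bar>"
        then have r: "\<bar>r\<bar> \<le> 1" using h(1,2)[of n] by simp
        have "norm y \<le> norm (y + r *\<^sub>R axis i 1) + norm (r *\<^sub>R axis i (1::real) :: (real,'n) vec)"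
          by (metis norm_triangle_sub add_diff_cancel_left' add.commute norm_triangle_ineq4 add_diff_cancel_right')
        then have "norm y \<le> norm (y + r *\<^sub>R axis i 1) + 1" using r by (simp add: norm_axis_1)
        then have "exp (- norm (y + r *\<^sub>R axis i 1)) \<le> exp (1 - norm y)" by simp
        then have "C * exp (- norm (y + r *\<^sub>R axis i 1)) \<le> C * exp (1 - norm y)" using C0 by (rule mult_left_mono)
        then show "\<bar>H' (y + r *\<^sub>R axis i 1)\<bar> \<le> C * exp 1 * exp (- norm y)"
          using b(2)[of "y + r *\<^sub>R axis i 1"] by (simp add: exp_diff exp_minus divide_inverse mult.assoc)
      qed
      then show "norm (?q n y) \<le> C * exp 1 * exp (- norm y)" using h(1)[of n] by (simp add: field_simps)
    qed
  qed measurable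
  have z: "(\<integral>y. ?q n y \<partial>lborel) = 0" for n
  proof -
    have i1: "integrable lborel H" by (rule integrable_exp_dominated[OF m(1) b(1)])
    have "integrable (distr lborel borel ((+) (h n *\<^sub>R axis i 1))) H" using i1 by (simp add: lborel_distr_plus)
    then have i2: "integrable lborel (\<lambda>y. H (h n *\<^sub>R axis i 1 + y))" by (subst (asm) integrable_distr_eq) auto
    have "(\<integral>y. H y \<partial>lborel) = (\<integral>y. H y \<partial>distr lborel borel ((+) (h n *\<^sub>R axis i 1)))" by (simp add: lborel_distr_plus)
    also have "\<dots> = (\<integral>y. H (h n *\<^sub>R axis i 1 + y) \<partial>lborel)" by (subst integral_distr) auto
    finally show ?thesis using i1 i2 by (simp add: add.commute)
  qed
  show ?thesis using LIMSEQ_unique[OF lim[unfolded z] tendsto_const] .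
qed

text \<open>\<open>kap k e r / r\<close> is the logarithmic derivative of \<open>rho k e\<close>, and \<open>rho k 0 r = r powr (2 * k)\<close> for \<open>r > 0\<close>.\<close>

definition rho :: "real \<Rightarrow> real \<Rightarrow> real \<Rightarrow> real" where
  "rho k e r = (if r > 0 then r powr (2 * k) * (r\<^sup>2 / (r\<^sup>2 + e\<^sup>2)) else 0)"

definition kap :: "real \<Rightarrow> real \<Rightarrow> real \<Rightarrow> real" where
  "kap k e r = 2 * k + 2 * e\<^sup>2 / (r\<^sup>2 + e\<^sup>2)"

text \<open>The factor \<open>r^2 / (r^2 + e^2)\<close> makes the function at most of order
  \<open>r^2\<close> at 0 from the right, hence differentiable there with derivative 0, and the
  formula agrees because \<open>rho k e 0 = 0\<close>. The bare power \<open>r powr (2 * k)\<close>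
  has no derivative at 0 for small \<open>k\<close>.\<close>

lemma rho_deriv:
  assumes e: "e > 0" and k: "k > 0"
  shows "(rho k e has_real_derivative rho k e r * (kap k e r / r)) (at r)"
proof -
  consider "r > 0" | "r < 0" | "r = 0" by linarith
  then show ?thesis
  proof cases
    case 1
    have pos: "r\<^sup>2 + e\<^sup>2 > 0" using 1 by (simp add: add_pos_nonneg)
    have "((\<lambda>r. r powr (2 * k) * (r\<^sup>2 / (r\<^sup>2 + e\<^sup>2))) has_real_derivative
        (2 * k * r powr (2 * k - 1)) * (r\<^sup>2 / (r\<^sup>2 + e\<^sup>2)) + r powr (2 * k) * ((2 * r * (r\<^sup>2 + e\<^sup>2) - r\<^sup>2 * (2 * r)) / ((r\<^sup>2 + e\<^sup>2) * (r\<^sup>2 + e\<^sup>2)))) (at r)"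
    proof -
      have a: "((\<lambda>r. r powr (2 * k)) has_real_derivative 2 * k * r powr (2 * k - 1)) (at r)"
        by (rule has_real_derivative_powr[OF 1])
      have b: "((\<lambda>r. r\<^sup>2 / (r\<^sup>2 + e\<^sup>2)) has_real_derivative (2 * r * (r\<^sup>2 + e\<^sup>2) - r\<^sup>2 * (2 * r)) / ((r\<^sup>2 + e\<^sup>2) * (r\<^sup>2 + e\<^sup>2))) (at r)"
        using pos by (intro DERIV_divide) (auto intro!: derivative_eq_intros)
      show ?thesis using DERIV_mult[OF a b] by (simp only: mult.commute)
    qed
    moreover have "(2 * k * r powr (2 * k - 1)) * (r\<^sup>2 / (r\<^sup>2 + e\<^sup>2)) + r powr (2 * k) * ((2 * r * (r\<^sup>2 + e\<^sup>2) - r\<^sup>2 * (2 * r)) / ((r\<^sup>2 + e\<^sup>2) * (r\<^sup>2 + e\<^sup>2)))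
       = rho k e r * (kap k e r / r)"
    proof -
      have p: "r powr (2 * k - 1) = r powr (2 * k) / r" using 1 by (simp add: powr_diff)
      have n: "2 * r * (r\<^sup>2 + e\<^sup>2) - r\<^sup>2 * (2 * r) = 2 * r * e\<^sup>2" by (simp add: algebra_simps)
      have "(2 * k * (P / r)) * (r\<^sup>2 / Q) + P * (2 * r * e\<^sup>2 / (Q * Q)) = P * (r\<^sup>2 / Q) * ((2 * k + 2 * e\<^sup>2 / Q) / r)" if "Q > 0" for P Q
        using 1 that by (simp add: field_simps power2_eq_square)
      from this[OF pos, of "r powr (2 * k)"] show ?thesis unfolding p n using 1 by (simp add: rho_def kap_def)
    qed
    ultimately have d: "((\<lambda>r. r powr (2 * k) * (r\<^sup>2 / (r\<^sup>2 + e\<^sup>2))) has_real_derivative rho k e r * (kap k e r / r)) (at r)" by simp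
    have ev: "\<forall>\<^sub>F r in nhds r. rho k e r = r powr (2 * k) * (r\<^sup>2 / (r\<^sup>2 + e\<^sup>2))"
      using eventually_nhds_in_open[of "{0<..}" r] 1 by (auto elim!: eventually_mono simp: rho_def)
    show ?thesis using d by (subst DERIV_cong_ev[OF refl ev refl])
  next
    case 2
    have ev: "\<forall>\<^sub>F r in nhds r. rho k e r = 0"
      using eventually_nhds_in_open[of "{..<0}" r] 2 by (auto elim!: eventually_mono simp: rho_def)
    show ?thesis using 2 by (subst DERIV_cong_ev[OF refl ev refl]) (simp add: rho_def)
  next
    case 3
    have t: "((\<lambda>h::real. \<bar>h\<bar> / e\<^sup>2) \<longlongrightarrow> 0) (at 0)"
      using tendsto_divide[OF tendsto_rabs[OF tendsto_ident_at] tendsto_const[of "e\<^sup>2"], of 0 UNIV] e by simp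
    have "((\<lambda>h. rho k e h / h) \<longlongrightarrow> 0) (at 0)"
    proof (rule Lim_null_comparison[OF _ t])
      show "\<forall>\<^sub>F h in at 0. norm (rho k e h / h) \<le> \<bar>h\<bar> / e\<^sup>2"
      proof (rule eventually_mono[OF eventually_at_ball'[of 1 "0::real" UNIV]])
        fix h :: real assume h: "h \<in> ball 0 1 \<and> h \<noteq> 0 \<and> h \<in> UNIV"
        show "norm (rho k e h / h) \<le> \<bar>h\<bar> / e\<^sup>2"
        proof (cases "h > 0")
          case True
          have p: "h powr (2 * k) \<le> 1" using True h k by (intro powr_le1) (auto simp: dist_norm)
          have "rho k e h / h = h powr (2 * k) * (h / (h\<^sup>2 + e\<^sup>2))" using True by (simp add: rho_def power2_eq_square)
          also have "\<dots> \<le> 1 * (h / e\<^sup>2)" using True p e by (intro mult_mono divide_left_mono) (auto intro!: mult_pos_pos add_pos_pos)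
          finally have "rho k e h / h \<le> h / e\<^sup>2" by simp
          moreover have "rho k e h / h \<ge> 0" using True by (simp add: rho_def)
          ultimately show ?thesis using True by simp
        next
          case False
          have "0 \<le> \<bar>h\<bar> / e\<^sup>2" by (intro divide_nonneg_nonneg) auto
          then show ?thesis using False by (simp add: rho_def)
        qed
      qed simp
    qed
    then show ?thesis using 3 by (simp add: DERIV_def rho_def)
  qed
qed

text \<open>The third bound is a purpose of the regularisation: \<open>r * e \<le> r^2 + e^2\<close>
  trades the pole \<open>1 / r\<close> for the constant \<open>1 / e\<close>. The majorants of
  \<open>rho k e\<close> involve only \<open>rho k 0\<close>, whose decay against the Gaussian is
  settled once in \<open>wgt_bound\<close>.\<close>

lemma rho_bounds:
  assumes "e > 0" "k > 0"
  shows "0 \<le> rho k e r" "rho k e r \<le> rho k 0 r" "\<bar>rho k e r / r\<bar> \<le> rho k 0 r / e" "0 \<le> rho k 0 r"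
    "\<bar>kap k e r\<bar> \<le> 2 * k + 2" "kap k e (- r) = kap k e r" "r > 0 \<Longrightarrow> rho k 0 r = r powr (2 * k)"
proof -
  show "0 \<le> rho k e r" "0 \<le> rho k 0 r" by (auto simp: rho_def)
  show z: "r > 0 \<Longrightarrow> rho k 0 r = r powr (2 * k)" by (simp add: rho_def)
  have pos: "r\<^sup>2 + e\<^sup>2 > 0" using assms by (simp add: add_nonneg_pos)
  have "r\<^sup>2 / (r\<^sup>2 + e\<^sup>2) \<le> 1" using pos by (simp add: field_simps)
  then show "rho k e r \<le> rho k 0 r" unfolding rho_def using mult_left_mono[of "r\<^sup>2 / (r\<^sup>2 + e\<^sup>2)" 1 "r powr (2*k)"] by (simp del: times_divide_eq_right)
  show "\<bar>rho k e r / r\<bar> \<le> rho k 0 r / e"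
  proof (cases "r > 0")
    case True
    have "2 * (r * e) \<le> r\<^sup>2 + e\<^sup>2" using zero_le_power2[of "r - e"] by (simp add: power2_diff algebra_simps)
    then have "r * e \<le> r\<^sup>2 + e\<^sup>2" using True assms mult_pos_pos[of r e] by linarith
    then have "r / (r\<^sup>2 + e\<^sup>2) \<le> 1 / e" using pos assms by (simp add: field_simps)
    then have "r powr (2 * k) * (r / (r\<^sup>2 + e\<^sup>2)) \<le> r powr (2 * k) * (1 / e)" by (intro mult_left_mono) auto
    moreover have "rho k e r / r = r powr (2 * k) * (r / (r\<^sup>2 + e\<^sup>2))" using True by (simp add: rho_def power2_eq_square)
    moreover have "0 \<le> rho k e r / r" using True by (simp add: rho_def)
    ultimately show ?thesis using z[OF True] by simp
  qed (simp add: rho_def)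
  have "0 \<le> e\<^sup>2 / (r\<^sup>2 + e\<^sup>2)" "e\<^sup>2 / (r\<^sup>2 + e\<^sup>2) \<le> 1" using pos by (auto simp: field_simps)
  then show "\<bar>kap k e r\<bar> \<le> 2 * k + 2" unfolding kap_def using assms by (simp add: abs_le_iff)
  show "kap k e (- r) = kap k e r" by (simp add: kap_def)
qed

lemma rho_kap_tendsto:
  assumes "a \<longlonglongrightarrow> 0"
  shows "(\<lambda>n. rho k (a n) r) \<longlonglongrightarrow> rho k 0 r" "r \<noteq> 0 \<Longrightarrow> (\<lambda>n. kap k (a n) r) \<longlonglongrightarrow> 2 * k"
proof -
  show "(\<lambda>n. rho k (a n) r) \<longlonglongrightarrow> rho k 0 r"
  proof (cases "r > 0")
    case True
    have "(\<lambda>n. r powr (2 * k) * (r\<^sup>2 / (r\<^sup>2 + (a n)\<^sup>2))) \<longlonglongrightarrow> r powr (2 * k) * (r\<^sup>2 / (r\<^sup>2 + 0\<^sup>2))"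
      by (intro tendsto_intros assms) (use True in auto)
    then show ?thesis using True by (simp add: rho_def)
  qed (simp add: rho_def)
  assume r: "r \<noteq> 0"
  have "(\<lambda>n. 2 * k + 2 * (a n)\<^sup>2 / (r\<^sup>2 + (a n)\<^sup>2)) \<longlonglongrightarrow> 2 * k + 2 * 0\<^sup>2 / (r\<^sup>2 + 0\<^sup>2)"
    by (intro tendsto_intros assms) (use r in auto)
  then show "(\<lambda>n. kap k (a n) r) \<longlonglongrightarrow> 2 * k" by (simp add: kap_def)
qed


definition pairs :: "('n::linorder \<times> 'n) set" where "pairs = {(i, j). i < j}"

text \<open>As \<open>rho\<close> vanishes for nonpositive arguments, the indicator of the chamber
  is built into the product, and \<open>wgt k s 0\<close> is the unnormalised density of the law
  (\<open>weight_A_eq\<close>).\<close>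

definition wgt :: "real \<Rightarrow> real \<Rightarrow> real \<Rightarrow> (real,'n::{finite,linorder}) vec \<Rightarrow> real" where
  "wgt k s e y = exp (- (norm y)\<^sup>2 / (2 * s)) * (\<Prod>p\<in>pairs. rho k e (y $ fst p - y $ snd p))"

lemma has_partial_prod_log:
  assumes "finite S" "\<And>a. a \<in> S \<Longrightarrow> has_partial i (f a) (\<lambda>y. f a y * l a y)"
  shows "has_partial i (\<lambda>y. \<Prod>a\<in>S. f a y) (\<lambda>y. (\<Prod>a\<in>S. f a y) * (\<Sum>a\<in>S. l a y))"
  using assms
proof (induction S rule: finite_induct)
  case empty
  show ?case using has_partial_const[of i 1] by simp
next
  case (insert a S)
  from has_partial_mult[OF insert.prems[of a] insert.IH] insert show ?case
    by (simp add: algebra_simps)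
qed

text \<open>Every pair containing \<open>i\<close> occurs once in \<open>pairs\<close>, with
  \<open>i\<close> as first or as second component; antisymmetry makes it contribute
  \<open>F i j\<close> in both cases.\<close>

lemma sum_pairs:
  fixes F :: "'n::{finite,linorder} \<Rightarrow> 'n \<Rightarrow> real"
  assumes "\<And>a b. F b a = - F a b"
  shows "(\<Sum>p\<in>pairs. F (fst p) (snd p) * ((if fst p = i then 1 else 0) - (if snd p = i then 1 else 0))) = (\<Sum>j\<in>UNIV - {i}. F i j)"
proof -
  let ?G = "\<lambda>a b. F a b * ((if a = i then 1 else 0) - (if b = i then 1 else 0))"
  have "(\<Sum>p\<in>pairs. ?G (fst p) (snd p)) = (\<Sum>p\<in>UNIV \<times> UNIV. if fst p < snd p then ?G (fst p) (snd p) else 0)"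
    by (rule sum.mono_neutral_cong_left) (auto simp: pairs_def)
  also have "\<dots> = (\<Sum>a\<in>UNIV. \<Sum>b\<in>UNIV. if a < b then ?G a b else 0)"
    by (subst sum.cartesian_product) (intro sum.cong, auto)
  also have "\<dots> = (\<Sum>a\<in>UNIV. \<Sum>b\<in>UNIV. (if a = i then (if i < b then F i b else 0) else 0) - (if b = i then (if a < i then F a i else 0) else 0))"
    by (intro sum.cong refl) auto
  also have "\<dots> = (\<Sum>a\<in>UNIV. \<Sum>b\<in>UNIV. (if a = i then (if i < b then F i b else 0) else 0)) - (\<Sum>a\<in>UNIV. if a < i then F a i else 0)"
    by (simp add: sum_subtractf)
  also have "(\<Sum>a\<in>UNIV. \<Sum>b\<in>UNIV. (if a = i then (if i < b then F i b else 0) else 0)) = (\<Sum>b\<in>UNIV. if i < b then F i b else 0)"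
    by (subst sum.swap) simp
  also have "(\<Sum>b\<in>UNIV. if i < b then F i b else 0) - (\<Sum>a\<in>UNIV. if a < i then F a i else 0) = (\<Sum>j\<in>UNIV. if j \<noteq> i then F i j else 0)"
    unfolding sum_subtractf[symmetric]
  proof (intro sum.cong refl)
    fix j
    show "(if i < j then F i j else 0) - (if j < i then F j i else 0) = (if j \<noteq> i then F i j else 0)"
      unfolding assms[of j i] by (cases i j rule: linorder_cases) auto
  qed
  also have "\<dots> = (\<Sum>j\<in>UNIV - {i}. F i j)"
    by (rule sum.mono_neutral_cong_right) auto
  finally show ?thesis .
qed

lemma has_partial_wgt:
  assumes "e > 0" "k > 0" "s > 0"
  shows "has_partial i (wgt k s e) (\<lambda>y. wgt k s e y * (- y $ i / s + (\<Sum>j\<in>UNIV - {i}. kap k e (y $ i - y $ j) / (y $ i - y $ j))))"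
proof -
  have 1: "has_partial i (\<lambda>y::(real,'a) vec. exp (- (norm y)\<^sup>2 / (2 * s))) (\<lambda>y. exp (- (norm y)\<^sup>2 / (2 * s)) * (- y $ i / s))"
  proof -
    have "((\<lambda>w. exp (- w / (2 * s))) has_real_derivative exp (- w / (2 * s)) * (- 1 / (2 * s))) (at w)" for w
      using assms by (auto intro!: derivative_eq_intros)
    from has_partial_compose[OF C2_dataE(4)[OF C2_data_norm2, of i] this] show ?thesis
      by (rule has_partial_eqI) (use assms in \<open>auto simp: fun_eq_iff field_simps\<close>)
  qed
  let ?l = "\<lambda>a b (y::(real,'a) vec). kap k e (y $ a - y $ b) / (y $ a - y $ b)"
  have 2: "has_partial i (\<lambda>y. rho k e (y $ fst p - y $ snd p))
     (\<lambda>y. rho k e (y $ fst p - y $ snd p) * (?l (fst p) (snd p) y * ((if fst p = i then 1 else 0) - (if snd p = i then 1 else 0))))" for p :: "'a \<times> 'a"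
  proof -
    have "has_partial i (\<lambda>y::(real,'a) vec. y $ fst p + (-1) * y $ snd p) (\<lambda>y. (if fst p = i then 1 else 0) + (0 * y $ snd p + (-1) * (if snd p = i then 1 else 0)))"
      by (intro has_partial_add has_partial_mult has_partial_const has_partial_component)
    from has_partial_compose[OF this rho_deriv[OF assms(1,2)]] show ?thesis
      by (rule has_partial_eqI) (auto simp: fun_eq_iff)
  qed
  have "finite (pairs :: ('a \<times> 'a) set)" by simp
  from has_partial_mult[OF 1 has_partial_prod_log[OF this 2]]
  show ?thesis
  proof (rule has_partial_eqI)
    have a: "?l b a y = - ?l a b y" for a b and y :: "(real,'a) vec"
      using rho_bounds(6)[OF assms(1,2), of "y $ a - y $ b"] by (simp add: minus_divide_right)
    have "(\<Sum>p\<in>pairs. ?l (fst p) (snd p) y * ((if fst p = i then 1 else 0) - (if snd p = i then 1 else 0))) = (\<Sum>j\<in>UNIV - {i}. ?l i j y)" for y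
      by (rule sum_pairs[OF a])
    then show "(\<lambda>y. exp (- (norm y)\<^sup>2 / (2 * s)) * (- y $ i / s) * (\<Prod>p\<in>pairs. rho k e (y $ fst p - y $ snd p)) +
      exp (- (norm y)\<^sup>2 / (2 * s)) * ((\<Prod>p\<in>pairs. rho k e (y $ fst p - y $ snd p)) *
         (\<Sum>p\<in>pairs. ?l (fst p) (snd p) y * ((if fst p = i then 1 else 0) - (if snd p = i then 1 else 0)))))
      = (\<lambda>y. wgt k s e y * (- y $ i / s + (\<Sum>j\<in>UNIV - {i}. ?l i j y)))"
      by (simp add: wgt_def fun_eq_iff algebra_simps)
  qed (simp add: wgt_def[abs_def])
qed

lemma wgt_nonneg: "0 \<le> wgt k s e y"
  by (auto simp: wgt_def rho_def intro!: mult_nonneg_nonneg prod_nonneg)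

lemma wgt_le: "e > 0 \<Longrightarrow> k > 0 \<Longrightarrow> wgt k s e y \<le> wgt k s 0 y"
  unfolding wgt_def by (intro mult_left_mono prod_mono) (auto intro: rho_bounds)

text \<open>The factor of the product that belongs to the pair of \<open>i\<close> and
  \<open>j\<close> absorbs the pole, by the third bound of \<open>rho_bounds\<close>.\<close>

lemma wgt_quotient_le:
  assumes e: "e > 0" and k: "k > 0" and ij: "i \<noteq> j"
  shows "\<bar>wgt k s e y / (y $ i - y $ j)\<bar> \<le> wgt k s 0 y / e"
proof -
  define p where "p = (if i < j then (i, j) else (j, i))"
  have p: "p \<in> pairs" using ij by (auto simp: p_def pairs_def)
  let ?r = "y $ fst p - y $ snd p"
  let ?P = "\<lambda>e. \<Prod>q\<in>pairs - {p}. rho k e (y $ fst q - y $ snd q)"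
  let ?E = "exp (- (norm y)\<^sup>2 / (2 * s))"
  have w: "wgt k s e y = ?E * (rho k e ?r * ?P e)" for e
    unfolding wgt_def by (subst prod.remove[OF _ p]) auto
  have P: "0 \<le> ?P e" "?P e \<le> ?P 0" by (auto intro!: prod_nonneg prod_mono rho_bounds[OF e k])
  have "\<bar>wgt k s e y / (y $ i - y $ j)\<bar> = \<bar>wgt k s e y / ?r\<bar>"
    by (auto simp: p_def abs_divide abs_minus_commute)
  also have "\<dots> = ?E * (\<bar>rho k e ?r / ?r\<bar> * ?P e)" unfolding w using P by (simp add: abs_mult)
  also have "\<dots> \<le> ?E * ((rho k 0 ?r / e) * ?P 0)"
    using P rho_bounds[OF e k] e by (intro mult_left_mono mult_mono) auto
  also have "\<dots> = wgt k s 0 y / e" unfolding w by simp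
  finally show ?thesis .
qed

lemma wgt_measurable [measurable]: "wgt k s e \<in> borel_measurable borel"
proof -
  have [measurable]: "rho k e \<in> borel_measurable borel" unfolding rho_def[abs_def] by measurable
  have [measurable]: "(\<lambda>y::(real,'a) vec. rho k e (y $ a - y $ b)) \<in> borel_measurable borel" for a b by measurable
  show ?thesis unfolding wgt_def[abs_def] by measurable
qed

lemma poly_growth_prod:
  "finite S \<Longrightarrow> (\<And>a. a \<in> S \<Longrightarrow> poly_growth (f a)) \<Longrightarrow> poly_growth (\<lambda>y. \<Prod>a\<in>S. f a y)"
  by (induction S rule: finite_induct) (auto intro: poly_growth_const poly_growth_mult)

text \<open>The Gaussian factor beats the product, which grows polynomially, and any exponential.
  Keeping \<open>exp (c * norm y)\<close> in the bound yields the exponential moments on which the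
  method of moments relies.\<close>

lemma wgt_bound:
  assumes q: "poly_growth q" and k: "k > 0" and s: "s > 0"
  obtains C where "\<And>y::(real,'n::{finite,linorder}) vec. \<bar>q y\<bar> * exp (c * norm y) * wgt k s 0 y \<le> C * exp (- norm y)"
proof -
  define m where "m = nat \<lceil>2 * k\<rceil>"
  have r: "\<bar>rho k 0 r\<bar> \<le> (1 + \<bar>r\<bar>) ^ m" for r
  proof (cases "r > 0")
    case True
    have "r powr (2 * k) \<le> (1 + r) powr (2 * k)" using True k by (intro powr_mono2) auto
    also have "\<dots> \<le> (1 + r) powr real m" using True real_nat_ceiling_ge[of "2 * k"] by (intro powr_mono) (auto simp: m_def)
    also have "\<dots> = (1 + r) ^ m" using True by (simp add: powr_realpow)
    finally show ?thesis using True by (simp add: rho_def)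
  qed (simp add: rho_def)
  have "poly_growth (\<lambda>y::(real,'n) vec. \<Prod>p\<in>pairs. rho k 0 (y $ fst p - y $ snd p))"
  proof (rule poly_growth_prod)
    fix p :: "'n \<times> 'n"
    show "poly_growth (\<lambda>y::(real,'n) vec. rho k 0 (y $ fst p - y $ snd p))"
    proof (rule poly_growth_mono)
      show "poly_growth (\<lambda>y::(real,'n) vec. (1 + (\<bar>y $ fst p\<bar> + \<bar>y $ snd p\<bar>)) ^ m)"
        by (intro poly_growth_power poly_growth_add poly_growth_const poly_growth_abs poly_growth_component)
      fix y :: "(real,'n) vec"
      have "\<bar>rho k 0 (y $ fst p - y $ snd p)\<bar> \<le> (1 + \<bar>y $ fst p - y $ snd p\<bar>) ^ m" by (rule r)
      also have "\<dots> \<le> (1 + (\<bar>y $ fst p\<bar> + \<bar>y $ snd p\<bar>)) ^ m" by (intro power_mono) auto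
      finally show "\<bar>rho k 0 (y $ fst p - y $ snd p)\<bar> \<le> \<bar>(1 + (\<bar>y $ fst p\<bar> + \<bar>y $ snd p\<bar>)) ^ m\<bar>" by simp
    qed
  qed simp
  from poly_exp_bound[OF poly_growth_mult[OF q this]] obtain C where C: "C > 0"
    "\<And>y::(real,'n) vec. \<bar>q y * (\<Prod>p\<in>pairs. rho k 0 (y $ fst p - y $ snd p))\<bar> \<le> C * exp (norm y)" by blast
  have "\<bar>q y\<bar> * exp (c * norm y) * wgt k s 0 y \<le> (C * exp ((2 + c)\<^sup>2 * s / 2)) * exp (- norm y)" for y :: "(real,'n) vec"
  proof -
    let ?P = "\<Prod>p\<in>pairs. rho k 0 (y $ fst p - y $ snd p)"
    have P0: "?P \<ge> 0" by (auto intro!: prod_nonneg simp: rho_def)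
    have "\<bar>q y\<bar> * exp (c * norm y) * wgt k s 0 y = \<bar>q y * ?P\<bar> * exp (c * norm y - (norm y)\<^sup>2 / (2 * s))"
    proof -
      have "exp (c * norm y - (norm y)\<^sup>2 / (2 * s)) = exp (c * norm y) * exp (- (norm y)\<^sup>2 / (2 * s))"
        by (simp add: exp_add[symmetric])
      moreover have "\<bar>q y * ?P\<bar> = \<bar>q y\<bar> * ?P" using P0 by (simp add: abs_mult)
      ultimately show ?thesis by (simp only: wgt_def mult_ac)
    qed
    also have "\<dots> \<le> (C * exp (norm y)) * exp (c * norm y - (norm y)\<^sup>2 / (2 * s))" by (intro mult_right_mono C) auto
    also have "\<dots> = C * exp ((2 + c) * norm y - (norm y)\<^sup>2 / (2 * s)) * exp (- norm y)"
      by (simp add: mult.assoc exp_add[symmetric] algebra_simps)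
    \<comment> \<open>In the exponent \<open>2 + c\<close>, one unit majorises the polynomial, one
      is the price of splitting off \<open>exp (- norm y)\<close>, and \<open>c\<close> is given;
      completing the square bounds what remains.\<close>
    also have "\<dots> \<le> C * exp ((2 + c)\<^sup>2 * s / 2) * exp (- norm y)"
    proof -
      have "0 \<le> (norm y - (2 + c) * s)\<^sup>2 / (2 * s)" using s by simp
      also have "\<dots> = (norm y)\<^sup>2 / (2 * s) - (2 + c) * norm y + (2 + c)\<^sup>2 * s / 2"
        using s by (simp add: power2_eq_square field_simps)
      finally have "(2 + c) * norm y - (norm y)\<^sup>2 / (2 * s) \<le> (2 + c)\<^sup>2 * s / 2" by linarith
      then show ?thesis using C(1) by (intro mult_right_mono mult_left_mono) auto
    qed
    finally show ?thesis .
  qed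
  then show thesis using that by blast
qed

section \<open>Integration by parts for the law of type A\<close>

lemma wgt_integrable:
  assumes q: "poly_growth q" and [measurable]: "q \<in> borel_measurable borel" and k: "k > 0" and s: "s > 0"
  shows "integrable lborel (\<lambda>y::(real,'n::{finite,linorder}) vec. wgt k s 0 y * (q y * exp (c * norm y)))"
proof -
  obtain C where C: "\<And>y::(real,'n) vec. \<bar>q y\<bar> * exp (c * norm y) * wgt k s 0 y \<le> C * exp (- norm y)"
    using wgt_bound[OF q k s] by blast
  show ?thesis
    by (rule integrable_exp_dominated[where C=C]) (use C in \<open>auto simp: abs_mult wgt_nonneg mult_ac\<close>)
qed

text \<open>The integrand is the divergence of \<open>wgt k s e\<close> times the gradient of
  \<open>f\<close>, so each component integrates to 0 by \<open>integral_partial_eq_0\<close>. The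
  logarithmic derivative of the weight supplies \<open>- y / s\<close> and the interaction;
  symmetrising the latter leaves difference quotients of \<open>g\<close>, which for symmetric
  \<open>f\<close> can be bounded independently of \<open>e\<close>.\<close>

lemma integral_divergence_eq_0:
  fixes f :: "(real,'n::{finite,linorder}) vec \<Rightarrow> real"
  assumes f: "C2_data f g h" and gr: "\<And>i. poly_growth (g i)" "\<And>i j. poly_growth (h i j)"
    and k: "k > 0" and s: "s > 0" and e: "e > 0"
  shows "(\<integral>y. wgt k s e y * ((\<Sum>i\<in>UNIV. h i i y) - (\<Sum>i\<in>UNIV. y $ i * g i y) / s
     + (\<Sum>i\<in>UNIV. \<Sum>j\<in>UNIV - {i}. kap k e (y $ i - y $ j) * ((g i y - g j y) / (y $ i - y $ j))) / 2) \<partial>lborel) = 0"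
proof -
  let ?S = "\<lambda>i y. \<Sum>j\<in>UNIV - {i}. kap k e (y $ i - y $ j) / (y $ i - y $ j)"
  let ?H' = "\<lambda>i y. h i i y * wgt k s e y + g i y * (wgt k s e y * (- y $ i / s + ?S i y))"
  have [measurable]: "g i \<in> borel_measurable borel" "h i j \<in> borel_measurable borel" for i j
    using C2_dataE[OF f] by (auto intro: borel_measurable_continuous_onI)
  have [measurable]: "(\<lambda>y::(real,'n) vec. kap k e (y $ i - y $ j)) \<in> borel_measurable borel" for i j
    unfolding kap_def by measurable
  have H'm: "?H' i \<in> borel_measurable borel" for i by measurable
  \<comment> \<open>Bounds the interaction part of the logarithmic derivative against
    \<open>wgt k s 0\<close>: at most N terms, each with \<open>kap\<close> at most
    \<open>2 * k + 2\<close> and a pole worth \<open>1 / e\<close>.\<close>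
  define c where "c = real CARD('n) * ((2 * k + 2) / e)"
  have H': "integrable lborel (?H' i) \<and> (\<integral>y. ?H' i y \<partial>lborel) = 0" for i
  proof -
    let ?q = "\<lambda>y. \<bar>g i y\<bar> + (\<bar>h i i y\<bar> + (\<bar>g i y\<bar> * \<bar>y $ i\<bar> * (1 / s) + c * \<bar>g i y\<bar>))"
    have "poly_growth ?q"
      by (intro poly_growth_add poly_growth_mult poly_growth_abs poly_growth_const poly_growth_component gr)
    then obtain C where C: "\<And>y. \<bar>?q y\<bar> * exp (0 * norm y) * wgt k s 0 y \<le> C * exp (- norm y)"
      using wgt_bound[OF _ k s] by blast
    have c0: "c \<ge> 0" using k e by (simp add: c_def)
    have q0: "?q y \<ge> 0" for y using c0 s by (intro add_nonneg_nonneg mult_nonneg_nonneg) auto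
    have C': "?q y * wgt k s 0 y \<le> C * exp (- norm y)" for y using C[of y] abs_of_nonneg[OF q0[of y]] by simp
    have b1: "\<bar>g i y * wgt k s e y\<bar> \<le> C * exp (- norm y)" for y
    proof -
      have "\<bar>g i y * wgt k s e y\<bar> = \<bar>g i y\<bar> * wgt k s e y" by (simp add: abs_mult wgt_nonneg)
      also have "\<dots> \<le> ?q y * wgt k s 0 y"
        using wgt_le[OF e k, of s y] c0 s by (intro mult_mono wgt_nonneg) (auto intro!: add_nonneg_nonneg mult_nonneg_nonneg)
      finally show ?thesis using C'[of y] by linarith
    qed
    have b2: "\<bar>?H' i y\<bar> \<le> C * exp (- norm y)" for y
    proof -
      have S: "\<bar>wgt k s e y * ?S i y\<bar> \<le> c * wgt k s 0 y"
      proof -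
        have "\<bar>wgt k s e y * ?S i y\<bar> \<le> (\<Sum>j\<in>UNIV - {i}. \<bar>wgt k s e y * (kap k e (y $ i - y $ j) / (y $ i - y $ j))\<bar>)"
          unfolding sum_distrib_left by (rule sum_abs)
        also have "\<dots> \<le> (\<Sum>j\<in>UNIV - {i}. (2 * k + 2) * (wgt k s 0 y / e))"
        proof (rule sum_mono)
          fix j assume "j \<in> UNIV - {i}"
          then have ij: "i \<noteq> j" by auto
          have "\<bar>wgt k s e y * (kap k e (y $ i - y $ j) / (y $ i - y $ j))\<bar> = \<bar>kap k e (y $ i - y $ j)\<bar> * \<bar>wgt k s e y / (y $ i - y $ j)\<bar>"
            by (simp add: abs_mult)
          also have "\<dots> \<le> (2 * k + 2) * (wgt k s 0 y / e)"
            using wgt_quotient_le[OF e k ij, of s y] rho_bounds(5)[OF e k] k by (intro mult_mono) auto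
          finally show "\<bar>wgt k s e y * (kap k e (y $ i - y $ j) / (y $ i - y $ j))\<bar> \<le> (2 * k + 2) * (wgt k s 0 y / e)" .
        qed
        also have "\<dots> \<le> (\<Sum>j\<in>(UNIV :: 'n set). (2 * k + 2) * (wgt k s 0 y / e))"
          using k e by (intro sum_mono2) (auto simp: wgt_nonneg)
        also have "\<dots> = c * wgt k s 0 y" by (simp add: c_def)
        finally show ?thesis .
      qed
      have le: "\<bar>a * wgt k s e y\<bar> \<le> \<bar>a\<bar> * wgt k s 0 y" for a
        using wgt_le[OF e k, of s y] by (simp add: abs_mult wgt_nonneg mult_left_mono)
      have eq: "?H' i y = h i i y * wgt k s e y + ((g i y * (- y $ i / s)) * wgt k s e y + g i y * (wgt k s e y * ?S i y))"
        by (simp add: algebra_simps)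
      have "\<bar>g i y * (wgt k s e y * ?S i y)\<bar> \<le> \<bar>g i y\<bar> * (c * wgt k s 0 y)"
        unfolding abs_mult[of "g i y"] by (rule mult_left_mono[OF S]) simp
      then have "\<bar>?H' i y\<bar> \<le> \<bar>h i i y\<bar> * wgt k s 0 y + (\<bar>g i y * (- y $ i / s)\<bar> * wgt k s 0 y + \<bar>g i y\<bar> * (c * wgt k s 0 y))"
        unfolding eq by (intro order_trans[OF abs_triangle_ineq add_mono[OF le order_trans[OF abs_triangle_ineq add_mono[OF le]]]])
      also have "\<dots> = (\<bar>h i i y\<bar> + (\<bar>g i y\<bar> * \<bar>y $ i\<bar> * (1 / s) + c * \<bar>g i y\<bar>)) * wgt k s 0 y"
        using s by (simp add: abs_mult algebra_simps)
      also have "\<dots> \<le> ?q y * wgt k s 0 y" by (rule mult_right_mono[OF _ wgt_nonneg]) simp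
      finally show ?thesis using C'[of y] by linarith
    qed
    have hp: "has_partial i (\<lambda>y. g i y * wgt k s e y) (?H' i)"
      by (rule has_partial_mult[OF C2_dataE(5)[OF f] has_partial_wgt[OF e k s]])
    show ?thesis
      using integral_partial_eq_0[OF hp _ H'm b1 b2] integrable_exp_dominated[OF H'm b2] by simp
  qed
  have "(\<Sum>i\<in>UNIV. ?H' i y) = wgt k s e y * ((\<Sum>i\<in>UNIV. h i i y) - (\<Sum>i\<in>UNIV. y $ i * g i y) / s
     + (\<Sum>i\<in>UNIV. \<Sum>j\<in>UNIV - {i}. kap k e (y $ i - y $ j) * ((g i y - g j y) / (y $ i - y $ j))) / 2)" for y
  proof -
    have "(\<Sum>i\<in>UNIV. \<Sum>j\<in>UNIV - {i}. g i y * (kap k e (y $ i - y $ j) / (y $ i - y $ j)))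
       = (\<Sum>i\<in>UNIV. \<Sum>j\<in>UNIV - {i}. kap k e (y $ i - y $ j) * ((g i y - g j y) / (y $ i - y $ j))) / 2"
    proof (subst sum_offdiag_symmetrize, intro arg_cong[where f="\<lambda>x. x / 2"] sum.cong refl)
      fix i j
      have 1: "kap k e (y $ j - y $ i) = kap k e (y $ i - y $ j)" using rho_bounds(6)[OF e k, of "y $ i - y $ j"] by simp
      have 2: "x / (y $ j - y $ i) = - (x / (y $ i - y $ j))" for x by (metis minus_diff_eq minus_divide_right)
      show "g i y * (kap k e (y $ i - y $ j) / (y $ i - y $ j)) + g j y * (kap k e (y $ j - y $ i) / (y $ j - y $ i))
        = kap k e (y $ i - y $ j) * ((g i y - g j y) / (y $ i - y $ j))"
        unfolding 1 2 by (simp add: diff_divide_distrib algebra_simps)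
    qed
    moreover have "?H' i y = wgt k s e y * (h i i y - y $ i * g i y / s + (\<Sum>j\<in>UNIV - {i}. g i y * (kap k e (y $ i - y $ j) / (y $ i - y $ j))))" for i
      unfolding sum_distrib_left[symmetric] by (simp add: algebra_simps)
    ultimately show ?thesis
      by (simp add: sum_distrib_left[symmetric] sum.distrib sum_subtractf sum_divide_distrib)
  qed
  then have "(\<integral>y. wgt k s e y * ((\<Sum>i\<in>UNIV. h i i y) - (\<Sum>i\<in>UNIV. y $ i * g i y) / s
     + (\<Sum>i\<in>UNIV. \<Sum>j\<in>UNIV - {i}. kap k e (y $ i - y $ j) * ((g i y - g j y) / (y $ i - y $ j))) / 2) \<partial>lborel)
     = (\<integral>y. (\<Sum>i\<in>UNIV. ?H' i y) \<partial>lborel)" by simp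
  also have "\<dots> = (\<Sum>i\<in>UNIV. \<integral>y. ?H' i y \<partial>lborel)" by (rule Bochner_Integration.integral_sum) (use H' in auto)
  also have "\<dots> = 0" using H' by simp
  finally show ?thesis .
qed

lemma wgt_nonzero_distinct: "wgt k s 0 y \<noteq> 0 \<Longrightarrow> i < j \<Longrightarrow> y $ j < y $ i"
proof (rule ccontr)
  assume w: "wgt k s 0 y \<noteq> 0" and ij: "i < j" "\<not> y $ j < y $ i"
  have "(i, j) \<in> pairs" "rho k 0 (y $ fst (i, j) - y $ snd (i, j)) = 0" using ij by (auto simp: pairs_def rho_def)
  then have "(\<Prod>p\<in>pairs. rho k 0 (y $ fst p - y $ snd p)) = 0" by (intro prod_zero bexI[of _ "(i, j)"]) auto
  then show False using w by (simp add: wgt_def)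
qed

text \<open>Regularising the weight by \<open>kap\<close> and \<open>rho\<close> makes it continuously differentiable across the walls also when
  \<open>2 * k < 1\<close>; the error terms stay bounded because the partial derivatives of a symmetric function agree on the walls.\<close>

lemma stein_weight:
  fixes f :: "(real,'n::{finite,linorder}) vec \<Rightarrow> real"
  assumes f: "C2_data f g h" and inv: "perm_invariant f" and gr: "\<And>i. poly_growth (g i)" "\<And>i j. poly_growth (h i j)"
    and k: "k > 0" and s: "s > 0"
  shows "(\<integral>y. wgt k s 0 y * (2 * ((\<Sum>i\<in>UNIV. h i i y) / 2 + k * (\<Sum>i\<in>UNIV. \<Sum>j\<in>UNIV - {i}. g i y / (y $ i - y $ j)))
      - (\<Sum>i\<in>UNIV. y $ i * g i y) / s) \<partial>lborel) = 0"
proof -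
  have [measurable]: "g i \<in> borel_measurable borel" "h i j \<in> borel_measurable borel" for i j
    using C2_dataE[OF f] by (auto intro: borel_measurable_continuous_onI)
  have "poly_growth (\<lambda>y. \<Sum>i\<in>UNIV. \<Sum>j\<in>UNIV. \<bar>h i j y\<bar>)" by (intro poly_growth_sum poly_growth_abs gr)
  then obtain K m where K: "K \<ge> 0" "\<And>n y. n \<ge> m \<Longrightarrow> \<bar>\<Sum>i\<in>UNIV. \<Sum>j\<in>UNIV. \<bar>h i j y\<bar>\<bar> \<le> K * (1 + norm y ^ 2) ^ n"
    by (rule poly_growthE) blast
  have hK: "\<bar>h i j y\<bar> \<le> K * (1 + norm y ^ 2) ^ m" for i j y
  proof -
    have "\<bar>h i j y\<bar> \<le> (\<Sum>j\<in>UNIV. \<bar>h i j y\<bar>)" by (intro member_le_sum) auto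
    also have "\<dots> \<le> (\<Sum>i\<in>UNIV. \<Sum>j\<in>UNIV. \<bar>h i j y\<bar>)"
      by (rule member_le_sum[of i UNIV "\<lambda>i. \<Sum>j\<in>UNIV. \<bar>h i j y\<bar>"]) (auto intro: sum_nonneg)
    also have "\<dots> \<le> K * (1 + norm y ^ 2) ^ m" using K(2)[of m y] by simp
    finally show ?thesis .
  qed
  \<comment> \<open>Again \<open>25 = 5^2\<close>, from the ball on which
    \<open>partial_diff_bound\<close> asks for bounds on the second derivatives.\<close>
  let ?K = "\<lambda>y::(real,'n) vec. K * 25 ^ m * (1 + norm y ^ 2) ^ m"
  have K0: "0 \<le> ?K y" for y using K(1) by simp
  have gd: "\<bar>(g i y - g j y) / (y $ i - y $ j)\<bar> \<le> 2 * ?K y" for i j y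
  proof -
    have "\<bar>g i y - g j y\<bar> \<le> 2 * ?K y * \<bar>y $ i - y $ j\<bar>"
    proof (rule partial_diff_bound[OF f inv])
      fix z :: "(real,'n) vec" and i j assume "norm z \<le> 5 * norm y"
      then have "norm z ^ 2 \<le> (5 * norm y) ^ 2" by (intro power_mono) auto
      then have "1 + norm z ^ 2 \<le> 25 * (1 + norm y ^ 2)" by (simp add: power_mult_distrib)
      then have "K * (1 + norm z ^ 2) ^ m \<le> K * (25 * (1 + norm y ^ 2)) ^ m"
        using K by (intro mult_left_mono power_mono) auto
      also have "\<dots> = ?K y" by (simp only: power_mult_distrib mult.assoc)
      finally show "\<bar>h i j z\<bar> \<le> ?K y" using hK[of i j z] by linarith
    qed
    then show ?thesis using K0[of y] by (cases "y $ i = y $ j") (auto simp: divide_simps)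
  qed
  define a where "a = (\<lambda>n. inverse (real (Suc n)))"
  have a: "0 < a n" for n by (auto simp: a_def)
  have a0: "a \<longlonglongrightarrow> 0" unfolding a_def by (rule LIMSEQ_inverse_real_of_nat)
  let ?T = "\<lambda>c y. (\<Sum>i\<in>UNIV. h i i y) - (\<Sum>i\<in>UNIV. y $ i * g i y) / s
     + (\<Sum>i\<in>UNIV. \<Sum>j\<in>UNIV - {i}. c (y $ i - y $ j) * ((g i y - g j y) / (y $ i - y $ j))) / 2"
  let ?q = "\<lambda>y. (\<Sum>i\<in>UNIV. \<bar>h i i y\<bar>) + ((\<Sum>i\<in>UNIV. \<bar>y $ i\<bar> * \<bar>g i y\<bar>) * (1 / s)
     + (\<Sum>i\<in>(UNIV::'n set). \<Sum>j\<in>UNIV - {i}. (2 * k + 2) * (2 * ?K y)) * (1 / 2))"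
  have q: "poly_growth ?q"
    by (intro poly_growth_add poly_growth_sum poly_growth_mult poly_growth_abs poly_growth_const poly_growth_component gr poly_growth_norm_power)
  have T: "\<bar>?T (kap k (a n)) y\<bar> \<le> ?q y" for n y
  proof -
    have 1: "\<bar>\<Sum>i\<in>UNIV. h i i y\<bar> \<le> (\<Sum>i\<in>UNIV. \<bar>h i i y\<bar>)" by (rule sum_abs)
    have "\<bar>\<Sum>i\<in>UNIV. y $ i * g i y\<bar> \<le> (\<Sum>i\<in>UNIV. \<bar>y $ i\<bar> * \<bar>g i y\<bar>)"
      by (rule order_trans[OF sum_abs]) (simp add: abs_mult)
    then have 2: "\<bar>(\<Sum>i\<in>UNIV. y $ i * g i y) / s\<bar> \<le> (\<Sum>i\<in>UNIV. \<bar>y $ i\<bar> * \<bar>g i y\<bar>) * (1 / s)"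
      using s by (simp add: divide_right_mono)
    have 3: "\<bar>\<Sum>i\<in>UNIV. \<Sum>j\<in>UNIV - {i}. kap k (a n) (y $ i - y $ j) * ((g i y - g j y) / (y $ i - y $ j))\<bar>
       \<le> (\<Sum>i\<in>(UNIV::'n set). \<Sum>j\<in>UNIV - {i}. (2 * k + 2) * (2 * ?K y))"
    proof (rule order_trans[OF sum_abs], rule sum_mono, rule order_trans[OF sum_abs], rule sum_mono)
      fix i j
      show "\<bar>kap k (a n) (y $ i - y $ j) * ((g i y - g j y) / (y $ i - y $ j))\<bar> \<le> (2 * k + 2) * (2 * ?K y)"
        unfolding abs_mult using rho_bounds(5)[OF a k] gd k by (intro mult_mono) auto
    qed
    show ?thesis using 1 2 3 by linarith
  qed
  \<comment> \<open>Where the limit weight vanishes, so do all regularised ones, being smaller;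
    elsewhere the coordinates are distinct and \<open>kap\<close> tends to
    \<open>2 * k\<close>.\<close>
  have lim: "(\<lambda>n. wgt k s (a n) y * ?T (kap k (a n)) y) \<longlonglongrightarrow> wgt k s 0 y * ?T (\<lambda>_. 2 * k) y" for y
  proof (cases "wgt k s 0 y = 0")
    case True
    then have "wgt k s (a n) y = 0" for n using wgt_le[OF a[of n] k, of s y] wgt_nonneg[of k s "a n" y] by simp
    then show ?thesis using True by simp
  next
    case False
    have ne: "y $ i - y $ j \<noteq> 0" if "j \<in> UNIV - {i}" for i j
      using wgt_nonzero_distinct[OF False, of i j] wgt_nonzero_distinct[OF False, of j i] that by (cases i j rule: linorder_cases) auto
    have "(\<lambda>n. wgt k s (a n) y) \<longlonglongrightarrow> wgt k s 0 y"
      unfolding wgt_def by (intro tendsto_intros rho_kap_tendsto(1)[OF a0])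
    moreover have "(\<lambda>n. ?T (kap k (a n)) y) \<longlonglongrightarrow> ?T (\<lambda>_. 2 * k) y"
      by (intro tendsto_add tendsto_const tendsto_divide tendsto_sum tendsto_mult rho_kap_tendsto(2)[OF a0] ne) auto
    ultimately show ?thesis by (rule tendsto_mult)
  qed
  have [measurable]: "(\<lambda>y::(real,'n) vec. kap k e (y $ i - y $ j)) \<in> borel_measurable borel" for i j e
    unfolding kap_def by measurable
  have "(\<lambda>n. \<integral>y. wgt k s (a n) y * ?T (kap k (a n)) y \<partial>lborel) \<longlonglongrightarrow> (\<integral>y. wgt k s 0 y * ?T (\<lambda>_. 2 * k) y \<partial>lborel)"
  proof (rule integral_dominated_convergence[where w="\<lambda>y. wgt k s 0 y * (?q y * exp (0 * norm y))"])
    show "integrable lborel (\<lambda>y. wgt k s 0 y * (?q y * exp (0 * norm y)))"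
      by (rule wgt_integrable[OF q _ k s]) measurable
    show "AE y in lborel. norm (wgt k s (a n) y * ?T (kap k (a n)) y) \<le> wgt k s 0 y * (?q y * exp (0 * norm y))" for n
    proof (intro AE_I2)
      fix y
      have "\<bar>wgt k s (a n) y * ?T (kap k (a n)) y\<bar> \<le> wgt k s 0 y * ?q y"
        unfolding abs_mult[of "wgt k s (a n) y"] abs_of_nonneg[OF wgt_nonneg]
        by (rule mult_mono[OF wgt_le[OF a k] T wgt_nonneg abs_ge_zero])
      then show "norm (wgt k s (a n) y * ?T (kap k (a n)) y) \<le> wgt k s 0 y * (?q y * exp (0 * norm y))" by simp
    qed
  qed (use lim in \<open>auto intro!: AE_I2\<close>)
  then have z: "(\<integral>y. wgt k s 0 y * ?T (\<lambda>_. 2 * k) y \<partial>lborel) = 0"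
    unfolding integral_divergence_eq_0[OF f gr k s a] by (rule LIMSEQ_unique[OF _ tendsto_const])
  \<comment> \<open>Undoing the symmetrisation turns the difference quotients back into the drift of
    the type A generator.\<close>
  have "?T (\<lambda>_. 2 * k) y = 2 * ((\<Sum>i\<in>UNIV. h i i y) / 2 + k * (\<Sum>i\<in>UNIV. \<Sum>j\<in>UNIV - {i}. g i y / (y $ i - y $ j)))
      - (\<Sum>i\<in>UNIV. y $ i * g i y) / s" for y
  proof -
    have e: "(\<Sum>i\<in>UNIV. \<Sum>j\<in>UNIV - {i}. g i y / (y $ i - y $ j)) = (\<Sum>i\<in>UNIV. \<Sum>j\<in>UNIV - {i}. (g i y - g j y) / (y $ i - y $ j)) / 2"
    proof (subst sum_offdiag_symmetrize, intro arg_cong[where f="\<lambda>x. x / 2"] sum.cong refl)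
      fix i j
      have 2: "x / (y $ j - y $ i) = - (x / (y $ i - y $ j))" for x by (metis minus_diff_eq minus_divide_right)
      show "g i y / (y $ i - y $ j) + g j y / (y $ j - y $ i) = (g i y - g j y) / (y $ i - y $ j)"
        unfolding 2 by (simp add: diff_divide_distrib)
    qed
    have aux: "A - B + 2 * k * S / 2 = 2 * (A / 2 + k * (S / 2)) - B" for A B S :: real by (simp add: algebra_simps)
    show ?thesis unfolding sum_distrib_left[symmetric] e by (rule aux)
  qed
  from z[unfolded this] show ?thesis .
qed

text \<open>On the walls of the chamber both products contain the factor 0, since a power of 0 under
  \<open>powr\<close> is 0; outside the chamber some difference is negative and its
  \<open>rho\<close> is 0.\<close>

lemma weight_A_eq: "indicator chamber_A y * weight_A k s y = wgt k s 0 (y :: (real,'n::{finite,linorder}) vec)"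
proof (cases "y \<in> chamber_A")
  case True
  have "(y $ fst p - y $ snd p) powr (2 * k) = rho k 0 (y $ fst p - y $ snd p)" if "p \<in> pairs" for p
  proof -
    have "y $ snd p \<le> y $ fst p" using True that by (auto simp: chamber_A_def pairs_def)
    then show ?thesis by (auto simp: rho_def)
  qed
  then have "(\<Prod>p\<in>pairs. (y $ fst p - y $ snd p) powr (2 * k)) = (\<Prod>p\<in>pairs. rho k 0 (y $ fst p - y $ snd p))"
    by (rule prod.cong[OF refl])
  then show ?thesis using True by (simp add: weight_A_def wgt_def pairs_def power2_eq_square)
next
  case False
  then obtain i j where "i \<le> j" "\<not> y $ j \<le> y $ i" by (auto simp: chamber_A_def)
  then have "i < j" by (cases "i = j") auto
  then have "wgt k s 0 y = 0" using wgt_nonzero_distinct[of k s y i j] \<open>\<not> y $ j \<le> y $ i\<close> by linarith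
  then show ?thesis using False by simp
qed

text \<open>The weight is positive on the nonempty open set of strictly decreasing vectors. This
  keeps the normalisation in \<open>bessel_A_law\<close> from being a division by 0.\<close>

lemma wgt_integral_pos:
  assumes k: "k > 0" and s: "s > 0"
  shows "(\<integral>y. wgt k s 0 (y :: (real,'n::{finite,linorder}) vec) \<partial>lborel) > 0"
proof -
  have i: "integrable lborel (wgt k s 0 :: (real,'n) vec \<Rightarrow> real)"
    using wgt_integrable[OF poly_growth_const[of 1] _ k s, of 0] by simp
  let ?S = "\<Inter>p\<in>pairs. {y :: (real,'n) vec. y $ snd p < y $ fst p}"
  have op: "open ?S" by (intro open_INT ballI open_Collect_less continuous_intros) auto
  define y0 :: "(real,'n) vec" where "y0 = (\<chi> i. - real (card {j. j < i}))"
  have "y0 \<in> ?S"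
  proof (intro INT_I CollectI)
    fix p :: "'n \<times> 'n" assume "p \<in> pairs"
    then have "fst p < snd p" by (auto simp: pairs_def)
    then have "{j. j < fst p} \<subset> {j. j < snd p}" by (auto simp: psubset_eq)
    then have "card {j. j < fst p} < card {j. j < snd p}" by (intro psubset_card_mono) auto
    then show "y0 $ snd p < y0 $ fst p" by (simp add: y0_def)
  qed
  then have nn: "\<not> negligible ?S" using open_not_negligible[OF op] by blast
  have pos: "wgt k s 0 y > 0" if "y \<in> ?S" for y
    using that by (auto simp: wgt_def rho_def intro!: mult_pos_pos prod_pos)
  show ?thesis
  proof (rule ccontr)
    assume "\<not> ?thesis"
    moreover have "(\<integral>y. wgt k s 0 (y :: (real,'n) vec) \<partial>lborel) \<ge> 0" by (intro Bochner_Integration.integral_nonneg wgt_nonneg)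
    ultimately have "(\<integral>y. wgt k s 0 (y :: (real,'n) vec) \<partial>lborel) = 0" by linarith
    then have "AE y in lborel. wgt k s 0 (y :: (real,'n) vec) = 0"
      using integral_nonneg_eq_0_iff_AE[OF i AE_I2[OF wgt_nonneg]] by simp
    then have "AE y in lborel. y \<notin> ?S" by eventually_elim (use pos in force)
    then have "?S \<in> null_sets lborel"
      using op by (subst (asm) AE_iff_null_sets[symmetric]) auto
    then show False using nn null_sets_completionI unfolding negligible_iff_null_sets by blast
  qed
qed

lemma poly_growth_psums:
  "poly_growth (psums ms :: (real,'n::finite) vec \<Rightarrow> real)" "poly_growth (dpsums i ms :: (real,'n) vec \<Rightarrow> real)"
  "poly_growth (ddpsums i j ms :: (real,'n) vec \<Rightarrow> real)"
proof -
  have p: "poly_growth (psum m :: (real,'n) vec \<Rightarrow> real)" for m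
    unfolding psum_def[abs_def] by (intro poly_growth_sum poly_growth_power poly_growth_component)
  have 1: "poly_growth (psums ms :: (real,'n) vec \<Rightarrow> real)" for ms
    by (induction ms) (auto intro: poly_growth_const poly_growth_mult p)
  have 2: "poly_growth (dpsums i ms :: (real,'n) vec \<Rightarrow> real)" for i ms
    by (induction ms) (auto intro!: poly_growth_const poly_growth_mult poly_growth_add p 1 poly_growth_power poly_growth_component)
  have d: "poly_growth (\<lambda>u::(real,'n) vec. if i = j then real m * real (m - 1) * (u $ i) ^ (m - 2) else 0)" for i j m
    by (cases "i = j") (auto intro!: poly_growth_const poly_growth_mult poly_growth_power poly_growth_component)
  have 3: "poly_growth (ddpsums i j ms :: (real,'n) vec \<Rightarrow> real)" for i j ms
  proof (induction ms)
    case (Cons m ms)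
    show ?case unfolding ddpsums.simps
      by (intro poly_growth_add poly_growth_mult poly_growth_const poly_growth_power poly_growth_component d p 1 2 Cons)
  qed (simp add: poly_growth_const)
  show "poly_growth (psums ms :: (real,'n) vec \<Rightarrow> real)" "poly_growth (dpsums i ms :: (real,'n) vec \<Rightarrow> real)"
    "poly_growth (ddpsums i j ms :: (real,'n) vec \<Rightarrow> real)" by (rule 1 2 3)+
qed

lemma psums_measurable [measurable]:
  "psums ms \<in> borel_measurable (borel :: (real,'n::{finite,linorder}) vec measure)"
  by (rule borel_measurable_continuous_onI[OF C2_dataE(1)[OF C2_data_psums]])

context
  fixes k s :: real and \<mu> :: "(real,'n::{finite,linorder}) vec measure"
  assumes k: "k > 0" and s: "s > 0" and \<mu>: "\<mu> = bessel_A_law k s"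
begin

lemma law_density: "\<mu> = density lborel (\<lambda>y. ennreal (wgt k s 0 y / (\<integral>z. wgt k s 0 (z :: (real,'n) vec) \<partial>lborel)))"
  unfolding \<mu> bessel_A_law_def weight_A_eq ..

lemma law_sets: "sets \<mu> = sets borel" "space \<mu> = UNIV"
  unfolding law_density by auto

lemma law_integrable:
  assumes q: "poly_growth q" and [measurable]: "q \<in> borel_measurable borel"
  shows "integrable \<mu> (\<lambda>y. q y * exp (c * norm y))"
proof -
  have "integrable lborel (\<lambda>y. (wgt k s 0 y / (\<integral>z. wgt k s 0 (z :: (real,'n) vec) \<partial>lborel)) *\<^sub>R (q y * exp (c * norm y)))"
    using integrable_divide[OF wgt_integrable[OF q _ k s, of c]] by simp
  then show ?thesis unfolding law_density
    using wgt_integral_pos[OF k s, where 'n='n] by (subst integrable_density) (auto simp: wgt_nonneg less_imp_le)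
qed

lemma law_integral:
  assumes [measurable]: "q \<in> borel_measurable borel"
  shows "(\<integral>y. q y \<partial>\<mu>) = (\<integral>y. wgt k s 0 y * q y \<partial>lborel) / (\<integral>z. wgt k s 0 (z :: (real,'n) vec) \<partial>lborel)"
  unfolding law_density using wgt_integral_pos[OF k s, where 'n='n]
  by (subst integral_density) (auto simp: wgt_nonneg less_imp_le)

lemma law_prob_space: "prob_space \<mu>"
proof
  have i: "integrable lborel (wgt k s 0 :: (real,'n) vec \<Rightarrow> real)"
    using wgt_integrable[OF poly_growth_const[of 1] _ k s, of 0] by simp
  have "emeasure \<mu> (space \<mu>) = (\<integral>\<^sup>+y. ennreal (wgt k s 0 (y :: (real,'n) vec) / (\<integral>z. wgt k s 0 (z :: (real,'n) vec) \<partial>lborel)) \<partial>lborel)"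
    unfolding law_density by (simp add: emeasure_density)
  also have "\<dots> = ennreal (\<integral>y. wgt k s 0 (y :: (real,'n) vec) / (\<integral>z. wgt k s 0 (z :: (real,'n) vec) \<partial>lborel) \<partial>lborel)"
    using i wgt_integral_pos[OF k s, where 'n='n] by (intro nn_integral_eq_integral) (auto simp: wgt_nonneg less_imp_le)
  also have "\<dots> = 1" using wgt_integral_pos[OF k s, where 'n='n] by simp
  finally show "emeasure \<mu> (space \<mu>) = 1" .
qed

lemma law_AE: "AE y in \<mu>. y \<in> chamber_A \<and> distinct_coords y"
proof -
  have "AE y in lborel. 0 < ennreal (wgt k s 0 (y :: (real,'n) vec) / (\<integral>z. wgt k s 0 (z :: (real,'n) vec) \<partial>lborel)) \<longrightarrow> y \<in> chamber_A \<and> distinct_coords y"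
  proof (intro AE_I2 impI)
    fix y :: "(real,'n) vec"
    assume "0 < ennreal (wgt k s 0 y / (\<integral>z. wgt k s 0 (z :: (real,'n) vec) \<partial>lborel))"
    then have "wgt k s 0 y \<noteq> 0" by auto
    then have lt: "i < j \<Longrightarrow> y $ j < y $ i" for i j by (rule wgt_nonzero_distinct)
    then have "y \<in> chamber_A" unfolding chamber_A_def by (auto simp: le_less)
    moreover have "distinct_coords y" unfolding distinct_coords_def
    proof (intro allI impI)
      fix i j :: 'n assume "i \<noteq> j"
      then show "y $ i \<noteq> y $ j" using lt[of i j] lt[of j i] by (cases i j rule: linorder_cases) auto
    qed
    ultimately show "y \<in> chamber_A \<and> distinct_coords y" by blast
  qed
  then show ?thesis unfolding law_density by (subst AE_density) auto
qed

lemma law_integrable_psums: "integrable \<mu> (psums ms)"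
  using law_integrable[OF poly_growth_psums(1) psums_measurable, of ms 0] by simp

text \<open>Stein's equation for the law: the Gaussian part gives the degree by
  \<open>euler_psums\<close>, the rest is the type A operator. The coefficients \<open>cs\<close>
  are those of the moment equation, so both recursions match term by term.\<close>

lemma law_stein:
  assumes A: "\<And>u::(real,'n) vec. distinct_coords u \<Longrightarrow> opA k ms u = lincomb cs u"
  shows "real (sum_list ms) * (\<integral>y. psums ms y \<partial>\<mu>) = 2 * s * (\<Sum>(c, ns)\<leftarrow>cs. c * (\<integral>y. psums ns y \<partial>\<mu>))"
proof -
  have lm [measurable]: "(lincomb cs :: (real,'n) vec \<Rightarrow> real) \<in> borel_measurable borel" for cs
  proof (induction cs)
    case Nil
    show ?case by (simp add: lincomb_def[abs_def])
  next
    case (Cons a cs)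
    then show ?case by (cases a) (simp add: lincomb_simps)
  qed
  have li: "integrable \<mu> (lincomb cs) \<and> (\<integral>y. lincomb cs y \<partial>\<mu>) = (\<Sum>(c, ns)\<leftarrow>cs. c * (\<integral>y. psums ns y \<partial>\<mu>))" for cs
  proof (induction cs)
    case Nil
    show ?case by (simp add: lincomb_def[abs_def])
  next
    case (Cons a cs)
    then show ?case using law_integrable_psums by (cases a) (simp add: lincomb_simps)
  qed
  let ?L = "\<lambda>y::(real,'n) vec. 2 * lincomb cs y - (real (sum_list ms) * psums ms y) / s"
  have "(\<integral>y. wgt k s 0 y * ?L y \<partial>lborel) = (\<integral>y. wgt k s 0 (y :: (real,'n) vec) * (2 * ((\<Sum>i\<in>UNIV. ddpsums i i ms y) / 2 + k * (\<Sum>i\<in>UNIV. \<Sum>j\<in>UNIV - {i}. dpsums i ms y / (y $ i - y $ j)))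
      - (\<Sum>i\<in>UNIV. y $ i * dpsums i ms y) / s) \<partial>lborel)"
  proof (intro Bochner_Integration.integral_cong refl)
    fix y :: "(real,'n) vec"
    show "wgt k s 0 y * ?L y = wgt k s 0 y * (2 * ((\<Sum>i\<in>UNIV. ddpsums i i ms y) / 2 + k * (\<Sum>i\<in>UNIV. \<Sum>j\<in>UNIV - {i}. dpsums i ms y / (y $ i - y $ j)))
      - (\<Sum>i\<in>UNIV. y $ i * dpsums i ms y) / s)"
    proof (cases "wgt k s 0 y = 0")
      case False
      have "distinct_coords y" unfolding distinct_coords_def
      proof (intro allI impI)
        fix i j :: 'n assume "i \<noteq> j"
        then show "y $ i \<noteq> y $ j" using wgt_nonzero_distinct[OF False, of i j] wgt_nonzero_distinct[OF False, of j i]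
          by (cases i j rule: linorder_cases) auto
      qed
      then show ?thesis using A[of y] unfolding euler_psums opA_def by simp
    qed simp
  qed
  also have "\<dots> = 0"
    by (rule stein_weight[OF C2_data_psums perm_invariant_psums poly_growth_psums(2,3) k s])
  finally have "(\<integral>y. ?L y \<partial>\<mu>) = 0" by (subst law_integral) auto
  moreover have "(\<integral>y. ?L y \<partial>\<mu>) = 2 * (\<Sum>(c, ns)\<leftarrow>cs. c * (\<integral>y. psums ns y \<partial>\<mu>)) - real (sum_list ms) * (\<integral>y. psums ms y \<partial>\<mu>) / s"
    using li[of cs] law_integrable_psums[of ms] by simp
  ultimately show ?thesis using s by (simp add: field_simps)
qed

end

section \<open>Method of moments for symmetric polynomials\<close>

definition sympoly :: "((real,'n::finite) vec \<Rightarrow> real) \<Rightarrow> bool" where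
  "sympoly \<phi> \<longleftrightarrow> (\<exists>cs. \<phi> = lincomb cs)"

lemma sympoly_add: "sympoly \<phi> \<Longrightarrow> sympoly \<psi> \<Longrightarrow> sympoly (\<lambda>y. \<phi> y + \<psi> y)"
proof -
  assume "sympoly \<phi>" "sympoly \<psi>"
  then obtain cs ds where "\<phi> = lincomb cs" "\<psi> = lincomb ds" unfolding sympoly_def by blast
  then show ?thesis unfolding sympoly_def by (intro exI[of _ "cs @ ds"]) (auto simp: fun_eq_iff)
qed

lemma sympoly_const: "sympoly (\<lambda>_. c)"
  unfolding sympoly_def by (intro exI[of _ "[(c, [])]"]) (auto simp: fun_eq_iff)

lemma sympoly_psums: "sympoly (\<lambda>y. c * psums ms y)"
  unfolding sympoly_def by (intro exI[of _ "[(c, ms)]"]) (auto simp: fun_eq_iff)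

lemma sympoly_mult: "sympoly \<phi> \<Longrightarrow> sympoly \<psi> \<Longrightarrow> sympoly (\<lambda>y. \<phi> y * \<psi> y)"
proof -
  assume s: "sympoly \<phi>" "sympoly \<psi>"
  then obtain cs ds where e: "\<phi> = lincomb cs" "\<psi> = lincomb ds" unfolding sympoly_def by blast
  have "sympoly (\<lambda>y. lincomb cs y * lincomb ds y)"
  proof (induction cs)
    case Nil
    show ?case using sympoly_const[of 0] by simp
  next
    case (Cons a cs)
    obtain c ns where a: "a = (c, ns)" by (cases a)
    have "c * psums ns y * lincomb ds y = lincomb (map (\<lambda>(b, ms). (c * b, ns @ ms)) ds) y" for y
      by (induction ds) (auto simp: psums_append algebra_simps)
    then have "sympoly (\<lambda>y. c * psums ns y * lincomb ds y)" unfolding sympoly_def by blast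
    from sympoly_add[OF this Cons] show ?case by (simp add: a distrib_right)
  qed
  then show ?thesis by (simp add: e)
qed

lemma sympoly_sum: "(\<And>a. a \<in> S \<Longrightarrow> sympoly (f a)) \<Longrightarrow> sympoly (\<lambda>y. \<Sum>a\<in>S. f a y)"
  by (induction S rule: infinite_finite_induct) (auto intro: sympoly_const sympoly_add)

lemma sympoly_poly: "sympoly (\<lambda>y. \<Sum>i\<in>UNIV. poly p (y $ i))"
proof -
  have "(\<Sum>i\<in>UNIV. poly p (y $ i)) = (\<Sum>m\<le>degree p. coeff p m * psums [m] y)" for y :: "(real,'a) vec"
    unfolding poly_altdef by (subst sum.swap) (simp add: psum_def sum_distrib_left)
  then show ?thesis by (simp only:) (intro sympoly_sum sympoly_psums)
qed

lemma sympoly_props: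
  fixes \<phi> :: "(real,'n::{finite,linorder}) vec \<Rightarrow> real"
  assumes "sympoly \<phi>"
  shows "poly_growth \<phi>" "continuous_on UNIV \<phi>" "perm_invariant \<phi>" "\<phi> \<in> borel_measurable borel"
proof -
  obtain cs where cs: "\<phi> = lincomb cs" using assms unfolding sympoly_def by blast
  have "poly_growth (lincomb cs :: (real,'n) vec \<Rightarrow> real) \<and> continuous_on UNIV (lincomb cs :: (real,'n) vec \<Rightarrow> real)
     \<and> perm_invariant (lincomb cs :: (real,'n) vec \<Rightarrow> real)"
  proof (induction cs)
    case Nil
    show ?case by (simp add: lincomb_def[abs_def] poly_growth_const perm_invariant_def)
  next
    case (Cons a cs)
    obtain c ns where a: "a = (c, ns)" by (cases a)
    have e: "lincomb (a # cs) = (\<lambda>y::(real,'n) vec. c * psums ns y + lincomb cs y)" by (simp add: a fun_eq_iff)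
    show ?case unfolding e
      using Cons C2_dataE(1)[OF C2_data_psums[of ns]] poly_growth_psums(1)[of ns] perm_invariant_psums[of ns]
      by (auto intro!: poly_growth_add poly_growth_mult poly_growth_const continuous_intros simp: perm_invariant_def)
  qed
  then show "poly_growth \<phi>" "continuous_on UNIV \<phi>" "perm_invariant \<phi>" by (simp_all add: cs)
  then show "\<phi> \<in> borel_measurable borel" by (simp add: borel_measurable_continuous_onI)
qed

text \<open>Among the finitely many permutations, one that minimises the sum of rank times value
  must sort decreasingly: exchanging a pair in the wrong order would lower the sum.\<close>

lemma sorting_permutation:
  fixes u :: "(real,'n::{finite,linorder}) vec"
  shows "\<exists>\<sigma>. \<sigma> permutes UNIV \<and> (\<chi> i. u $ \<sigma> i) \<in> chamber_A"
proof -
  define r where "r = (\<lambda>i::'n. real (card {..<i}))"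
  define F where "F = (\<lambda>\<sigma>. \<Sum>i\<in>UNIV. r i * u $ \<sigma> i)"
  have fin: "finite {\<sigma>. \<sigma> permutes (UNIV :: 'n set)}" by (intro finite_permutations) simp
  moreover have "{\<sigma>. \<sigma> permutes (UNIV :: 'n set)} \<noteq> {}" using permutes_id by blast
  ultimately obtain \<sigma> where s: "\<sigma> permutes UNIV" and min: "\<And>\<tau>. \<tau> permutes UNIV \<Longrightarrow> F \<sigma> \<le> F \<tau>"
    using ex_min_if_finite[of "F ` {\<sigma>. \<sigma> permutes (UNIV :: 'n set)}"] by (auto simp: not_less)
  have "u $ \<sigma> j \<le> u $ \<sigma> i" if ij: "i \<le> j" for i j
  proof (rule ccontr)
    assume n: "\<not> u $ \<sigma> j \<le> u $ \<sigma> i"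
    then have "i \<noteq> j" by auto
    with ij have lt: "i < j" by simp
    define \<tau> where "\<tau> = \<sigma> \<circ> Transposition.transpose i j"
    have t: "\<tau> permutes UNIV" unfolding \<tau>_def by (intro permutes_compose[OF _ s] permutes_swap_id) auto
    have "F \<tau> - F \<sigma> = (\<Sum>l\<in>UNIV. r l * (u $ \<tau> l - u $ \<sigma> l))"
      by (simp add: F_def sum_subtractf right_diff_distrib)
    also have "\<dots> = (\<Sum>l\<in>{i, j}. r l * (u $ \<tau> l - u $ \<sigma> l))"
      by (rule sum.mono_neutral_right) (auto simp: \<tau>_def Transposition.transpose_def)
    also have "\<dots> = (r i - r j) * (u $ \<sigma> j - u $ \<sigma> i)"
      using \<open>i \<noteq> j\<close> by (simp add: \<tau>_def algebra_simps)
    also have "\<dots> < 0"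
    proof (rule mult_neg_pos)
      have "{..<i} \<subset> {..<j}" using lt by auto
      then have "card {..<i} < card {..<j}" by (intro psubset_card_mono) auto
      then show "r i - r j < 0" by (simp add: r_def)
    qed (use n in simp)
    finally show False using min[OF t] by simp
  qed
  then show ?thesis using s by (intro exI[of _ \<sigma>]) (simp add: chamber_A_def)
qed

text \<open>Power sums give the sum of any polynomial over the coordinates, and a polynomial
  vanishing at all other values in play counts how often \<open>v\<close> occurs. Two decreasing
  vectors with the same multiplicities coincide.\<close>

lemma psum_separates:
  fixes x y :: "(real,'n::{finite,linorder}) vec"
  assumes x: "x \<in> chamber_A" and y: "y \<in> chamber_A" and eq: "\<And>m. psum m x = psum m y"
  shows "x = y"
proof -
  have poly: "(\<Sum>i\<in>UNIV. poly p (x $ i)) = (\<Sum>i\<in>UNIV. poly p (y $ i))" for p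
  proof -
    have "(\<Sum>i\<in>UNIV. poly p (z $ i)) = (\<Sum>m\<le>degree p. coeff p m * psum m z)" for z :: "(real,'n) vec"
      unfolding poly_altdef by (subst sum.swap) (simp add: psum_def sum_distrib_left)
    then show ?thesis by (simp add: eq)
  qed
  define V where "V = range (($) x) \<union> range (($) y)"
  have V: "finite V" "x $ i \<in> V" "y $ i \<in> V" for i by (auto simp: V_def)
  have cnt: "card {i. x $ i = v} = card {i. y $ i = v}" for v
  proof -
    define p where "p = (\<Prod>a\<in>V - {v}. [:- a, 1:])"
    have p0: "poly p a = 0" if "a \<in> V" "a \<noteq> v" for a using that V(1) by (auto simp: p_def poly_prod)
    have pv: "poly p v \<noteq> 0" using V(1) by (auto simp: p_def poly_prod)
    have "(\<Sum>i\<in>UNIV. poly p (z $ i)) = real (card {i. z $ i = v}) * poly p v" if "\<And>i. z $ i \<in> V" for z :: "(real,'n) vec"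
    proof -
      have "(\<Sum>i\<in>UNIV. poly p (z $ i)) = (\<Sum>i\<in>{i. z $ i = v}. poly p v)"
        by (rule sum.mono_neutral_cong_right) (use p0 that in auto)
      then show ?thesis by simp
    qed
    from this[OF V(2)] this[OF V(3)] poly[of p] pv show ?thesis by simp
  qed
  have ge: "card {i. v \<le> x $ i} = card {i. v \<le> y $ i}" for v
  proof -
    have "card {i. v \<le> z $ i} = (\<Sum>a\<in>{a \<in> V. v \<le> a}. card {i. z $ i = a})" if "\<And>i. z $ i \<in> V" for z :: "(real,'n) vec"
    proof -
      have "{i. v \<le> z $ i} = (\<Union>a\<in>{a \<in> V. v \<le> a}. {i. z $ i = a})" using that by auto
      then show ?thesis using V(1) by (simp only:) (subst card_UN_disjoint, auto)
    qed
    from this[OF V(2)] this[OF V(3)] show ?thesis by (simp add: cnt)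
  qed
  \<comment> \<open>If \<open>a $ i\<close> exceeded \<open>b $ i\<close>, then all coordinates of
    \<open>a\<close> up to and including \<open>i\<close>, but only strictly earlier ones of
    \<open>b\<close>, would reach the level \<open>a $ i\<close>.\<close>
  have key: "a $ i \<le> b $ i" if a: "a \<in> chamber_A" and b: "b \<in> chamber_A" and c: "\<And>v. card {i. v \<le> a $ i} = card {i. v \<le> b $ i}"
    for a b :: "(real,'n) vec" and i
  proof (rule ccontr)
    assume n: "\<not> a $ i \<le> b $ i"
    have "{..i} \<subseteq> {j. a $ i \<le> a $ j}" using a by (auto simp: chamber_A_def)
    then have "card {..i} \<le> card {j. a $ i \<le> a $ j}" by (intro card_mono) auto
    moreover have "{j. a $ i \<le> b $ j} \<subseteq> {..<i}"
    proof
      fix j assume j: "j \<in> {j. a $ i \<le> b $ j}"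
      have "\<not> i \<le> j" using b n j by (force simp: chamber_A_def)
      then show "j \<in> {..<i}" by simp
    qed
    then have "card {j. a $ i \<le> b $ j} \<le> card {..<i}" by (intro card_mono) auto
    moreover have "card {..<i} < card {..i}" by (intro psubset_card_mono) auto
    ultimately show False using c[of "a $ i"] by linarith
  qed
  show ?thesis unfolding vec_eq_iff using key[OF x y ge] key[OF y x ge[symmetric]] by (auto intro: antisym)
qed

text \<open>On ordered vectors the power sums separate points, so Stone-Weierstrass applies to the
  algebra of symmetric polynomials there, which on the full cube would fail to separate permuted
  points.\<close>

lemma symmetric_approximation:
  fixes G :: "(real,'n::{finite,linorder}) vec \<Rightarrow> real"
  assumes "continuous_on (chamber_A \<inter> {u. \<forall>i. \<bar>u $ i\<bar> \<le> 1}) G" "e > 0"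
  obtains \<phi> where "sympoly \<phi>" "\<And>u. u \<in> chamber_A \<Longrightarrow> (\<And>i. \<bar>u $ i\<bar> \<le> 1) \<Longrightarrow> \<bar>G u - \<phi> u\<bar> < e"
proof -
  let ?S = "chamber_A \<inter> {u :: (real,'n) vec. \<forall>i. \<bar>u $ i\<bar> \<le> 1}"
  have "closed ?S"
  proof (intro closed_Int)
    have "chamber_A = (\<Inter>i. \<Inter>j\<in>{j. i \<le> j}. {y::(real,'n) vec. y $ j \<le> y $ i})" by (auto simp: chamber_A_def)
    moreover have "closed (\<Inter>i. \<Inter>j\<in>{j. i \<le> j}. {y::(real,'n) vec. y $ j \<le> y $ i})"
      by (intro closed_INT ballI closed_Collect_le continuous_intros)
    ultimately show "closed (chamber_A :: (real,'n) vec set)" by simp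
    have "{u :: (real,'n) vec. \<forall>i. \<bar>u $ i\<bar> \<le> 1} = (\<Inter>i. {u. \<bar>u $ i\<bar> \<le> 1})" by auto
    moreover have "closed (\<Inter>i. {u :: (real,'n) vec. \<bar>u $ i\<bar> \<le> 1})"
      by (intro closed_INT ballI closed_Collect_le continuous_intros)
    ultimately show "closed {u :: (real,'n) vec. \<forall>i. \<bar>u $ i\<bar> \<le> 1}" by simp
  qed
  moreover have "bounded ?S" unfolding bounded_iff
  proof (intro exI ballI)
    fix u :: "(real,'n) vec" assume "u \<in> ?S"
    then have "\<bar>u $ i\<bar> \<le> 1" for i by auto
    then have "(\<Sum>i\<in>UNIV. \<bar>u $ i\<bar>) \<le> (\<Sum>i\<in>(UNIV::'n set). 1)" by (intro sum_mono)
    then show "norm u \<le> (\<Sum>i\<in>(UNIV::'n set). 1)" using norm_le_l1_cart[of u] by linarith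
  qed
  ultimately have comp: "compact ?S" by (simp add: compact_eq_bounded_closed)
  interpret function_ring_on "{\<phi> :: (real,'n) vec \<Rightarrow> real. sympoly \<phi>}" ?S
  proof
    fix f :: "(real,'n) vec \<Rightarrow> real" assume "f \<in> {\<phi>. sympoly \<phi>}"
    then show "continuous_on ?S f" using sympoly_props(2)[of f] by (auto intro: continuous_on_subset)
  next
    fix x y :: "(real,'n) vec" assume "x \<in> ?S" "y \<in> ?S" "x \<noteq> y"
    then obtain m where "psum m x \<noteq> psum m y" using psum_separates[of x y] by auto
    then show "\<exists>f\<in>{\<phi>. sympoly \<phi>}. f x \<noteq> f y" using sympoly_psums[of 1 "[m]"] by (intro bexI[of _ "\<lambda>y. 1 * psums [m] y"]) auto
  qed (use comp in \<open>auto intro: sympoly_add sympoly_mult sympoly_const\<close>)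
  obtain \<phi> where "sympoly \<phi>" "\<And>u. u \<in> ?S \<Longrightarrow> \<bar>G u - \<phi> u\<bar> < e"
    using Stone_Weierstrass_basic[OF assms] by blast
  then show thesis by (intro that[of \<phi>]) auto
qed


text \<open>Exponential moments are what ties the law to its polynomial moments: they let the Taylor
  polynomials of the sine converge in mean.\<close>

locale exp_moments = prob_space \<mu> for \<mu> :: "(real,'n::{finite,linorder}) vec measure" +
  assumes sets_law: "sets \<mu> = sets borel"
    and exp_integrable: "poly_growth q \<Longrightarrow> q \<in> borel_measurable borel \<Longrightarrow> integrable \<mu> (\<lambda>y. q y * exp (c * norm y))"
begin

lemma borel_measurable_law: "f \<in> borel_measurable borel \<Longrightarrow> f \<in> borel_measurable \<mu>"
  using measurable_cong_sets[OF sets_law refl] by blast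

lemma sympoly_integrable: "sympoly \<phi> \<Longrightarrow> integrable \<mu> \<phi>"
  using exp_integrable[of \<phi> 0] sympoly_props[of \<phi>] by simp

text \<open>Allowing an arbitrary polynomial weight \<open>w\<close> makes both classes closed under products.\<close>

definition nice1 :: "(real \<Rightarrow> real) \<Rightarrow> bool" where
  "nice1 f \<longleftrightarrow> (\<exists>B. \<forall>x. \<bar>f x\<bar> \<le> B) \<and> (\<forall>w e. sympoly w \<longrightarrow> (\<forall>y. 0 \<le> w y) \<longrightarrow> e > 0 \<longrightarrow>
     (\<exists>p q. (\<forall>x. \<bar>f x - poly p x\<bar> \<le> poly q x) \<and> (\<integral>y. w y * (\<Sum>i\<in>UNIV. poly q (y $ i)) \<partial>\<mu>) < e))"

definition nice :: "((real,'n) vec \<Rightarrow> real) \<Rightarrow> bool" where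
  "nice f \<longleftrightarrow> (\<exists>B. \<forall>x. \<bar>f x\<bar> \<le> B) \<and> (\<forall>w e. sympoly w \<longrightarrow> (\<forall>y. 0 \<le> w y) \<longrightarrow> e > 0 \<longrightarrow>
     (\<exists>p q. sympoly p \<and> sympoly q \<and> (\<forall>x. \<bar>f x - p x\<bar> \<le> q x) \<and> (\<integral>y. w y * q y \<partial>\<mu>) < e))"

text \<open>Taylor's formula of even order has the remainder bound
  \<open>(c * x) ^ (2 * m) / fact (2 * m)\<close>, which is itself a polynomial and at most
  \<open>exp (\<bar>c\<bar> * \<bar>x\<bar>)\<close>; exponential moments dominate it, so its
  integral tends to 0.\<close>

lemma nice1_sin: "nice1 (\<lambda>x. sin (c * x))"
  unfolding nice1_def
proof (intro conjI allI impI)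
  show "\<exists>B. \<forall>x. \<bar>sin (c * x)\<bar> \<le> B" using abs_sin_le_one by blast
  fix w :: "(real,'n) vec \<Rightarrow> real" and e :: real assume w: "sympoly w" "\<forall>y. 0 \<le> w y" and e: "e > 0"
  note wp = sympoly_props[OF w(1)]
  let ?q = "\<lambda>m. monom (inverse (fact (2 * m)) * c ^ (2 * m)) (2 * m) :: real poly"
  let ?b = "\<lambda>m y. w y * (\<Sum>i\<in>UNIV. poly (?q m) (y $ i))"
  have qx: "poly (?q m) x = inverse (fact (2 * m)) * (c * x) ^ (2 * m)" for m x
    by (simp add: poly_monom power_mult_distrib)
  have q0: "0 \<le> poly (?q m) x" for m x unfolding qx by simp
  have qe: "poly (?q m) x \<le> exp (\<bar>c\<bar> * \<bar>x\<bar>)" for m x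
  proof -
    have "(c * x) ^ (2 * m) = \<bar>c * x\<bar> ^ (2 * m)" by (simp add: power_even_abs)
    also have "\<dots> \<le> fact (2 * m) * exp \<bar>c * x\<bar>" by (rule power_le_fact_exp) simp
    finally show ?thesis unfolding qx by (simp add: field_simps abs_mult)
  qed
  have "(\<lambda>m. \<integral>y. ?b m y \<partial>\<mu>) \<longlonglongrightarrow> (\<integral>y. 0 \<partial>\<mu>)"
  proof (rule integral_dominated_convergence[where w="\<lambda>y. (w y * real CARD('n)) * exp (\<bar>c\<bar> * norm y)"])
    show "integrable \<mu> (\<lambda>y. (w y * real CARD('n)) * exp (\<bar>c\<bar> * norm y))"
      by (rule exp_integrable) (use wp in \<open>auto intro!: poly_growth_mult poly_growth_const\<close>)
    show "?b m \<in> borel_measurable \<mu>" for m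
      by (intro borel_measurable_law sympoly_props(4) sympoly_mult w sympoly_poly)
    show "AE y in \<mu>. norm (?b m y) \<le> (w y * real CARD('n)) * exp (\<bar>c\<bar> * norm y)" for m
    proof (intro AE_I2)
      fix y :: "(real,'n) vec"
      have "(\<Sum>i\<in>UNIV. poly (?q m) (y $ i)) \<le> (\<Sum>i\<in>(UNIV::'n set). exp (\<bar>c\<bar> * norm y))"
      proof (rule sum_mono)
        fix i
        have "\<bar>c\<bar> * \<bar>y $ i\<bar> \<le> \<bar>c\<bar> * norm y" by (intro mult_left_mono component_abs_le_norm) simp
        then show "poly (?q m) (y $ i) \<le> exp (\<bar>c\<bar> * norm y)" using qe[of m "y $ i"] by (meson exp_le_cancel_iff order_trans)
      qed
      then have "w y * (\<Sum>i\<in>UNIV. poly (?q m) (y $ i)) \<le> w y * (real CARD('n) * exp (\<bar>c\<bar> * norm y))"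
        using w(2) by (intro mult_left_mono) auto
      moreover have "0 \<le> w y * (\<Sum>i\<in>UNIV. poly (?q m) (y $ i))" using w(2) q0 by (intro mult_nonneg_nonneg sum_nonneg) auto
      ultimately show "norm (?b m y) \<le> (w y * real CARD('n)) * exp (\<bar>c\<bar> * norm y)" by (simp add: mult.assoc)
    qed
    show "AE y in \<mu>. (\<lambda>m. ?b m y) \<longlonglongrightarrow> 0"
    proof (intro AE_I2)
      fix y :: "(real,'n) vec"
      have "(\<lambda>m. poly (?q m) x) \<longlonglongrightarrow> 0" for x
      proof -
        have "(\<lambda>n. inverse (fact n) * (c * x) ^ n) \<longlonglongrightarrow> 0" by (rule summable_LIMSEQ_zero[OF summable_exp])
        from LIMSEQ_subseq_LIMSEQ[OF this, of "\<lambda>m. 2 * m"] show ?thesis unfolding qx by (simp add: strict_mono_def o_def)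
      qed
      then have "(\<lambda>m. ?b m y) \<longlonglongrightarrow> w y * (\<Sum>i\<in>(UNIV::'n set). 0)" by (intro tendsto_intros)
      then show "(\<lambda>m. ?b m y) \<longlonglongrightarrow> 0" by simp
    qed
  qed simp
  then have "(\<lambda>m. \<integral>y. ?b m y \<partial>\<mu>) \<longlonglongrightarrow> 0" by simp
  then have "\<forall>\<^sub>F m in sequentially. (\<integral>y. ?b m y \<partial>\<mu>) < e" by (rule order_tendstoD(2)[OF _ e])
  then obtain m where m: "(\<integral>y. ?b m y \<partial>\<mu>) < e" using eventually_happens'[OF sequentially_bot] by blast
  let ?p = "\<Sum>l<2 * m. monom (sin_coeff l * c ^ l) l"
  have "poly ?p x = (\<Sum>l<2 * m. sin_coeff l * (c * x) ^ l)" for x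
    by (simp add: poly_sum poly_monom power_mult_distrib mult.assoc)
  then have "\<bar>sin (c * x) - poly ?p x\<bar> \<le> poly (?q m) x" for x
    using Maclaurin_sin_bound[of "c * x" "2 * m"] unfolding qx by (simp add: power_even_abs)
  with m show "\<exists>p q. (\<forall>x. \<bar>sin (c * x) - poly p x\<bar> \<le> poly q x) \<and> (\<integral>y. w y * (\<Sum>i\<in>UNIV. poly q (y $ i)) \<partial>\<mu>) < e" by blast
qed

text \<open>Estimating \<open>\<bar>q\<bar>\<close> by \<open>1 + q^2\<close> makes the error bound
  a polynomial whenever \<open>q\<close>, \<open>r\<close> and \<open>s\<close> are values of
  polynomials.\<close>

lemma product_error:
  fixes a b p q C r s :: real
  assumes "\<bar>a\<bar> \<le> C" "\<bar>a - p\<bar> \<le> r" "\<bar>b - q\<bar> \<le> s"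
  shows "\<bar>a * b - p * q\<bar> \<le> C * s + (1 + q\<^sup>2) * r"
proof -
  have "a * b - p * q = a * (b - q) + q * (a - p)" by (simp add: algebra_simps)
  then have "\<bar>a * b - p * q\<bar> \<le> \<bar>a\<bar> * \<bar>b - q\<bar> + \<bar>q\<bar> * \<bar>a - p\<bar>" by (simp add: abs_triangle_ineq order_trans flip: abs_mult)
  also have "\<bar>a\<bar> * \<bar>b - q\<bar> \<le> C * s" using assms by (intro mult_mono) auto
  also have "\<bar>q\<bar> * \<bar>a - p\<bar> \<le> (1 + q\<^sup>2) * r"
  proof (intro mult_mono assms)
    have "0 \<le> (\<bar>q\<bar> - 1)\<^sup>2" by simp
    then show "\<bar>q\<bar> \<le> 1 + q\<^sup>2" using abs_ge_zero[of q] unfolding power2_diff by simp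
  qed auto
  finally show ?thesis by simp
qed

text \<open>The order of choice matters: the error of \<open>f\<close> gets multiplied by
  \<open>1 + p2^2\<close>, so the approximation \<open>p2\<close> of \<open>g\<close> is fixed
  first, and then \<open>f\<close> is approximated under the correspondingly enlarged
  weight.\<close>

lemma nice1_mult:
  assumes f: "nice1 f" and g: "nice1 g"
  shows "nice1 (\<lambda>x. f x * g x)"
proof -
  obtain B where B: "\<And>x. \<bar>f x\<bar> \<le> B" using f unfolding nice1_def by blast
  obtain B' where B': "\<And>x. \<bar>g x\<bar> \<le> B'" using g unfolding nice1_def by blast
  have B0: "B \<ge> 0" using B[of 0] by linarith
  show ?thesis unfolding nice1_def
  proof (intro conjI allI impI)
    have "\<bar>f x * g x\<bar> \<le> B * B'" for x unfolding abs_mult using B B' B0 by (intro mult_mono) auto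
    then show "\<exists>B. \<forall>x. \<bar>f x * g x\<bar> \<le> B" by blast
    fix w :: "(real,'n) vec \<Rightarrow> real" and e :: real assume w: "sympoly w" "\<forall>y. 0 \<le> w y" and e: "e > 0"
    have "e / (2 * (B + 1)) > 0" using e B0 by simp
    then obtain p2 q2 where 2: "\<And>x. \<bar>g x - poly p2 x\<bar> \<le> poly q2 x" "(\<integral>y. w y * (\<Sum>i\<in>UNIV. poly q2 (y $ i)) \<partial>\<mu>) < e / (2 * (B + 1))"
      using g w unfolding nice1_def by blast
    define r where "r = 1 + p2\<^sup>2"
    have r: "poly r x = 1 + (poly p2 x)\<^sup>2" for x by (simp add: r_def)
    have r0: "0 \<le> poly r x" for x unfolding r by simp
    have w': "sympoly (\<lambda>y. w y * (\<Sum>i\<in>UNIV. poly r (y $ i)))" by (intro sympoly_mult w sympoly_poly)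
    have w'0: "\<forall>y. 0 \<le> w y * (\<Sum>i\<in>UNIV. poly r (y $ i))" using w(2) r0 by (auto intro!: mult_nonneg_nonneg sum_nonneg)
    have "e / 2 > 0" using e by simp
    from f[unfolded nice1_def, THEN conjunct2, rule_format, OF w' w'0[rule_format] this]
    obtain p1 q1 where 1: "\<And>x. \<bar>f x - poly p1 x\<bar> \<le> poly q1 x"
      "(\<integral>y. (w y * (\<Sum>i\<in>UNIV. poly r (y $ i))) * (\<Sum>i\<in>UNIV. poly q1 (y $ i)) \<partial>\<mu>) < e / 2"
      by blast
    let ?q = "smult B q2 + r * q1"
    have q10: "0 \<le> poly q1 x" and q20: "0 \<le> poly q2 x" for x using 1(1)[of x] 2(1)[of x] by linarith+
    have b: "\<bar>f x * g x - poly (p1 * p2) x\<bar> \<le> poly ?q x" for x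
      using product_error[OF B 1(1) 2(1), of x] by (simp add: r)
    have "(\<integral>y. w y * (\<Sum>i\<in>UNIV. poly ?q (y $ i)) \<partial>\<mu>)
       \<le> (\<integral>y. B * (w y * (\<Sum>i\<in>UNIV. poly q2 (y $ i))) + (w y * (\<Sum>i\<in>UNIV. poly r (y $ i))) * (\<Sum>i\<in>UNIV. poly q1 (y $ i)) \<partial>\<mu>)"
    proof (rule integral_mono)
      show "integrable \<mu> (\<lambda>y. w y * (\<Sum>i\<in>UNIV. poly ?q (y $ i)))"
        by (intro sympoly_integrable sympoly_mult w sympoly_poly)
      show "integrable \<mu> (\<lambda>y. B * (w y * (\<Sum>i\<in>UNIV. poly q2 (y $ i))) + (w y * (\<Sum>i\<in>UNIV. poly r (y $ i))) * (\<Sum>i\<in>UNIV. poly q1 (y $ i)))"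
        by (intro sympoly_integrable sympoly_add sympoly_mult sympoly_const w sympoly_poly)
      fix y :: "(real,'n) vec"
      \<comment> \<open>A product at the same coordinate is below the product of the two sums,
        because all terms are nonnegative; this turns the one-variable weight \<open>r\<close> into
        a symmetric polynomial.\<close>
      have "(\<Sum>i\<in>UNIV. poly r (y $ i) * poly q1 (y $ i)) \<le> (\<Sum>i\<in>UNIV. (\<Sum>j\<in>UNIV. poly r (y $ j)) * poly q1 (y $ i))"
        by (intro sum_mono mult_right_mono q10 member_le_sum r0) auto
      then have "w y * (\<Sum>i\<in>UNIV. poly r (y $ i) * poly q1 (y $ i)) \<le> w y * ((\<Sum>j\<in>UNIV. poly r (y $ j)) * (\<Sum>i\<in>UNIV. poly q1 (y $ i)))"
        using w(2) by (intro mult_left_mono) (auto simp: sum_distrib_left)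
      then show "w y * (\<Sum>i\<in>UNIV. poly ?q (y $ i)) \<le> B * (w y * (\<Sum>i\<in>UNIV. poly q2 (y $ i))) + (w y * (\<Sum>i\<in>UNIV. poly r (y $ i))) * (\<Sum>i\<in>UNIV. poly q1 (y $ i))"
        by (simp add: sum.distrib sum_distrib_left[symmetric] distrib_left mult_ac)
    qed
    also have "\<dots> = B * (\<integral>y. w y * (\<Sum>i\<in>UNIV. poly q2 (y $ i)) \<partial>\<mu>) + (\<integral>y. (w y * (\<Sum>i\<in>UNIV. poly r (y $ i))) * (\<Sum>i\<in>UNIV. poly q1 (y $ i)) \<partial>\<mu>)"
    proof -
      have "integrable \<mu> (\<lambda>y. w y * (\<Sum>i\<in>UNIV. poly q2 (y $ i)))"
        "integrable \<mu> (\<lambda>y. (w y * (\<Sum>i\<in>UNIV. poly r (y $ i))) * (\<Sum>i\<in>UNIV. poly q1 (y $ i)))"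
        by (intro sympoly_integrable sympoly_mult w sympoly_poly)+
      then show ?thesis by simp
    qed
    also have "\<dots> < e"
    proof -
      have "B * (\<integral>y. w y * (\<Sum>i\<in>UNIV. poly q2 (y $ i)) \<partial>\<mu>) \<le> B * (e / (2 * (B + 1)))"
        using 2(2) B0 by (intro mult_left_mono) auto
      also have "\<dots> \<le> e / 2" using B0 e by (simp add: field_simps)
      finally show ?thesis using 1(2) by linarith
    qed
    finally show "\<exists>p q. (\<forall>x. \<bar>f x * g x - poly p x\<bar> \<le> poly q x) \<and> (\<integral>y. w y * (\<Sum>i\<in>UNIV. poly q (y $ i)) \<partial>\<mu>) < e"
      using b by blast
  qed
qed

lemma nice1_power: "nice1 f \<Longrightarrow> nice1 (\<lambda>x. f x ^ m)"
proof (induction m)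
  case 0
  show ?case unfolding nice1_def
    by (intro conjI allI impI exI[of _ 1] exI[of _ "0 :: real poly"]) (auto intro: exI[of _ "1 :: real poly"])
next
  case (Suc m)
  then show ?case using nice1_mult[of f "\<lambda>x. f x ^ m"] by simp
qed

lemma nice_linear_statistic:
  assumes "nice1 f"
  shows "nice (\<lambda>y. \<Sum>i\<in>UNIV. f (y $ i))"
  unfolding nice_def
proof (intro conjI allI impI)
  obtain B where B: "\<And>x. \<bar>f x\<bar> \<le> B" using assms unfolding nice1_def by blast
  have "\<bar>\<Sum>i\<in>UNIV. f (y $ i)\<bar> \<le> (\<Sum>i\<in>(UNIV::'n set). B)" for y :: "(real,'n) vec"
    by (rule order_trans[OF sum_abs]) (intro sum_mono B)
  then show "\<exists>B. \<forall>y::(real,'n) vec. \<bar>\<Sum>i\<in>UNIV. f (y $ i)\<bar> \<le> B" by blast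
  fix w :: "(real,'n) vec \<Rightarrow> real" and e :: real assume w: "sympoly w" "\<forall>y. 0 \<le> w y" and e: "e > 0"
  then obtain p q where pq: "\<And>x. \<bar>f x - poly p x\<bar> \<le> poly q x" "(\<integral>y. w y * (\<Sum>i\<in>UNIV. poly q (y $ i)) \<partial>\<mu>) < e"
    using assms unfolding nice1_def by blast
  have "\<bar>(\<Sum>i\<in>UNIV. f (y $ i)) - (\<Sum>i\<in>UNIV. poly p (y $ i))\<bar> \<le> (\<Sum>i\<in>UNIV. poly q (y $ i))" for y :: "(real,'n) vec"
    unfolding sum_subtractf[symmetric] by (rule order_trans[OF sum_abs]) (intro sum_mono pq)
  then show "\<exists>p q. sympoly p \<and> sympoly q \<and> (\<forall>y. \<bar>(\<Sum>i\<in>UNIV. f (y $ i)) - p y\<bar> \<le> q y) \<and> (\<integral>y. w y * q y \<partial>\<mu>) < e"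
    using pq(2) sympoly_poly by blast
qed

lemma nice_const: "nice (\<lambda>_. c)"
  unfolding nice_def
proof (intro conjI allI impI)
  show "\<exists>B. \<forall>x::(real,'n) vec. \<bar>c\<bar> \<le> B" by blast
  fix w :: "(real,'n) vec \<Rightarrow> real" and e :: real assume "e > 0"
  then show "\<exists>p q. sympoly p \<and> sympoly q \<and> (\<forall>y. \<bar>c - p y\<bar> \<le> q y) \<and> (\<integral>y. w y * q y \<partial>\<mu>) < e"
    by (intro exI[of _ "\<lambda>_. c"] exI[of _ "\<lambda>_. 0"]) (auto intro: sympoly_const)
qed

lemma nice_add:
  assumes f: "nice f" and g: "nice g"
  shows "nice (\<lambda>x. f x + g x)"
  unfolding nice_def
proof (intro conjI allI impI)
  obtain B B' where "\<And>x. \<bar>f x\<bar> \<le> B" "\<And>x. \<bar>g x\<bar> \<le> B'" using f g unfolding nice_def by blast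
  then have "\<bar>f x + g x\<bar> \<le> B + B'" for x by (intro order_trans[OF abs_triangle_ineq] add_mono)
  then show "\<exists>B. \<forall>x. \<bar>f x + g x\<bar> \<le> B" by blast
  fix w :: "(real,'n) vec \<Rightarrow> real" and e :: real assume w: "sympoly w" "\<forall>y. 0 \<le> w y" and e: "e > 0"
  then have "e / 2 > 0" by simp
  with f g w obtain p q p' q' where 1: "sympoly p" "sympoly q" "\<And>x. \<bar>f x - p x\<bar> \<le> q x" "(\<integral>y. w y * q y \<partial>\<mu>) < e / 2"
    and 2: "sympoly p'" "sympoly q'" "\<And>x. \<bar>g x - p' x\<bar> \<le> q' x" "(\<integral>y. w y * q' y \<partial>\<mu>) < e / 2"
    unfolding nice_def by meson
  have "\<bar>(f x + g x) - (p x + p' x)\<bar> \<le> q x + q' x" for x using 1(3)[of x] 2(3)[of x] by linarith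
  moreover have "(\<integral>y. w y * (q y + q' y) \<partial>\<mu>) = (\<integral>y. w y * q y \<partial>\<mu>) + (\<integral>y. w y * q' y \<partial>\<mu>)"
    using sympoly_integrable[OF sympoly_mult[OF w(1) 1(2)]] sympoly_integrable[OF sympoly_mult[OF w(1) 2(2)]]
    by (simp add: distrib_left)
  ultimately show "\<exists>p q. sympoly p \<and> sympoly q \<and> (\<forall>x. \<bar>(f x + g x) - p x\<bar> \<le> q x) \<and> (\<integral>y. w y * q y \<partial>\<mu>) < e"
    using 1 2 by (intro exI[of _ "\<lambda>x. p x + p' x"] exI[of _ "\<lambda>x. q x + q' x"]) (auto intro: sympoly_add)
qed

lemma nice_mult:
  assumes f: "nice f" and g: "nice g"
  shows "nice (\<lambda>x. f x * g x)"
proof -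
  obtain B B' where B: "\<And>x. \<bar>f x\<bar> \<le> B" and B': "\<And>x. \<bar>g x\<bar> \<le> B'" using f g unfolding nice_def by blast
  have B0: "B \<ge> 0" using B[of 0] by linarith
  show ?thesis unfolding nice_def
  proof (intro conjI allI impI)
    have "\<bar>f x * g x\<bar> \<le> B * B'" for x unfolding abs_mult using B B' B0 by (intro mult_mono) auto
    then show "\<exists>B. \<forall>x. \<bar>f x * g x\<bar> \<le> B" by blast
    fix w :: "(real,'n) vec \<Rightarrow> real" and e :: real assume w: "sympoly w" "\<forall>y. 0 \<le> w y" and e: "e > 0"
    have "e / (2 * (B + 1)) > 0" using e B0 by simp
    then obtain p2 q2 where 2: "sympoly p2" "sympoly q2" "\<And>x. \<bar>g x - p2 x\<bar> \<le> q2 x" "(\<integral>y. w y * q2 y \<partial>\<mu>) < e / (2 * (B + 1))"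
      using g w unfolding nice_def by meson
    let ?r = "\<lambda>y. 1 + (p2 y)\<^sup>2"
    have r: "sympoly ?r" unfolding power2_eq_square by (intro sympoly_add sympoly_const sympoly_mult 2)
    have w': "sympoly (\<lambda>y. w y * ?r y)" by (intro sympoly_mult w r)
    have w'0: "\<forall>y. 0 \<le> w y * ?r y" using w(2) by (auto intro!: mult_nonneg_nonneg)
    have "e / 2 > 0" using e by simp
    then obtain p1 q1 where 1: "sympoly p1" "sympoly q1" "\<And>x. \<bar>f x - p1 x\<bar> \<le> q1 x" "(\<integral>y. (w y * ?r y) * q1 y \<partial>\<mu>) < e / 2"
      using f w' w'0 unfolding nice_def by meson
    have b: "\<bar>f x * g x - p1 x * p2 x\<bar> \<le> B * q2 x + ?r x * q1 x" for x
      by (rule product_error[OF B 1(3) 2(3)])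
    have i: "integrable \<mu> (\<lambda>y. w y * q2 y)" "integrable \<mu> (\<lambda>y. (w y * ?r y) * q1 y)"
      by (intro sympoly_integrable sympoly_mult w' w 1 2)+
    have "(\<integral>y. w y * (B * q2 y + ?r y * q1 y) \<partial>\<mu>) = (\<integral>y. B * (w y * q2 y) + (w y * ?r y) * q1 y \<partial>\<mu>)"
      by (intro Bochner_Integration.integral_cong refl) (simp add: algebra_simps)
    also have "\<dots> = B * (\<integral>y. w y * q2 y \<partial>\<mu>) + (\<integral>y. (w y * ?r y) * q1 y \<partial>\<mu>)" using i by simp
    also have "\<dots> < e"
    proof -
      have "B * (\<integral>y. w y * q2 y \<partial>\<mu>) \<le> B * (e / (2 * (B + 1)))"
        using 2(4) B0 by (intro mult_left_mono) auto
      also have "\<dots> \<le> e / 2" using B0 e by (simp add: field_simps)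
      finally show ?thesis using 1(4) by linarith
    qed
    finally show "\<exists>p q. sympoly p \<and> sympoly q \<and> (\<forall>x. \<bar>f x * g x - p x\<bar> \<le> q x) \<and> (\<integral>y. w y * q y \<partial>\<mu>) < e"
      using b by (intro exI[of _ "\<lambda>x. p1 x * p2 x"] exI[of _ "\<lambda>x. B * q2 x + ?r x * q1 x"])
        (auto intro!: sympoly_add sympoly_mult sympoly_const r 1 2)
  qed
qed

lemma nice_sin_sympoly:
  assumes "sympoly \<phi>"
  shows "nice (\<lambda>y. \<phi> (\<chi> i. sin (c * y $ i)))"
proof -
  have p: "nice (\<lambda>y. psum m (\<chi> i. sin (c * y $ i)))" for m
    using nice_linear_statistic[OF nice1_power[OF nice1_sin[of c], of m]] by (simp add: psum_def)
  have ps: "nice (\<lambda>y. psums ms (\<chi> i. sin (c * y $ i)))" for ms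
    by (induction ms) (auto intro: nice_const nice_mult p)
  obtain cs where cs: "\<phi> = lincomb cs" using assms unfolding sympoly_def by blast
  have "nice (\<lambda>y. lincomb cs (\<chi> i. sin (c * y $ i)))"
  proof (induction cs)
    case Nil
    show ?case using nice_const[of 0] by simp
  next
    case (Cons a cs)
    obtain b ns where a: "a = (b, ns)" by (cases a)
    show ?case unfolding a lincomb_simps by (intro nice_add nice_mult nice_const ps Cons)
  qed
  then show ?thesis by (simp add: cs)
qed

text \<open>The substitution \<open>u = sin (y / R)\<close> carries the box of radius
  \<open>R\<close> monotonically into the cube, since \<open>1 < pi / 2\<close>, and
  \<open>arcsin\<close> undoes it there; Stone-Weierstrass on the ordered cube then gives a
  symmetric polynomial in sines close to \<open>g\<close> on the ordered part of the box. Unlike a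
  polynomial in \<open>y\<close> it is bounded on the whole space, so the region outside the box
  costs only a multiple of \<open>psum 2 y / R^2\<close>. Finally \<open>nice_sin_sympoly\<close>
  passes from sines to polynomials.\<close>

lemma bounded_continuous_approximation:
  assumes g: "continuous_on UNIV g" and B: "\<And>y. \<bar>g y\<bar> \<le> B" and e: "e > 0"
  obtains p q where "sympoly p" "sympoly q" "\<And>y. y \<in> chamber_A \<Longrightarrow> \<bar>g y - p y\<bar> \<le> q y" "(\<integral>y. q y \<partial>\<mu>) < e"
proof -
  define \<delta> where "\<delta> = e / 4"
  have d: "\<delta> > 0" using e by (simp add: \<delta>_def)
  have B0: "B \<ge> 0" using B[of 0] by linarith
  define m2 where "m2 = (\<integral>y. psum 2 y \<partial>\<mu>)"
  have m2: "m2 \<ge> 0" unfolding m2_def by (intro Bochner_Integration.integral_nonneg) (auto simp: psum_def intro!: sum_nonneg)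
  \<comment> \<open>Chosen so that \<open>(2 * B + \<delta>) / R^2\<close> times the second moment
    is at most \<open>\<delta>\<close>; three errors of size \<open>\<delta> = e / 4\<close> then
    stay below \<open>e\<close>.\<close>
  define R where "R = sqrt ((2 * B + \<delta>) * (m2 + 1) / \<delta>)"
  have R: "R > 0" "R\<^sup>2 = (2 * B + \<delta>) * (m2 + 1) / \<delta>" unfolding R_def using B0 d m2 by (auto simp: less_imp_le)
  let ?S = "chamber_A \<inter> {u :: (real,'n) vec. \<forall>i. \<bar>u $ i\<bar> \<le> 1}"
  let ?G = "\<lambda>u::(real,'n) vec. g (\<chi> i. R * arcsin (u $ i))"
  have "continuous_on ?S ?G"
  proof (rule continuous_on_compose2[OF g])
    show "continuous_on ?S (\<lambda>u. \<chi> i. R * arcsin (u $ i))"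
      by (intro continuous_intros) (auto simp: abs_le_iff)
  qed auto
  then obtain \<phi> where \<phi>: "sympoly \<phi>" "\<And>u. u \<in> chamber_A \<Longrightarrow> (\<And>i. \<bar>u $ i\<bar> \<le> 1) \<Longrightarrow> \<bar>?G u - \<phi> u\<bar> < \<delta>"
    using symmetric_approximation[OF _ d] by blast
  let ?T = "\<lambda>y::(real,'n) vec. \<phi> (\<chi> i. sin (1 / R * y $ i))"
  \<comment> \<open>The vector of sines of an arbitrary \<open>y\<close> lies in the cube but may be
    unordered; sorting it does not change the value of the symmetric \<open>\<phi>\<close>.\<close>
  have Tb: "\<bar>?T y\<bar> \<le> B + \<delta>" for y
  proof -
    obtain \<sigma> where s: "\<sigma> permutes UNIV" "(\<chi> i. (\<chi> i. sin (1 / R * y $ i)) $ \<sigma> i) \<in> chamber_A"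
      using sorting_permutation by blast
    let ?u = "\<chi> i. (\<chi> i. sin (1 / R * y $ i)) $ \<sigma> i"
    have "\<bar>?G ?u - \<phi> ?u\<bar> < \<delta>" by (rule \<phi>(2)[OF s(2)]) (simp add: abs_sin_le_one)
    moreover have "\<phi> ?u = ?T y" using sympoly_props(3)[OF \<phi>(1)] s(1) unfolding perm_invariant_def by blast
    ultimately show ?thesis using B[of "\<chi> i. R * arcsin (?u $ i)"] by linarith
  qed
  have gT: "\<bar>g y - ?T y\<bar> \<le> \<delta> + (2 * B + \<delta>) / R\<^sup>2 * psum 2 y" if y: "y \<in> chamber_A" for y
  proof (cases "\<forall>i. \<bar>y $ i\<bar> \<le> R")
    case True
    have yi: "- (pi / 2) \<le> 1 / R * y $ i" "1 / R * y $ i \<le> pi / 2" for i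
    proof -
      have "\<bar>1 / R * y $ i\<bar> \<le> 1" using True R by (simp add: abs_mult)
      then show "- (pi / 2) \<le> 1 / R * y $ i" "1 / R * y $ i \<le> pi / 2" using pi_gt3 by linarith+
    qed
    let ?u = "\<chi> i. sin (1 / R * y $ i)"
    have "?u \<in> chamber_A" unfolding chamber_A_def
    proof (intro CollectI allI impI)
      fix i j :: 'n assume "i \<le> j"
      then have "y $ j \<le> y $ i" using y by (simp add: chamber_A_def)
      then have "1 / R * y $ j \<le> 1 / R * y $ i" using R by (simp add: divide_right_mono)
      then show "?u $ j \<le> ?u $ i" using sin_monotone_2pi_le[OF yi(1)[of j] _ yi(2)[of i]] by simp
    qed
    then have "\<bar>?G ?u - \<phi> ?u\<bar> < \<delta>" by (rule \<phi>(2)) (simp add: abs_sin_le_one)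
    moreover have "(\<chi> i. R * arcsin (?u $ i)) = y" using R arcsin_sin[OF yi] by (simp add: vec_eq_iff)
    moreover have "0 \<le> (2 * B + \<delta>) / R\<^sup>2 * psum 2 y" using B0 d
      by (intro mult_nonneg_nonneg divide_nonneg_nonneg) (auto simp: psum_def intro!: sum_nonneg)
    ultimately show ?thesis by simp
  next
    case False
    then obtain i where i: "R < \<bar>y $ i\<bar>" by (auto simp: not_le)
    have "R\<^sup>2 \<le> (y $ i)\<^sup>2" using i R by (metis abs_le_square_iff abs_of_pos less_imp_le)
    also have "\<dots> \<le> psum 2 y" unfolding psum_def by (rule member_le_sum[of i UNIV "\<lambda>i. (y $ i)\<^sup>2"]) auto
    finally have "1 \<le> psum 2 y / R\<^sup>2" using R(1) by simp
    then have "(2 * B + \<delta>) * 1 \<le> (2 * B + \<delta>) * (psum 2 y / R\<^sup>2)" using B0 d by (intro mult_left_mono) auto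
    moreover have "\<bar>g y - ?T y\<bar> \<le> 2 * B + \<delta>" using B[of y] Tb[of y] by linarith
    ultimately show ?thesis using d by simp
  qed
  have "nice ?T" by (rule nice_sin_sympoly[OF \<phi>(1)])
  from this[unfolded nice_def, THEN conjunct2, rule_format, OF sympoly_const[of 1] zero_le_one d]
  obtain p q where pq: "sympoly p" "sympoly q" "\<And>y. \<bar>?T y - p y\<bar> \<le> q y" "(\<integral>y. 1 * q y \<partial>\<mu>) < \<delta>"
    by blast
  let ?q = "\<lambda>y. (\<delta> + (2 * B + \<delta>) / R\<^sup>2 * psums [2] y) + q y"
  have "\<bar>g y - p y\<bar> \<le> ?q y" if "y \<in> chamber_A" for y
    using gT[OF that] pq(3)[of y] by simp
  moreover have "sympoly ?q" by (intro sympoly_add sympoly_const sympoly_psums pq)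
  moreover have "(\<integral>y. ?q y \<partial>\<mu>) < e"
  proof -
    have i: "integrable \<mu> (psum 2)" using sympoly_integrable[OF sympoly_psums[of 1 "[2]"]] by simp
    have "(\<integral>y. ?q y \<partial>\<mu>) = \<delta> + (2 * B + \<delta>) / R\<^sup>2 * m2 + (\<integral>y. q y \<partial>\<mu>)"
      using i sympoly_integrable[OF pq(2)] by (simp add: m2_def prob_space)
    moreover have "(2 * B + \<delta>) / R\<^sup>2 * m2 \<le> \<delta>"
    proof -
      have "(2 * B + \<delta>) / R\<^sup>2 * m2 = \<delta> * (m2 / (m2 + 1))" unfolding R(2)
      proof -
        have "A / (A * D / \<delta>) * m2 = \<delta> * (m2 / D)" if "A > 0" "D > 0" for A D :: real
          using that d m2 by (simp add: field_simps)
        from this[of "2 * B + \<delta>" "m2 + 1"] show "(2 * B + \<delta>) / ((2 * B + \<delta>) * (m2 + 1) / \<delta>) * m2 = \<delta> * (m2 / (m2 + 1))"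
          using B0 d m2 by simp
      qed
      also have "\<dots> \<le> \<delta> * 1" using d m2 by (intro mult_left_mono) auto
      finally show ?thesis by simp
    qed
    ultimately show ?thesis using pq(4) d by (simp add: \<delta>_def)
  qed
  ultimately show thesis using that pq(1) by blast
qed

text \<open>On the chamber \<open>q\<close> dominates \<open>\<bar>g - p\<bar>\<close>, and the
  means of \<open>p\<close> and \<open>q\<close> converge as linear combinations of moments, so the
  error is small under the approximating laws as well as under the limit.\<close>

lemma method_of_moments:
  fixes V :: "real \<Rightarrow> 'b \<Rightarrow> (real,'n) vec" and g :: "(real,'n) vec \<Rightarrow> real"
  assumes V: "\<forall>\<^sub>F k in at_top. prob_space (M k) \<and> V k \<in> borel_measurable (M k) \<and> (\<forall>\<omega>\<in>space (M k). V k \<omega> \<in> chamber_A)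
      \<and> (\<forall>ms. integrable (M k) (\<lambda>\<omega>. psums ms (V k \<omega>)))"
    and law: "AE y in \<mu>. y \<in> chamber_A"
    and lim: "\<And>ms. ((\<lambda>k. \<integral>\<omega>. psums ms (V k \<omega>) \<partial>M k) \<longlongrightarrow> (\<integral>y. psums ms y \<partial>\<mu>)) at_top"
    and g: "continuous_on UNIV g" "bounded (range g)"
  shows "((\<lambda>k. \<integral>\<omega>. g (V k \<omega>) \<partial>M k) \<longlongrightarrow> (\<integral>y. g y \<partial>\<mu>)) at_top"
proof -
  obtain B where B: "\<And>y. \<bar>g y\<bar> \<le> B" using g(2) unfolding bounded_iff by auto
  have gm [measurable]: "g \<in> borel_measurable borel" by (rule borel_measurable_continuous_onI[OF g(1)])
  have si: "\<forall>\<^sub>F k in at_top. integrable (M k) (\<lambda>\<omega>. \<phi> (V k \<omega>))"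
    and sl: "((\<lambda>k. \<integral>\<omega>. \<phi> (V k \<omega>) \<partial>M k) \<longlongrightarrow> (\<integral>y. \<phi> y \<partial>\<mu>)) at_top" if sp: "sympoly \<phi>" for \<phi> :: "(real,'n) vec \<Rightarrow> real"
  proof -
    obtain cs where cs: "\<phi> = lincomb cs" using sp unfolding sympoly_def by blast
    have "(\<forall>\<^sub>F k in at_top. integrable (M k) (\<lambda>\<omega>. lincomb cs (V k \<omega>))) \<and>
      ((\<lambda>k. \<integral>\<omega>. lincomb cs (V k \<omega>) \<partial>M k) \<longlongrightarrow> (\<integral>y. lincomb cs y \<partial>\<mu>)) at_top"
    proof (induction cs)
      case Nil
      show ?case by simp
    next
      case (Cons a cs)
      obtain c ns where a: "a = (c, ns)" by (cases a)
      have i: "\<forall>\<^sub>F k in at_top. integrable (M k) (\<lambda>\<omega>. lincomb cs (V k \<omega>)) \<and> integrable (M k) (\<lambda>\<omega>. psums ns (V k \<omega>))"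
        using Cons V by (auto elim: eventually_elim2)
      have t1: "((\<lambda>k. c * (\<integral>\<omega>. psums ns (V k \<omega>) \<partial>M k) + (\<integral>\<omega>. lincomb cs (V k \<omega>) \<partial>M k)) \<longlongrightarrow> c * (\<integral>y. psums ns y \<partial>\<mu>) + (\<integral>y. lincomb cs y \<partial>\<mu>)) at_top"
        using Cons by (intro tendsto_intros lim) auto
      have t2: "\<forall>\<^sub>F k in at_top. c * (\<integral>\<omega>. psums ns (V k \<omega>) \<partial>M k) + (\<integral>\<omega>. lincomb cs (V k \<omega>) \<partial>M k) = (\<integral>\<omega>. lincomb (a # cs) (V k \<omega>) \<partial>M k)"
        using i by eventually_elim (simp add: a)
      have t3: "c * (\<integral>y. psums ns y \<partial>\<mu>) + (\<integral>y. lincomb cs y \<partial>\<mu>) = (\<integral>y. lincomb (a # cs) y \<partial>\<mu>)"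
      proof -
        have "integrable \<mu> (psums ns)" using sympoly_integrable[OF sympoly_psums[of 1 ns]] by simp
        moreover have "integrable \<mu> (lincomb cs)" by (rule sympoly_integrable) (auto simp: sympoly_def)
        ultimately show ?thesis by (simp add: a)
      qed
      have "((\<lambda>k. \<integral>\<omega>. lincomb (a # cs) (V k \<omega>) \<partial>M k) \<longlongrightarrow> (\<integral>y. lincomb (a # cs) y \<partial>\<mu>)) at_top"
        using Lim_transform_eventually[OF t1 t2] unfolding t3 .
      moreover have "\<forall>\<^sub>F k in at_top. integrable (M k) (\<lambda>\<omega>. lincomb (a # cs) (V k \<omega>))"
        using i by eventually_elim (simp add: a)
      ultimately show ?case by blast
    qed
    then show "\<forall>\<^sub>F k in at_top. integrable (M k) (\<lambda>\<omega>. \<phi> (V k \<omega>))"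
      "((\<lambda>k. \<integral>\<omega>. \<phi> (V k \<omega>) \<partial>M k) \<longlongrightarrow> (\<integral>y. \<phi> y \<partial>\<mu>)) at_top" by (auto simp: cs)
  qed
  show ?thesis
  proof (rule tendstoI)
    fix e :: real assume e: "e > 0"
    then have "e / 4 > 0" by simp
    then obtain p q where pq: "sympoly p" "sympoly q" "\<And>y. y \<in> chamber_A \<Longrightarrow> \<bar>g y - p y\<bar> \<le> q y" "(\<integral>y. q y \<partial>\<mu>) < e / 4"
      using bounded_continuous_approximation[OF g(1) B] by blast
    have gi: "integrable \<mu> g" by (rule integrable_const_bound[of _ B]) (use B borel_measurable_law[OF gm] in auto)
    have "\<bar>(\<integral>y. g y \<partial>\<mu>) - (\<integral>y. p y \<partial>\<mu>)\<bar> = \<bar>\<integral>y. g y - p y \<partial>\<mu>\<bar>" using gi sympoly_integrable[OF pq(1)] by simp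
    also have "\<dots> \<le> (\<integral>y. \<bar>g y - p y\<bar> \<partial>\<mu>)" by (rule integral_abs_bound)
    also have "\<dots> \<le> (\<integral>y. q y \<partial>\<mu>)"
      by (rule integral_mono_AE) (use gi sympoly_integrable[OF pq(1)] sympoly_integrable[OF pq(2)] law pq(3) in auto)
    finally have 1: "\<bar>(\<integral>y. g y \<partial>\<mu>) - (\<integral>y. p y \<partial>\<mu>)\<bar> < e / 4" using pq(4) by linarith
    have 2: "\<forall>\<^sub>F k in at_top. (\<integral>\<omega>. q (V k \<omega>) \<partial>M k) < e / 4"
      by (rule order_tendstoD(2)[OF sl[OF pq(2)] pq(4)])
    have 3: "\<forall>\<^sub>F k in at_top. dist (\<integral>\<omega>. p (V k \<omega>) \<partial>M k) (\<integral>y. p y \<partial>\<mu>) < e / 4"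
      by (rule tendstoD[OF sl[OF pq(1)]]) (use e in simp)
    show "\<forall>\<^sub>F k in at_top. dist (\<integral>\<omega>. g (V k \<omega>) \<partial>M k) (\<integral>y. g y \<partial>\<mu>) < e"
      using 2 3 V si[OF pq(1)] si[OF pq(2)]
    proof eventually_elim
      fix k
      assume a: "(\<integral>\<omega>. q (V k \<omega>) \<partial>M k) < e / 4" "dist (\<integral>\<omega>. p (V k \<omega>) \<partial>M k) (\<integral>y. p y \<partial>\<mu>) < e / 4"
        and k: "prob_space (M k) \<and> V k \<in> borel_measurable (M k) \<and> (\<forall>\<omega>\<in>space (M k). V k \<omega> \<in> chamber_A) \<and> (\<forall>ms. integrable (M k) (\<lambda>\<omega>. psums ms (V k \<omega>)))"
        and i: "integrable (M k) (\<lambda>\<omega>. p (V k \<omega>))" "integrable (M k) (\<lambda>\<omega>. q (V k \<omega>))"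
      interpret P: prob_space "M k" using k by blast
      have [measurable]: "V k \<in> borel_measurable (M k)" using k by blast
      have gk: "integrable (M k) (\<lambda>\<omega>. g (V k \<omega>))" by (rule P.integrable_const_bound[of _ B]) (use B in auto)
      have "\<bar>(\<integral>\<omega>. g (V k \<omega>) \<partial>M k) - (\<integral>\<omega>. p (V k \<omega>) \<partial>M k)\<bar> = \<bar>\<integral>\<omega>. g (V k \<omega>) - p (V k \<omega>) \<partial>M k\<bar>" using gk i by simp
      also have "\<dots> \<le> (\<integral>\<omega>. \<bar>g (V k \<omega>) - p (V k \<omega>)\<bar> \<partial>M k)" by (rule integral_abs_bound)
      also have "\<dots> \<le> (\<integral>\<omega>. q (V k \<omega>) \<partial>M k)"
        by (rule integral_mono_AE) (use gk i k pq(3) in auto)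
      finally show "dist (\<integral>\<omega>. g (V k \<omega>) \<partial>M k) (\<integral>y. g y \<partial>\<mu>) < e"
        using a 1 unfolding dist_real_def by linarith
    qed
  qed
qed

end

section \<open>Convergence of the moments and of the law\<close>

lemma psums_scaleR: "psums ms (c *\<^sub>R u) = c ^ sum_list ms * psums ms u"
proof (induction ms)
  case (Cons m ms)
  have "psum m (c *\<^sub>R u) = c ^ m * psum m u" by (simp add: psum_def power_mult_distrib sum_distrib_left)
  then show ?case using Cons by (simp add: power_add mult_ac)
qed simp

lemma psums_degree_0:
  fixes u v :: "(real,'n::finite) vec"
  shows "sum_list ms = 0 \<Longrightarrow> psums ms u = psums ms v"
  by (induction ms) (auto simp: psum_def)

lemma continuous_bounded_image: "continuous_on {0..t} f \<Longrightarrow> bounded (f ` {0..t::real})"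
  by (intro compact_imp_bounded compact_continuous_image) auto

lemma uniform_limit_lincomb:
  fixes f :: "real \<Rightarrow> 'b \<Rightarrow> real \<Rightarrow> real"
  assumes "\<And>c ns. (c, ns) \<in> set cs \<Longrightarrow> uniform_limit {0..t} (\<lambda>k s. f k ns s) (\<lambda>s. l ns s) at_top"
    "\<And>ns. continuous_on {0..t} (l ns)"
  shows "uniform_limit {0..t} (\<lambda>k s. \<Sum>(c, ns)\<leftarrow>cs. c * f k ns s) (\<lambda>s. \<Sum>(c, ns)\<leftarrow>cs. c * l ns s) at_top"
    "continuous_on {0..t} (\<lambda>s. \<Sum>(c, ns)\<leftarrow>cs. c * l ns s)"
  using assms
proof (induction cs)
  case Nil
  { case 1 show ?case by (simp add: uniform_limit_const) next
    case 2 show ?case by simp }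
next
  case (Cons a cs)
  obtain c ns where a: "a = (c, ns)" by (cases a)
  { case 1
    have "uniform_limit {0..t} (\<lambda>k s. c * f k ns s) (\<lambda>s. c * l ns s) at_top"
      by (rule uniform_lim_mult) (use 1(1)[of c ns] 1(2)[of ns] in \<open>auto simp: a intro!: uniform_limit_const continuous_bounded_image\<close>)
    moreover have "uniform_limit {0..t} (\<lambda>k s. \<Sum>(c, ns)\<leftarrow>cs. c * f k ns s) (\<lambda>s. \<Sum>(c, ns)\<leftarrow>cs. c * l ns s) at_top"
      by (rule Cons(1)) (use 1 in auto)
    ultimately show ?case by (simp add: a uniform_limit_add) next
    case 2
    have "continuous_on {0..t} (\<lambda>s. \<Sum>(c, ns)\<leftarrow>cs. c * l ns s)" by (rule Cons(2)) (use 2 in auto)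
    then show ?case using 2(2)[of ns] by (simp add: a continuous_intros) }
qed

lemma lbm_continuous:
  assumes "continuous_on UNIV f" shows "locally_bounded_measurable f"
  unfolding locally_bounded_measurable_def
proof (intro conjI allI)
  show "f \<in> borel_measurable lborel" using borel_measurable_continuous_onI[OF assms] by simp
  fix T :: real
  have "bounded (f ` {0..T})" by (rule continuous_bounded_image[OF continuous_on_subset[OF assms]]) simp
  then obtain C where "\<forall>s\<in>{0..T}. \<bar>f s\<bar> \<le> C" unfolding bounded_iff by auto
  then have "\<forall>s\<in>{0..T}. \<bar>f s\<bar> \<le> max C 0" by auto
  then show "\<exists>C\<ge>0. \<forall>s\<in>{0..T}. \<bar>f s\<bar> \<le> C" by (intro exI[of _ "max C 0"]) auto
qed

locale bessel_B_family =
  fixes M :: "real \<Rightarrow> 'a measure" and X :: "real \<Rightarrow> real \<Rightarrow> 'a \<Rightarrow> (real,'n::{finite,linorder}) vec"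
    and x :: "(real,'n) vec" and k2 t :: real
  assumes process: "\<And>k1. k1 > 0 \<Longrightarrow> bessel_B_process (M k1) (X k1) k1 k2 x" and k2: "k2 > 0" and t: "t > 0"
begin

definition law :: "(real,'n) vec measure" where "law = bessel_A_law k2 (t / 2)"

lemma family_bessel_B: "k1 > 0 \<Longrightarrow> bessel_B (M k1) (X k1) k1 k2 x"
  by unfold_locales (use process k2 in auto)

sublocale law: exp_moments law
proof (rule exp_moments.intro)
  have t2: "t / 2 > 0" using t by simp
  show "prob_space law" by (rule law_prob_space[OF k2 t2 law_def])
  show "exp_moments_axioms law"
    by unfold_locales (use law_sets(1)[OF k2 t2 law_def] law_integrable[OF k2 t2 law_def] in auto)
qed

definition mean :: "nat list \<Rightarrow> real" where "mean ms = (\<integral>y. psums ms y \<partial>law)"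

definition moment :: "real \<Rightarrow> nat list \<Rightarrow> real \<Rightarrow> real" where
  "moment k1 = bessel_B.mom (M k1) (X k1) k1"

definition scl :: "real \<Rightarrow> real" where "scl k1 = 2 * sqrt (2 * k1)"

text \<open>At clock \<open>s^2 / 2\<close> the type A process has the law at \<open>t / 2\<close>
  scaled by \<open>s / sqrt t\<close>, because space scales like the square root of time; these are
  its moments.\<close>

definition limit_moment :: "nat list \<Rightarrow> real \<Rightarrow> real" where
  "limit_moment ms s = (s / sqrt t) ^ sum_list ms * mean ms"

lemma inverse_scl_tendsto: "((\<lambda>k. 1 / scl k) \<longlongrightarrow> 0) at_top"
proof -
  have "filterlim (\<lambda>k::real. 2 * k) at_top at_top"
    by (rule filterlim_tendsto_pos_mult_at_top[OF tendsto_const _ filterlim_ident]) simp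
  then have "filterlim (\<lambda>k. sqrt (2 * k)) at_top at_top" by (rule filterlim_compose[OF sqrt_at_top])
  then have "filterlim scl at_top at_top" unfolding scl_def[abs_def]
    by (intro filterlim_tendsto_pos_mult_at_top[OF tendsto_const]) auto
  from tendsto_inverse_0_at_top[OF this] show ?thesis by (simp add: inverse_eq_divide)
qed

lemma moment_equation':
  assumes k: "k > 0" and s: "s \<ge> 0"
    and A: "\<And>u::(real,'n) vec. distinct_coords u \<Longrightarrow> opA k2 ms u = lincomb cs u"
    and Bd: "\<And>u::(real,'n) vec. distinct_coords u \<Longrightarrow> opB k2 ms u = lincomb ds u"
  shows "moment k ms s = (1 / scl k) ^ sum_list ms * psums ms (\<chi> i. (x $ i)\<^sup>2)
    + (LINT r:{0..s}|lborel. r * (\<Sum>(c, ns)\<leftarrow>cs. c * moment k ns r) + 1 / scl k * (\<Sum>(c, ns)\<leftarrow>ds. c * moment k ns r))"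
proof -
  interpret H: bessel_B "M k" "X k" k k2 x by (rule family_bessel_B[OF k])
  have sc: "H.bscale = scl k" by (simp add: H.bscale_def scl_def)
  have "H.centred 0 x = (1 / scl k) *\<^sub>R (\<chi> i. (x $ i)\<^sup>2)" by (simp add: vec_eq_iff H.centred_nth sc)
  then show ?thesis using H.moment_equation[OF s A Bd] unfolding moment_def sc by (simp add: psums_scaleR)
qed

text \<open>Differentiating \<open>(r / sqrt t) ^ d\<close> produces \<open>d * r / t\<close> times
  the power \<open>d - 2\<close>, and Stein's equation at time \<open>t / 2\<close> gives
  \<open>d * mean ms = t * S\<close>, so \<open>d / t\<close> cancels. The term
  \<open>0 ^ sum_list ms\<close> is the value at time 0: 1 in degree 0 and 0 otherwise.\<close>

lemma limit_equation:
  assumes s: "s \<ge> 0" and cs: "\<forall>(c, ns)\<in>set cs. sum_list ns + 2 = sum_list ms"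
    and A: "\<And>u::(real,'n) vec. distinct_coords u \<Longrightarrow> opA k2 ms u = lincomb cs u"
  shows "limit_moment ms s = 0 ^ sum_list ms * mean ms + (LINT r:{0..s}|lborel. r * (\<Sum>(c, ns)\<leftarrow>cs. c * limit_moment ns r))"
proof -
  define d where "d = sum_list ms"
  define S where "S = (\<Sum>(c, ns)\<leftarrow>cs. c * mean ns)"
  have t2: "t / 2 > 0" using t by simp
  have st: "real d * mean ms = t * S"
    using law_stein[OF k2 t2 law_def A] by (simp add: mean_def S_def d_def)
  show ?thesis
  \<comment> \<open>An empty list says nothing about the degree: either it is 0 and the moment is
    constant, or the mean vanishes by Stein's equation. Any entry of \<open>cs\<close> forces the
    degree to be at least 2.\<close>
  proof (cases "cs = []")
    case True
    then have "real d * mean ms = 0" using st by (simp add: S_def)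
    then show ?thesis using True by (cases "d = 0") (auto simp: limit_moment_def set_lebesgue_integral_def d_def[symmetric])
  next
    case False
    then obtain c0 n0 where "(c0, n0) \<in> set cs" by (cases cs) auto
    then have "sum_list n0 + 2 = d" using cs unfolding d_def by (auto dest: bspec)
    then obtain d' where d': "d = d' + 2" by metis
    have lm: "(\<Sum>(c, ns)\<leftarrow>cs. c * limit_moment ns r) = (r / sqrt t) ^ d' * S" for r
    proof -
      have "(\<Sum>(c, ns)\<leftarrow>cs. c * limit_moment ns r) = (\<Sum>(c, ns)\<leftarrow>cs. (r / sqrt t) ^ d' * (c * mean ns))"
        using cs d' by (intro arg_cong[where f=sum_list] map_cong refl) (auto simp: limit_moment_def d_def)
      also have "\<dots> = (r / sqrt t) ^ d' * S" unfolding S_def by (induction cs) (auto simp: distrib_left)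
      finally show ?thesis .
    qed
    have "((\<lambda>r. (r / sqrt t) ^ d * mean ms) has_real_derivative r * ((r / sqrt t) ^ d' * S)) (at r)" for r
    proof -
      have "((\<lambda>r. r / sqrt t) has_real_derivative 1 / sqrt t) (at r)" by (rule DERIV_cdivide[OF DERIV_ident])
      from DERIV_cmult_right[OF DERIV_power[OF this, of d], of "mean ms"]
      have "((\<lambda>r. (r / sqrt t) ^ d * mean ms) has_real_derivative real d * (1 / sqrt t * (r / sqrt t) ^ (d - Suc 0)) * mean ms) (at r)" .
      moreover have "real d * (1 / sqrt t * (r / sqrt t) ^ (d - Suc 0)) * mean ms = r * ((r / sqrt t) ^ d' * S)"
      proof -
        have "real d * (1 / sqrt t * (r / sqrt t) ^ (d - Suc 0)) * mean ms = (1 / sqrt t * (r / sqrt t)) * (r / sqrt t) ^ d' * (real d * mean ms)"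
          by (simp add: d')
        also have "\<dots> = (1 / sqrt t * (r / sqrt t) * t) * ((r / sqrt t) ^ d' * S)" by (simp add: st)
        also have "1 / sqrt t * (r / sqrt t) * t = r" using t by simp
        finally show ?thesis .
      qed
      ultimately show ?thesis by simp
    qed
    then have "(\<integral>r. (r * ((r / sqrt t) ^ d' * S)) * indicator {0..s} r \<partial>lborel) = (s / sqrt t) ^ d * mean ms - (0 / sqrt t) ^ d * mean ms"
      by (intro integral_FTC_Icc_real[OF s]) (auto intro!: continuous_intros simp: t less_imp_neq[symmetric])
    then have "(LINT r:{0..s}|lborel. r * ((r / sqrt t) ^ d' * S)) = (s / sqrt t) ^ d * mean ms"
      unfolding set_lebesgue_integral_def by (simp add: mult.commute d')
    then show ?thesis unfolding lm by (simp add: limit_moment_def d_def[symmetric] d')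
  qed
qed

lemma continuous_limit_moment: "continuous_on A (limit_moment ms)"
  unfolding limit_moment_def[abs_def] by (intro continuous_intros) (use t in auto)

text \<open>Induction on the degree, since both sums in the moment equation involve lower degrees
  only. Uniform convergence on \<open>{0..t}\<close> passes under the time integral, and the factor
  \<open>1 / scl k\<close> removes the sum from \<open>opB\<close> as well as, in positive degree,
  the starting point \<open>x\<close>.\<close>

lemma moment_uniform_limit: "uniform_limit {0..t} (\<lambda>k s. moment k ms s) (limit_moment ms) at_top"
proof (induction "sum_list ms" arbitrary: ms rule: less_induct)
  case less
  define d where "d = sum_list ms"
  obtain cs where cs: "\<forall>(c, ns)\<in>set cs. sum_list ns + 2 = sum_list ms" "\<And>u::(real,'n) vec. distinct_coords u \<Longrightarrow> opA k2 ms u = lincomb cs u"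
    using lower_opA[of ms k2, where 'n='n] unfolding lower_def by blast
  obtain ds where ds: "\<forall>(c, ns)\<in>set ds. sum_list ns + 1 = sum_list ms" "\<And>u::(real,'n) vec. distinct_coords u \<Longrightarrow> opB k2 ms u = lincomb ds u"
    using lower_opB[of ms k2, where 'n='n] unfolding lower_def by blast
  have UA: "uniform_limit {0..t} (\<lambda>k s. \<Sum>(c, ns)\<leftarrow>cs. c * moment k ns s) (\<lambda>s. \<Sum>(c, ns)\<leftarrow>cs. c * limit_moment ns s) at_top"
    "continuous_on {0..t} (\<lambda>s. \<Sum>(c, ns)\<leftarrow>cs. c * limit_moment ns s)"
    by (rule uniform_limit_lincomb; use less cs(1) continuous_limit_moment in force)+
  have UB: "uniform_limit {0..t} (\<lambda>k s. \<Sum>(c, ns)\<leftarrow>ds. c * moment k ns s) (\<lambda>s. \<Sum>(c, ns)\<leftarrow>ds. c * limit_moment ns s) at_top"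
    "continuous_on {0..t} (\<lambda>s. \<Sum>(c, ns)\<leftarrow>ds. c * limit_moment ns s)"
    by (rule uniform_limit_lincomb; use less ds(1) continuous_limit_moment in force)+
  have US: "uniform_limit {0..t} (\<lambda>k s::real. 1 / scl k) (\<lambda>s. 0) at_top"
  proof (rule uniform_limitI)
    fix e :: real assume "e > 0"
    from tendstoD[OF inverse_scl_tendsto this] show "\<forall>\<^sub>F k in at_top. \<forall>s\<in>{0..t}. dist (1 / scl k) 0 < e"
      by eventually_elim auto
  qed
  let ?g = "\<lambda>k r. r * (\<Sum>(c, ns)\<leftarrow>cs. c * moment k ns r) + 1 / scl k * (\<Sum>(c, ns)\<leftarrow>ds. c * moment k ns r)"
  let ?l = "\<lambda>r. r * (\<Sum>(c, ns)\<leftarrow>cs. c * limit_moment ns r) + 0 * (\<Sum>(c, ns)\<leftarrow>ds. c * limit_moment ns r)"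
  have U: "uniform_limit {0..t} ?g ?l at_top"
    by (intro uniform_limit_add uniform_lim_mult uniform_limit_const UA UB US continuous_bounded_image continuous_intros)
  have P: "((\<lambda>k. (1 / scl k) ^ d * psums ms (\<chi> i. (x $ i)\<^sup>2)) \<longlongrightarrow> 0 ^ d * mean ms) at_top"
  proof -
    have "((\<lambda>k. (1 / scl k) ^ d * psums ms (\<chi> i. (x $ i)\<^sup>2)) \<longlongrightarrow> 0 ^ d * psums ms (\<chi> i. (x $ i)\<^sup>2)) at_top"
      by (intro tendsto_intros inverse_scl_tendsto)
    \<comment> \<open>In degree 0 the product of power sums is a constant, and the law has total
      mass 1.\<close>
    moreover have "0 ^ d * psums ms (\<chi> i. (x $ i)\<^sup>2) = 0 ^ d * mean ms"
    proof (cases "d = 0")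
      case True
      have "mean ms = (\<integral>y. psums ms (\<chi> i. (x $ i)\<^sup>2) \<partial>law)"
        unfolding mean_def by (intro Bochner_Integration.integral_cong refl psums_degree_0) (use True in \<open>simp add: d_def\<close>)
      then show ?thesis using law.prob_space by simp
    qed simp
    ultimately show ?thesis by simp
  qed
  show ?case
  proof (rule uniform_limitI)
    fix e :: real assume e: "e > 0"
    \<comment> \<open>Integrands within \<open>\<epsilon>\<close> of each other have integrals
      within \<open>\<epsilon> * t\<close>; the \<open>t + 1\<close> makes this strictly less than
      \<open>e / 2\<close>.\<close>
    define \<epsilon> where "\<epsilon> = e / (2 * (t + 1))"
    have eps: "\<epsilon> > 0" "\<epsilon> * t < e / 2"
    proof -
      show "\<epsilon> > 0" using e t by (simp add: \<epsilon>_def)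
      have "\<epsilon> * t < \<epsilon> * (t + 1)" using \<open>\<epsilon> > 0\<close> by (intro mult_strict_left_mono) auto
      also have "\<dots> = e / 2" using t by (simp add: \<epsilon>_def field_simps)
      finally show "\<epsilon> * t < e / 2" .
    qed
    have e2: "e / 2 > 0" using e by simp
    from uniform_limitD[OF U eps(1)] tendstoD[OF P e2] eventually_gt_at_top[of 0]
    show "\<forall>\<^sub>F k in at_top. \<forall>s\<in>{0..t}. dist (moment k ms s) (limit_moment ms s) < e"
    proof eventually_elim
      fix k :: real
      assume u: "\<forall>r\<in>{0..t}. dist (?g k r) (?l r) < \<epsilon>"
        and p: "dist ((1 / scl k) ^ d * psums ms (\<chi> i. (x $ i)\<^sup>2)) (0 ^ d * mean ms) < e / 2" and k: "0 < k"
      interpret H: bessel_B "M k" "X k" k k2 x by (rule family_bessel_B[OF k])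
      have lm: "locally_bounded_measurable (\<lambda>s. \<Sum>(c, ns)\<leftarrow>as. c * moment k ns s)" for as :: "(real \<times> nat list) list"
      proof (induction as)
        case Nil
        show ?case using lbm_continuous[of "\<lambda>_. 0"] by simp
      next
        case (Cons a as)
        obtain c ns where a: "a = (c, ns)" by (cases a)
        have "locally_bounded_measurable (\<lambda>s. c * moment k ns s)"
          unfolding locally_bounded_measurable_def
        proof (intro conjI allI)
          show "(\<lambda>s. c * moment k ns s) \<in> borel_measurable lborel"
            using H.lbm_mom[of ns, unfolded locally_bounded_measurable_def, THEN conjunct1]
            unfolding moment_def by (intro borel_measurable_times borel_measurable_const)
          fix T
          obtain C where "C \<ge> 0" "\<forall>s\<in>{0..T}. \<bar>moment k ns s\<bar> \<le> C"
            using H.lbm_mom[of ns] unfolding locally_bounded_measurable_def moment_def by blast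
          then show "\<exists>C\<ge>0. \<forall>s\<in>{0..T}. \<bar>c * moment k ns s\<bar> \<le> C"
            by (intro exI[of _ "\<bar>c\<bar> * C"]) (auto simp: abs_mult intro!: mult_left_mono)
        qed
        from lbm_add[OF this Cons] show ?case by (simp add: a)
      qed
      have lg: "locally_bounded_measurable (?g k)"
      proof (rule lbm_add[OF lbm_times[OF lm]])
        have "(\<Sum>(c, ns)\<leftarrow>ds. (1 / scl k * c) * moment k ns s) = 1 / scl k * (\<Sum>(c, ns)\<leftarrow>ds. c * moment k ns s)" for s
          by (induction ds) (auto simp: distrib_left add_divide_distrib)
        moreover have "(\<Sum>(c, ns)\<leftarrow>ds. (1 / scl k * c) * moment k ns s) = (\<Sum>(c, ns)\<leftarrow>map (\<lambda>(c, ns). (1 / scl k * c, ns)) ds. c * moment k ns s)" for s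
          by (induction ds) auto
        ultimately show "locally_bounded_measurable (\<lambda>s. 1 / scl k * (\<Sum>(c, ns)\<leftarrow>ds. c * moment k ns s))"
          using lm[of "map (\<lambda>(c, ns). (1 / scl k * c, ns)) ds"] by simp
      qed
      have cl: "continuous_on UNIV (\<lambda>r. \<Sum>(c, ns)\<leftarrow>as. c * limit_moment ns r)" for as :: "(real \<times> nat list) list"
      proof (induction as)
        case (Cons a as)
        then show ?case using continuous_limit_moment by (cases a) (auto intro!: continuous_intros)
      qed simp
      have ll: "locally_bounded_measurable ?l" by (intro lbm_continuous continuous_intros cl)
      show "\<forall>s\<in>{0..t}. dist (moment k ms s) (limit_moment ms s) < e"
      proof
        fix s assume s: "s \<in> {0..t}"
        have 1: "moment k ms s = (1 / scl k) ^ d * psums ms (\<chi> i. (x $ i)\<^sup>2) + (LINT r:{0..s}|lborel. ?g k r)"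
          unfolding d_def by (rule moment_equation'[OF k _ cs(2) ds(2)]) (use s in auto)
        have 2: "limit_moment ms s = 0 ^ d * mean ms + (LINT r:{0..s}|lborel. ?l r)"
          using limit_equation[OF _ cs] s by (simp add: d_def)
        have "(LINT r:{0..s}|lborel. ?g k r) - (LINT r:{0..s}|lborel. ?l r) = (LINT r:{0..s}|lborel. ?g k r - ?l r)"
          by (rule set_integral_diff(2)[symmetric]) (intro lbm_set_integrable lg ll)+
        also have "\<bar>\<dots>\<bar> \<le> \<epsilon> * s"
          by (rule LINT_abs_le_const) (use u s eps in \<open>auto simp: dist_real_def intro: less_imp_le\<close>)
        also have "\<dots> \<le> \<epsilon> * t" using s eps by (intro mult_left_mono) auto
        finally have "\<bar>(LINT r:{0..s}|lborel. ?g k r) - (LINT r:{0..s}|lborel. ?l r)\<bar> < e / 2" using eps by linarith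
        then show "dist (moment k ms s) (limit_moment ms s) < e"
          using p unfolding 1 2 dist_real_def by linarith
      qed
    qed
  qed
qed

section \<open>From the centred squares to the centred process\<close>

definition V :: "real \<Rightarrow> 'a \<Rightarrow> (real,'n) vec" where
  "V k \<omega> = (1 / sqrt t) *\<^sub>R (\<chi> i. ((X k t \<omega> $ i)\<^sup>2 - 2 * k * t) / scl k)"

lemma V_props:
  assumes k: "k > 0"
  shows "V k \<in> borel_measurable (M k)" "integrable (M k) (\<lambda>\<omega>. psums ms (V k \<omega>))"
    "(\<integral>\<omega>. psums ms (V k \<omega>) \<partial>M k) = (1 / sqrt t) ^ sum_list ms * moment k ms t"
    "\<omega> \<in> space (M k) \<Longrightarrow> V k \<omega> \<in> chamber_A"
proof -
  interpret H: bessel_B "M k" "X k" k k2 x by (rule family_bessel_B[OF k])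
  have sc: "H.bscale = scl k" "scl k > 0" using H.bscale(1) by (simp_all add: H.bscale_def scl_def)
  have mt: "max 0 t = t" using t by simp
  have Vc: "V k \<omega> = (1 / sqrt t) *\<^sub>R H.centred t (X k (max 0 t) \<omega>)" for \<omega>
    by (simp add: V_def H.centred_def sc(1) mt)
  have c: "continuous_on UNIV (\<lambda>y. (1 / sqrt t) *\<^sub>R H.centred t y)"
    unfolding H.centred_def[abs_def] by (intro continuous_intros) (use sc in auto)
  have "V k = (\<lambda>\<omega>. (\<lambda>y. (1 / sqrt t) *\<^sub>R H.centred t y) (X k (max 0 t) \<omega>))" by (simp add: fun_eq_iff Vc)
  then show "V k \<in> borel_measurable (M k)"
    using measurable_compose[OF H.X_measurable[of t] borel_measurable_continuous_onI[OF c]] by simp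
  have p: "psums ms (V k \<omega>) = (1 / sqrt t) ^ sum_list ms * psums ms (H.centred t (X k (max 0 t) \<omega>))" for \<omega>
    unfolding Vc by (rule psums_scaleR)
  have "integrable (M k) (\<lambda>\<omega>. psums ms (H.centred t (X k (max 0 t) \<omega>)))"
    using H.dynkin(4,5)[OF H.smooth_invariant_psums_centred[of ms t]] by (rule H.integrable_poly_growth)
  then show "integrable (M k) (\<lambda>\<omega>. psums ms (V k \<omega>))" unfolding p by simp
  show "(\<integral>\<omega>. psums ms (V k \<omega>) \<partial>M k) = (1 / sqrt t) ^ sum_list ms * moment k ms t"
    unfolding p moment_def H.mom_def H.ex_def by simp
  assume w: "\<omega> \<in> space (M k)"
  have X: "X k t \<omega> \<in> chamber_B" using H.X_path(2)[OF w, of t] by (simp add: mt)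
  show "V k \<omega> \<in> chamber_A" unfolding chamber_A_def
  proof (intro CollectI allI impI)
    fix i j :: 'n assume "i \<le> j"
    then have "(X k t \<omega> $ j)\<^sup>2 \<le> (X k t \<omega> $ i)\<^sup>2" using X by (intro power_mono) (auto simp: chamber_B_def)
    then have "((X k t \<omega> $ j)\<^sup>2 - 2 * k * t) / scl k \<le> ((X k t \<omega> $ i)\<^sup>2 - 2 * k * t) / scl k"
      using sc(2) by (intro divide_right_mono) auto
    then have "(1 / sqrt t) * (((X k t \<omega> $ j)\<^sup>2 - 2 * k * t) / scl k) \<le> (1 / sqrt t) * (((X k t \<omega> $ i)\<^sup>2 - 2 * k * t) / scl k)"
      using t by (intro mult_left_mono) auto
    then show "V k \<omega> $ j \<le> V k \<omega> $ i" by (simp only: V_def vector_scaleR_component vec_lambda_beta real_scaleR_def)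
  qed
qed

lemma V_moment_tendsto: "((\<lambda>k. \<integral>\<omega>. psums ms (V k \<omega>) \<partial>M k) \<longlongrightarrow> (\<integral>y. psums ms y \<partial>law)) at_top"
proof -
  have "((\<lambda>k. moment k ms t) \<longlongrightarrow> limit_moment ms t) at_top"
    by (rule tendsto_uniform_limitI[OF moment_uniform_limit]) (use t in auto)
  then have "((\<lambda>k. (1 / sqrt t) ^ sum_list ms * moment k ms t) \<longlongrightarrow> (1 / sqrt t) ^ sum_list ms * limit_moment ms t) at_top"
    by (intro tendsto_intros)
  moreover have "(1 / sqrt t) ^ sum_list ms * limit_moment ms t = mean ms"
  proof -
    have "(1 / sqrt t) * (t / sqrt t) = 1" using t by simp
    then have "(1 / sqrt t) ^ n * (t / sqrt t) ^ n = 1" for n by (metis power_mult_distrib power_one)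
    then show ?thesis unfolding limit_moment_def by (simp only: mult.assoc[symmetric] mult_1_left)
  qed
  ultimately have "((\<lambda>k. (1 / sqrt t) ^ sum_list ms * moment k ms t) \<longlongrightarrow> (\<integral>y. psums ms y \<partial>law)) at_top"
    by (simp add: mean_def)
  moreover have "\<forall>\<^sub>F k in at_top. (1 / sqrt t) ^ sum_list ms * moment k ms t = (\<integral>\<omega>. psums ms (V k \<omega>) \<partial>M k)"
    using eventually_gt_at_top[of 0] by eventually_elim (simp add: V_props(3))
  ultimately show ?thesis by (rule Lim_transform_eventually)
qed

definition Y :: "real \<Rightarrow> 'a \<Rightarrow> (real,'n) vec" where
  "Y k \<omega> = X k t \<omega> - sqrt (2 * t * k) *\<^sub>R (\<chi> i. 1)"

text \<open>With a = sqrt (2 * t * k), completing the square gives V = Y + Y^2 / (2 * a), and Y \<open>\<ge>\<close> - a.\<close>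

lemma Y_V:
  assumes k: "k > 0" and w: "\<omega> \<in> space (M k)"
  shows "V k \<omega> $ i = Y k \<omega> $ i + (Y k \<omega> $ i)\<^sup>2 / (2 * sqrt (2 * t * k))" "\<bar>Y k \<omega> $ i\<bar> \<le> 2 * \<bar>V k \<omega> $ i\<bar>"
proof -
  interpret H: bessel_B "M k" "X k" k k2 x by (rule family_bessel_B[OF k])
  define a where "a = sqrt (2 * t * k)"
  have a: "a > 0" "a\<^sup>2 = 2 * t * k" using t k by (auto simp: a_def)
  have sa: "sqrt t * scl k = 2 * a" by (simp add: scl_def a_def real_sqrt_mult mult_ac)
  define X' where "X' = X k t \<omega> $ i"
  have X0: "X' \<ge> 0" using H.X_path(2)[OF w, of t] t by (simp add: max_def chamber_B_def X'_def)
  have Yi: "Y k \<omega> $ i = X' - a" by (simp add: Y_def X'_def a_def)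
  have Vi: "V k \<omega> $ i = (X'\<^sup>2 - a\<^sup>2) / (2 * a)"
    unfolding sa[symmetric] a(2) by (simp add: V_def X'_def mult_ac)
  show "V k \<omega> $ i = Y k \<omega> $ i + (Y k \<omega> $ i)\<^sup>2 / (2 * sqrt (2 * t * k))"
    unfolding Vi Yi a_def[symmetric] using a(1) by (simp add: field_simps power2_eq_square)
  have "\<bar>X' - a\<bar> * a \<le> \<bar>X' - a\<bar> * (X' + a)" using X0 by (intro mult_left_mono) auto
  also have "\<dots> = \<bar>(X' - a) * (X' + a)\<bar>" using X0 a by (simp add: abs_mult)
  also have "(X' - a) * (X' + a) = X'\<^sup>2 - a\<^sup>2" by (simp add: power2_eq_square algebra_simps)
  finally have "\<bar>X' - a\<bar> * a \<le> \<bar>X'\<^sup>2 - a\<^sup>2\<bar>" .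
  then show "\<bar>Y k \<omega> $ i\<bar> \<le> 2 * \<bar>V k \<omega> $ i\<bar>" unfolding Vi Yi using a(1) by (simp add: field_simps abs_divide)
qed

lemma Y_measurable: "k > 0 \<Longrightarrow> Y k \<in> borel_measurable (M k)"
proof -
  assume k: "k > 0"
  interpret H: bessel_B "M k" "X k" k k2 x by (rule family_bessel_B[OF k])
  show ?thesis unfolding Y_def[abs_def] using H.X_measurable[of t] t by (simp add: max_def)
qed

text \<open>On the box \<open>\<bar>V k \<omega> $ i\<bar> \<le> R\<close> the distance of
  \<open>Y\<close> and \<open>V\<close> is of order \<open>R^2 / a\<close>, uniformly in
  \<open>\<omega>\<close>, and \<open>g\<close> is uniformly continuous on compact sets; off the box
  \<open>psum 2 (V k \<omega>) / R^2\<close> exceeds 1 and pays for the trivial bound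
  \<open>2 * C\<close>.\<close>

lemma Y_V_close:
  fixes g :: "(real,'n) vec \<Rightarrow> real"
  assumes g: "continuous_on UNIV g" and B: "\<And>y. \<bar>g y\<bar> \<le> C" and R: "R > 0" and e: "e > 0"
  shows "\<forall>\<^sub>F k in at_top. \<forall>\<omega>\<in>space (M k). \<bar>g (Y k \<omega>) - g (V k \<omega>)\<bar> \<le> e + 2 * C / R\<^sup>2 * psum 2 (V k \<omega>)"
proof -
  let ?N = "real CARD('n)"
  have "uniformly_continuous_on (cball 0 (2 * R * ?N)) g"
    by (intro compact_uniformly_continuous continuous_on_subset[OF g]) auto
  then obtain d where d: "d > 0" "\<And>y z. norm y \<le> 2 * R * ?N \<Longrightarrow> norm z \<le> 2 * R * ?N \<Longrightarrow> dist z y < d \<Longrightarrow> dist (g z) (g y) < e"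
    unfolding uniformly_continuous_on_def using e by (metis mem_cball_0)
  have C0: "C \<ge> 0" using B[of 0] by linarith
  have "((\<lambda>k. (2 * R\<^sup>2 * ?N / sqrt t) * 2 * (1 / scl k)) \<longlongrightarrow> (2 * R\<^sup>2 * ?N / sqrt t) * 2 * 0) at_top"
    by (intro tendsto_intros inverse_scl_tendsto)
  then have "\<forall>\<^sub>F k in at_top. (2 * R\<^sup>2 * ?N / sqrt t) * 2 * (1 / scl k) < d"
    using d(1) by (intro order_tendstoD(2)) auto
  then show ?thesis using eventually_gt_at_top[of 0]
  proof eventually_elim
    fix k :: real assume sm: "(2 * R\<^sup>2 * ?N / sqrt t) * 2 * (1 / scl k) < d" and k: "0 < k"
    show "\<forall>\<omega>\<in>space (M k). \<bar>g (Y k \<omega>) - g (V k \<omega>)\<bar> \<le> e + 2 * C / R\<^sup>2 * psum 2 (V k \<omega>)"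
    proof
      fix \<omega> assume w: "\<omega> \<in> space (M k)"
      define a where "a = sqrt (2 * t * k)"
      have a: "a > 0" using t k by (simp add: a_def)
      have sa: "sqrt t * scl k = 2 * a" by (simp add: scl_def a_def real_sqrt_mult mult_ac)
      show "\<bar>g (Y k \<omega>) - g (V k \<omega>)\<bar> \<le> e + 2 * C / R\<^sup>2 * psum 2 (V k \<omega>)"
      proof (cases "\<forall>i. \<bar>V k \<omega> $ i\<bar> \<le> R")
        case True
        have Yb: "\<bar>Y k \<omega> $ i\<bar> \<le> 2 * R" for i using Y_V(2)[OF k w, of i] True[rule_format, of i] by linarith
        have nb: "norm z \<le> b * ?N" if "\<And>i. \<bar>z $ i\<bar> \<le> b" for z :: "(real,'n) vec" and b
        proof -
          have "norm z \<le> (\<Sum>i\<in>UNIV. \<bar>z $ i\<bar>)" by (rule norm_le_l1_cart)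
          also have "\<dots> \<le> (\<Sum>i\<in>(UNIV::'n set). b)" by (intro sum_mono that)
          finally show ?thesis by (simp add: mult.commute)
        qed
        have n1: "norm (Y k \<omega>) \<le> 2 * R * ?N" by (rule nb[OF Yb])
        have n2: "norm (V k \<omega>) \<le> 2 * R * ?N" by (rule nb) (use True R in \<open>auto intro: order_trans[of _ R]\<close>)
        have "\<bar>(V k \<omega> - Y k \<omega>) $ i\<bar> \<le> 2 * R\<^sup>2 / a" for i
        proof -
          have "(Y k \<omega> $ i)\<^sup>2 \<le> (2 * R)\<^sup>2" using Yb[of i] R by (metis abs_le_square_iff abs_of_pos mult_pos_pos zero_less_numeral)
          then have "(Y k \<omega> $ i)\<^sup>2 / (2 * a) \<le> (2 * R)\<^sup>2 / (2 * a)" using a by (intro divide_right_mono) auto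
          moreover have "(V k \<omega> - Y k \<omega>) $ i = (Y k \<omega> $ i)\<^sup>2 / (2 * a)" using Y_V(1)[OF k w, of i] by (simp add: a_def)
          moreover have "0 \<le> (Y k \<omega> $ i)\<^sup>2 / (2 * a)" using a by simp
          ultimately show ?thesis by (simp add: power_mult_distrib)
        qed
        then have "norm (V k \<omega> - Y k \<omega>) \<le> 2 * R\<^sup>2 / a * ?N" by (rule nb)
        also have "\<dots> = (2 * R\<^sup>2 * ?N / sqrt t) * 2 * (1 / scl k)"
        proof -
          have "(2 * R\<^sup>2 * ?N / sqrt t) * 2 * (1 / scl k) = 4 * R\<^sup>2 * ?N / (sqrt t * scl k)" by simp
          then show ?thesis unfolding sa by simp
        qed
        finally have "dist (V k \<omega>) (Y k \<omega>) < d" using sm by (simp add: dist_norm)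
        from d(2)[OF n1 n2 this] have "\<bar>g (Y k \<omega>) - g (V k \<omega>)\<bar> < e" by (simp add: dist_real_def abs_minus_commute)
        moreover have "0 \<le> 2 * C / R\<^sup>2 * psum 2 (V k \<omega>)"
          using C0 by (intro mult_nonneg_nonneg divide_nonneg_nonneg) (auto simp: psum_def intro!: sum_nonneg)
        ultimately show ?thesis by linarith
      next
        case False
        then obtain i where i: "R < \<bar>V k \<omega> $ i\<bar>" by (auto simp: not_le)
        have "R\<^sup>2 \<le> (V k \<omega> $ i)\<^sup>2" using i R by (metis abs_le_square_iff abs_of_pos less_imp_le)
        also have "\<dots> \<le> psum 2 (V k \<omega>)" unfolding psum_def by (rule member_le_sum[of i UNIV "\<lambda>i. (V k \<omega> $ i)\<^sup>2"]) auto
        finally have "1 \<le> psum 2 (V k \<omega>) / R\<^sup>2" using R by simp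
        then have "2 * C * 1 \<le> 2 * C * (psum 2 (V k \<omega>) / R\<^sup>2)" using C0 by (intro mult_left_mono) auto
        moreover have "\<bar>g (Y k \<omega>) - g (V k \<omega>)\<bar> \<le> 2 * C" using B[of "Y k \<omega>"] B[of "V k \<omega>"] by linarith
        ultimately show ?thesis using e by simp
      qed
    qed
  qed
qed

text \<open>Slutsky's argument: the second moments of \<open>V\<close> stay bounded because they
  converge, so \<open>Y_V_close\<close> makes the difference of the two expectations vanish in the
  limit.\<close>

lemma Y_tendsto:
  fixes g :: "(real,'n) vec \<Rightarrow> real"
  assumes g: "continuous_on UNIV g" and bd: "bounded (range g)"
  shows "((\<lambda>k. \<integral>\<omega>. g (Y k \<omega>) \<partial>M k) \<longlongrightarrow> (\<integral>y. g y \<partial>law)) at_top"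
proof -
  have t2: "t / 2 > 0" using t by simp
  have gm [measurable]: "g \<in> borel_measurable borel" by (rule borel_measurable_continuous_onI[OF g])
  have 1: "((\<lambda>k. \<integral>\<omega>. g (V k \<omega>) \<partial>M k) \<longlongrightarrow> (\<integral>y. g y \<partial>law)) at_top"
  proof (rule law.method_of_moments[OF _ _ V_moment_tendsto g bd])
    show "\<forall>\<^sub>F k in at_top. prob_space (M k) \<and> V k \<in> borel_measurable (M k) \<and> (\<forall>\<omega>\<in>space (M k). V k \<omega> \<in> chamber_A) \<and> (\<forall>ms. integrable (M k) (\<lambda>\<omega>. psums ms (V k \<omega>)))"
      using eventually_gt_at_top[of 0]
    proof eventually_elim
      fix k :: real assume k: "0 < k"
      interpret H: bessel_B "M k" "X k" k k2 x by (rule family_bessel_B[OF k])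
      show "prob_space (M k) \<and> V k \<in> borel_measurable (M k) \<and> (\<forall>\<omega>\<in>space (M k). V k \<omega> \<in> chamber_A) \<and> (\<forall>ms. integrable (M k) (\<lambda>\<omega>. psums ms (V k \<omega>)))"
        using V_props[OF k] H.prob_space_axioms by blast
    qed
    show "AE y in law. y \<in> chamber_A" using law_AE[OF k2 t2 law_def] by eventually_elim auto
  qed
  obtain C where C: "\<And>y. \<bar>g y\<bar> \<le> C" using bd unfolding bounded_iff by auto
  have C0: "C \<ge> 0" using C[of 0] by linarith
  have m0: "mean [2] \<ge> 0" unfolding mean_def
    by (intro Bochner_Integration.integral_nonneg) (auto simp: psum_def intro!: sum_nonneg)
  have "((\<lambda>k. (\<integral>\<omega>. g (Y k \<omega>) \<partial>M k) - (\<integral>\<omega>. g (V k \<omega>) \<partial>M k)) \<longlongrightarrow> 0) at_top"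
  proof (rule tendstoI)
    fix e :: real assume e: "e > 0"
    \<comment> \<open>Makes the tail term \<open>2 * C / R^2 * (mean [2] + 1)\<close> less than
      \<open>e / 2\<close>; with \<open>2 * C + 1\<close> in place of \<open>2 * C\<close> the
      radius stays positive when \<open>C = 0\<close>.\<close>
    define R where "R = sqrt (4 * (2 * C + 1) * (mean [2] + 1) / e)"
    have R: "R > 0" "R\<^sup>2 = 4 * (2 * C + 1) * (mean [2] + 1) / e" unfolding R_def using C0 m0 e by (auto simp: less_imp_le)
    have e2: "e / 2 > 0" using e by simp
    have "\<forall>\<^sub>F k in at_top. (\<integral>\<omega>. psums [2] (V k \<omega>) \<partial>M k) < mean [2] + 1"
      using V_moment_tendsto[of "[2]"] by (rule order_tendstoD(2)) (simp add: mean_def)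
    with Y_V_close[OF g C R(1) e2] eventually_gt_at_top[of 0]
    show "\<forall>\<^sub>F k in at_top. dist ((\<integral>\<omega>. g (Y k \<omega>) \<partial>M k) - (\<integral>\<omega>. g (V k \<omega>) \<partial>M k)) 0 < e"
    proof eventually_elim
      fix k :: real
      assume cl: "\<forall>\<omega>\<in>space (M k). \<bar>g (Y k \<omega>) - g (V k \<omega>)\<bar> \<le> e / 2 + 2 * C / R\<^sup>2 * psum 2 (V k \<omega>)"
        and k: "0 < k" and m: "(\<integral>\<omega>. psums [2] (V k \<omega>) \<partial>M k) < mean [2] + 1"
      interpret H: bessel_B "M k" "X k" k k2 x by (rule family_bessel_B[OF k])
      have [measurable]: "V k \<in> borel_measurable (M k)" "Y k \<in> borel_measurable (M k)" using V_props(1)[OF k] Y_measurable[OF k] by auto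
      have i: "integrable (M k) (\<lambda>\<omega>. g (Y k \<omega>))" "integrable (M k) (\<lambda>\<omega>. g (V k \<omega>))"
        by (rule H.integrable_const_bound[of _ C]; use C in auto)+
      have ip: "integrable (M k) (\<lambda>\<omega>. psum 2 (V k \<omega>))" using V_props(2)[OF k, of "[2]"] by simp
      have "\<bar>(\<integral>\<omega>. g (Y k \<omega>) \<partial>M k) - (\<integral>\<omega>. g (V k \<omega>) \<partial>M k)\<bar> = \<bar>\<integral>\<omega>. g (Y k \<omega>) - g (V k \<omega>) \<partial>M k\<bar>" using i by simp
      also have "\<dots> \<le> (\<integral>\<omega>. \<bar>g (Y k \<omega>) - g (V k \<omega>)\<bar> \<partial>M k)" by (rule integral_abs_bound)
      also have "\<dots> \<le> (\<integral>\<omega>. e / 2 + 2 * C / R\<^sup>2 * psum 2 (V k \<omega>) \<partial>M k)"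
        by (rule integral_mono) (use i ip cl in auto)
      also have "\<dots> = e / 2 + 2 * C / R\<^sup>2 * (\<integral>\<omega>. psum 2 (V k \<omega>) \<partial>M k)" using ip by (simp add: H.prob_space)
      also have "\<dots> \<le> e / 2 + 2 * C / R\<^sup>2 * (mean [2] + 1)"
        using m C0 by (intro add_left_mono mult_left_mono) auto
      also have "2 * C / R\<^sup>2 * (mean [2] + 1) < e / 2"
      proof -
        have "2 * C / (4 * (2 * C + 1) * D / e) * D < e / 2" if "D > 0" for D
        proof -
          have "2 * C / (4 * (2 * C + 1) * D / e) * D = e * (2 * C / (4 * (2 * C + 1)))" using that e by simp
          also have "\<dots> < e * (1 / 2)" using C0 e by (intro mult_strict_left_mono) (auto simp: field_simps)
          finally show ?thesis by simp
        qed
        from this[of "mean [2] + 1"] show ?thesis unfolding R(2) using m0 by simp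
      qed
      finally show "dist ((\<integral>\<omega>. g (Y k \<omega>) \<partial>M k) - (\<integral>\<omega>. g (V k \<omega>) \<partial>M k)) 0 < e" by (simp add: dist_real_def)
    qed
  qed
  from tendsto_add[OF this 1] show ?thesis by simp
qed

end

theorem theorem4p2:
  fixes M :: "real \<Rightarrow> 'a measure"
    and X :: "real \<Rightarrow> real \<Rightarrow> 'a \<Rightarrow> (real,'n::{finite,linorder}) vec"
    and x :: "(real,'n) vec" and k2 t :: real
  assumes "x \<in> chamber_B" and "k2 > 0"
    and "\<And>k1. k1 > 0 \<Longrightarrow> bessel_B_process (M k1) (X k1) k1 k2 x"
    and "t > 0"
  shows "conv_distr_at_top M (\<lambda>k1 \<omega>. X k1 t \<omega> - sqrt (2 * t * k1) *\<^sub>R (\<chi> i. 1))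
           (bessel_A_law k2 (t / 2))"
proof -
  interpret bessel_B_family M X x k2 t by unfold_locales (use assms in auto)
  show ?thesis unfolding conv_distr_at_top_def using Y_tendsto by (simp add: Y_def law_def)
qed

end
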